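(* Consider the $N$-relay Gaussian 1-2-1 network (defined in the context), with relays operating either all in full-duplex (FD) mode or all in half-duplex (HD) mode. Let $\mathsf{C}$ be its capacity, and let $\mathsf{C}_{\rm cs,iid}$ be the quantity defined in the context, computed with link capacities $\ell_{j,i}=\log\left(1+P|h_{ji}|^2\right)$ and with the state set $\mathcal{S}$ of the corresponding mode (FD or HD). Then $$\mathsf{C}_{\rm cs,iid}\le \mathsf{C}\le \mathsf{C}_{\rm cs,iid}+\mathsf{GAP},\qquad \mathsf{GAP}=(N+1)\log e+2\log(N+2)+N\log\big(\mathrm{Card}(S_1)\big),$$ where $\mathrm{Card}(S_1)=(N+1)^2$ if the relays operate in FD and $\mathrm{Card}(S_1)=2N+1$ if the relays operate in HD.
   Context: Logarithms are base 2. Nodes are $[0:N+1]=\{0,1,\dots,N+1\}$: node $0$ is the source, node $N+1$ the destination, nodes $[1:N]$ are relays. Network states: a state $s$ consists of sets $s_{i,t}$ and $s_{i,r}$ for every node $i\in[0:N+1]$ with $s_{i,t}\subseteq[1:N+1]\setminus\{i\}$, $|s_{i,t}|\le 1$, $s_{i,r}\subseteq[0:N]\setminus\{i\}$, $|s_{i,r}|\le1$, and $s_{0,r}=s_{N+1,t}=\emptyset$ ($s_{i,t}$ is the node towards which $i$ beams its transmission, $s_{i,r}$ the node towards which $i$ points its receive beam). In FD mode there is no further constraint; in HD mode additionally $|s_{i,t}|+|s_{i,r}|\le1$ for every $i\in[1:N]$. Let $\mathcal{S}$ denote the finite set of all such states (for the given mode). A link $(i,j)$ (from $i$ to $j$)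 is active in state $s$ if $j\in s_{i,t}$ and $i\in s_{j,r}$. Given nonnegative numbers $\ell_{j,i}$ for $i\in[0:N]$, $j\in[1:N+1]$, $i\neq j$, define $$\mathsf{C}_{\rm cs,iid}=\max_{\lambda}\ \min_{\Omega}\ \sum_{i\in\Omega,\ j\in\Omega^c}\Big(\sum_{s\in\mathcal S:\ (i,j)\text{ active in }s}\lambda_s\Big)\ell_{j,i},$$ where the maximum is over probability vectors $\lambda=(\lambda_s)_{s\in\mathcal S}$ ($\lambda_s\ge0$, $\sum_s\lambda_s=1$), the minimum is over sets $\Omega$ with $0\in\Omega\subseteq[0:N]$, and $\Omega^c=[0:N+1]\setminus\Omega$. Gaussian 1-2-1 network: in each channel use every node $i\in[0:N]$ chooses a state component $S_i=(S_{i,t},S_{i,r})$ (so that the collection forms a state in $\mathcal S$) and a channel input $X_i\in\mathbb{C}$; both may be functions of the node's message (source) or past received signals (relays) and together form the node's channel input. The destination always receives, the source always transmits. The received signal at node $j\in[1:N+1]$ is $$Y_j=Z_j+\sum_{i\in[0:N]\setminus\{j\}}h_{ji}\,\mathbf 1\{i\in S_{j,r},\ j\in S_{i,t}\}X_i,$$ where $h_{ji}\in\mathbb C$ are constant channel gains known to all nodes, $Z_j$ are i.i.d. $\mathcal{CN}(0,1)$ noises independent across nodes and time, and inputs satisfy the power constraint $\mathbb E[|X_k|^2]\le P$ for all $k\in[0:N]$. The capacity $\mathsf C$ is the supremum of rates achievable from source to destination with vanishing error probability under the standard definitions of codes and achievable rates. *)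

theory Defs
  imports "HOL-Probability.Probability"
begin

datatype mode = FD | HD

type_synonym comp = "nat set \<times> nat set"   (* (s_{i,t}, s_{i,r}) *)
type_synonym state = "nat \<Rightarrow> comp"

text \<open>Admissible state component of node i (nodes 0..N+1; 0 source, N+1 destination).\<close>
definition node_ok :: "mode \<Rightarrow> nat \<Rightarrow> nat \<Rightarrow> comp \<Rightarrow> bool" where
  "node_ok m N i c \<longleftrightarrow>
     fst c \<subseteq> {1..N+1} - {i} \<and> card (fst c) \<le> 1 \<and>
     snd c \<subseteq> {0..N} - {i} \<and> card (snd c) \<le> 1 \<and>
     (i = 0 \<longrightarrow> snd c = {}) \<and> (i = N+1 \<longrightarrow> fst c = {}) \<and>
     (m = HD \<and> 1 \<le> i \<and> i \<le> N \<longrightarrow> card (fst c) + card (snd c) \<le> 1)"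

definition states :: "mode \<Rightarrow> nat \<Rightarrow> state set" where
  "states m N = {s. (\<forall>i\<in>{0..N+1}. node_ok m N i (s i)) \<and> (\<forall>i. i \<notin> {0..N+1} \<longrightarrow> s i = ({}, {}))}"

definition active :: "state \<Rightarrow> nat \<Rightarrow> nat \<Rightarrow> bool" where
  "active s i j \<longleftrightarrow> j \<in> fst (s i) \<and> i \<in> snd (s j)"

definition prob_vecs :: "state set \<Rightarrow> (state \<Rightarrow> real) set" where
  "prob_vecs S = {lam. (\<forall>s\<in>S. lam s \<ge> 0) \<and> sum lam S = 1}"

definition cut_val :: "mode \<Rightarrow> nat \<Rightarrow> (nat \<Rightarrow> nat \<Rightarrow> real) \<Rightarrow> (state \<Rightarrow> real) \<Rightarrow> nat set \<Rightarrow> real" where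
  "cut_val m N l lam \<Omega> =
     (\<Sum>i\<in>\<Omega>. \<Sum>j\<in>{0..N+1} - \<Omega>.
        (\<Sum>s\<in>{s\<in>states m N. active s i j}. lam s) * l j i)"

definition cuts :: "nat \<Rightarrow> nat set set" where
  "cuts N = {\<Omega>. 0 \<in> \<Omega> \<and> \<Omega> \<subseteq> {0..N}}"

text \<open>C_cs,iid with link capacities l j i (from i to j).\<close>
definition C_cs_iid :: "mode \<Rightarrow> nat \<Rightarrow> (nat \<Rightarrow> nat \<Rightarrow> real) \<Rightarrow> real" where
  "C_cs_iid m N l = (SUP lam\<in>prob_vecs (states m N). Min (cut_val m N l lam ` cuts N))"

definition CN01 :: "complex measure" where
  "CN01 = density lborel (\<lambda>z. ennreal (exp (- (cmod z)\<^sup>2) / pi))"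

definition noise :: "nat \<Rightarrow> nat \<Rightarrow> (nat \<times> nat \<Rightarrow> complex) measure" where
  "noise N n = PiM ({..<n} \<times> {1..N+1}) (\<lambda>_. CN01)"

text \<open>A code: block length, number of messages (messages 0..M-1),
  source map (message, time) -> (state component, input),
  relay maps (node, time, past received signals) -> (state component, input),
  destination receive-beam map (time, past received signals) -> state component,
  decoder (received signals of the block) -> message.
  Past signals are passed as a function of time, truncated to the times before the current one.\<close>
record code =
  blen :: nat
  nmsg :: nat
  src  :: "nat \<Rightarrow> nat \<Rightarrow> comp \<times> complex"
  rel  :: "nat \<Rightarrow> nat \<Rightarrow> (nat \<Rightarrow> complex) \<Rightarrow> comp \<times> complex"
  dst  :: "nat \<Rightarrow> (nat \<Rightarrow> complex) \<Rightarrow> comp"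
  dec  :: "(nat \<Rightarrow> complex) \<Rightarrow> nat"

definition choice :: "code \<Rightarrow> nat \<Rightarrow> nat \<Rightarrow> nat \<Rightarrow> nat \<Rightarrow> (nat \<Rightarrow> nat \<Rightarrow> complex) \<Rightarrow> comp \<times> complex" where
  "choice c N w i t H =
     (if i = 0 then src c w t
      else if i \<le> N then rel c i t (H i)
      else if i = N+1 then (dst c t (H (N+1)), 0)
      else (({}, {}), 0))"

definition rx :: "code \<Rightarrow> nat \<Rightarrow> (nat \<Rightarrow> nat \<Rightarrow> complex) \<Rightarrow> nat \<Rightarrow> (nat \<times> nat \<Rightarrow> complex)
                  \<Rightarrow> nat \<Rightarrow> (nat \<Rightarrow> nat \<Rightarrow> complex) \<Rightarrow> nat \<Rightarrow> complex" where
  "rx c N h w z t H j =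
     z (t, j) + (\<Sum>i\<in>{0..N} - {j}.
        (if i \<in> snd (fst (choice c N w j t H)) \<and> j \<in> fst (fst (choice c N w i t H))
         then h j i * snd (choice c N w i t H) else 0))"

primrec hist :: "code \<Rightarrow> nat \<Rightarrow> (nat \<Rightarrow> nat \<Rightarrow> complex) \<Rightarrow> nat \<Rightarrow> (nat \<times> nat \<Rightarrow> complex)
                  \<Rightarrow> nat \<Rightarrow> nat \<Rightarrow> nat \<Rightarrow> complex" where
  "hist c N h w z 0 = (\<lambda>j tau. 0)"
| "hist c N h w z (Suc t) =
     (\<lambda>j tau. if tau < t then hist c N h w z t j tau
              else if tau = t then rx c N h w z t (hist c N h w z t) j else 0)"

definition input :: "code \<Rightarrow> nat \<Rightarrow> (nat \<Rightarrow> nat \<Rightarrow> complex) \<Rightarrow> nat \<Rightarrow> (nat \<times> nat \<Rightarrow> complex) \<Rightarrow> nat \<Rightarrow> nat \<Rightarrow> complex" where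
  "input c N h w z k t = snd (choice c N w k t (hist c N h w z t))"

definition err_event :: "code \<Rightarrow> nat \<Rightarrow> (nat \<Rightarrow> nat \<Rightarrow> complex) \<Rightarrow> nat \<Rightarrow> (nat \<times> nat \<Rightarrow> complex) set" where
  "err_event c N h w = {z \<in> space (noise N (blen c)). dec c (hist c N h w z (blen c) (N+1)) \<noteq> w}"

definition err_prob :: "code \<Rightarrow> nat \<Rightarrow> (nat \<Rightarrow> nat \<Rightarrow> complex) \<Rightarrow> real" where
  "err_prob c N h = (\<Sum>w<nmsg c. measure (noise N (blen c)) (err_event c N h w)) / nmsg c"

definition valid_code :: "mode \<Rightarrow> nat \<Rightarrow> (nat \<Rightarrow> nat \<Rightarrow> complex) \<Rightarrow> real \<Rightarrow> code \<Rightarrow> bool" where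
  "valid_code m N h P c \<longleftrightarrow>
     nmsg c \<ge> 1 \<and>
     (\<forall>w<nmsg c. \<forall>t<blen c. node_ok m N 0 (fst (src c w t))) \<and>
     (\<forall>i\<in>{1..N}. \<forall>t<blen c. \<forall>Y. node_ok m N i (fst (rel c i t Y))) \<and>
     (\<forall>t<blen c. \<forall>Y. node_ok m N (N+1) (dst c t Y)) \<and>
     (\<forall>w<nmsg c. err_event c N h w \<in> sets (noise N (blen c))) \<and>
     (\<forall>w<nmsg c. \<forall>k\<in>{0..N}. \<forall>t<blen c.
        (\<lambda>z. input c N h w z k t) \<in> borel_measurable (noise N (blen c))) \<and>
     (\<forall>k\<in>{0..N}. \<forall>t<blen c.
        (\<Sum>w<nmsg c. \<integral>\<^sup>+ z. ennreal ((cmod (input c N h w z k t))\<^sup>2) \<partial>noise N (blen c))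
          \<le> ennreal (real (nmsg c) * P))"

definition achievable :: "mode \<Rightarrow> nat \<Rightarrow> (nat \<Rightarrow> nat \<Rightarrow> complex) \<Rightarrow> real \<Rightarrow> real \<Rightarrow> bool" where
  "achievable m N h P R \<longleftrightarrow>
     (\<forall>\<epsilon>>0. \<exists>n0. \<forall>n\<ge>n0. \<exists>c. valid_code m N h P c \<and> blen c = n \<and>
        real (nmsg c) \<ge> 2 powr (real n * R) \<and> err_prob c N h \<le> \<epsilon>)"

definition capacity :: "mode \<Rightarrow> nat \<Rightarrow> (nat \<Rightarrow> nat \<Rightarrow> complex) \<Rightarrow> real \<Rightarrow> ereal" where
  "capacity m N h P = Sup (ereal ` {R. R \<ge> 0 \<and> achievable m N h P R})"

definition card_S1 :: "mode \<Rightarrow> nat \<Rightarrow> nat" where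
  "card_S1 m N = (if m = FD then (N+1)\<^sup>2 else 2*N+1)"

definition GAP :: "mode \<Rightarrow> nat \<Rightarrow> real" where
  "GAP m N = (N+1) * log 2 (exp 1) + 2 * log 2 (N+2) + N * log 2 (card_S1 m N)"

definition link_cap :: "(nat \<Rightarrow> nat \<Rightarrow> complex) \<Rightarrow> real \<Rightarrow> nat \<Rightarrow> nat \<Rightarrow> real" where
  "link_cap h P j i = log 2 (1 + P * (cmod (h j i))\<^sup>2)"

end

theory Submission
  imports Defs "HOL-Probability.Probability" "HOL-Real_Asymp.Real_Asymp"
begin

text \<open>Upper bound. Fix a cut and compare the joint density of the noise with a product density that
  depends only on the signals received across the cut and on the noise on the source side, mixed
  uniformly over the states. Applying \<open>ln x \<le> x - 1\<close> to the likelihood ratio bounds the log of the number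
  of messages by the average over time of the information crossing the cut: the received power across
  an active link gives its capacity up to \<open>log e\<close> per node, and the uniform mixture over states costs the
  logarithm of their number, which is at most \<open>2 log (N + 2) + N log Card(S_1)\<close>. The states chosen by the relays may
  depend non-measurably on the received signals, so all integrals are taken with a translation-invariant
  extension of the Lebesgue integral to arbitrary functions (Hahn-Banach applied to averages over translates).

  Lower bound. For a schedule \<open>\<lambda>\<close> all of whose cuts exceed the rate, max-flow min-cut on the
  link rates yields flow paths from source to destination. Time is divided into superblocks in which each
  hop of each path receives slots in proportion to its share of the link; messages are forwarded
  hop by hop in a pipeline, with random Gaussian codes truncated to bounded amplitude, so that
  decoding errors at the relays affect the transmit power only negligibly.\<close>

section \<open>A translation-invariant integral of arbitrary functions\<close>

text \<open>The invariant integral is only finitely additive: for arbitrary integrands there is no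
  limit theorem and no exchange of integrals. The noise is therefore integrated coordinate by
  coordinate in chronological order, and every change of variables shifts a coordinate by a function
  of earlier ones only. The uniform mixture answers the fact that the realised state depends on the
  message: the mixture does not, and it still contains the term of the realised state with weight
  \<open>1 / card (states m N)\<close>. Under a density common to all messages a decoder is right
  for at most one of them per outcome, which takes the place of Fano's inequality. The summand
  \<open>(N + 1) * log 2 (exp 1)\<close> of \<open>GAP\<close> is an energy balance. Across the cut,
  the received energy relative to the reference variances is at most the number of receivers plus
  the sum of |X_i|^2 / P over the transmitters of the cut. The noise energy takes off the number of
  receivers, and at most N + 1 transmitters of average power P remain. In the lower bound the
  amplitude bound of the link codes is fixed before their error probability, so the error can be
  made small against it.\<close>

definition sublinear_on :: "('a \<Rightarrow> real) set \<Rightarrow> (('a \<Rightarrow> real) \<Rightarrow> real) \<Rightarrow> bool" where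
  "sublinear_on V q \<longleftrightarrow> (\<forall>f\<in>V. \<forall>g\<in>V. q (\<lambda>x. f x + g x) \<le> q f + q g) \<and>
     (\<forall>f\<in>V. \<forall>c\<ge>0. q (\<lambda>x. c * f x) = c * q f)"

locale function_space =
  fixes V :: "('a \<Rightarrow> real) set"
  assumes V_zero: "(\<lambda>_. 0) \<in> V"
    and V_add: "\<And>f g. f \<in> V \<Longrightarrow> g \<in> V \<Longrightarrow> (\<lambda>x. f x + g x) \<in> V"
    and V_scale: "\<And>f c. f \<in> V \<Longrightarrow> (\<lambda>x. c * f x) \<in> V"
begin

lemma V_uminus: "f \<in> V \<Longrightarrow> (\<lambda>x. - f x) \<in> V"
  using V_scale[of f "-1"] by simp

lemma sublinear_zero:
  assumes "sublinear_on V q" shows "q (\<lambda>_. 0) = 0"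
proof -
  have "\<forall>f\<in>V. \<forall>c\<ge>0. q (\<lambda>x. c * f x) = c * q f"
    using assms by (simp add: sublinear_on_def)
  from this[rule_format, OF V_zero, of 0] show ?thesis by simp
qed

lemma sublinear_lower:
  assumes q: "sublinear_on V q" and f: "f \<in> V"
  shows "- q (\<lambda>x. - f x) \<le> q f"
proof -
  have "q (\<lambda>x. f x + - f x) \<le> q f + q (\<lambda>x. - f x)"
    using q f V_uminus[OF f] by (simp only: sublinear_on_def)
  then show ?thesis using sublinear_zero[OF q] by simp
qed

text \<open>A minimal sublinear functional below \<open>p\<close> is linear: shifting the argument of \<open>q\<close> along
  a fixed \<open>f\<close> gives a sublinear functional below \<open>q\<close>, so minimality makes \<open>q\<close> superadditive.\<close>
lemma linear_minorant:
  assumes p: "sublinear_on V p"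
  obtains q where "\<And>f. f \<in> V \<Longrightarrow> q f \<le> p f"
    and "\<And>f g. f \<in> V \<Longrightarrow> g \<in> V \<Longrightarrow> q (\<lambda>x. f x + g x) = q f + q g"
    and "\<And>f c. f \<in> V \<Longrightarrow> c \<ge> 0 \<Longrightarrow> q (\<lambda>x. c * f x) = c * q f"
proof -
  \<comment> \<open>Values off \<open>V\<close> are normalised to 0, so that the pointwise order is
    antisymmetric on \<open>A\<close>.\<close>
  define A where "A = {q. (\<forall>f. f \<notin> V \<longrightarrow> q f = 0) \<and> sublinear_on V q \<and> (\<forall>f\<in>V. q f \<le> p f)}"
  \<comment> \<open>The order is reversed: \<open>P q r\<close> puts \<open>r\<close> below
    \<open>q\<close>, so the maximal element of Zorn's lemma is a pointwise minimal
    functional.\<close>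
  define P where "P = (\<lambda>q r :: ('a \<Rightarrow> real) \<Rightarrow> real. \<forall>f. r f \<le> q f)"
  have po: "partial_order_on A (relation_of P A)"
  proof (rule partial_order_on_relation_ofI)
    show "P a a" for a by (simp add: P_def)
    show "P a c" if "P a b" "P b c" for a b c using that unfolding P_def by (meson order_trans)
    show "a = b" if "P a b" "P b a" for a b using that unfolding P_def by (intro ext antisym) auto
  qed
  \<comment> \<open>The bound does not depend on \<open>q\<close>, which keeps the pointwise infimum
    of a chain finite.\<close>
  have lower: "- p (\<lambda>x. - f x) \<le> q f" if "q \<in> A" "f \<in> V" for q f
    using sublinear_lower[of q f] that V_uminus[of f] by (fastforce simp: A_def)
  have ch: "\<exists>u\<in>A. \<forall>a\<in>C. P a u" if C: "C \<in> Chains (relation_of P A)" for C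
  proof (cases "C = {}")
    case True
    have "(\<lambda>f. if f \<in> V then p f else 0) \<in> A"
      using p V_add V_scale by (auto simp: A_def sublinear_on_def)
    with True show ?thesis by blast
  next
    case ne: False
    have CA: "C \<subseteq> A" using C by (auto simp: Chains_def relation_of_def)
    have total: "P a b \<or> P b a" if "a \<in> C" "b \<in> C" for a b
      using C that by (auto simp: Chains_def relation_of_def)
    define u where "u = (\<lambda>f. if f \<in> V then INF q\<in>C. q f else 0)"
    have bdd: "bdd_below ((\<lambda>q. q f) ` C)" if "f \<in> V" for f
      using lower[OF _ that] CA by (intro bdd_belowI[of _ "- p (\<lambda>x. - f x)"]) auto
    have ule: "u f \<le> q f" if "q \<in> C" "f \<in> V" for q f
      using that bdd by (auto simp: u_def intro: cINF_lower)
    have sub: "u (\<lambda>x. f x + g x) \<le> u f + u g" if fg: "f \<in> V" "g \<in> V" for f g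
    proof -
      \<comment> \<open>In a chain \<open>a\<close> and \<open>b\<close> are comparable, so the
        smaller one serves at \<open>f\<close> and at \<open>g\<close> simultaneously.\<close>
      have *: "u (\<lambda>x. f x + g x) \<le> a f + b g" if ab: "a \<in> C" "b \<in> C" for a b
      proof -
        obtain r where r: "r \<in> C" "r f \<le> a f" "r g \<le> b g"
          using total[OF ab] ab unfolding P_def by blast
        have "u (\<lambda>x. f x + g x) \<le> r (\<lambda>x. f x + g x)" using r(1) fg V_add by (intro ule)
        also have "\<dots> \<le> r f + r g" using r(1) CA fg by (auto simp: A_def sublinear_on_def)
        finally show ?thesis using r by linarith
      qed
      have "u (\<lambda>x. f x + g x) - b g \<le> u f" if "b \<in> C" for b
      proof -
        have "u (\<lambda>x. f x + g x) - b g \<le> (INF a\<in>C. a f)"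
          using *[OF _ that] by (intro cINF_greatest ne) (simp add: algebra_simps)
        then show ?thesis using fg by (simp add: u_def)
      qed
      then have "u (\<lambda>x. f x + g x) - u f \<le> (INF b\<in>C. b g)"
        by (intro cINF_greatest ne) (simp add: algebra_simps)
      then show ?thesis using fg by (simp add: u_def)
    qed
    have hom: "u (\<lambda>x. c * f x) = c * u f" if f: "f \<in> V" and c: "c \<ge> 0" for f c
    proof (cases "c = 0")
      case True
      have z: "q (\<lambda>_. 0) = 0" if "q \<in> C" for q
        using CA that sublinear_zero[of q] by (auto simp: A_def)
      have "(INF q\<in>C. q (\<lambda>_. 0)) = (INF q\<in>C. 0)" by (intro INF_cong refl z)
      then have "u (\<lambda>_. 0) = 0" using ne by (simp add: u_def)
      with True show ?thesis by simp
    next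
      case False
      with c have c: "c > 0" by simp
      have hq: "q (\<lambda>x. c * f x) = c * q f" if "q \<in> C" for q
        using CA that f c by (auto simp: A_def sublinear_on_def)
      have "c * u f \<le> u (\<lambda>x. c * f x)"
      proof -
        have "c * u f \<le> (INF q\<in>C. q (\<lambda>x. c * f x))"
          by (intro cINF_greatest ne) (metis hq ule f c mult_left_mono less_imp_le)
        then show ?thesis using V_scale[OF f] by (simp add: u_def)
      qed
      moreover have "u (\<lambda>x. c * f x) / c \<le> u f"
      proof -
        have "u (\<lambda>x. c * f x) / c \<le> (INF q\<in>C. q f)"
        proof (intro cINF_greatest ne)
          fix q assume q: "q \<in> C"
          have "u (\<lambda>x. c * f x) \<le> c * q f" using ule[OF q V_scale[OF f], of c] hq[OF q] by simp
          then show "u (\<lambda>x. c * f x) / c \<le> q f" using c by (simp add: field_simps)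
        qed
        then show ?thesis using f by (simp add: u_def)
      qed
      ultimately show ?thesis using c by (simp add: field_simps)
    qed
    have "u f \<le> p f" if "f \<in> V" for f
      using ne ule[OF _ that] CA that unfolding A_def by (smt (verit) ex_in_conv mem_Collect_eq subsetD)
    then have "u \<in> A" using sub hom by (simp add: A_def sublinear_on_def) (simp add: u_def)
    moreover have "P q u" if "q \<in> C" for q
      unfolding P_def
    proof
      fix f show "u f \<le> q f"
        using ule[OF that, of f] CA that by (cases "f \<in> V") (auto simp: u_def A_def)
    qed
    ultimately show ?thesis by blast
  qed
  obtain q where qA: "q \<in> A" and qmin: "\<And>r. r \<in> A \<Longrightarrow> P q r \<Longrightarrow> r = q"
    using predicate_Zorn[OF po ch] by blast
  have q: "sublinear_on V q" using qA by (simp add: A_def)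
  have qsub: "q (\<lambda>x. f x + g x) \<le> q f + q g" if "f \<in> V" "g \<in> V" for f g
    using q that by (simp add: sublinear_on_def)
  have qhom: "q (\<lambda>x. c * f x) = c * q f" if "f \<in> V" "c \<ge> 0" for f c
    using q that by (simp add: sublinear_on_def)
  have super: "q f + q g \<le> q (\<lambda>x. f x + g x)" if fg: "f \<in> V" "g \<in> V" for f g
  proof -
    define r where "r = (\<lambda>h. if h \<in> V then INF t\<in>{0..}. q (\<lambda>x. h x + t * f x) - t * q f else 0)"
    have inV: "(\<lambda>x. h x + t * f x) \<in> V" if "h \<in> V" for h t
      using that fg(1) V_add V_scale by blast
    have bdd: "bdd_below ((\<lambda>t. q (\<lambda>x. h x + t * f x) - t * q f) ` {0..})" if h: "h \<in> V" for h
    proof (rule bdd_belowI)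
      fix y assume "y \<in> (\<lambda>t. q (\<lambda>x. h x + t * f x) - t * q f) ` {0..}"
      then obtain t where t: "t \<ge> 0" and y: "y = q (\<lambda>x. h x + t * f x) - t * q f" by auto
      have "t * q f = q (\<lambda>x. (h x + t * f x) + - h x)" using qhom[OF fg(1) t] by simp
      also have "\<dots> \<le> q (\<lambda>x. h x + t * f x) + q (\<lambda>x. - h x)"
        by (intro qsub inV h V_uminus)
      finally show "- q (\<lambda>x. - h x) \<le> y" using y by simp
    qed
    have rle: "r h \<le> q (\<lambda>x. h x + t * f x) - t * q f" if "h \<in> V" "t \<ge> 0" for h t
      using that bdd[OF that(1)] by (auto simp: r_def intro: cINF_lower)
    have rge: "y \<le> r h" if "h \<in> V" "\<And>t. t \<ge> 0 \<Longrightarrow> y \<le> q (\<lambda>x. h x + t * f x) - t * q f" for h y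
      using that by (auto simp: r_def intro!: cINF_greatest)
    have rq: "r h \<le> q h" if "h \<in> V" for h using rle[OF that, of 0] by simp
    have rsub: "r (\<lambda>x. h x + k x) \<le> r h + r k" if hk: "h \<in> V" "k \<in> V" for h k
    proof -
      have *: "r (\<lambda>x. h x + k x) \<le>
          (q (\<lambda>x. h x + s * f x) - s * q f) + (q (\<lambda>x. k x + t * f x) - t * q f)"
        if st: "s \<ge> 0" "t \<ge> 0" for s t
      proof -
        have "r (\<lambda>x. h x + k x) \<le> q (\<lambda>x. (h x + k x) + (s + t) * f x) - (s + t) * q f"
          using st by (intro rle V_add hk) auto
        also have "(\<lambda>x. (h x + k x) + (s + t) * f x) = (\<lambda>x. (h x + s * f x) + (k x + t * f x))"
          by (simp add: algebra_simps)
        also have "q \<dots> \<le> q (\<lambda>x. h x + s * f x) + q (\<lambda>x. k x + t * f x)"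
          by (intro qsub inV hk)
        finally show ?thesis by (simp add: algebra_simps)
      qed
      have "r (\<lambda>x. h x + k x) - (q (\<lambda>x. h x + s * f x) - s * q f) \<le> r k" if "s \<ge> 0" for s
        by (rule rge[OF hk(2)]) (use *[OF that] in \<open>simp add: algebra_simps\<close>)
      then have "r (\<lambda>x. h x + k x) - r k \<le> r h"
        by (intro rge[OF hk(1)]) (simp add: algebra_simps)
      then show ?thesis by simp
    qed
    have rhom: "r (\<lambda>x. c * h x) = c * r h" if h: "h \<in> V" and c0: "c \<ge> 0" for h c
    proof (cases "c = 0")
      case True
      have "r (\<lambda>_. 0) = 0"
        using rq[OF V_zero] sublinear_zero[OF q] qhom[OF fg(1)]
        by (intro antisym rge V_zero) auto
      with True show ?thesis by simp
    next
      case False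
      with c0 have c: "c > 0" by simp
      have eq: "q (\<lambda>x. c * h x + c * t * f x) = c * q (\<lambda>x. h x + t * f x)" for t
        using qhom[OF inV[OF h] c0, of t] by (simp add: algebra_simps)
      have "r (\<lambda>x. c * h x) / c \<le> r h"
      proof (rule rge[OF h])
        fix t :: real assume t: "t \<ge> 0"
        have "r (\<lambda>x. c * h x) \<le> q (\<lambda>x. c * h x + c * t * f x) - c * t * q f"
          using t c by (intro rle V_scale h) auto
        then have "r (\<lambda>x. c * h x) \<le> c * (q (\<lambda>x. h x + t * f x) - t * q f)"
          unfolding eq by (simp add: right_diff_distrib)
        then show "r (\<lambda>x. c * h x) / c \<le> q (\<lambda>x. h x + t * f x) - t * q f"
          using c by (simp add: pos_divide_le_eq mult.commute)
      qed
      moreover have "c * r h \<le> r (\<lambda>x. c * h x)"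
      proof (rule rge[OF V_scale[OF h]])
        fix t :: real assume t: "t \<ge> 0"
        have "r h \<le> q (\<lambda>x. h x + (t / c) * f x) - (t / c) * q f" using t c by (intro rle h) auto
        then have "c * r h \<le> c * q (\<lambda>x. h x + (t / c) * f x) - t * q f"
          using c by (simp add: field_simps)
        then show "c * r h \<le> q (\<lambda>x. c * h x + t * f x) - t * q f"
          using eq[of "t / c"] c by simp
      qed
      ultimately show ?thesis using c by (simp add: field_simps)
    qed
    have r0: "r h = 0" if "h \<notin> V" for h using that by (simp add: r_def)
    have rp: "r h \<le> p h" if "h \<in> V" for h
      using rq[OF that] qA that by (auto simp: A_def intro: order_trans)
    have "r \<in> A"
      using rsub rhom r0 rp by (simp add: A_def sublinear_on_def)
    moreover have "P q r"
    proof -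
      have "r h \<le> q h" for h using rq qA by (cases "h \<in> V") (auto simp: r_def A_def)
      then show ?thesis by (simp add: P_def)
    qed
    ultimately have "r = q" by (rule qmin)
    \<comment> \<open>With \<open>r = q\<close>, the term \<open>t = 1\<close> of the infimum is
      superadditivity.\<close>
    then have "q g \<le> q (\<lambda>x. g x + f x) - q f" using rle[OF fg(2), of 1] by simp
    then show ?thesis by (simp add: add.commute)
  qed
  show thesis
  proof (rule that)
    show "q f \<le> p f" if "f \<in> V" for f using qA that by (simp add: A_def)
    show "q (\<lambda>x. f x + g x) = q f + q g" if "f \<in> V" "g \<in> V" for f g
      using qsub super that by (intro antisym) auto
  qed (use qhom in auto)
qed

end

section \<open>An upper mean built from averages over translates\<close>

definition dominated_functions :: "('a::euclidean_space \<Rightarrow> real) set" where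
  "dominated_functions = {f. \<exists>g. integrable lborel g \<and> (\<forall>x. \<bar>f x\<bar> \<le> g x)}"

interpretation dominated: function_space dominated_functions
proof
  show "(\<lambda>_. 0) \<in> dominated_functions"
    by (auto simp: dominated_functions_def intro: exI[of _ "\<lambda>_. 0"])
  show "(\<lambda>x. f x + g x) \<in> dominated_functions"
    if fg: "f \<in> dominated_functions" "g \<in> dominated_functions" for f g :: "'a \<Rightarrow> real"
  proof -
    obtain F G where "integrable lborel F" "\<forall>x. \<bar>f x\<bar> \<le> F x" "integrable lborel G" "\<forall>x. \<bar>g x\<bar> \<le> G x"
      using fg by (auto simp: dominated_functions_def)
    then show ?thesis
      unfolding dominated_functions_def mem_Collect_eq
      by (intro exI[of _ "\<lambda>x. F x + G x"]) (auto intro!: order_trans[OF abs_triangle_ineq] add_mono)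
  qed
  show "(\<lambda>x. c * f x) \<in> dominated_functions"
    if f: "f \<in> dominated_functions" for f :: "'a \<Rightarrow> real" and c
  proof -
    obtain F where "integrable lborel F" "\<forall>x. \<bar>f x\<bar> \<le> F x"
      using f by (auto simp: dominated_functions_def)
    then show ?thesis
      unfolding dominated_functions_def mem_Collect_eq
      by (intro exI[of _ "\<lambda>x. \<bar>c\<bar> * F x"]) (auto simp: abs_mult intro: mult_left_mono)
  qed
qed

lemma lborel_translation:
  fixes g :: "'a::euclidean_space \<Rightarrow> real"
  assumes "integrable lborel g"
  shows "integrable lborel (\<lambda>x. g (x + a))" and "integral\<^sup>L lborel (\<lambda>x. g (x + a)) = integral\<^sup>L lborel g"
proof -
  have g: "integrable (distr lborel borel ((+) a)) g"
    using assms by (simp add: lborel_distr_plus)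
  have gm: "g \<in> borel_measurable borel" using assms by auto
  show "integrable lborel (\<lambda>x. g (x + a))"
    using g gm by (subst (asm) integrable_distr_eq) (auto simp: add.commute)
  have "integral\<^sup>L lborel g = integral\<^sup>L (distr lborel borel ((+) a)) g" by (simp add: lborel_distr_plus)
  also have "\<dots> = integral\<^sup>L lborel (\<lambda>x. g (x + a))"
    using gm by (subst integral_distr) (auto simp: add.commute)
  finally show "integral\<^sup>L lborel (\<lambda>x. g (x + a)) = integral\<^sup>L lborel g" ..
qed

lemma dominated_translation:
  assumes "f \<in> dominated_functions" shows "(\<lambda>x. f (x + a)) \<in> dominated_functions"
proof -
  obtain F where F: "integrable lborel F" "\<forall>x. \<bar>f x\<bar> \<le> F x"
    using assms by (auto simp: dominated_functions_def)
  then show ?thesis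
    unfolding dominated_functions_def mem_Collect_eq
    by (intro exI[of _ "\<lambda>x. F (x + a)"]) (auto intro: lborel_translation)
qed

text \<open>A list keeps multiplicities, so that composing two averages is again an average of this
  form.\<close>

definition translate_avg :: "'a::euclidean_space list \<Rightarrow> ('a \<Rightarrow> real) \<Rightarrow> 'a \<Rightarrow> real" where
  "translate_avg as f x = (\<Sum>a\<leftarrow>as. f (x + a)) / real (length as)"

lemma translate_avg_integral:
  assumes g: "integrable lborel g" and as: "as \<noteq> []"
  shows "integrable lborel (translate_avg as g)"
    and "integral\<^sup>L lborel (translate_avg as g) = integral\<^sup>L lborel g"
proof -
  have *: "integrable lborel (\<lambda>x. \<Sum>a\<leftarrow>bs. g (x + a)) \<and>
     integral\<^sup>L lborel (\<lambda>x. \<Sum>a\<leftarrow>bs. g (x + a)) = length bs * integral\<^sup>L lborel g" for bs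
    by (induction bs) (simp_all add: lborel_translation[OF g] distrib_right)
  then show "integrable lborel (translate_avg as g)"
    unfolding translate_avg_def[abs_def] by auto
  show "integral\<^sup>L lborel (translate_avg as g) = integral\<^sup>L lborel g"
    using * as unfolding translate_avg_def[abs_def] by simp
qed

lemma translate_avg_mono:
  "(\<And>x. f x \<le> g x) \<Longrightarrow> translate_avg as f x \<le> translate_avg as g x"
  unfolding translate_avg_def by (intro divide_right_mono sum_list_mono) auto

lemma translate_avg_add:
  "translate_avg as (\<lambda>x. f x + g x) x = translate_avg as f x + translate_avg as g x"
  unfolding translate_avg_def by (simp add: sum_list_addf add_divide_distrib)

lemma translate_avg_scale: "translate_avg as (\<lambda>x. c * f x) x = c * translate_avg as f x"
  unfolding translate_avg_def by (simp add: sum_list_const_mult)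

lemma translate_avg_single: "translate_avg [0] f = f"
  by (auto simp: translate_avg_def)

lemma translate_avg_twice:
  "translate_avg bs (translate_avg as f) = translate_avg (concat (map (\<lambda>b. map (\<lambda>a. a + b) as) bs)) f"
proof
  fix x
  have l: "length (concat (map (\<lambda>b. map (\<lambda>a. a + b) as) bs)) = length bs * length as"
    by (induction bs) auto
  have s: "(\<Sum>c\<leftarrow>concat (map (\<lambda>b. map (\<lambda>a. a + b) as) bs). f (x + c)) = (\<Sum>b\<leftarrow>bs. \<Sum>a\<leftarrow>as. f (x + b + a))"
    by (induction bs) (auto simp: o_def add_ac)
  show "translate_avg bs (translate_avg as f) x = translate_avg (concat (map (\<lambda>b. map (\<lambda>a. a + b) as) bs)) f x"
    unfolding translate_avg_def l s
    by (simp add: divide_inverse sum_list_mult_const sum_list_const_mult mult_ac)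
qed

lemma translate_avg_commute:
  "translate_avg bs (translate_avg as f) = translate_avg as (translate_avg bs f)"
proof
  fix x
  have swap: "(\<Sum>b\<leftarrow>bs. \<Sum>a\<leftarrow>as. F a b) = (\<Sum>a\<leftarrow>as. \<Sum>b\<leftarrow>bs. F a b)" for F :: "'a \<Rightarrow> 'a \<Rightarrow> real"
    by (induction bs) (auto simp: sum_list_addf)
  show "translate_avg bs (translate_avg as f) x = translate_avg as (translate_avg bs f) x"
    unfolding translate_avg_def divide_inverse sum_list_mult_const swap[of "\<lambda>a b. f (x + b + a)"]
    by (simp add: add.commute add.left_commute)
qed

text \<open>A majorant is required only of some average of translates of \<open>f\<close>. This
  lowers the usual upper integral far enough to give every difference \<open>f (x + a) - f x\<close>
  an upper mean of at most 0, while integrable functions keep their integral.\<close>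

definition upper_mean_values :: "('a::euclidean_space \<Rightarrow> real) \<Rightarrow> real set" where
  "upper_mean_values f = {I. \<exists>g as. I = integral\<^sup>L lborel g \<and> as \<noteq> [] \<and> integrable lborel g \<and>
     (\<forall>x. translate_avg as f x \<le> g x)}"

definition upper_mean :: "('a::euclidean_space \<Rightarrow> real) \<Rightarrow> real" where
  "upper_mean f = Inf (upper_mean_values f)"

text \<open>Averaging over translates preserves Lebesgue integrals, so an integrable minorant of
  \<open>f\<close> is still a minorant, with the same integral, of whatever average is majorised.
  Thus the infimum in \<open>upper_mean\<close> is over a set bounded below.\<close>

lemma upper_mean_values_ge:
  assumes k: "integrable lborel k" "\<And>x. - k x \<le> f x" and I: "I \<in> upper_mean_values f"
  shows "- integral\<^sup>L lborel k \<le> I"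
proof -
  obtain g as where g: "I = integral\<^sup>L lborel g" "as \<noteq> []" "integrable lborel g"
    "\<And>x. translate_avg as f x \<le> g x" using I by (auto simp: upper_mean_values_def)
  have k': "integrable lborel (\<lambda>x. - k x)" using k(1) by simp
  have "- integral\<^sup>L lborel k = integral\<^sup>L lborel (translate_avg as (\<lambda>x. - k x))"
    using translate_avg_integral(2)[OF k' g(2)] by simp
  also have "\<dots> \<le> integral\<^sup>L lborel g"
    using g translate_avg_mono[of "\<lambda>x. - k x" f as] k(2)
    by (intro integral_mono translate_avg_integral(1)[OF k']) (auto intro: order_trans)
  finally show ?thesis using g by simp
qed

lemma upper_mean_values_bdd:
  assumes "f \<in> dominated_functions" shows "bdd_below (upper_mean_values f)"
proof -
  obtain k where k: "integrable lborel k" "\<And>x. \<bar>f x\<bar> \<le> k x"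
    using assms by (auto simp: dominated_functions_def)
  have "- k x \<le> f x" for x using k(2)[of x] by linarith
  then show ?thesis using upper_mean_values_ge[OF k(1)] by (intro bdd_belowI[of _ "- integral\<^sup>L lborel k"]) auto
qed

lemma upper_mean_values_nonempty:
  assumes "f \<in> dominated_functions" shows "upper_mean_values f \<noteq> {}"
proof -
  obtain k where k: "integrable lborel k" "\<And>x. \<bar>f x\<bar> \<le> k x"
    using assms by (auto simp: dominated_functions_def)
  have "f x \<le> k x" for x using k(2)[of x] by linarith
  then have "integral\<^sup>L lborel k \<in> upper_mean_values f"
    unfolding upper_mean_values_def mem_Collect_eq
    using k(1) by (intro exI[of _ k] exI[of _ "[0]"]) (simp add: translate_avg_single)
  then show ?thesis by blast
qed

lemma upper_mean_le:
  assumes "f \<in> dominated_functions" "as \<noteq> []" "integrable lborel g" "\<And>x. translate_avg as f x \<le> g x"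
  shows "upper_mean f \<le> integral\<^sup>L lborel g"
  unfolding upper_mean_def using assms
  by (intro cInf_lower upper_mean_values_bdd) (auto simp: upper_mean_values_def)

text \<open>Translations commute. If the list \<open>as\<close> serves \<open>f\<close> and
  \<open>bs\<close> serves \<open>g\<close>, the list of all sums serves \<open>f + g\<close>: the
  majorants are averaged once more, each over the other's list, which does not change their
  integrals.\<close>

lemma upper_mean_sublinear: "sublinear_on dominated_functions (upper_mean :: ('a::euclidean_space \<Rightarrow> real) \<Rightarrow> real)"
  unfolding sublinear_on_def
proof (intro conjI ballI allI impI)
  fix f g :: "'a \<Rightarrow> real" assume f: "f \<in> dominated_functions" and g: "g \<in> dominated_functions"
  note fg = dominated.V_add[OF f g]
  have *: "upper_mean (\<lambda>x. f x + g x) \<le> I + J" if I: "I \<in> upper_mean_values f" and J: "J \<in> upper_mean_values g" for I J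
  proof -
    obtain F as where F: "I = integral\<^sup>L lborel F" "as \<noteq> []" "integrable lborel F"
      "\<And>x. translate_avg as f x \<le> F x" using I by (auto simp: upper_mean_values_def)
    obtain G bs where G: "J = integral\<^sup>L lborel G" "bs \<noteq> []" "integrable lborel G"
      "\<And>x. translate_avg bs g x \<le> G x" using J by (auto simp: upper_mean_values_def)
    let ?c = "concat (map (\<lambda>b. map (\<lambda>a. a + b) as) bs)"
    have "upper_mean (\<lambda>x. f x + g x) \<le> integral\<^sup>L lborel (\<lambda>x. translate_avg bs F x + translate_avg as G x)"
    proof (rule upper_mean_le[OF fg])
      show "?c \<noteq> []" using F(2) G(2) by (cases bs) auto
      show "integrable lborel (\<lambda>x. translate_avg bs F x + translate_avg as G x)"
        using F G by (intro Bochner_Integration.integrable_add translate_avg_integral)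
      fix x
      have "translate_avg ?c (\<lambda>x. f x + g x) x = translate_avg bs (translate_avg as f) x + translate_avg as (translate_avg bs g) x"
        unfolding translate_avg_add translate_avg_twice[symmetric] by (simp add: translate_avg_commute)
      also have "\<dots> \<le> translate_avg bs F x + translate_avg as G x"
        by (intro add_mono translate_avg_mono F G)
      finally show "translate_avg ?c (\<lambda>x. f x + g x) x \<le> translate_avg bs F x + translate_avg as G x" .
    qed
    also have "\<dots> = I + J"
      using F G by (subst Bochner_Integration.integral_add) (auto simp: translate_avg_integral)
    finally show ?thesis .
  qed
  have "upper_mean (\<lambda>x. f x + g x) - J \<le> upper_mean f" if "J \<in> upper_mean_values g" for J
    unfolding upper_mean_def[of f]
    by (intro cInf_greatest upper_mean_values_nonempty f) (use *[OF _ that] in \<open>simp add: algebra_simps\<close>)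
  then have "upper_mean (\<lambda>x. f x + g x) - upper_mean f \<le> upper_mean g"
    unfolding upper_mean_def[of g]
    by (intro cInf_greatest upper_mean_values_nonempty g) (simp add: algebra_simps)
  then show "upper_mean (\<lambda>x. f x + g x) \<le> upper_mean f + upper_mean g" by simp
next
  fix f :: "'a \<Rightarrow> real" and c :: real assume f: "f \<in> dominated_functions" and c0: "0 \<le> c"
  have le: "upper_mean (\<lambda>x. c * f x) \<le> c * upper_mean f" if f: "f \<in> dominated_functions" and c: "c > 0" for c and f :: "'a \<Rightarrow> real"
  proof -
    have "upper_mean (\<lambda>x. c * f x) / c \<le> upper_mean f"
      unfolding upper_mean_def[of f]
    proof (intro cInf_greatest upper_mean_values_nonempty f)
      fix I assume "I \<in> upper_mean_values f"
      then obtain g as where g: "I = integral\<^sup>L lborel g" "as \<noteq> []" "integrable lborel g"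
        "\<And>x. translate_avg as f x \<le> g x" by (auto simp: upper_mean_values_def)
      have "upper_mean (\<lambda>x. c * f x) \<le> integral\<^sup>L lborel (\<lambda>x. c * g x)"
        using g c by (intro upper_mean_le[of _ as] dominated.V_scale f) (auto simp: translate_avg_scale)
      then show "upper_mean (\<lambda>x. c * f x) / c \<le> I" using g c by (simp add: field_simps)
    qed
    then show ?thesis using c by (simp add: field_simps)
  qed
  show "upper_mean (\<lambda>x. c * f x) = c * upper_mean f"
  proof (cases "c = 0")
    case True
    have "upper_mean (\<lambda>_::'a. 0 :: real) \<le> integral\<^sup>L lborel (\<lambda>x::'a. 0)"
      by (intro upper_mean_le[of _ "[0]"] dominated.V_zero) (auto simp: translate_avg_single)
    moreover have "0 \<le> upper_mean (\<lambda>_::'a. 0 :: real)"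
      unfolding upper_mean_def using upper_mean_values_ge[of "\<lambda>_. 0" "\<lambda>_::'a. 0::real"]
      by (intro cInf_greatest upper_mean_values_nonempty dominated.V_zero) auto
    ultimately show ?thesis using True by simp
  next
    case False
    with c0 have c: "c > 0" by simp
    have "upper_mean (\<lambda>x. (1 / c) * (c * f x)) \<le> (1 / c) * upper_mean (\<lambda>x. c * f x)"
      using c by (intro le dominated.V_scale f) auto
    then have "c * upper_mean f \<le> upper_mean (\<lambda>x. c * f x)" using c by (simp add: field_simps)
    with le[OF f c] show ?thesis by simp
  qed
qed

text \<open>The averages in \<open>upper_mean\<close> force every linear functional below it to be translation invariant.\<close>
lemma translation_invariant_real_extension:
  obtains q :: "('a::euclidean_space \<Rightarrow> real) \<Rightarrow> real" where
    "\<And>f g. f \<in> dominated_functions \<Longrightarrow> g \<in> dominated_functions \<Longrightarrow> q (\<lambda>x. f x + g x) = q f + q g"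
    and "\<And>f c. f \<in> dominated_functions \<Longrightarrow> c \<ge> 0 \<Longrightarrow> q (\<lambda>x. c * f x) = c * q f"
    and "\<And>f g. f \<in> dominated_functions \<Longrightarrow> g \<in> dominated_functions \<Longrightarrow> (\<And>x. f x \<le> g x) \<Longrightarrow> q f \<le> q g"
    and "\<And>f a. f \<in> dominated_functions \<Longrightarrow> q (\<lambda>x. f (x + a)) = q f"
    and "\<And>f. integrable lborel f \<Longrightarrow> q f = integral\<^sup>L lborel f"
proof -
  obtain q :: "('a \<Rightarrow> real) \<Rightarrow> real" where qle: "\<And>f. f \<in> dominated_functions \<Longrightarrow> q f \<le> upper_mean f"
    and qadd: "\<And>f g. f \<in> dominated_functions \<Longrightarrow> g \<in> dominated_functions \<Longrightarrow> q (\<lambda>x. f x + g x) = q f + q g"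
    and qhom: "\<And>f c. f \<in> dominated_functions \<Longrightarrow> c \<ge> 0 \<Longrightarrow> q (\<lambda>x. c * f x) = c * q f"
    using dominated.linear_minorant[OF upper_mean_sublinear] by blast
  have q0: "q (\<lambda>_. 0) = 0" using qhom[OF dominated.V_zero, of 0] by simp
  have qneg: "q (\<lambda>x. - f x) = - q f" if "f \<in> dominated_functions" for f
    using qadd[OF that dominated.V_uminus[OF that]] q0 by simp
  have qnonpos: "q f \<le> 0" if "f \<in> dominated_functions" "\<And>x. f x \<le> 0" for f
    using qle[OF that(1)] upper_mean_le[OF that(1), of "[0]" "\<lambda>_. 0"] that(2)
    by (simp add: translate_avg_single)
  have qdiff: "q (\<lambda>x. f x - g x) = q f - q g"
    if "f \<in> dominated_functions" "g \<in> dominated_functions" for f g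
    using qadd[OF that(1) dominated.V_uminus[OF that(2)]] qneg[OF that(2)] by simp
  have diffV: "(\<lambda>x. f x - g x) \<in> dominated_functions"
    if "f \<in> dominated_functions" "g \<in> dominated_functions" for f g :: "'a \<Rightarrow> real"
    using dominated.V_add[OF that(1) dominated.V_uminus[OF that(2)]] by simp
  have trans_le: "q (\<lambda>x. f (x + a)) \<le> q f" if f: "f \<in> dominated_functions" for f a
  proof -
    obtain k where k: "integrable lborel k" "\<And>x. \<bar>f x\<bar> \<le> k x"
      using f by (auto simp: dominated_functions_def)
    let ?d = "\<lambda>x. f (x + a) - f x"
    have d: "?d \<in> dominated_functions" by (intro diffV dominated_translation f)
    \<comment> \<open>Averaged over the translates 0, a, ..., (n - 1) a, the difference telescopes
      to \<open>(f (x + n a) - f x) / n\<close>, whose majorant has an integral of order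
      \<open>1 / n\<close>.\<close>
    have "q ?d \<le> 2 * integral\<^sup>L lborel k / real n" if n: "n > 0" for n
    proof -
      let ?as = "map (\<lambda>i. real i *\<^sub>R a) [0..<n]"
      have tel: "(\<Sum>b\<leftarrow>?as. ?d (x + b)) = f (x + real n *\<^sub>R a) - f x" for x
        by (induction n) (auto simp: algebra_simps)
      have "upper_mean ?d \<le> integral\<^sup>L lborel (\<lambda>x. (k (x + real n *\<^sub>R a) + k x) / real n)"
      proof (rule upper_mean_le[OF d])
        show "?as \<noteq> []" using n by simp
        show "integrable lborel (\<lambda>x. (k (x + real n *\<^sub>R a) + k x) / real n)"
          using lborel_translation[OF k(1)] k(1) by auto
        show "translate_avg ?as ?d x \<le> (k (x + real n *\<^sub>R a) + k x) / real n" for x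
          unfolding translate_avg_def tel using k(2)[of x] k(2)[of "x + real n *\<^sub>R a"] n
          by (auto simp: divide_right_mono)
      qed
      also have "\<dots> = 2 * integral\<^sup>L lborel k / real n"
        using lborel_translation[OF k(1)] k(1) by simp
      finally show ?thesis using qle[OF d] by simp
    qed
    then have "eventually (\<lambda>n. q ?d \<le> 2 * integral\<^sup>L lborel k / real n) sequentially"
      by (intro eventually_sequentiallyI[of 1]) simp
    moreover have "(\<lambda>n. 2 * integral\<^sup>L lborel k / real n) \<longlonglongrightarrow> 0"
      by (rule lim_const_over_n)
    ultimately have "q ?d \<le> 0" by (intro tendsto_lowerbound[of _ 0 sequentially]) auto
    then show ?thesis using qdiff[OF dominated_translation[OF f] f] by simp
  qed
  have int_le: "q f \<le> integral\<^sup>L lborel f" if f: "integrable lborel f" for f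
  proof -
    have "f \<in> dominated_functions" using f by (auto simp: dominated_functions_def intro!: exI[of _ "\<lambda>x. \<bar>f x\<bar>"])
    then show ?thesis using qle[of f] upper_mean_le[of f "[0]" f] f by (simp add: translate_avg_single)
  qed
  show thesis
  proof (rule that[OF qadd qhom])
    show "q f \<le> q g" if "f \<in> dominated_functions" "g \<in> dominated_functions" "\<And>x. f x \<le> g x" for f g
      using qnonpos[OF diffV[OF that(1,2)]] qdiff[OF that(1,2)] that(3) by simp
    show "q (\<lambda>x. f (x + a)) = q f" if "f \<in> dominated_functions" for f a
      using trans_le[OF that, of a] trans_le[OF dominated_translation[OF that, of a], of "- a"] by simp
    show "q f = integral\<^sup>L lborel f" if f: "integrable lborel f" for f
    proof -
      have fd: "f \<in> dominated_functions" using f by (auto simp: dominated_functions_def intro!: exI[of _ "\<lambda>x. \<bar>f x\<bar>"])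
      have "q (\<lambda>x. - f x) \<le> integral\<^sup>L lborel (\<lambda>x. - f x)" using f by (intro int_le) simp
      then show ?thesis using int_le[OF f] qneg[OF fd] by simp
    qed
  qed
qed

section \<open>From dominated real functions to arbitrary nonnegative ones\<close>

definition truncate_at :: "('a \<Rightarrow> ennreal) \<Rightarrow> ('a \<Rightarrow> real) \<Rightarrow> 'a \<Rightarrow> real" where
  "truncate_at f g x = enn2real (min (f x) (ennreal (g x)))"

lemma ennreal_le_plusD: "ennreal a \<le> ennreal b + ennreal c \<Longrightarrow> 0 \<le> b \<Longrightarrow> 0 \<le> c \<Longrightarrow> a \<le> b + c"
  by (simp flip: ennreal_plus add: ennreal_le_iff)

lemma ennreal_plus_leD: "ennreal a + ennreal b \<le> ennreal c \<Longrightarrow> 0 \<le> a \<Longrightarrow> 0 \<le> b \<Longrightarrow> 0 \<le> c \<Longrightarrow> a + b \<le> c"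
  by (simp flip: ennreal_plus add: ennreal_le_iff)

lemma ennreal_le_plusI: "a \<le> b + c \<Longrightarrow> 0 \<le> b \<Longrightarrow> 0 \<le> c \<Longrightarrow> ennreal a \<le> ennreal b + ennreal c"
  by (simp flip: ennreal_plus add: ennreal_leI)

lemma truncate_at_bounds:
  assumes "0 \<le> g x"
  shows "0 \<le> truncate_at f g x" "truncate_at f g x \<le> g x" "ennreal (truncate_at f g x) = min (f x) (ennreal (g x))"
proof -
  have fin: "min (f x) (ennreal (g x)) < top" by (rule min.strict_coboundedI2) simp
  show 1: "ennreal (truncate_at f g x) = min (f x) (ennreal (g x))"
    unfolding truncate_at_def using fin by simp
  show "0 \<le> truncate_at f g x" by (simp add: truncate_at_def)
  show "truncate_at f g x \<le> g x"
    using 1 assms by (metis ennreal_le_iff min.cobounded2)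
qed

definition nonneg_integrable :: "('a::euclidean_space \<Rightarrow> real) set" where
  "nonneg_integrable = {g. integrable lborel g \<and> (\<forall>x. 0 \<le> g x)}"

lemma truncate_at_dominated:
  assumes "g \<in> nonneg_integrable" shows "truncate_at f g \<in> dominated_functions"
  using assms truncate_at_bounds[of g _ f]
  by (auto simp: nonneg_integrable_def dominated_functions_def intro!: exI[of _ g])

text \<open>Relay and receiver maps are not assumed measurable in the model, so the converse integrates
  arbitrary functions; translation invariance is what makes the change of variables from noise
  to received signals legitimate.\<close>
locale invariant_integral =
  fixes \<Lambda> :: "('a::euclidean_space \<Rightarrow> ennreal) \<Rightarrow> ennreal"
  assumes I_add: "\<And>f g. \<Lambda> (\<lambda>x. f x + g x) = \<Lambda> f + \<Lambda> g"
    and I_mono: "\<And>f g. (\<And>x. f x \<le> g x) \<Longrightarrow> \<Lambda> f \<le> \<Lambda> g"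
    and I_cmult: "\<And>f c. c \<ge> 0 \<Longrightarrow> \<Lambda> (\<lambda>x. ennreal c * f x) = ennreal c * \<Lambda> f"
    and I_trans: "\<And>f a. \<Lambda> (\<lambda>x. f (x + a)) = \<Lambda> f"
    and I_measurable: "\<And>f. f \<in> borel_measurable borel \<Longrightarrow> \<Lambda> f = (\<integral>\<^sup>+x. f x \<partial>lborel)"

theorem invariant_integral_exists: "\<exists>\<Lambda> :: ('a::euclidean_space \<Rightarrow> ennreal) \<Rightarrow> ennreal. invariant_integral \<Lambda>"
proof (rule translation_invariant_real_extension[where 'a='a], goal_cases)
  case (1 q)
  note qadd = 1(1) and qhom = 1(2) and qmono = 1(3) and qtrans = 1(4) and qint = 1(5)
  let ?G = "nonneg_integrable :: ('a \<Rightarrow> real) set"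
  \<comment> \<open>\<open>q\<close> accepts dominated functions only, so \<open>f\<close> is cut
    down by integrable caps \<open>g\<close>. Any two caps lie below their sum, and over such a
    directed family the supremum commutes with sums.\<close>
  define \<Lambda> :: "('a \<Rightarrow> ennreal) \<Rightarrow> ennreal" where "\<Lambda> f = (SUP g\<in>?G. ennreal (q (truncate_at f g)))" for f
  have Gadd: "(\<lambda>x. g x + h x) \<in> ?G" if "g \<in> ?G" "h \<in> ?G" for g h
    using that by (auto simp: nonneg_integrable_def)
  have "(\<lambda>_. 0) \<in> ?G" by (simp add: nonneg_integrable_def)
  then have Gne: "?G \<noteq> {}" by blast
  have Gnn: "0 \<le> g x" if "g \<in> ?G" for g x using that by (auto simp: nonneg_integrable_def)
  have tb: "0 \<le> truncate_at f g x" "truncate_at f g x \<le> g x"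
    "ennreal (truncate_at f g x) = min (f x) (ennreal (g x))" if "g \<in> ?G" for f g x
    using truncate_at_bounds[of g x f, OF Gnn[OF that]] by auto
  note td = truncate_at_dominated
  have qnn: "0 \<le> q f" if "f \<in> dominated_functions" "\<And>x. 0 \<le> f x" for f
    using qmono[OF dominated.V_zero that(1)] that(2) qhom[OF dominated.V_zero, of 0] by simp
  have mono2: "truncate_at f g x \<le> truncate_at f' g' x"
    if "g \<in> ?G" "g' \<in> ?G" "f x \<le> f' x" "g x \<le> g' x" for f f' g g' and x :: 'a
  proof -
    have "ennreal (truncate_at f g x) \<le> ennreal (truncate_at f' g' x)"
      unfolding tb(3)[OF that(1)] tb(3)[OF that(2)] by (intro min.mono ennreal_leI that)
    then show ?thesis by (simp only: ennreal_le_iff[OF tb(1)[OF that(2)]])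
  qed
  have le: "ennreal (q (truncate_at f g)) \<le> \<Lambda> f" if "g \<in> ?G" for f g
    unfolding \<Lambda>_def using that by (rule SUP_upper)
  have mono: "\<Lambda> f \<le> \<Lambda> f'" if "\<And>x. f x \<le> f' x" for f f'
    unfolding \<Lambda>_def
  proof (rule SUP_mono)
    fix g assume g: "g \<in> ?G"
    have "q (truncate_at f g) \<le> q (truncate_at f' g)"
      by (intro qmono td mono2 g that order_refl)
    then show "\<exists>h\<in>?G. ennreal (q (truncate_at f g)) \<le> ennreal (q (truncate_at f' h))"
      using g ennreal_leI by blast
  qed
  have sub: "\<Lambda> (\<lambda>x. f x + f' x) \<le> \<Lambda> f + \<Lambda> f'" for f f'
    unfolding \<Lambda>_def[of "\<lambda>x. f x + f' x"]
  proof (rule SUP_least)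
    fix g assume g: "g \<in> ?G"
    have pt: "truncate_at (\<lambda>x. f x + f' x) g x \<le> truncate_at f g x + truncate_at f' g x" for x
    proof -
      have *: "min (a + b) c \<le> min a c + min b c" for a b c :: ennreal
      proof (cases "a \<le> c \<and> b \<le> c")
        case False
        then have "c \<le> min a c + min b c"
          by (metis add_increasing add_increasing2 linear min.absorb2 order_refl zero_le)
        then show ?thesis by (rule min.coboundedI2)
      qed (auto simp: min.absorb1)
      have "ennreal (truncate_at (\<lambda>x. f x + f' x) g x) \<le> ennreal (truncate_at f g x) + ennreal (truncate_at f' g x)"
        unfolding tb(3)[OF g] by (rule *)
      then show ?thesis by (rule ennreal_le_plusD) (rule tb(1)[OF g])+
    qed
    have "q (truncate_at (\<lambda>x. f x + f' x) g) \<le> q (\<lambda>x. truncate_at f g x + truncate_at f' g x)"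
      by (intro qmono dominated.V_add td g pt)
    also have "\<dots> = q (truncate_at f g) + q (truncate_at f' g)" by (intro qadd td g)
    finally have "ennreal (q (truncate_at (\<lambda>x. f x + f' x) g)) \<le> ennreal (q (truncate_at f g)) + ennreal (q (truncate_at f' g))"
      by (intro ennreal_le_plusI qnn td g tb(1)) auto
    also have "\<dots> \<le> \<Lambda> f + \<Lambda> f'" by (intro add_mono le g)
    finally show "ennreal (q (truncate_at (\<lambda>x. f x + f' x) g)) \<le> \<Lambda> f + \<Lambda> f'" .
  qed
  have super: "\<Lambda> f + \<Lambda> f' \<le> \<Lambda> (\<lambda>x. f x + f' x)" for f f'
  proof -
    have "\<Lambda> f + \<Lambda> f' = (SUP g\<in>?G. ennreal (q (truncate_at f g)) + ennreal (q (truncate_at f' g)))"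
      unfolding \<Lambda>_def
    proof (rule SUP_add_directed_ennreal[symmetric])
      fix g h assume gh: "g \<in> ?G" "h \<in> ?G"
      have "ennreal (q (truncate_at f g)) + ennreal (q (truncate_at f' h)) \<le>
          ennreal (q (truncate_at f (\<lambda>x. g x + h x))) + ennreal (q (truncate_at f' (\<lambda>x. g x + h x)))"
        using gh Gadd[OF gh]
        by (intro add_mono ennreal_leI qmono td mono2) (auto simp: Gnn)
      then show "\<exists>k\<in>?G. ennreal (q (truncate_at f g)) + ennreal (q (truncate_at f' h)) \<le>
          ennreal (q (truncate_at f k)) + ennreal (q (truncate_at f' k))" using Gadd[OF gh] by blast
    qed
    also have "\<dots> \<le> \<Lambda> (\<lambda>x. f x + f' x)"
    proof (rule SUP_least)
      fix g assume g: "g \<in> ?G"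
      have pt: "truncate_at f g x + truncate_at f' g x \<le> truncate_at (\<lambda>x. f x + f' x) (\<lambda>x. g x + g x) x" for x
      proof -
        have *: "min a c + min b c \<le> min (a + b) (c + c)" for a b c :: ennreal
          by (intro min.boundedI add_mono) auto
        have "ennreal (truncate_at f g x) + ennreal (truncate_at f' g x) \<le> ennreal (truncate_at (\<lambda>x. f x + f' x) (\<lambda>x. g x + g x) x)"
          unfolding tb(3)[OF g] tb(3)[OF Gadd[OF g g]] ennreal_plus[OF Gnn[OF g] Gnn[OF g]] by (rule *)
        then show ?thesis
          by (rule ennreal_plus_leD) (rule tb(1)[OF g] tb(1)[OF Gadd[OF g g]])+
      qed
      have "q (truncate_at f g) + q (truncate_at f' g) = q (\<lambda>x. truncate_at f g x + truncate_at f' g x)"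
        by (intro qadd[symmetric] td g)
      also have "\<dots> \<le> q (truncate_at (\<lambda>x. f x + f' x) (\<lambda>x. g x + g x))"
        by (intro qmono dominated.V_add td g pt Gadd)
      finally have "ennreal (q (truncate_at f g)) + ennreal (q (truncate_at f' g)) \<le> ennreal (q (truncate_at (\<lambda>x. f x + f' x) (\<lambda>x. g x + g x)))"
        using qnn[OF td[OF g] tb(1)[OF g]] by (simp flip: ennreal_plus add: ennreal_leI)
      also have "\<dots> \<le> \<Lambda> (\<lambda>x. f x + f' x)" by (intro le Gadd g)
      finally show "ennreal (q (truncate_at f g)) + ennreal (q (truncate_at f' g)) \<le> \<Lambda> (\<lambda>x. f x + f' x)" .
    qed
    finally show ?thesis .
  qed
  have trans_le: "\<Lambda> (\<lambda>x. f (x + a)) \<le> \<Lambda> f" for f a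
    unfolding \<Lambda>_def[of "\<lambda>x. f (x + a)"]
  proof (rule SUP_least)
    fix g assume g: "g \<in> ?G"
    have g': "(\<lambda>x. g (x + - a)) \<in> ?G" using g lborel_translation(1)[of g "- a"] by (auto simp: nonneg_integrable_def)
    have "truncate_at (\<lambda>x. f (x + a)) g = (\<lambda>x. truncate_at f (\<lambda>x. g (x + - a)) (x + a))"
      by (auto simp: truncate_at_def)
    then show "ennreal (q (truncate_at (\<lambda>x. f (x + a)) g)) \<le> \<Lambda> f"
      using le[OF g', of f] qtrans[OF td[OF g']] by simp
  qed
  have trans: "\<Lambda> (\<lambda>x. f (x + a)) = \<Lambda> f" for f a
    using trans_le[of f a] trans_le[of "\<lambda>x. f (x + a)" "- a"] by simp
  have cmult_le: "\<Lambda> (\<lambda>x. ennreal c * f x) \<le> ennreal c * \<Lambda> f" if c: "c > 0" for c f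
    unfolding \<Lambda>_def[of "\<lambda>x. ennreal c * f x"]
  proof (rule SUP_least)
    fix g assume g: "g \<in> ?G"
    have g': "(\<lambda>x. g x / c) \<in> ?G" using g c by (auto simp: nonneg_integrable_def)
    have "truncate_at (\<lambda>x. ennreal c * f x) g = (\<lambda>x. c * truncate_at f (\<lambda>x. g x / c) x)"
    proof
      fix x
      have "ennreal (g x) = ennreal c * ennreal (g x / c)" using c Gnn[OF g] by (simp flip: ennreal_mult)
      then have "min (ennreal c * f x) (ennreal (g x)) = ennreal c * min (f x) (ennreal (g x / c))"
        by (simp add: min_of_mono monoI mult_left_mono)
      then show "truncate_at (\<lambda>x. ennreal c * f x) g x = c * truncate_at f (\<lambda>x. g x / c) x"
        using c by (simp add: truncate_at_def enn2real_mult)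
    qed
    then have "ennreal (q (truncate_at (\<lambda>x. ennreal c * f x) g)) = ennreal c * ennreal (q (truncate_at f (\<lambda>x. g x / c)))"
      using c qhom[OF td[OF g'], of c f] qnn[OF td[OF g'] tb(1)[OF g']] by (simp add: ennreal_mult)
    also have "\<dots> \<le> ennreal c * \<Lambda> f" by (intro mult_left_mono le g') simp
    finally show "ennreal (q (truncate_at (\<lambda>x. ennreal c * f x) g)) \<le> ennreal c * \<Lambda> f" .
  qed
  have cmult: "\<Lambda> (\<lambda>x. ennreal c * f x) = ennreal c * \<Lambda> f" if c0: "c \<ge> 0" for c f
  proof (cases "c = 0")
    case True
    have "\<Lambda> (\<lambda>_. 0) = 0"
      using Gne qhom[OF dominated.V_zero, of 0] by (simp add: \<Lambda>_def truncate_at_def[abs_def])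
    then show ?thesis using True by simp
  next
    case False
    with c0 have c: "c > 0" by simp
    have e: "ennreal (1 / c) * ennreal c = 1" "ennreal c * ennreal (1 / c) = 1"
      using c by (simp_all flip: ennreal_mult add: ennreal_1[symmetric] del: ennreal_1)
    have "\<Lambda> f = \<Lambda> (\<lambda>x. ennreal (1 / c) * (ennreal c * f x))"
      using e by (simp add: mult.assoc[symmetric])
    also have "\<dots> \<le> ennreal (1 / c) * \<Lambda> (\<lambda>x. ennreal c * f x)" using c by (intro cmult_le) simp
    finally have "ennreal c * \<Lambda> f \<le> ennreal c * (ennreal (1 / c) * \<Lambda> (\<lambda>x. ennreal c * f x))"
      by (rule mult_left_mono) simp
    then show ?thesis using cmult_le[OF c, of f] e by (simp add: mult.assoc[symmetric])
  qed
  have meas: "\<Lambda> f = (\<integral>\<^sup>+x. f x \<partial>lborel)" if f: "f \<in> borel_measurable borel" for f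
  proof -
    have qt: "ennreal (q (truncate_at f g)) = (\<integral>\<^sup>+x. min (f x) (ennreal (g x)) \<partial>lborel)" if g: "g \<in> ?G" for g
    proof -
      have gi: "integrable lborel g" using g by (simp add: nonneg_integrable_def)
      have gm: "g \<in> borel_measurable borel" using gi by auto
      have tm: "truncate_at f g \<in> borel_measurable lborel"
        unfolding truncate_at_def[abs_def] using f gm by measurable
      have ti: "integrable lborel (truncate_at f g)"
        using tb(1,2)[OF g] Gnn[OF g] by (intro Bochner_Integration.integrable_bound[OF gi tm]) auto
      have "ennreal (q (truncate_at f g)) = (\<integral>\<^sup>+x. ennreal (truncate_at f g x) \<partial>lborel)"
        using tb(1)[OF g] by (simp add: qint[OF ti] nn_integral_eq_integral[OF ti])
      also have "\<dots> = (\<integral>\<^sup>+x. min (f x) (ennreal (g x)) \<partial>lborel)"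
        using tb(3)[OF g] by simp
      finally show ?thesis .
    qed
    have up: "\<Lambda> f \<le> (\<integral>\<^sup>+x. f x \<partial>lborel)"
      unfolding \<Lambda>_def by (rule SUP_least) (auto simp: qt intro!: nn_integral_mono)
    \<comment> \<open>For measurable \<open>f\<close> these caps exhaust \<open>f\<close>
      monotonically. Monotone convergence is applied to the Lebesgue integral, since
      \<open>q\<close> itself is only finitely additive.\<close>
    define g :: "nat \<Rightarrow> 'a \<Rightarrow> real" where "g n x = real n * indicator (cball 0 (real n)) x" for n x
    have gG: "g n \<in> ?G" for n
      unfolding nonneg_integrable_def g_def
      by (auto intro!: integrable_real_indicator intro: emeasure_lborel_cball_finite)
    have inc: "incseq (\<lambda>n x. min (f x) (ennreal (g n x)))"
    proof (intro incseq_SucI le_funI min.mono order_refl ennreal_leI)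
      show "g n x \<le> g (Suc n) x" for n x by (auto simp: g_def indicator_def)
    qed
    have sup: "(SUP n. min (f x) (ennreal (g n x))) = f x" for x
    proof -
      have "(SUP n. ennreal (g n x)) = top"
      proof (rule ennreal_SUP_eq_top)
        fix k :: nat
        obtain n :: nat where n: "real k \<le> real n" "norm x \<le> real n"
          by (meson max.bounded_iff real_arch_simple)
        then have "of_nat k \<le> ennreal (g n x)"
          by (auto simp: g_def ennreal_of_nat_eq_real_of_nat intro!: ennreal_leI)
        then show "\<exists>n\<in>UNIV. of_nat k \<le> ennreal (g n x)" by blast
      qed
      then show ?thesis
        by (simp only: inf_min[symmetric] inf_SUP[symmetric] inf_top_right)
    qed
    have "(\<integral>\<^sup>+x. f x \<partial>lborel) = (SUP n. \<integral>\<^sup>+x. min (f x) (ennreal (g n x)) \<partial>lborel)"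
    proof -
      have "(\<lambda>x. min (f x) (ennreal (g n x))) \<in> borel_measurable lborel" for n
        using f unfolding g_def
        by (intro borel_measurable_min measurable_compose[OF _ measurable_ennreal]
            borel_measurable_times borel_measurable_indicator) auto
      from nn_integral_monotone_convergence_SUP[OF inc this] show ?thesis by (simp only: sup)
    qed
    also have "\<dots> = (SUP n. ennreal (q (truncate_at f (g n))))" by (simp add: qt[OF gG])
    also have "\<dots> \<le> \<Lambda> f" by (intro SUP_least le gG)
    finally show ?thesis using up by simp
  qed
  show ?thesis
    by (intro exI[of _ \<Lambda>] invariant_integral.intro antisym sub super mono trans cmult meas)
qed

section \<open>Complex Gaussian densities\<close>

text \<open>Splits the measure into real and imaginary part, so that complex Gaussian integrals
  reduce to those of the real normal density.\<close>

lemma lborel_complex: "lborel = distr (lborel \<Otimes>\<^sub>M lborel) borel (\<lambda>(x, y). Complex x y)"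
proof (rule lborel_eqI)
  have m: "(\<lambda>(x, y). Complex x y) \<in> borel_measurable ((lborel :: real measure) \<Otimes>\<^sub>M (lborel :: real measure))"
    unfolding Complex_eq split_def by measurable
  fix l u :: complex assume lu: "\<And>b. b \<in> Basis \<Longrightarrow> l \<bullet> b \<le> u \<bullet> b"
  have le: "Re l \<le> Re u" "Im l \<le> Im u" using lu[of 1] lu[of \<i>] by (auto simp: Basis_complex_def inner_complex_def)
  have vim: "(\<lambda>(x, y). Complex x y) -` box l u \<inter> space (lborel \<Otimes>\<^sub>M lborel) = {Re l<..<Re u} \<times> {Im l<..<Im u}"
    by (auto simp: box_def Basis_complex_def inner_complex_def space_pair_measure)
  have "emeasure (distr (lborel \<Otimes>\<^sub>M lborel) borel (\<lambda>(x, y). Complex x y)) (box l u) =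
      emeasure (lborel \<Otimes>\<^sub>M lborel) ({Re l<..<Re u} \<times> {Im l<..<Im u})"
    using vim by (subst emeasure_distr[OF m]) auto
  also have "\<dots> = ennreal (Re u - Re l) * ennreal (Im u - Im l)"
    using le by (subst lborel.emeasure_pair_measure_Times) auto
  also have "\<dots> = (\<Prod>b\<in>Basis. (u - l) \<bullet> b)"
    using le by (simp add: Basis_complex_def inner_complex_def ennreal_mult)
  finally show "emeasure (distr (lborel \<Otimes>\<^sub>M lborel) borel (\<lambda>(x, y). Complex x y)) (box l u) = (\<Prod>b\<in>Basis. (u - l) \<bullet> b)" .
qed simp

lemma nn_integral_lborel_complex_prod:
  assumes [measurable]: "f \<in> borel_measurable borel" "g \<in> borel_measurable borel"
  shows "(\<integral>\<^sup>+z. f (Re z) * g (Im z) \<partial>lborel) = (\<integral>\<^sup>+x. f x \<partial>lborel) * (\<integral>\<^sup>+y. g y \<partial>lborel)"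
proof -
  have m: "(\<lambda>(x, y). Complex x y) \<in> borel_measurable ((lborel :: real measure) \<Otimes>\<^sub>M (lborel :: real measure))"
    unfolding Complex_eq split_def by measurable
  have "(\<integral>\<^sup>+z. f (Re z) * g (Im z) \<partial>lborel) = (\<integral>\<^sup>+p. f (fst p) * g (snd p) \<partial>(lborel \<Otimes>\<^sub>M lborel))"
    by (subst lborel_complex, subst nn_integral_distr[OF m]) (auto simp: split_def)
  also have "\<dots> = (\<integral>\<^sup>+x. \<integral>\<^sup>+y. f x * g y \<partial>lborel \<partial>lborel)"
    by (subst lborel.nn_integral_fst[symmetric]) auto
  also have "\<dots> = (\<integral>\<^sup>+x. f x \<partial>lborel) * (\<integral>\<^sup>+y. g y \<partial>lborel)"
    by (simp add: nn_integral_cmult nn_integral_multc)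
  finally show ?thesis .
qed

lemma nn_integral_lborel_translation:
  fixes f :: "'a::euclidean_space \<Rightarrow> ennreal"
  assumes [measurable]: "f \<in> borel_measurable borel"
  shows "(\<integral>\<^sup>+x. f (x + a) \<partial>lborel) = (\<integral>\<^sup>+x. f x \<partial>lborel)"
proof -
  have "(\<integral>\<^sup>+x. f x \<partial>lborel) = (\<integral>\<^sup>+x. f x \<partial>distr lborel borel ((+) a))" by (simp add: lborel_distr_plus)
  also have "\<dots> = (\<integral>\<^sup>+x. f (x + a) \<partial>lborel)" by (subst nn_integral_distr) (auto simp: add.commute)
  finally show ?thesis ..
qed

text \<open>The circularly symmetric complex normal density of total variance \<open>v\<close>, that
  is \<open>v / 2\<close> for each real component; \<open>cgauss 1\<close> is the density of
  \<open>CN01\<close>.\<close>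

definition cgauss :: "real \<Rightarrow> complex \<Rightarrow> real" where
  "cgauss v z = exp (- (cmod z)\<^sup>2 / v) / (pi * v)"

lemma cgauss_pos: "v > 0 \<Longrightarrow> cgauss v z > 0"
  by (simp add: cgauss_def)

lemma cgauss_measurable[measurable]: "cgauss v \<in> borel_measurable borel"
  unfolding cgauss_def[abs_def] by measurable

lemma cgauss_normal:
  assumes "v > 0"
  shows "cgauss v (z - m) = normal_density (Re m) (sqrt (v / 2)) (Re z) * normal_density (Im m) (sqrt (v / 2)) (Im z)"
proof -
  have s: "2 * (sqrt (v / 2))\<^sup>2 = v" "2 * pi * (sqrt (v / 2))\<^sup>2 = pi * v" using assms by auto
  have "normal_density (Re m) (sqrt (v / 2)) (Re z) * normal_density (Im m) (sqrt (v / 2)) (Im z)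
     = (1 / (sqrt (pi * v) * sqrt (pi * v))) * (exp (- (Re z - Re m)\<^sup>2 / v) * exp (- (Im z - Im m)\<^sup>2 / v))"
    unfolding normal_density_def s by simp
  also have "\<dots> = (1 / (pi * v)) * exp (- (Re z - Re m)\<^sup>2 / v + - (Im z - Im m)\<^sup>2 / v)"
    using assms by (simp only: exp_add) simp
  also have "- (Re z - Re m)\<^sup>2 / v + - (Im z - Im m)\<^sup>2 / v = - (cmod (z - m))\<^sup>2 / v"
    by (simp add: cmod_power2 add_divide_distrib diff_divide_distrib)
  finally show ?thesis by (simp add: cgauss_def)
qed

lemma nn_integral_normal_density: "\<sigma> > 0 \<Longrightarrow> (\<integral>\<^sup>+x. ennreal (normal_density \<mu> \<sigma> x) \<partial>lborel) = 1"
  by (subst nn_integral_eq_integral) auto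

lemma nn_integral_normal_second_moment:
  assumes s: "\<sigma> > 0"
  shows "(\<integral>\<^sup>+x. ennreal (normal_density \<mu> \<sigma> x * x\<^sup>2) \<partial>lborel) = ennreal (\<sigma>\<^sup>2 + \<mu>\<^sup>2)"
proof -
  have "has_bochner_integral lborel
      (\<lambda>x. normal_density \<mu> \<sigma> x * (x - \<mu>) ^ (2 * 1) + (2 * \<mu>) * (normal_density \<mu> \<sigma> x * x) - \<mu>\<^sup>2 * normal_density \<mu> \<sigma> x)
      (fact (2 * 1) / ((2 / \<sigma>\<^sup>2)^1 * fact 1) + (2 * \<mu>) * \<mu> - \<mu>\<^sup>2 * 1)"
    by (intro has_bochner_integral_add has_bochner_integral_diff has_bochner_integral_mult_right
        normal_moment_even normal_moment_nz_1 s)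
       (auto simp: has_bochner_integral_iff s)
  moreover have "fact (2 * 1) / ((2 / \<sigma>\<^sup>2)^1 * fact 1) + (2 * \<mu>) * \<mu> - \<mu>\<^sup>2 * 1 = \<sigma>\<^sup>2 + \<mu>\<^sup>2"
    using s by (simp add: power2_eq_square)
  moreover have "(\<lambda>x. normal_density \<mu> \<sigma> x * (x - \<mu>) ^ (2 * 1) + (2 * \<mu>) * (normal_density \<mu> \<sigma> x * x) - \<mu>\<^sup>2 * normal_density \<mu> \<sigma> x)
     = (\<lambda>x. normal_density \<mu> \<sigma> x * x\<^sup>2)"
    by (intro ext) (simp add: power2_eq_square algebra_simps)
  ultimately have "has_bochner_integral lborel (\<lambda>x. normal_density \<mu> \<sigma> x * x\<^sup>2) (\<sigma>\<^sup>2 + \<mu>\<^sup>2)" by (simp only:)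
  then show ?thesis by (subst nn_integral_eq_integral) (auto simp: has_bochner_integral_iff)
qed

lemma nn_integral_cgauss:
  assumes v: "v > 0" shows "(\<integral>\<^sup>+z. ennreal (cgauss v (z - m)) \<partial>lborel) = 1"
  using v nn_integral_lborel_complex_prod[of "\<lambda>x. ennreal (normal_density (Re m) (sqrt (v / 2)) x)"
      "\<lambda>x. ennreal (normal_density (Im m) (sqrt (v / 2)) x)"]
  by (simp add: cgauss_normal ennreal_mult nn_integral_normal_density)

lemma nn_integral_cgauss_second_moment:
  assumes v: "v > 0"
  shows "(\<integral>\<^sup>+z. ennreal (cgauss v (z - m) * (cmod z)\<^sup>2) \<partial>lborel) = ennreal (v + (cmod m)\<^sup>2)"
proof -
  let ?s = "sqrt (v / 2)"
  let ?f = "\<lambda>x. ennreal (normal_density (Re m) ?s x)" and ?g = "\<lambda>x. ennreal (normal_density (Im m) ?s x)"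
  have s: "?s > 0" using v by simp
  have "(\<integral>\<^sup>+z. ennreal (cgauss v (z - m) * (cmod z)\<^sup>2) \<partial>lborel) =
     (\<integral>\<^sup>+z. ennreal (normal_density (Re m) ?s (Re z) * (Re z)\<^sup>2) * ?g (Im z) +
        ?f (Re z) * ennreal (normal_density (Im m) ?s (Im z) * (Im z)\<^sup>2) \<partial>lborel)"
    by (intro nn_integral_cong)
       (simp add: cgauss_normal[OF v] cmod_power2 algebra_simps flip: ennreal_mult ennreal_plus)
  also have "\<dots> = ennreal (v / 2 + (Re m)\<^sup>2) + ennreal (v / 2 + (Im m)\<^sup>2)"
    using v
    by (subst nn_integral_add)
       (auto simp: nn_integral_lborel_complex_prod[of "\<lambda>x. ennreal (normal_density (Re m) ?s x * x\<^sup>2)" ?g]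
         nn_integral_lborel_complex_prod[of ?f "\<lambda>x. ennreal (normal_density (Im m) ?s x * x\<^sup>2)"]
         nn_integral_normal_density nn_integral_normal_second_moment)
  also have "\<dots> = ennreal (v + (cmod m)\<^sup>2)"
    using v by (simp add: cmod_power2 flip: ennreal_plus)
  finally show ?thesis .
qed

lemma nn_integral_exp_square:
  assumes c: "c > 0"
  shows "(\<integral>\<^sup>+z. ennreal (exp (- c * (cmod (z - m))\<^sup>2)) \<partial>lborel) = ennreal (pi / c)"
proof -
  have "exp (- c * (cmod (z - m))\<^sup>2) = (pi / c) * cgauss (1 / c) (z - m)" for z
    using c by (simp add: cgauss_def mult.commute)
  then have "(\<integral>\<^sup>+z. ennreal (exp (- c * (cmod (z - m))\<^sup>2)) \<partial>lborel) =
      (\<integral>\<^sup>+z. ennreal (pi / c) * ennreal (cgauss (1 / c) (z - m)) \<partial>lborel)"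
    using c by (subst ennreal_mult[symmetric]) (auto simp: cgauss_pos less_imp_le)
  also have "\<dots> = ennreal (pi / c)"
    using c by (subst nn_integral_cmult) (auto simp: nn_integral_cgauss)
  finally show ?thesis .
qed

text \<open>The Gaussian conditioning identity: the joint exponent of \<open>x\<close> and
  \<open>y\<close> splits into that of \<open>x\<close> given \<open>y\<close>, with precision
  \<open>d\<close>, and the marginal exponent of \<open>y\<close>.\<close>

lemma complete_square:
  fixes x y h :: complex
  assumes a: "a > 0" and b: "b \<ge> 0"
  defines "d \<equiv> a + b * (cmod h)\<^sup>2"
  shows "a * (cmod x)\<^sup>2 + b * (cmod (y - h * x))\<^sup>2 =
    d * (cmod (x - of_real (b / d) * cnj h * y))\<^sup>2 + (a * b / d) * (cmod y)\<^sup>2"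
proof -
  have d: "d > 0" using a b by (simp add: d_def add_pos_nonneg)
  have n: "complex_of_real ((cmod w)\<^sup>2) = w * cnj w" for w by (rule complex_norm_square)
  have dc: "complex_of_real d = of_real a + of_real b * (h * cnj h)"
    unfolding d_def by (simp only: of_real_add of_real_mult n)
  have d0: "complex_of_real d \<noteq> 0" using d by simp
  \<comment> \<open>Over the complex numbers a squared modulus is \<open>w * cnj w\<close>, and
    after multiplication by \<open>d\<close> the claim is a polynomial identity in \<open>x\<close>,
    \<open>y\<close>, \<open>h\<close> and their conjugates.\<close>
  have "complex_of_real (d * (a * (cmod x)\<^sup>2 + b * (cmod (y - h * x))\<^sup>2)) =
     complex_of_real (d * (d * (cmod (x - of_real (b / d) * cnj h * y))\<^sup>2 + (a * b / d) * (cmod y)\<^sup>2))"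
  proof -
    have "complex_of_real (d * (d * (cmod (x - of_real (b / d) * cnj h * y))\<^sup>2 + (a * b / d) * (cmod y)\<^sup>2))
       = (of_real d * x - of_real b * cnj h * y) * cnj (of_real d * x - of_real b * cnj h * y) + of_real a * of_real b * (y * cnj y)"
      unfolding of_real_mult of_real_add n of_real_divide using d0 by (simp add: field_simps)
    also have "\<dots> = of_real d * (of_real a * (x * cnj x) + of_real b * ((y - h * x) * cnj (y - h * x)))"
      unfolding dc complex_cnj_diff complex_cnj_add complex_cnj_mult complex_cnj_complex_of_real complex_cnj_cnj
      by algebra
    also have "\<dots> = complex_of_real (d * (a * (cmod x)\<^sup>2 + b * (cmod (y - h * x))\<^sup>2))"
      unfolding of_real_mult of_real_add n by simp
    finally show ?thesis ..
  qed
  then have "d * (a * (cmod x)\<^sup>2 + b * (cmod (y - h * x))\<^sup>2) =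
     d * (d * (cmod (x - of_real (b / d) * cnj h * y))\<^sup>2 + (a * b / d) * (cmod y)\<^sup>2)"
    by (simp only: of_real_eq_iff)
  then show ?thesis using d by (simp only: mult_left_cancel)
qed

lemma nn_integral_gaussian_convolution:
  fixes h y :: complex
  assumes a: "a > 0" and b: "b \<ge> 0"
  defines "d \<equiv> a + b * (cmod h)\<^sup>2"
  shows "(\<integral>\<^sup>+x. ennreal (exp (- (a * (cmod x)\<^sup>2) - b * (cmod (y - h * x))\<^sup>2)) \<partial>lborel) =
    ennreal (pi / d * exp (- (a * b / d) * (cmod y)\<^sup>2))"
proof -
  have d: "d > 0" using a b by (simp add: d_def add_pos_nonneg)
  have "exp (- (a * (cmod x)\<^sup>2) - b * (cmod (y - h * x))\<^sup>2) =
     exp (- (a * b / d) * (cmod y)\<^sup>2) * exp (- d * (cmod (x - of_real (b / d) * cnj h * y))\<^sup>2)" for x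
    using complete_square[OF a b, of x y h, folded d_def]
    by (simp add: exp_add[symmetric] algebra_simps)
  then have "(\<integral>\<^sup>+x. ennreal (exp (- (a * (cmod x)\<^sup>2) - b * (cmod (y - h * x))\<^sup>2)) \<partial>lborel) =
     (\<integral>\<^sup>+x. ennreal (exp (- (a * b / d) * (cmod y)\<^sup>2)) * ennreal (exp (- d * (cmod (x - of_real (b / d) * cnj h * y))\<^sup>2)) \<partial>lborel)"
    by (simp add: ennreal_mult)
  also have "\<dots> = ennreal (exp (- (a * b / d) * (cmod y)\<^sup>2)) * ennreal (pi / d)"
    using nn_integral_exp_square[OF d] by (subst nn_integral_cmult) auto
  finally show ?thesis using d by (simp add: mult.commute flip: ennreal_mult)
qed

lemma CN01_eq: "CN01 = density lborel (\<lambda>z. ennreal (cgauss 1 z))"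
  by (simp add: CN01_def cgauss_def)

lemma space_CN01[simp]: "space CN01 = UNIV" and sets_CN01[simp, measurable_cong]: "sets CN01 = sets borel"
  by (simp_all add: CN01_def)

lemma prob_space_CN01: "prob_space CN01"
  using nn_integral_cgauss[of 1 0] by (intro prob_spaceI) (simp add: CN01_eq emeasure_density)

lemma nn_integral_CN01:
  "f \<in> borel_measurable borel \<Longrightarrow> (\<integral>\<^sup>+z. f z \<partial>CN01) = (\<integral>\<^sup>+z. ennreal (cgauss 1 z) * f z \<partial>lborel)"
  unfolding CN01_eq by (subst nn_integral_density) auto

lemma CN01_second_moment: "(\<integral>\<^sup>+z. ennreal ((cmod (z + m))\<^sup>2) \<partial>CN01) = ennreal (1 + (cmod m)\<^sup>2)"
proof -
  have "(\<integral>\<^sup>+z. ennreal ((cmod (z + m))\<^sup>2) \<partial>CN01) = (\<integral>\<^sup>+z. ennreal (cgauss 1 (z + m - m) * (cmod (z + m))\<^sup>2) \<partial>lborel)"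
    by (subst nn_integral_CN01) (auto simp: ennreal_mult' cgauss_pos less_imp_le)
  also have "\<dots> = (\<integral>\<^sup>+z. ennreal (cgauss 1 (z - m) * (cmod z)\<^sup>2) \<partial>lborel)"
    by (rule nn_integral_lborel_translation) auto
  finally show ?thesis by (simp add: nn_integral_cgauss_second_moment)
qed

section \<open>Iterated integrals over noise coordinates\<close>

text \<open>The head of the list is the outermost integral and coordinates off the list stay frozen
  at \<open>z\<close>. Along a chronological list the latest coordinates are thus integrated first.
  The order must be fixed because a non-measurable integrand admits no Fubini theorem.\<close>

primrec iter :: "(('a \<Rightarrow> ennreal) \<Rightarrow> ennreal) \<Rightarrow> 'i list \<Rightarrow> (('i \<Rightarrow> 'a) \<Rightarrow> ennreal) \<Rightarrow> ('i \<Rightarrow> 'a) \<Rightarrow> ennreal" where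
  "iter L [] F z = F z"
| "iter L (i # is) F z = L (\<lambda>x. iter L is F (z(i := x)))"

lemma iter_append: "iter L (xs @ ys) F z = iter L xs (iter L ys F) z"
  by (induction xs arbitrary: z) auto

lemma iter_single: "iter L [i] F = (\<lambda>z. L (\<lambda>x. F (z(i := x))))"
  by (rule ext) simp

locale positive_functional =
  fixes L :: "('a \<Rightarrow> ennreal) \<Rightarrow> ennreal"
  assumes L_add: "\<And>f g. L (\<lambda>x. f x + g x) = L f + L g"
    and L_mono: "\<And>f g. (\<And>x. f x \<le> g x) \<Longrightarrow> L f \<le> L g"
    and L_cmult: "\<And>f c. c \<ge> 0 \<Longrightarrow> L (\<lambda>x. ennreal c * f x) = ennreal c * L f"
begin

lemma iter_mono: "(\<And>z. F z \<le> G z) \<Longrightarrow> iter L is F z \<le> iter L is G z"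
  by (induction "is" arbitrary: z) (auto intro: L_mono)

lemma iter_add: "iter L is (\<lambda>z. F z + G z) z = iter L is F z + iter L is G z"
  by (induction "is" arbitrary: z) (auto simp: L_add)

lemma iter_cmult: "c \<ge> 0 \<Longrightarrow> iter L is (\<lambda>z. ennreal c * F z) z = ennreal c * iter L is F z"
  by (induction "is" arbitrary: z) (auto simp: L_cmult)

lemma iter_zero: "iter L is (\<lambda>_. 0) z = 0"
  using iter_cmult[of 0 "is" "\<lambda>_. 0" z] by simp

lemma iter_sum: "finite A \<Longrightarrow> iter L is (\<lambda>z. \<Sum>a\<in>A. F a z) z = (\<Sum>a\<in>A. iter L is (F a) z)"
  by (induction A rule: finite_induct) (auto simp: iter_zero iter_add)

lemma iter_factor:
  assumes "\<And>j z x. j \<in> set is \<Longrightarrow> A (z(j := x)) = A z" and "\<And>z. A z \<ge> 0"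
  shows "iter L is (\<lambda>z. ennreal (A z) * F z) z = ennreal (A z) * iter L is F z"
  using assms(1)
proof (induction "is" arbitrary: z)
  case (Cons i "is")
  have "iter L (i # is) (\<lambda>z. ennreal (A z) * F z) z = L (\<lambda>x. ennreal (A (z(i := x))) * iter L is F (z(i := x)))"
    using Cons by simp
  also have "\<dots> = L (\<lambda>x. ennreal (A z) * iter L is F (z(i := x)))" by (simp only: Cons.prems list.set_intros(1))
  finally show ?case by (simp add: L_cmult assms(2))
qed simp

end

sublocale invariant_integral \<subseteq> positive_functional \<Lambda>
  by standard (rule I_add I_mono I_cmult; assumption)+

context invariant_integral
begin

text \<open>The shift \<open>g i\<close> may depend only on coordinates before \<open>i\<close> in
  the list, a triangular change of variables. The last coordinate is innermost and occurs in no
  shift, so its own shift is a constant there and disappears by translation invariance; the rest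
  follows by induction from the end.\<close>

lemma iter_shear:
  assumes "distinct is"
    and "\<And>xs i ys j z x. is = xs @ i # ys \<Longrightarrow> j \<in> set (i # ys) \<Longrightarrow> g i (z(j := x)) = g i z"
  shows "iter \<Lambda> is (\<lambda>z. F (\<lambda>i. if i \<in> set is then z i + g i z else z i)) z = iter \<Lambda> is F z"
  using assms
proof (induction "is" arbitrary: F rule: rev_induct)
  case (snoc i xs)
  let ?s = "\<lambda>z k. if k \<in> set xs then z k + g k z else z k"
  have gk: "g k (z(i := x)) = g k z" if k: "k \<in> set xs" for k z x
  proof -
    obtain us vs where "xs = us @ k # vs" using k by (meson split_list)
    then show ?thesis by (intro snoc.prems(2)[of us k "vs @ [i]" i]) auto
  qed
  have gi: "g i (z(i := x)) = g i z" for z x by (rule snoc.prems(2)[of xs i "[]" i]) auto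
  have i: "i \<notin> set xs" using snoc.prems(1) by simp
  have eq: "(\<lambda>k. if k \<in> set (xs @ [i]) then (z(i := x)) k + g k (z(i := x)) else (z(i := x)) k) = (?s z)(i := x + g i z)" for z x
    using gk gi i by auto
  have "iter \<Lambda> (xs @ [i]) (\<lambda>z. F (\<lambda>k. if k \<in> set (xs @ [i]) then z k + g k z else z k)) z
     = iter \<Lambda> xs (\<lambda>z. \<Lambda> (\<lambda>x. F ((?s z)(i := x + g i z)))) z"
    unfolding iter_append by (simp only: iter_single eq)
  also have "\<dots> = iter \<Lambda> xs (\<lambda>z. \<Lambda> (\<lambda>x. F ((?s z)(i := x)))) z"
    using I_trans[of "\<lambda>x. F ((?s _)(i := x))"] by simp
  also have "\<dots> = iter \<Lambda> xs (\<lambda>z. \<Lambda> (\<lambda>x. F (z(i := x)))) z"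
  proof (rule snoc.IH[of "\<lambda>z. \<Lambda> (\<lambda>x. F (z(i := x)))"])
    show "distinct xs" using snoc.prems(1) by simp
    show "g k (z(j := x)) = g k z" if "xs = us @ k # vs" "j \<in> set (k # vs)" for us k vs j z x
      using that by (intro snoc.prems(2)[of us k "vs @ [i]" j]) auto
  qed
  finally show ?case by (simp only: iter_append iter_single)
qed simp

text \<open>No density changes with the coordinates being integrated, except through its own
  argument, so the factors come off one at a time.\<close>

lemma iter_prod_one:
  assumes "distinct is"
    and "\<And>i j z x. i \<in> set is \<Longrightarrow> j \<in> set is \<Longrightarrow> f i (z(j := x)) = f i z"
    and "\<And>i z. i \<in> set is \<Longrightarrow> f i z \<in> borel_measurable borel"
    and "\<And>i z x. f i z x \<ge> 0"
    and "\<And>i z. i \<in> set is \<Longrightarrow> (\<integral>\<^sup>+x. ennreal (f i z x) \<partial>lborel) = 1"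
  shows "iter \<Lambda> is (\<lambda>z. \<Prod>i\<leftarrow>is. ennreal (f i z (z i))) z = 1"
  using assms(1-3,5)
proof (induction "is" arbitrary: z)
  case (Cons i "is")
  have "iter \<Lambda> (i # is) (\<lambda>z. \<Prod>i\<leftarrow>i # is. ennreal (f i z (z i))) z =
      \<Lambda> (\<lambda>x. iter \<Lambda> is (\<lambda>z. ennreal (f i z (z i)) * (\<Prod>i\<leftarrow>is. ennreal (f i z (z i)))) (z(i := x)))"
    by simp
  also have "\<dots> = \<Lambda> (\<lambda>x. ennreal (f i (z(i := x)) x) * iter \<Lambda> is (\<lambda>z. \<Prod>i\<leftarrow>is. ennreal (f i z (z i))) (z(i := x)))"
  proof -
    have "f i (z(j := y)) ((z(j := y)) i) = f i z (z i)" if "j \<in> set is" for j z y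
    proof -
      have "f i (z(j := y)) = f i z" by (rule Cons.prems(2)) (use that in auto)
      then show ?thesis using that Cons.prems(1) by auto
    qed
    then show ?thesis by (subst iter_factor) (simp_all add: assms(4))
  qed
  also have "\<dots> = \<Lambda> (\<lambda>x. ennreal (f i z x))"
  proof -
    have "iter \<Lambda> is (\<lambda>z. \<Prod>i\<leftarrow>is. ennreal (f i z (z i))) z' = 1" for z'
      by (rule Cons.IH) (use Cons.prems in auto)
    moreover have "f i (z(i := x)) = f i z" for x by (rule Cons.prems(2)) auto
    ultimately show ?thesis by simp
  qed
  also have "\<dots> = 1"
    using Cons.prems(3,4)[of i] by (subst I_measurable) auto
  finally show ?case .
qed simp

end

locale complex_invariant_integral = invariant_integral \<Lambda>
  for \<Lambda> :: "(complex \<Rightarrow> ennreal) \<Rightarrow> ennreal"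
begin

text \<open>The expectation over one \<open>CN01\<close> variable, extended to integrands that need
  not be measurable.\<close>

definition \<E> :: "(complex \<Rightarrow> ennreal) \<Rightarrow> ennreal" where
  "\<E> f = \<Lambda> (\<lambda>x. ennreal (cgauss 1 x) * f x)"

lemma E_measurable: "f \<in> borel_measurable borel \<Longrightarrow> \<E> f = (\<integral>\<^sup>+x. f x \<partial>CN01)"
  unfolding \<E>_def by (subst I_measurable) (auto simp: nn_integral_CN01)

lemma E_const: "\<E> (\<lambda>_. c) = c"
proof -
  interpret prob_space CN01 by (rule prob_space_CN01)
  show ?thesis using emeasure_space_1 by (subst E_measurable) auto
qed

sublocale E: positive_functional \<E>
proof
  show "\<E> (\<lambda>x. f x + g x) = \<E> f + \<E> g" for f g
    unfolding \<E>_def by (simp add: distrib_left I_add)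
  show "\<E> f \<le> \<E> g" if "\<And>x. f x \<le> g x" for f g
    unfolding \<E>_def using that by (intro I_mono mult_left_mono) auto
  show "\<E> (\<lambda>x. ennreal c * f x) = ennreal c * \<E> f" if "c \<ge> 0" for c f
    unfolding \<E>_def using I_cmult[OF that, of "\<lambda>x. ennreal (cgauss 1 x) * f x"] by (simp add: mult.left_commute)
qed

text \<open>Collecting the Gaussian weights inside leaves a translation-invariant iterated integral,
  to which \<open>iter_shear\<close> applies.\<close>

lemma iter_E_eq:
  assumes "distinct is"
  shows "iter \<E> is F z = iter \<Lambda> is (\<lambda>z. (\<Prod>i\<leftarrow>is. ennreal (cgauss 1 (z i))) * F z) z"
  using assms
proof (induction "is" arbitrary: z)
  case (Cons i "is")
  have "iter \<E> (i # is) F z = \<Lambda> (\<lambda>x. ennreal (cgauss 1 ((z(i := x)) i)) * iter \<Lambda> is (\<lambda>z. (\<Prod>i\<leftarrow>is. ennreal (cgauss 1 (z i))) * F z) (z(i := x)))"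
    using Cons by (simp only: iter.simps \<E>_def[of "\<lambda>x. iter \<E> is F (z(i := x))"]) simp
  also have "\<dots> = \<Lambda> (\<lambda>x. iter \<Lambda> is (\<lambda>z. ennreal (cgauss 1 (z i)) * ((\<Prod>i\<leftarrow>is. ennreal (cgauss 1 (z i))) * F z)) (z(i := x)))"
    using Cons.prems by (subst iter_factor) (auto simp: cgauss_pos less_imp_le)
  finally show ?case by (simp add: mult.assoc)
qed simp

lemma iter_E_indep:
  assumes "\<And>j z x. j \<in> set is \<Longrightarrow> F (z(j := x)) = F z"
  shows "iter \<E> is F z = F z"
  using assms by (induction "is" arbitrary: z) (auto simp: E_const)

lemma iter_E_const: "iter \<E> is (\<lambda>_. c) z = c"
  by (rule iter_E_indep) simp

text \<open>Conditioning on the past: \<open>K\<close> may depend on the coordinates before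
  \<open>i\<close> in any way whatsoever, but is measurable in the fresh variable, so a genuine
  integral over \<open>CN01\<close> can replace the extended one.\<close>

lemma iter_E_conditional:
  assumes "distinct (xs @ i # ys)"
    and K: "\<And>j z x. j \<in> set (i # ys) \<Longrightarrow> K (z(j := x)) = K z"
    and "\<And>z. K z \<in> borel_measurable borel"
  shows "iter \<E> (xs @ i # ys) (\<lambda>z. K z (z i)) z = iter \<E> (xs @ i # ys) (\<lambda>z. \<integral>\<^sup>+x. K z x \<partial>CN01) z"
proof -
  have "iter \<E> (i # ys) (\<lambda>z. K z (z i)) z = (\<integral>\<^sup>+x. K z x \<partial>CN01)" for z
  proof -
    have "iter \<E> ys (\<lambda>z. K z (z i)) (z(i := x)) = K z x" for x
      using assms(1) K by (subst iter_E_indep) auto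
    then show ?thesis using assms(3) by (simp add: E_measurable)
  qed
  then have "iter \<E> (i # ys) (\<lambda>z. K z (z i)) = (\<lambda>z. \<integral>\<^sup>+x. K z x \<partial>CN01)" by (rule ext)
  moreover have "iter \<E> (i # ys) (\<lambda>z. \<integral>\<^sup>+x. K z x \<partial>CN01) z = (\<integral>\<^sup>+x. K z x \<partial>CN01)" for z
    by (rule iter_E_indep) (simp only: K)
  then have "iter \<E> (i # ys) (\<lambda>z. \<integral>\<^sup>+x. K z x \<partial>CN01) = (\<lambda>z. \<integral>\<^sup>+x. K z x \<partial>CN01)" by (rule ext)
  ultimately show ?thesis by (simp only: iter_append)
qed

text \<open>Connects the extended expectation with the noise measure of the model. The base point is
  \<open>undefined\<close> everywhere because that is the value of members of a product space off
  the index set.\<close>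

lemma iter_E_PiM:
  assumes "distinct is" "F \<in> borel_measurable (PiM (set is) (\<lambda>_. CN01))"
  shows "iter \<E> is F (\<lambda>_. undefined) = (\<integral>\<^sup>+z. F z \<partial>PiM (set is) (\<lambda>_. CN01))"
  using assms
proof (induction "is" arbitrary: F rule: rev_induct)
  case Nil
  then show ?case by (simp add: PiM_empty nn_integral_count_space_finite)
next
  case (snoc i xs)
  interpret prob_space CN01 by (rule prob_space_CN01)
  interpret product_sigma_finite "\<lambda>_. CN01" by standard
  have i: "i \<notin> set xs" "distinct xs" using snoc.prems(1) by auto
  have Fm: "F \<in> borel_measurable (PiM (insert i (set xs)) (\<lambda>_. CN01))" using snoc.prems(2) by simp
  have m: "(\<lambda>p. F ((fst p)(i := snd p))) \<in> borel_measurable (PiM (set xs) (\<lambda>_. CN01) \<Otimes>\<^sub>M CN01)"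
    using measurable_compose[OF measurable_add_dim Fm] by (simp add: split_def)
  have eq: "\<E> (\<lambda>x. F (z(i := x))) = (\<integral>\<^sup>+x. F (z(i := x)) \<partial>CN01)" if "z \<in> space (PiM (set xs) (\<lambda>_. CN01))" for z
    using measurable_compose[OF measurable_component_update[OF that i(1)] Fm]
    by (intro E_measurable) simp
  have Gm: "(\<lambda>z. \<E> (\<lambda>x. F (z(i := x)))) \<in> borel_measurable (PiM (set xs) (\<lambda>_. CN01))"
  proof (subst measurable_cong[OF eq])
    show "(\<lambda>z. \<integral>\<^sup>+x. F (z(i := x)) \<partial>CN01) \<in> borel_measurable (PiM (set xs) (\<lambda>_. CN01))"
      using borel_measurable_nn_integral_fst[OF m] by simp
  qed auto
  have "iter \<E> (xs @ [i]) F (\<lambda>_. undefined) = (\<integral>\<^sup>+z. \<E> (\<lambda>x. F (z(i := x))) \<partial>PiM (set xs) (\<lambda>_. CN01))"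
    using snoc.IH[OF i(2) Gm] by (simp only: iter_append iter_single)
  also have "\<dots> = (\<integral>\<^sup>+z. (\<integral>\<^sup>+x. F (z(i := x)) \<partial>CN01) \<partial>PiM (set xs) (\<lambda>_. CN01))"
    by (intro nn_integral_cong eq)
  also have "\<dots> = (\<integral>\<^sup>+z. F z \<partial>PiM (insert i (set xs)) (\<lambda>_. CN01))"
    using i Fm by (subst product_nn_integral_insert) auto
  finally show ?case by simp
qed

end

section \<open>States and code runs\<close>

lemma finite_node_ok: "finite {x. node_ok m N i x}"
proof -
  have "{x. node_ok m N i x} \<subseteq> Pow {1..N+1} \<times> Pow {0..N}"
    by (auto simp: node_ok_def)
  then show ?thesis by (rule finite_subset) auto
qed

lemma states_subset_PiE:
  "(\<lambda>s. restrict s {0..N+1}) ` states m N \<subseteq> (\<Pi>\<^sub>E i\<in>{0..N+1}. {x. node_ok m N i x})"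
  by (auto simp: states_def)

lemma inj_on_states: "inj_on (\<lambda>s. restrict s {0..N+1}) (states m N)"
proof (rule inj_onI, rule ext)
  fix s s' i assume s: "s \<in> states m N" "s' \<in> states m N" and eq: "restrict s {0..N+1} = restrict s' {0..N+1}"
  show "s i = s' i"
  proof (cases "i \<in> {0..N+1}")
    case True then show ?thesis using eq by (metis restrict_apply')
  next
    case False then show ?thesis using s by (auto simp: states_def)
  qed
qed

lemma finite_states: "finite (states m N)"
  by (rule inj_on_finite[OF inj_on_states states_subset_PiE]) (auto intro!: finite_PiE finite_node_ok)

lemma idle_state: "(\<lambda>_. ({}, {})) \<in> states m N"
  by (auto simp: states_def node_ok_def)

lemma card_states_pos: "0 < card (states m N)"
  using idle_state[of m N] finite_states[of m N] by (auto simp: card_gt_0_iff)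

lemma card_at_most_one: "finite A \<Longrightarrow> card {x. x \<subseteq> A \<and> card x \<le> 1} \<le> card A + 1"
  "finite A \<Longrightarrow> finite {x. x \<subseteq> A \<and> card x \<le> 1}"
proof -
  assume A: "finite A"
  have sub: "{x. x \<subseteq> A \<and> card x \<le> 1} \<subseteq> insert {} ((\<lambda>a. {a}) ` A)"
  proof
    fix x assume x: "x \<in> {x. x \<subseteq> A \<and> card x \<le> 1}"
    then have "finite x" using A finite_subset by auto
    show "x \<in> insert {} ((\<lambda>a. {a}) ` A)"
    proof (cases "x = {}")
      case False
      then have "card x > 0" using \<open>finite x\<close> by (simp add: card_gt_0_iff)
      then have "card x = 1" using x by simp
      then obtain k where "x = {k}" by (auto simp: card_1_singleton_iff)
      then show ?thesis using x by blast
    qed simp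
  qed
  have "card {x. x \<subseteq> A \<and> card x \<le> 1} \<le> card (insert {} ((\<lambda>a. {a}) ` A))"
    using A by (intro card_mono sub) auto
  also have "\<dots> \<le> card A + 1"
    using A card_image_le[OF A, of "\<lambda>a. {a}"] by (simp add: card_insert_if)
  finally show "card {x. x \<subseteq> A \<and> card x \<le> 1} \<le> card A + 1" .
  show "finite {x. x \<subseteq> A \<and> card x \<le> 1}" using A by (intro finite_subset[OF sub]) auto
qed

lemma card_node_ok_ends:
  "card {x. node_ok m N 0 x} \<le> N + 2" "card {x. node_ok m N (N+1) x} \<le> N + 2"
proof -
  have "{x. node_ok m N 0 x} \<subseteq> {x. x \<subseteq> {1..N+1} \<and> card x \<le> 1} \<times> {{}}"
    by (auto simp: node_ok_def)
  then have "card {x. node_ok m N 0 x} \<le> card ({x. x \<subseteq> {1..N+1} \<and> card x \<le> 1} \<times> {{} :: nat set})"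
    by (intro card_mono finite_cartesian_product card_at_most_one) auto
  also have "\<dots> \<le> N + 2" using card_at_most_one(1)[of "{1..N+1}"] by (simp add: card_cartesian_product)
  finally show "card {x. node_ok m N 0 x} \<le> N + 2" .
  have "{x. node_ok m N (N+1) x} \<subseteq> {{}} \<times> {x. x \<subseteq> {0..N} \<and> card x \<le> 1}"
    by (auto simp: node_ok_def)
  then have "card {x. node_ok m N (N+1) x} \<le> card ({{} :: nat set} \<times> {x. x \<subseteq> {0..N} \<and> card x \<le> 1})"
    by (intro card_mono finite_cartesian_product card_at_most_one) auto
  also have "\<dots> \<le> N + 2" using card_at_most_one(1)[of "{0..N}"] by (simp add: card_cartesian_product)
  finally show "card {x. node_ok m N (N+1) x} \<le> N + 2" .
qed

text \<open>In half-duplex a relay is idle, beams towards one of N nodes or listens to one of N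
  nodes, hence 2 N + 1 choices. In full-duplex both beams are chosen separately, with N + 1 choices
  each.\<close>

lemma card_node_ok_relay:
  assumes i: "i \<in> {1..N}"
  shows "card {x. node_ok m N i x} \<le> card_S1 m N"
proof -
  let ?T = "{x. x \<subseteq> {1..N+1} - {i} \<and> card x \<le> 1}" and ?R = "{x. x \<subseteq> {0..N} - {i} \<and> card x \<le> 1}"
  have cT: "card ?T \<le> N + 1" "finite ?T" using card_at_most_one[of "{1..N+1} - {i}"] i by auto
  have cR: "card ?R \<le> N + 1" "finite ?R" using card_at_most_one[of "{0..N} - {i}"] i by auto
  show ?thesis
  proof (cases m)
    case FD
    have "{x. node_ok m N i x} \<subseteq> ?T \<times> ?R" by (auto simp: node_ok_def)
    then have "card {x. node_ok m N i x} \<le> card (?T \<times> ?R)" using cT cR by (intro card_mono) auto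
    also have "\<dots> \<le> (N + 1) * (N + 1)" unfolding card_cartesian_product using cT cR by (intro mult_mono) auto
    finally show ?thesis using FD by (simp add: card_S1_def power2_eq_square)
  next
    case HD
    have fin: "finite a" if "a \<subseteq> {1..N+1} - {i} \<or> a \<subseteq> {0..N} - {i}" for a
      using that finite_subset by auto
    have "x = ({}, {}) \<or> x \<in> (\<lambda>a. ({a}, {})) ` ({1..N+1} - {i}) \<or> x \<in> (\<lambda>a. ({}, {a})) ` ({0..N} - {i})"
      if x: "node_ok m N i x" for x
    proof -
      obtain a b where ab: "x = (a, b)" by (cases x)
      have s: "a \<subseteq> {1..N+1} - {i}" "b \<subseteq> {0..N} - {i}" "card a + card b \<le> 1"
        using x i HD by (auto simp: node_ok_def ab)
      have f: "finite a" "finite b" using s fin by auto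
      show ?thesis
      proof (cases "a = {}")
        case True
        show ?thesis
        proof (cases "b = {}")
          case False
          then have "card b > 0" using f by (simp add: card_gt_0_iff)
          then have "card b = 1" using s by auto
          then obtain k where "b = {k}" by (auto simp: card_1_singleton_iff)
          then show ?thesis using True s ab by blast
        qed (simp add: ab True)
      next
        case False
        then have "card a > 0" using f by (simp add: card_gt_0_iff)
        then have "card b = 0" "card a = 1" using s by auto
        then obtain k where "a = {k}" "b = {}" using f by (auto simp: card_1_singleton_iff)
        then show ?thesis using s ab by blast
      qed
    qed
    then have sub: "{x. node_ok m N i x} \<subseteq> insert ({}, {}) ((\<lambda>a. ({a}, {})) ` ({1..N+1} - {i}) \<union> (\<lambda>a. ({}, {a})) ` ({0..N} - {i}))"
      by auto
    let ?U = "(\<lambda>a. ({a}, {})) ` ({1..N+1} - {i}) :: comp set" and ?V = "(\<lambda>a. ({}, {a})) ` ({0..N} - {i}) :: comp set"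
    have "card {x. node_ok m N i x} \<le> card (insert ({}, {}) (?U \<union> ?V))"
      by (intro card_mono sub) auto
    also have "\<dots> \<le> Suc (card (?U \<union> ?V))" by (simp add: card_insert_if)
    also have "\<dots> \<le> Suc (card ?U + card ?V)" using card_Un_le by simp
    also have "\<dots> \<le> Suc (card ({1..N+1} - {i}) + card ({0..N} - {i}))"
      by (intro Suc_le_mono[THEN iffD2] add_mono card_image_le) auto
    also have "\<dots> = 2 * N + 1" using i by auto
    finally show ?thesis using HD by (simp add: card_S1_def)
  qed
qed

lemma card_states_le: "card (states m N) \<le> (N + 2)\<^sup>2 * card_S1 m N ^ N"
proof -
  have "card (states m N) \<le> card (\<Pi>\<^sub>E i\<in>{0..N+1}. {x. node_ok m N i x})"
    by (rule card_inj_on_le[OF inj_on_states states_subset_PiE]) (auto intro!: finite_PiE finite_node_ok)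
  also have "\<dots> = (\<Prod>i\<in>{0..N+1}. card {x. node_ok m N i x})" by (rule card_PiE) simp
  also have "{0..N+1} = insert 0 (insert (N+1) {1..N})" by auto
  also have "(\<Prod>i\<in>insert 0 (insert (N+1) {1..N}). card {x. node_ok m N i x}) =
      card {x. node_ok m N 0 x} * (card {x. node_ok m N (N+1) x} * (\<Prod>i\<in>{1..N}. card {x. node_ok m N i x}))"
    by simp
  also have "\<dots> \<le> (N + 2) * ((N + 2) * (\<Prod>i\<in>{1..N}. card_S1 m N))"
    by (intro mult_mono card_node_ok_ends prod_mono conjI card_node_ok_relay) auto
  also have "\<dots> = (N + 2)\<^sup>2 * card_S1 m N ^ N"
    by (simp only: prod_constant card_atLeastAtMost power2_eq_square mult.assoc) simp
  finally show ?thesis .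
qed

text \<open>The number of states enters the upper bound through the mixture weight, and this
  accounts for the part \<open>2 log (N + 2) + N log Card(S_1)\<close> of \<open>GAP\<close>: source
  and destination have at most N + 2 components each.\<close>

lemma log_card_states_le:
  "log 2 (card (states m N)) + (N + 1) * log 2 (exp 1) \<le> GAP m N"
proof -
  have S1: "card_S1 m N > 0" by (cases m) (auto simp: card_S1_def)
  have "log 2 (card (states m N)) \<le> log 2 (real ((N + 2)\<^sup>2 * card_S1 m N ^ N))"
    using card_states_le[of m N] card_states_pos[of m N] S1
    by (subst log_le_cancel_iff) (auto simp del: of_nat_mult of_nat_power)
  also have "\<dots> = 2 * log 2 (N + 2) + N * log 2 (card_S1 m N)"
    using S1 by (simp add: log_mult log_nat_power)
  finally show ?thesis by (simp add: GAP_def add.commute)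
qed

text \<open>With \<open>active_card_dest\<close> this is the 1-2-1 property. At a transmitter it
  lets input energy be charged to a single receiver; at a receiver it excludes interference.\<close>

lemma active_card_source:
  assumes "s \<in> states m N" "i \<in> {0..N+1}"
  shows "card {j\<in>B. active s i j} \<le> 1"
proof -
  have "node_ok m N i (s i)" using assms by (simp add: states_def)
  then have "fst (s i) \<subseteq> {1..N+1}" "card (fst (s i)) \<le> 1" unfolding node_ok_def by blast+
  then have "card {j\<in>B. active s i j} \<le> card (fst (s i))"
    using finite_subset[of "fst (s i)" "{1..N+1}"] by (intro card_mono) (auto simp: active_def)
  then show ?thesis using \<open>card (fst (s i)) \<le> 1\<close> by simp
qed

lemma active_card_dest:
  assumes "s \<in> states m N" "j \<in> {0..N+1}"
  shows "card {i\<in>B. active s i j} \<le> 1"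
proof -
  have "node_ok m N j (s j)" using assms by (simp add: states_def)
  then have "snd (s j) \<subseteq> {0..N}" "card (snd (s j)) \<le> 1" unfolding node_ok_def by blast+
  then have "card {i\<in>B. active s i j} \<le> card (snd (s j))"
    using finite_subset[of "snd (s j)" "{0..N}"] by (intro card_mono) (auto simp: active_def)
  then show ?thesis using \<open>card (snd (s j)) \<le> 1\<close> by simp
qed

lemma active_dest_cases:
  assumes "s \<in> states m N" "j \<in> {0..N+1}" "finite B"
  obtains "{i\<in>B. active s i j} = {}" | i where "i \<in> B" "{i\<in>B. active s i j} = {i}"
proof (cases "{i\<in>B. active s i j} = {}")
  case False
  then have "card {i\<in>B. active s i j} > 0" using assms(3) by (simp add: card_gt_0_iff)
  then have "card {i\<in>B. active s i j} = 1" using active_card_dest[OF assms(1,2), of B] by linarith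
  then obtain i where "{i\<in>B. active s i j} = {i}" by (auto simp: card_1_singleton_iff)
  then show thesis using that(2) by blast
qed (rule that(1))

section \<open>Runs of a code and the extended expectation\<close>

locale code_run =
  fixes N :: nat and h :: "nat \<Rightarrow> nat \<Rightarrow> complex" and c :: code
begin

abbreviation "H \<equiv> hist c N h"

definition st :: "nat \<Rightarrow> (nat \<times> nat \<Rightarrow> complex) \<Rightarrow> nat \<Rightarrow> state" where
  "st w z t i = fst (choice c N w i t (H w z t))"

definition X :: "nat \<Rightarrow> (nat \<times> nat \<Rightarrow> complex) \<Rightarrow> nat \<Rightarrow> nat \<Rightarrow> complex" where
  "X w z t i = snd (choice c N w i t (H w z t))"

text \<open>The noiseless part of the received signal, which is the shift between noise and received
  coordinates.\<close>

definition mean :: "nat \<Rightarrow> (nat \<times> nat \<Rightarrow> complex) \<Rightarrow> nat \<Rightarrow> nat \<Rightarrow> complex" where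
  "mean w z t j = (\<Sum>i\<in>{0..N} - {j}. if active (st w z t) i j then h j i * X w z t i else 0)"

lemma rx_eq: "rx c N h w z t (H w z t) j = z (t, j) + mean w z t j"
  unfolding rx_def mean_def st_def X_def active_def
  by (intro arg_cong2[where f = "(+)"] refl sum.cong) auto

lemma hist_eq: "H w z t j \<tau> = (if \<tau> < t then z (\<tau>, j) + mean w z \<tau> j else 0)"
  by (induction t) (auto simp: rx_eq less_Suc_eq)

text \<open>Causality. A history at \<open>t\<close> holds receptions at times strictly below
  \<open>t\<close>, so \<open>t' = t\<close> is included; this makes all shifts triangular in the
  time order.\<close>

lemma hist_indep: "t \<le> t' \<Longrightarrow> H w (z((t', j') := x)) t = H w z t"
proof (induction t)
  case (Suc t)
  have IH: "H w (z((t', j') := x)) t = H w z t" by (rule Suc.IH) (use Suc.prems in simp)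
  have "t \<noteq> t'" using Suc.prems by simp
  then have "rx c N h w (z((t', j') := x)) t (H w z t) j = rx c N h w z t (H w z t) j" for j
    by (simp add: rx_def IH)
  then show ?case by (simp only: hist.simps IH)
qed simp

lemma st_indep: "t \<le> t' \<Longrightarrow> st w (z((t', j') := x)) t = st w z t"
  by (intro ext) (simp only: st_def hist_indep)

lemma X_indep: "t \<le> t' \<Longrightarrow> X w (z((t', j') := x)) t i = X w z t i"
  by (simp only: X_def hist_indep)

lemma mean_indep: "t \<le> t' \<Longrightarrow> mean w (z((t', j') := x)) t j = mean w z t j"
  by (simp only: mean_def st_indep X_indep)

end

locale network_code = code_run N h c
  for m :: mode and N :: nat and h :: "nat \<Rightarrow> nat \<Rightarrow> complex" and P :: real and c :: code +
  assumes P_pos: "P > 0" and valid: "valid_code m N h P c"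
begin

abbreviation "n \<equiv> blen c"
abbreviation "M \<equiv> nmsg c"

text \<open>Time is the major index. Within one channel use no shift depends on any of the
  coordinates, so the order of the nodes there is arbitrary.\<close>

definition coords :: "(nat \<times> nat) list" where
  "coords = List.product [0..<n] [1..<N+2]"

lemma st_states:
  assumes "w < M" "t < n" shows "st w z t \<in> states m N"
proof -
  have "node_ok m N i (st w z t i)" if i: "i \<in> {0..N+1}" for i
  proof -
    consider "i = 0" | "i \<in> {1..N}" | "i = N + 1" using i by (cases "i = 0"; cases "i \<le> N") auto
    then show ?thesis
      using valid assms unfolding valid_code_def st_def choice_def by cases auto
  qed
  moreover have "st w z t i = ({}, {})" if "i \<notin> {0..N+1}" for i
    using that unfolding st_def choice_def by auto
  ultimately show ?thesis by (simp add: states_def)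
qed

lemma coords_distinct: "distinct coords"
  unfolding coords_def by (intro distinct_product) auto

lemma coords_set[simp]: "set coords = {..<n} \<times> {1..N+1}"
  unfolding coords_def by auto

lemma sorted_coords: "sorted (map fst (List.product [0..<k] l))"
proof (induction k)
  case (Suc k)
  have "List.product [0..<Suc k] l = List.product [0..<k] l @ map (Pair k) l"
    by (simp add: product_concat_map)
  then show ?case using Suc by (auto simp: sorted_append o_def sorted_map)
qed simp

lemma coords_later:
  assumes "coords = xs @ (t, j) # ys" "(t', j') \<in> set ((t, j) # ys)"
  shows "t \<le> t'"
  using sorted_coords[of n "[1..<N+2]", folded coords_def] assms by (auto simp: sorted_append)

end

locale network_law = network_code m N h P c + complex_invariant_integral \<Lambda> for m N h P c \<Lambda>
begin

abbreviation EE :: "((nat \<times> nat \<Rightarrow> complex) \<Rightarrow> ennreal) \<Rightarrow> ennreal" where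
  "EE F \<equiv> iter \<E> coords F (\<lambda>_. undefined)"

definition ok :: "nat \<Rightarrow> (nat \<times> nat \<Rightarrow> complex) \<Rightarrow> bool" where
  "ok w z \<longleftrightarrow> dec c (H w z n (N + 1)) = w"

text \<open>The event that a given state is chosen need not be measurable, so its probability is
  taken from the extended expectation. That value is at most 1, hence nothing is lost in the
  conversion to a real number.\<close>

definition state_prob :: "nat \<Rightarrow> nat \<Rightarrow> state \<Rightarrow> real" where
  "state_prob w t s = enn2real (EE (\<lambda>z. of_bool (st w z t = s)))"

lemma EE_noise:
  assumes "F \<in> borel_measurable (noise N n)" shows "EE F = (\<integral>\<^sup>+z. F z \<partial>noise N n)"
  using iter_E_PiM[OF coords_distinct, of F] assms unfolding noise_def coords_set by simp

lemma EE_le_const: "(\<And>z. F z \<le> b) \<Longrightarrow> EE F \<le> b"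
  using E.iter_mono[of F "\<lambda>_. b" coords] by (simp add: iter_E_const)

lemma EE_conditional:
  assumes tj: "t < n" "j \<in> {1..N+1}"
    and K: "\<And>t' j' z x. t \<le> t' \<Longrightarrow> K (z((t', j') := x)) = K z"
    and "\<And>z. K z \<in> borel_measurable borel"
  shows "EE (\<lambda>z. K z (z (t, j))) = EE (\<lambda>z. \<integral>\<^sup>+x. K z x \<partial>CN01)"
proof -
  have "(t, j) \<in> set coords" using tj by auto
  then obtain xs ys where split: "coords = xs @ (t, j) # ys" by (meson split_list)
  show ?thesis unfolding split
  proof (rule iter_E_conditional)
    show "distinct (xs @ (t, j) # ys)" using coords_distinct split by (simp only:)
    fix k z x assume "k \<in> set ((t, j) # ys)"
    then have "t \<le> fst k" using coords_later[OF split, of "fst k" "snd k"] by simp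
    then show "K (z(k := x)) = K z" using K[of "fst k" z "snd k" x] by simp
  qed (rule assms(4))
qed

lemma EE_input:
  assumes "w < M" "t < n" "i \<in> {0..N}"
  shows "EE (\<lambda>z. ennreal ((cmod (X w z t i))\<^sup>2)) = (\<integral>\<^sup>+z. ennreal ((cmod (input c N h w z i t))\<^sup>2) \<partial>noise N n)"
proof -
  have eq: "X w z t i = input c N h w z i t" for z by (simp add: X_def input_def)
  have "(\<lambda>z. input c N h w z i t) \<in> borel_measurable (noise N n)"
    using valid assms by (simp add: valid_code_def)
  then show ?thesis unfolding eq by (intro EE_noise) measurable
qed

lemma EE_power:
  assumes "t < n" "i \<in> {0..N}"
  shows "(\<Sum>w<M. EE (\<lambda>z. ennreal ((cmod (X w z t i))\<^sup>2))) \<le> ennreal (real M * P)"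
  using valid assms by (simp add: EE_input valid_code_def)

lemma prob_space_noise: "prob_space (noise N k)"
  unfolding noise_def by (intro prob_space_PiM prob_space_CN01)

text \<open>Correct decoding and, in \<open>EE_input\<close>, the input energy are the two places
  where the extended expectation has to agree with the noise measure; \<open>valid_code\<close>
  requires measurability of exactly these.\<close>

lemma EE_ok:
  assumes "w < M"
  shows "EE (\<lambda>z. of_bool (ok w z)) = ennreal (1 - measure (noise N n) (err_event c N h w))"
proof -
  interpret prob_space "noise N n" by (rule prob_space_noise)
  have ev: "err_event c N h w \<in> events" using valid assms by (simp add: valid_code_def)
  have ind: "of_bool (ok w z) = (indicator (space (noise N n) - err_event c N h w) z :: ennreal)"
    if "z \<in> space (noise N n)" for z
    using that by (auto simp: ok_def err_event_def indicator_def)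
  have "(\<lambda>z. of_bool (ok w z) :: ennreal) \<in> borel_measurable (noise N n)"
    using ev by (subst measurable_cong[OF ind]) auto
  then have "EE (\<lambda>z. of_bool (ok w z)) = (\<integral>\<^sup>+z. of_bool (ok w z) \<partial>noise N n)" by (rule EE_noise)
  also have "\<dots> = emeasure (noise N n) (space (noise N n) - err_event c N h w)"
    using ev by (subst nn_integral_cong[OF ind]) auto
  also have "\<dots> = ennreal (1 - measure (noise N n) (err_event c N h w))"
    using ev by (simp add: emeasure_eq_measure prob_compl)
  finally show ?thesis .
qed

lemma state_prob_eq: "EE (\<lambda>z. of_bool (st w z t = s)) = ennreal (state_prob w t s)"
proof -
  have "EE (\<lambda>z. of_bool (st w z t = s)) \<le> 1" by (intro EE_le_const) simp
  then have "EE (\<lambda>z. of_bool (st w z t = s)) < top" by (rule le_less_trans) simp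
  then show ?thesis unfolding state_prob_def by simp
qed

lemma state_prob_nonneg: "0 \<le> state_prob w t s"
  by (simp add: state_prob_def)

lemma EE_state_function:
  assumes "w < M" "t < n" "\<And>s. s \<in> states m N \<Longrightarrow> 0 \<le> f s"
  shows "EE (\<lambda>z. ennreal (f (st w z t))) = ennreal (\<Sum>s\<in>states m N. f s * state_prob w t s)"
proof -
  have "(\<lambda>z. ennreal (f (st w z t))) = (\<lambda>z. \<Sum>s\<in>states m N. ennreal (f s) * of_bool (st w z t = s))"
    using st_states[OF assms(1,2)] finite_states[of m N]
    by (intro ext) (simp add: sum.remove[of _ "st w _ t"] sum.neutral)
  then have "EE (\<lambda>z. ennreal (f (st w z t))) = (\<Sum>s\<in>states m N. ennreal (f s) * EE (\<lambda>z. of_bool (st w z t = s)))"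
    by (simp only: E.iter_sum[OF finite_states]) (intro sum.cong refl E.iter_cmult assms(3))
  also have "\<dots> = (\<Sum>s\<in>states m N. ennreal (f s * state_prob w t s))"
    using assms(3) by (intro sum.cong refl) (simp add: state_prob_eq ennreal_mult state_prob_nonneg)
  also have "\<dots> = ennreal (\<Sum>s\<in>states m N. f s * state_prob w t s)"
    using assms(3) by (intro sum_ennreal) (simp add: state_prob_nonneg)
  finally show ?thesis .
qed

lemma state_prob_sum:
  assumes "w < M" "t < n" shows "(\<Sum>s\<in>states m N. state_prob w t s) = 1"
proof -
  have "ennreal (\<Sum>s\<in>states m N. 1 * state_prob w t s) = EE (\<lambda>z. ennreal 1)"
    using EE_state_function[OF assms, of "\<lambda>_. 1"] by simp
  then show ?thesis
    by (simp add: iter_E_const sum_nonneg state_prob_nonneg)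
qed

lemma M_pos: "M \<ge> 1"
  using valid by (simp add: valid_code_def)

end

section \<open>The cut-set bound\<close>

locale network_cut = network_law m N h P c \<Lambda>
  for m N h P c \<Lambda> +
  fixes \<Omega> :: "nat set"
  assumes cut: "\<Omega> \<in> cuts N"
begin

definition A :: "nat set" where "A = {0..N+1} - \<Omega>"

text \<open>The variance that \<open>j\<close> would see from the source side of the cut if the
  inputs were Gaussian of power \<open>P\<close>. At most one link into \<open>j\<close> is active
  in a state, so \<open>ln (v s j)\<close> is the capacity of that link in nats, or 0.\<close>

definition v :: "state \<Rightarrow> nat \<Rightarrow> real" where
  "v s j = 1 + P * (\<Sum>i\<in>\<Omega>. if active s i j then (cmod (h j i))\<^sup>2 else 0)"

text \<open>A relay outside \<open>\<Omega>\<close> computes its input from its own receptions.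
  These are among the mixed coordinates, for which \<open>u\<close> stands, so the input can be
  recovered without the message.\<close>

definition XA :: "(nat \<times> nat \<Rightarrow> complex) \<Rightarrow> nat \<Rightarrow> nat \<Rightarrow> complex" where
  "XA u t i = snd (rel c i t (\<lambda>\<tau>. if \<tau> < t then u (\<tau>, i) else 0))"

definition meanA :: "(nat \<times> nat \<Rightarrow> complex) \<Rightarrow> nat \<Rightarrow> nat \<Rightarrow> state \<Rightarrow> complex" where
  "meanA u t j s = (\<Sum>i\<in>{0..N} - {j} - \<Omega>. if active s i j then h j i * XA u t i else 0)"

definition meanO :: "nat \<Rightarrow> (nat \<times> nat \<Rightarrow> complex) \<Rightarrow> nat \<Rightarrow> nat \<Rightarrow> complex" where
  "meanO w z t j = (\<Sum>i\<in>\<Omega>. if active (st w z t) i j then h j i * X w z t i else 0)"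

text \<open>The centre keeps only what is sent from outside \<open>\<Omega>\<close>. The
  message-dependent contribution of \<open>\<Omega>\<close> is replaced by additional
  variance.\<close>

definition q :: "state \<Rightarrow> nat \<Rightarrow> nat \<Rightarrow> (nat \<times> nat \<Rightarrow> complex) \<Rightarrow> real" where
  "q s t j u = cgauss (v s j) (u (t, j) - meanA u t j s)"

definition Q :: "nat \<Rightarrow> (nat \<times> nat \<Rightarrow> complex) \<Rightarrow> real" where
  "Q t u = (\<Sum>s\<in>states m N. \<Prod>j\<in>A. q s t j u) / card (states m N)"

text \<open>The mixed coordinates: noise at the nodes of \<open>\<Omega>\<close>, received signals across the cut. The density
  \<open>G\<close> in these coordinates does not involve the message.\<close>
definition mixed :: "nat \<Rightarrow> (nat \<times> nat \<Rightarrow> complex) \<Rightarrow> nat \<times> nat \<Rightarrow> complex" where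
  "mixed w z = (\<lambda>i. if i \<in> set coords then z i + (if snd i \<in> A then mean w z (fst i) (snd i) else 0) else z i)"

definition G :: "(nat \<times> nat \<Rightarrow> complex) \<Rightarrow> real" where
  "G u = (\<Prod>t<n. Q t u * (\<Prod>j\<in>{1..N+1} - A. cgauss 1 (u (t, j))))"

text \<open>The likelihood ratio of the reference law against the true law, in noise coordinates.
  The factors of the nodes in \<open>\<Omega>\<close> agree in both laws and cancel.\<close>

definition R :: "nat \<Rightarrow> (nat \<times> nat \<Rightarrow> complex) \<Rightarrow> real" where
  "R w z = (\<Prod>t<n. Q t (mixed w z) / (\<Prod>j\<in>A. cgauss 1 (z (t, j))))"

lemma cut_facts: "0 \<in> \<Omega>" "\<Omega> \<subseteq> {0..N}" "finite \<Omega>" "finite A" "A \<subseteq> {1..N+1}" "N + 1 \<in> A" "\<And>j. j \<in> A \<Longrightarrow> j \<notin> \<Omega>"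
  using cut finite_subset[of \<Omega> "{0..N}"] by (auto simp: cuts_def A_def Suc_le_eq intro: gr0I)

lemma set_nodes: "set [1..<N+2] = {1..N+1}"
  by (simp only: set_upt) auto

lemma v_ge: "v s j \<ge> 1" and v_pos: "v s j > 0"
proof -
  show "v s j \<ge> 1" unfolding v_def using P_pos by (auto intro!: mult_nonneg_nonneg sum_nonneg)
  then show "v s j > 0" by simp
qed

lemma q_pos: "q s t j u > 0"
  by (simp add: q_def cgauss_pos v_pos)

lemma Q_pos: "Q t u > 0"
  unfolding Q_def using card_states_pos[of m N] idle_state[of m N] finite_states[of m N]
  by (intro divide_pos_pos sum_pos prod_pos) (auto simp: q_pos)

lemma mixed_A: "t < n \<Longrightarrow> j \<in> A \<Longrightarrow> mixed w z (t, j) = z (t, j) + mean w z t j"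
  using cut_facts(5) by (auto simp: mixed_def)

lemma mixed_other: "j \<notin> A \<Longrightarrow> mixed w z (t, j) = z (t, j)"
  by (auto simp: mixed_def)

lemma hist_mixed:
  assumes "j \<in> A" "t \<le> n"
  shows "H w z t j = (\<lambda>\<tau>. if \<tau> < t then mixed w z (\<tau>, j) else 0)"
  using assms by (intro ext) (auto simp: hist_eq mixed_A)

lemma XA_mixed:
  assumes "i \<in> A" "i \<le> N" "t < n" shows "XA (mixed w z) t i = X w z t i"
proof -
  have "i \<noteq> 0" using assms cut_facts by auto
  then show ?thesis using assms by (simp add: X_def XA_def choice_def hist_mixed)
qed

lemma mean_split:
  assumes "j \<in> A" "t < n"
  shows "mean w z t j = meanO w z t j + meanA (mixed w z) t j (st w z t)"
proof -
  have "mean w z t j = (\<Sum>i\<in>\<Omega> \<union> ({0..N} - {j} - \<Omega>). if active (st w z t) i j then h j i * X w z t i else 0)"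
    unfolding mean_def using cut_facts assms by (intro sum.cong) auto
  also have "\<dots> = meanO w z t j + (\<Sum>i\<in>{0..N} - {j} - \<Omega>. if active (st w z t) i j then h j i * X w z t i else 0)"
    unfolding meanO_def using cut_facts by (intro sum.union_disjoint) auto
  also have "(\<Sum>i\<in>{0..N} - {j} - \<Omega>. if active (st w z t) i j then h j i * X w z t i else 0) = meanA (mixed w z) t j (st w z t)"
    unfolding meanA_def using assms by (intro sum.cong) (auto simp: XA_mixed A_def)
  finally show ?thesis .
qed

lemma q_mixed:
  assumes "j \<in> A" "t < n"
  shows "q (st w z t) t j (mixed w z) = cgauss (v (st w z t) j) (z (t, j) + meanO w z t j)"
  using assms by (simp add: q_def mixed_A mean_split)

lemma XA_indep: "t \<le> t' \<Longrightarrow> XA (u((t', j') := x)) t i = XA u t i"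
  unfolding XA_def by (intro arg_cong[where f = snd] arg_cong[where f = "rel c i t"] ext) auto

lemma meanA_indep: "t \<le> t' \<Longrightarrow> meanA (u((t', j') := x)) t j s = meanA u t j s"
  by (simp only: meanA_def XA_indep)

lemma Q_indep: "t < t' \<Longrightarrow> Q t (u((t', j') := x)) = Q t u"
  unfolding Q_def q_def by (simp add: meanA_indep)

lemma meanO_indep: "t \<le> t' \<Longrightarrow> meanO w (z((t', j') := x)) t j = meanO w z t j"
  by (simp only: meanO_def st_indep X_indep)

text \<open>Within one channel use the centres depend on earlier times only. For each fixed state
  the integrand is therefore a product of normalised densities, and the mixture averages such
  products.\<close>

lemma block_normalized:
  "iter \<Lambda> (map (Pair k) [1..<N+2]) (\<lambda>u. ennreal (Q k u * (\<Prod>j\<in>{1..N+1} - A. cgauss 1 (u (k, j))))) z = 1"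
proof -
  let ?b = "map (Pair k) [1..<N+2]"
  let ?S = "states m N"
  define f where "f s i u x = (if snd i \<in> A then cgauss (v s (snd i)) (x - meanA u k (snd i) s) else cgauss 1 x)"
    for s and i :: "nat \<times> nat" and u x
  have f_pos: "f s i u x \<ge> 0" for s i u x by (simp add: f_def cgauss_pos v_pos less_imp_le)
  have prod: "(\<Prod>i\<leftarrow>?b. ennreal (f s i u (u i))) = ennreal ((\<Prod>j\<in>A. q s k j u) * (\<Prod>j\<in>{1..N+1} - A. cgauss 1 (u (k, j))))" for s u
  proof -
    have "(\<Prod>i\<leftarrow>?b. ennreal (f s i u (u i))) = (\<Prod>j\<leftarrow>[1..<N+2]. ennreal (f s (k, j) u (u (k, j))))"
      by (simp add: o_def del: upt_Suc)
    also have "\<dots> = (\<Prod>j\<in>{1..N+1}. ennreal (f s (k, j) u (u (k, j))))"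
      using prod.distinct_set_conv_list[of "[1..<N+2]" "\<lambda>j. ennreal (f s (k, j) u (u (k, j)))"]
      by (simp only: set_nodes distinct_upt True_implies_equals)
    also have "\<dots> = ennreal (\<Prod>j\<in>{1..N+1}. f s (k, j) u (u (k, j)))"
      by (intro prod_ennreal f_pos)
    also have "(\<Prod>j\<in>{1..N+1}. f s (k, j) u (u (k, j))) = (\<Prod>j\<in>{1..N+1} - A. f s (k, j) u (u (k, j))) * (\<Prod>j\<in>A. f s (k, j) u (u (k, j)))"
      by (intro prod.subset_diff cut_facts) simp
    also have "\<dots> = (\<Prod>j\<in>A. q s k j u) * (\<Prod>j\<in>{1..N+1} - A. cgauss 1 (u (k, j)))"
      by (simp add: f_def q_def mult.commute)
    finally show ?thesis .
  qed
  have "ennreal (Q k u * (\<Prod>j\<in>{1..N+1} - A. cgauss 1 (u (k, j)))) =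
      (\<Sum>s\<in>?S. ennreal (1 / card ?S) * (\<Prod>i\<leftarrow>?b. ennreal (f s i u (u i))))" for u
  proof -
    have "(\<Sum>s\<in>?S. ennreal (1 / card ?S) * (\<Prod>i\<leftarrow>?b. ennreal (f s i u (u i)))) =
       (\<Sum>s\<in>?S. ennreal (1 / card ?S * ((\<Prod>j\<in>A. q s k j u) * (\<Prod>j\<in>{1..N+1} - A. cgauss 1 (u (k, j))))))"
      unfolding prod by (intro sum.cong refl ennreal_mult[symmetric] mult_nonneg_nonneg prod_nonneg)
        (auto simp: q_pos cgauss_pos less_imp_le)
    also have "\<dots> = ennreal (\<Sum>s\<in>?S. 1 / card ?S * ((\<Prod>j\<in>A. q s k j u) * (\<Prod>j\<in>{1..N+1} - A. cgauss 1 (u (k, j)))))"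
      by (intro sum_ennreal mult_nonneg_nonneg prod_nonneg) (auto simp: q_pos cgauss_pos less_imp_le)
    finally show ?thesis
      by (simp add: Q_def sum_divide_distrib sum_distrib_right)
  qed
  then have "iter \<Lambda> ?b (\<lambda>u. ennreal (Q k u * (\<Prod>j\<in>{1..N+1} - A. cgauss 1 (u (k, j))))) z =
     (\<Sum>s\<in>?S. ennreal (1 / card ?S) * iter \<Lambda> ?b (\<lambda>u. \<Prod>i\<leftarrow>?b. ennreal (f s i u (u i))) z)"
    by (simp add: iter_sum iter_cmult finite_states del: upt_Suc map_map)
  also have "\<dots> = (\<Sum>s\<in>?S. ennreal (1 / card ?S) * 1)"
  proof (intro sum.cong refl arg_cong2[where f = "(*)"] iter_prod_one)
    show "distinct ?b" by (simp add: distinct_map inj_on_def del: upt_Suc)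
    show "f s i (u(j := x)) = f s i u" if "i \<in> set ?b" "j \<in> set ?b" for s i j u x
      using that by (intro ext) (auto simp: f_def meanA_indep)
    show "f s i u \<in> borel_measurable borel" for s i u
      unfolding f_def[abs_def] by (cases "snd i \<in> A") auto
    show "(\<integral>\<^sup>+x. ennreal (f s i u x) \<partial>lborel) = 1" for s i u
      using nn_integral_cgauss[of 1 0] by (cases "snd i \<in> A") (auto simp: f_def nn_integral_cgauss v_pos)
  qed (rule f_pos)
  also have "\<dots> = 1"
    using card_states_pos[of m N] by (simp add: ennreal_of_nat_eq_real_of_nat flip: ennreal_mult)
  finally show ?thesis .
qed

text \<open>Channel uses come off from the last one backwards, since \<open>Q t\<close> involves no
  coordinate after time \<open>t\<close>.\<close>

lemma G_normalized: "iter \<Lambda> coords (\<lambda>u. ennreal (G u)) z = 1"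
proof -
  have "iter \<Lambda> (List.product [0..<k] [1..<N+2])
      (\<lambda>u. ennreal (\<Prod>t<k. Q t u * (\<Prod>j\<in>{1..N+1} - A. cgauss 1 (u (t, j))))) z = 1" for k
  proof (induction k)
    case (Suc k)
    let ?F = "\<lambda>t u. Q t u * (\<Prod>j\<in>{1..N+1} - A. cgauss 1 (u (t, j)))"
    have F_pos: "?F t u \<ge> 0" for t u
      by (intro mult_nonneg_nonneg prod_nonneg) (auto simp: Q_pos cgauss_pos less_imp_le)
    have P_nn: "(\<Prod>t<k. ?F t u) \<ge> 0" for u by (intro prod_nonneg F_pos)
    have p: "List.product [0..<Suc k] [1..<N+2] = List.product [0..<k] [1..<N+2] @ map (Pair k) [1..<N+2]"
      by (simp add: product_concat_map del: upt_Suc) (simp del: upt_Suc add: upt_Suc_append)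
    have "iter \<Lambda> (map (Pair k) [1..<N+2]) (\<lambda>u. ennreal (\<Prod>t<Suc k. ?F t u)) z = ennreal (\<Prod>t<k. ?F t z)" for z
    proof -
      define p where "p = (\<lambda>u. \<Prod>t<k. ?F t u)"
      have "(\<lambda>u. ennreal (\<Prod>t<Suc k. ?F t u)) = (\<lambda>u. ennreal (p u) * ennreal (?F k u))"
        unfolding p_def prod.lessThan_Suc by (intro ext ennreal_mult P_nn F_pos)
      then have "iter \<Lambda> (map (Pair k) [1..<N+2]) (\<lambda>u. ennreal (\<Prod>t<Suc k. ?F t u)) z =
          iter \<Lambda> (map (Pair k) [1..<N+2]) (\<lambda>u. ennreal (p u) * ennreal (?F k u)) z"
        by (simp only:)
      also have "\<dots> = ennreal (p z) * iter \<Lambda> (map (Pair k) [1..<N+2]) (\<lambda>u. ennreal (?F k u)) z"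
      proof (rule iter_factor)
        show "p (z(j := x)) = p z" if "j \<in> set (map (Pair k) [1..<N+2])" for j x z
          unfolding p_def using that by (intro prod.cong refl) (auto simp: Q_indep intro!: prod.cong)
        show "p z \<ge> 0" for z unfolding p_def by (rule P_nn)
      qed
      finally show ?thesis by (simp only: block_normalized p_def mult_1_right)
    qed
    then have "iter \<Lambda> (map (Pair k) [1..<N+2]) (\<lambda>u. ennreal (\<Prod>t<Suc k. ?F t u)) = (\<lambda>z. ennreal (\<Prod>t<k. ?F t z))"
      by (rule ext)
    then show ?case unfolding p iter_append using Suc by (simp only:)
  qed simp
  then show ?thesis unfolding G_def coords_def .
qed

end

context network_cut
begin

lemma cgauss_ratio:
  assumes "v0 > 0"
  shows "cgauss v0 y / cgauss 1 x = exp ((cmod x)\<^sup>2 - ln v0 - (cmod y)\<^sup>2 / v0)"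
proof -
  define B where "B = (cmod y)\<^sup>2 / v0"
  have "cgauss v0 y / cgauss 1 x = exp ((cmod x)\<^sup>2) / v0 / exp B"
    using assms by (simp add: cgauss_def exp_minus B_def[symmetric] field_simps)
  then show ?thesis using assms by (simp add: exp_diff B_def)
qed

lemma R_pos: "R w z > 0"
  unfolding R_def by (intro prod_pos divide_pos_pos) (auto simp: Q_pos cgauss_pos)

lemma weight_R: "(\<Prod>i\<leftarrow>coords. ennreal (cgauss 1 (z i))) * ennreal (R w z) = ennreal (G (mixed w z))"
proof -
  have "(\<Prod>i\<leftarrow>coords. ennreal (cgauss 1 (z i))) = (\<Prod>i\<in>set coords. ennreal (cgauss 1 (z i)))"
    by (rule prod.distinct_set_conv_list[OF coords_distinct, symmetric])
  also have "\<dots> = ennreal (\<Prod>i\<in>{..<n} \<times> {1..N+1}. cgauss 1 (z i))"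
    unfolding coords_set by (intro prod_ennreal) (simp add: cgauss_pos less_imp_le)
  also have "(\<Prod>i\<in>{..<n} \<times> {1..N+1}. cgauss 1 (z i)) = (\<Prod>t<n. \<Prod>j\<in>{1..N+1}. cgauss 1 (z (t, j)))"
    using prod.cartesian_product[of "\<lambda>t j. cgauss 1 (z (t, j))" "{1..N+1}" "{..<n}"]
    by (simp only: split_def prod.collapse)
  finally have 1: "(\<Prod>i\<leftarrow>coords. ennreal (cgauss 1 (z i))) = ennreal (\<Prod>t<n. \<Prod>j\<in>{1..N+1}. cgauss 1 (z (t, j)))" .
  have "(\<Prod>t<n. \<Prod>j\<in>{1..N+1}. cgauss 1 (z (t, j))) * R w z =
     (\<Prod>t<n. (\<Prod>j\<in>{1..N+1}. cgauss 1 (z (t, j))) * (Q t (mixed w z) / (\<Prod>j\<in>A. cgauss 1 (z (t, j)))))"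
    unfolding R_def by (rule prod.distrib[symmetric])
  also have "\<dots> = G (mixed w z)"
    unfolding G_def
  proof (intro prod.cong refl)
    fix t
    have "(\<Prod>j\<in>{1..N+1}. cgauss 1 (z (t, j))) = (\<Prod>j\<in>{1..N+1} - A. cgauss 1 (z (t, j))) * (\<Prod>j\<in>A. cgauss 1 (z (t, j)))"
      by (intro prod.subset_diff cut_facts) simp
    moreover have "(\<Prod>j\<in>A. cgauss 1 (z (t, j))) > 0" by (intro prod_pos) (simp add: cgauss_pos)
    moreover have "(\<Prod>j\<in>{1..N+1} - A. cgauss 1 (mixed w z (t, j))) = (\<Prod>j\<in>{1..N+1} - A. cgauss 1 (z (t, j)))"
      by (intro prod.cong refl) (simp add: mixed_other)
    ultimately show "(\<Prod>j\<in>{1..N+1}. cgauss 1 (z (t, j))) * (Q t (mixed w z) / (\<Prod>j\<in>A. cgauss 1 (z (t, j)))) =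
       Q t (mixed w z) * (\<Prod>j\<in>{1..N+1} - A. cgauss 1 (mixed w z (t, j)))"
      by simp
  qed
  finally have 2: "(\<Prod>t<n. \<Prod>j\<in>{1..N+1}. cgauss 1 (z (t, j))) * R w z = G (mixed w z)" .
  show ?thesis unfolding 1 2[symmetric]
    by (intro ennreal_mult[symmetric] prod_nonneg) (auto simp: R_pos cgauss_pos less_imp_le intro!: prod_nonneg)
qed

text \<open>The shift of a coordinate at time \<open>t\<close> depends on noise at earlier times
  only, so passing from noise to mixed coordinates is an instance of
  \<open>iter_shear\<close>.\<close>

lemma EE_change: "EE (\<lambda>z. F (mixed w z) * ennreal (R w z)) = iter \<Lambda> coords (\<lambda>u. F u * ennreal (G u)) (\<lambda>_. undefined)"
proof -
  let ?g = "\<lambda>i z. if snd i \<in> A then mean w z (fst i) (snd i) else 0"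
  have "EE (\<lambda>z. F (mixed w z) * ennreal (R w z)) =
      iter \<Lambda> coords (\<lambda>z. F (mixed w z) * ennreal (G (mixed w z))) (\<lambda>_. undefined)"
    unfolding iter_E_eq[OF coords_distinct] weight_R[symmetric] by (simp only: mult.left_commute)
  also have "\<dots> = iter \<Lambda> coords (\<lambda>u. F u * ennreal (G u)) (\<lambda>_. undefined)"
    unfolding mixed_def
  proof (rule iter_shear[OF coords_distinct, of ?g "\<lambda>u. F u * ennreal (G u)"])
    fix xs i ys j and z :: "nat \<times> nat \<Rightarrow> complex" and x
    assume 1: "coords = xs @ i # ys" and 2: "j \<in> set (i # ys)"
    have "fst i \<le> fst j"
      using coords_later[of xs "fst i" "snd i" ys "fst j" "snd j"] 1 2 by simp
    then have "mean w (z(j := x)) (fst i) (snd i) = mean w z (fst i) (snd i)"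
      using mean_indep[of "fst i" "fst j" w z "snd j" x "snd i"] by simp
    then show "?g i (z(j := x)) = ?g i z" by (simp only:)
  qed
  finally show ?thesis .
qed

lemma EE_R: "EE (\<lambda>z. ennreal (R w z)) = 1"
  using EE_change[of "\<lambda>_. 1" w] by (simp add: G_normalized)

text \<open>The destination lies across the cut, so what it decodes is a function of the mixed
  coordinates. Their density \<open>G\<close> is the same for all messages, and at each point the
  decoder is right for at most one message.\<close>

lemma sum_EE_ok_R: "(\<Sum>w<M. EE (\<lambda>z. of_bool (ok w z) * ennreal (R w z))) \<le> 1"
proof -
  define F where "F w u = (of_bool (dec c (\<lambda>\<tau>. if \<tau> < n then u (\<tau>, N + 1) else 0) = w) :: ennreal)" for w u
  have "of_bool (ok w z) = F w (mixed w z)" for w z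
    by (simp only: ok_def F_def hist_mixed[OF cut_facts(6) order_refl])
  then have "(\<Sum>w<M. EE (\<lambda>z. of_bool (ok w z) * ennreal (R w z))) = (\<Sum>w<M. iter \<Lambda> coords (\<lambda>u. F w u * ennreal (G u)) (\<lambda>_. undefined))"
    by (simp only: EE_change)
  also have "\<dots> = iter \<Lambda> coords (\<lambda>u. \<Sum>w<M. F w u * ennreal (G u)) (\<lambda>_. undefined)"
    by (simp only: iter_sum[OF finite_lessThan])
  also have "\<dots> \<le> iter \<Lambda> coords (\<lambda>u. ennreal (G u)) (\<lambda>_. undefined)"
  proof (rule iter_mono)
    fix u
    have "(\<Sum>w<M. F w u) \<le> 1" unfolding F_def by (simp add: sum.delta of_bool_def cong: if_cong)
    then have "(\<Sum>w<M. F w u) * ennreal (G u) \<le> 1 * ennreal (G u)" by (rule mult_right_mono) simp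
    then show "(\<Sum>w<M. F w u * ennreal (G u)) \<le> ennreal (G u)" by (simp add: sum_distrib_right)
  qed
  finally show ?thesis by (simp add: G_normalized)
qed

text \<open>From \<open>1 + y \<le> exp y\<close>, where \<open>exp y\<close> is at most
  \<open>\<phi> * R w z\<close> and \<open>\<phi>\<close> is the number of messages on correct
  decoding and 1 otherwise. On the right, both terms with \<open>R\<close> have expectation at most
  1 on average over the messages, so the logarithm of the number of messages is bought at constant
  cost.\<close>

lemma pointwise_bound:
  assumes w: "w < M"
  shows "of_bool (ok w z) * ln M + 1 + (\<Sum>t<n. \<Sum>j\<in>A. (cmod (z (t, j)))\<^sup>2) \<le>
    real M * (of_bool (ok w z) * R w z) + R w z + real n * ln (card (states m N)) +
    (\<Sum>t<n. \<Sum>j\<in>A. ln (v (st w z t) j) + (cmod (z (t, j) + meanO w z t j))\<^sup>2 / v (st w z t) j)"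
proof -
  let ?S = "states m N"
  let ?e = "\<lambda>t. (\<Sum>j\<in>A. (cmod (z (t, j)))\<^sup>2 - ln (v (st w z t) j) - (cmod (z (t, j) + meanO w z t j))\<^sup>2 / v (st w z t) j) - ln (card ?S)"
  define \<phi> where "\<phi> = (if ok w z then real M else 1)"
  have S: "real (card ?S) > 0" using card_states_pos by simp
  have M1: "real M \<ge> 1" using M_pos by simp
  \<comment> \<open>Of the mixture only the term of the realised state is kept, at the cost of
    \<open>ln (card ?S)\<close>. Its density involves just the energy received from the source
    side.\<close>
  have e: "exp (?e t) \<le> Q t (mixed w z) / (\<Prod>j\<in>A. cgauss 1 (z (t, j)))" if t: "t < n" for t
  proof -
    have s: "st w z t \<in> ?S" using st_states[OF w t] .
    have "exp (?e t) = (\<Prod>j\<in>A. exp ((cmod (z (t, j)))\<^sup>2 - ln (v (st w z t) j) - (cmod (z (t, j) + meanO w z t j))\<^sup>2 / v (st w z t) j)) / card ?S"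
      using S cut_facts by (simp add: exp_diff[of "sum _ _"] exp_sum)
    also have "\<dots> = (\<Prod>j\<in>A. q (st w z t) t j (mixed w z) / cgauss 1 (z (t, j))) / card ?S"
      using t by (intro arg_cong2[where f = "(/)"] prod.cong refl) (simp add: q_mixed cgauss_ratio v_pos)
    also have "\<dots> = (\<Prod>j\<in>A. q (st w z t) t j (mixed w z)) / card ?S / (\<Prod>j\<in>A. cgauss 1 (z (t, j)))"
      by (simp add: prod_dividef)
    also have "\<dots> \<le> Q t (mixed w z) / (\<Prod>j\<in>A. cgauss 1 (z (t, j)))"
      unfolding Q_def using s
      by (intro divide_right_mono member_le_sum finite_states prod_nonneg) (auto simp: q_pos cgauss_pos less_imp_le intro!: prod_nonneg)
    finally show ?thesis .
  qed
  have "1 + (ln \<phi> + (\<Sum>t<n. ?e t)) \<le> exp (ln \<phi> + (\<Sum>t<n. ?e t))" by (rule exp_ge_add_one_self)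
  also have "\<dots> = \<phi> * (\<Prod>t<n. exp (?e t))"
    using M1 by (simp add: exp_add exp_sum \<phi>_def)
  also have "\<dots> \<le> \<phi> * R w z"
    unfolding R_def using e M1 by (intro mult_left_mono prod_mono) (auto simp: \<phi>_def)
  also have "\<dots> \<le> real M * (of_bool (ok w z) * R w z) + R w z"
    using R_pos[of w z] M1 by (simp add: \<phi>_def)
  finally have main: "1 + (ln \<phi> + (\<Sum>t<n. ?e t)) \<le> real M * (of_bool (ok w z) * R w z) + R w z" .
  have "(\<Sum>t<n. ?e t) = (\<Sum>t<n. \<Sum>j\<in>A. (cmod (z (t, j)))\<^sup>2) - real n * ln (card ?S) -
    (\<Sum>t<n. \<Sum>j\<in>A. ln (v (st w z t) j) + (cmod (z (t, j) + meanO w z t j))\<^sup>2 / v (st w z t) j)"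
    by (simp add: sum_subtractf sum.distrib)
  moreover have "ln \<phi> = of_bool (ok w z) * ln M" by (simp add: \<phi>_def)
  ultimately show ?thesis using main by linarith
qed

lemma v_ln: 
  assumes "s \<in> states m N" "j \<in> A"
  shows "ln (v s j) = (\<Sum>i\<in>\<Omega>. if active s i j then ln (1 + P * (cmod (h j i))\<^sup>2) else 0)"
proof -
  have "j \<in> {0..N+1}" using assms(2) cut_facts(5) by auto
  then show ?thesis
  proof (rule active_dest_cases[OF assms(1) _ cut_facts(3)])
    assume "{i \<in> \<Omega>. active s i j} = {}"
    then have "\<And>i. i \<in> \<Omega> \<Longrightarrow> \<not> active s i j" by blast
    then show ?thesis by (simp add: v_def)
  next
    fix i assume i: "i \<in> \<Omega>" "{i \<in> \<Omega>. active s i j} = {i}"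
    have *: "(\<Sum>k\<in>\<Omega>. if active s k j then f k else 0) = f i" for f :: "nat \<Rightarrow> real"
      using i cut_facts(3) by (simp add: sum.If_cases Int_def conj_commute)
    show ?thesis unfolding v_def * by simp
  qed
qed

text \<open>With gain \<open>a\<close> and input energy \<open>b\<close> on the active link,
  \<open>1 + a * b \<le> (1 + b / P) * (1 + P * a)\<close>. A transmitter reaches at most one
  receiver in a state, so its energy is charged once in the sum over the receivers.\<close>

lemma second_moment_bound:
  assumes w: "w < M" "t < n"
  shows "(\<Sum>j\<in>A. (1 + (cmod (meanO w z t j))\<^sup>2) / v (st w z t) j) \<le> card A + (\<Sum>i\<in>\<Omega>. (cmod (X w z t i))\<^sup>2) / P"
proof -
  let ?s = "st w z t"
  have s: "?s \<in> states m N" by (rule st_states[OF w])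
  have j: "(1 + (cmod (meanO w z t j))\<^sup>2) / v ?s j \<le> 1 + (\<Sum>i\<in>\<Omega>. if active ?s i j then (cmod (X w z t i))\<^sup>2 / P else 0)"
    if "j \<in> A" for j
  proof -
    have "j \<in> {0..N+1}" using that cut_facts(5) by auto
    then show ?thesis
    proof (rule active_dest_cases[OF s _ cut_facts(3)])
      assume "{i \<in> \<Omega>. active ?s i j} = {}"
      then have "\<And>i. i \<in> \<Omega> \<Longrightarrow> \<not> active ?s i j" by blast
      then show ?thesis by (simp add: v_def meanO_def)
    next
      fix i assume i: "i \<in> \<Omega>" "{i \<in> \<Omega>. active ?s i j} = {i}"
      have r: "(\<Sum>k\<in>\<Omega>. if active ?s k j then f k else 0) = f i" for f :: "nat \<Rightarrow> real"
        using i cut_facts(3) by (simp add: sum.If_cases Int_def conj_commute)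
      have c: "(\<Sum>k\<in>\<Omega>. if active ?s k j then f k else 0) = f i" for f :: "nat \<Rightarrow> complex"
        using i cut_facts(3) by (simp add: sum.If_cases Int_def conj_commute)
      define a where "a = (cmod (h j i))\<^sup>2"
      define b where "b = (cmod (X w z t i))\<^sup>2"
      have ab: "a \<ge> 0" "b \<ge> 0" by (auto simp: a_def b_def)
      have "1 + a * b \<le> (1 + b / P) * (1 + P * a)"
        using ab P_pos by (simp add: field_simps)
      moreover have "1 + P * a > 0" using ab P_pos by (simp add: add_pos_nonneg)
      ultimately have "(1 + a * b) / (1 + P * a) \<le> 1 + b / P" by (simp add: pos_divide_le_eq)
      then show ?thesis
        unfolding v_def meanO_def r c by (simp add: norm_mult power_mult_distrib a_def b_def)
    qed
  qed
  have "(\<Sum>j\<in>A. (1 + (cmod (meanO w z t j))\<^sup>2) / v ?s j) \<le> (\<Sum>j\<in>A. 1 + (\<Sum>i\<in>\<Omega>. if active ?s i j then (cmod (X w z t i))\<^sup>2 / P else 0))"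
    by (intro sum_mono j)
  also have "\<dots> = card A + (\<Sum>i\<in>\<Omega>. \<Sum>j\<in>A. if active ?s i j then (cmod (X w z t i))\<^sup>2 / P else 0)"
    by (simp add: sum.distrib) (rule sum.swap)
  also have "(\<Sum>i\<in>\<Omega>. \<Sum>j\<in>A. if active ?s i j then (cmod (X w z t i))\<^sup>2 / P else 0) \<le> (\<Sum>i\<in>\<Omega>. (cmod (X w z t i))\<^sup>2 / P)"
  proof (intro sum_mono)
    fix i assume "i \<in> \<Omega>"
    then have "i \<in> {0..N+1}" using cut_facts(2) by auto
    then have "card {j\<in>A. active ?s i j} \<le> 1" by (rule active_card_source[OF s])
    then have "real (card {j\<in>A. active ?s i j}) * ((cmod (X w z t i))\<^sup>2 / P) \<le> 1 * ((cmod (X w z t i))\<^sup>2 / P)"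
      using P_pos by (intro mult_right_mono) auto
    then show "(\<Sum>j\<in>A. if active ?s i j then (cmod (X w z t i))\<^sup>2 / P else 0) \<le> (cmod (X w z t i))\<^sup>2 / P"
      using cut_facts(4) by (simp add: sum.If_cases Int_def conj_commute)
  qed
  finally show ?thesis by (simp add: sum_divide_distrib)
qed

end

section \<open>Expectations of the pointwise inequality\<close>

lemma ennreal_plus4:
  "0 \<le> x \<Longrightarrow> 0 \<le> y \<Longrightarrow> 0 \<le> z \<Longrightarrow> 0 \<le> w \<Longrightarrow>
    ennreal (x + y + z + w) = ennreal x + (ennreal y + (ennreal z + ennreal w))"
  by (simp add: add.assoc)

context network_cut
begin

lemma ln_v_nonneg: "0 \<le> ln (v s j)"
  using v_ge by (simp add: ln_ge_zero)

lemma v_nonneg: "0 \<le> v s j"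
  using v_pos less_imp_le by blast

text \<open>Every term stands on the side where it is nonnegative, because \<open>EE\<close> acts on
  extended nonnegative functions and knows no subtraction.\<close>

lemma pointwise_bound_ennreal:
  assumes w: "w < M"
  shows "ennreal (ln M) * of_bool (ok w z) + (1 + (\<Sum>t<n. \<Sum>j\<in>A. ennreal ((cmod (z (t, j)))\<^sup>2))) \<le>
    ennreal M * (of_bool (ok w z) * ennreal (R w z)) + (ennreal (R w z) + (ennreal (n * ln (card (states m N))) +
    (\<Sum>t<n. \<Sum>j\<in>A. ennreal (ln (v (st w z t) j)) + ennreal ((cmod (z (t, j) + meanO w z t j))\<^sup>2 / v (st w z t) j))))"
    (is "?l \<le> ?r")
proof -
  have M: "real M \<ge> 1" "ln (real M) \<ge> 0" using M_pos by auto
  have S: "ln (real (card (states m N))) \<ge> 0" using card_states_pos[of m N] by (auto intro: ln_ge_zero)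
  let ?lr = "of_bool (ok w z) * ln M + 1 + (\<Sum>t<n. \<Sum>j\<in>A. (cmod (z (t, j)))\<^sup>2)"
  let ?V = "\<lambda>t j. ln (v (st w z t) j) + (cmod (z (t, j) + meanO w z t j))\<^sup>2 / v (st w z t) j"
  have V: "0 \<le> ?V t j" for t j by (intro add_nonneg_nonneg divide_nonneg_nonneg ln_v_nonneg v_nonneg) simp
  let ?rr = "real M * (of_bool (ok w z) * R w z) + R w z + real n * ln (card (states m N)) + (\<Sum>t<n. \<Sum>j\<in>A. ?V t j)"
  have "?l = ennreal (ln M * of_bool (ok w z)) + (ennreal 1 + ennreal (\<Sum>t<n. \<Sum>j\<in>A. (cmod (z (t, j)))\<^sup>2))"
    by (simp add: sum_nonneg)
  also have "\<dots> = ennreal ?lr"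
    using M by (subst ennreal_plus[symmetric], simp_all add: sum_nonneg)
  finally have l: "?l = ennreal ?lr" .
  have Vs: "ennreal (ln (v (st w z t) j)) + ennreal ((cmod (z (t, j) + meanO w z t j))\<^sup>2 / v (st w z t) j) = ennreal (?V t j)" for t j
    by (intro ennreal_plus[symmetric] divide_nonneg_nonneg ln_v_nonneg v_nonneg) simp
  have "ennreal ?rr = ennreal (real M * (of_bool (ok w z) * R w z)) + (ennreal (R w z) + (ennreal (n * ln (card (states m N))) + ennreal (\<Sum>t<n. \<Sum>j\<in>A. ?V t j)))"
    by (rule ennreal_plus4) (use S R_pos[of w z] V in \<open>auto intro!: sum_nonneg\<close>)
  also have "ennreal (\<Sum>t<n. \<Sum>j\<in>A. ?V t j) = (\<Sum>t<n. \<Sum>j\<in>A. ennreal (?V t j))"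
    using V by (simp add: sum_nonneg)
  also have "ennreal (real M * (of_bool (ok w z) * R w z)) = ennreal M * (of_bool (ok w z) * ennreal (R w z))"
    using R_pos[of w z] by (simp add: ennreal_mult)
  finally have r: "?r = ennreal ?rr" unfolding Vs ..
  show ?thesis unfolding l r by (intro ennreal_leI pointwise_bound w)
qed

lemma EE_noise_power:
  assumes "t < n" "j \<in> A"
  shows "EE (\<lambda>z. ennreal ((cmod (z (t, j)))\<^sup>2)) = 1"
proof -
  have "EE (\<lambda>z. ennreal ((cmod (z (t, j)))\<^sup>2)) = EE (\<lambda>z. \<integral>\<^sup>+x. ennreal ((cmod x)\<^sup>2) \<partial>CN01)"
    using assms cut_facts(5) by (intro EE_conditional[of t j "\<lambda>_ x. ennreal ((cmod x)\<^sup>2)"]) auto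
  then show ?thesis using CN01_second_moment[of 0] by (simp add: iter_E_const)
qed

text \<open>State and source-side signal at time \<open>t\<close> depend on the past alone, so the
  fresh noise contributes exactly 1 to the conditional second moment.\<close>

lemma EE_received_power:
  assumes "t < n" "j \<in> A"
  shows "EE (\<lambda>z. ennreal ((cmod (z (t, j) + meanO w z t j))\<^sup>2 / v (st w z t) j)) =
    EE (\<lambda>z. ennreal ((1 + (cmod (meanO w z t j))\<^sup>2) / v (st w z t) j))"
proof -
  let ?K = "\<lambda>z x. ennreal ((cmod (x + meanO w z t j))\<^sup>2 / v (st w z t) j)"
  have 1: "EE (\<lambda>z. ?K z (z (t, j))) = EE (\<lambda>z. \<integral>\<^sup>+x. ?K z x \<partial>CN01)"
    using assms cut_facts(5) by (intro EE_conditional[of t j ?K]) (auto simp: meanO_indep st_indep simp del: fun_upd_apply)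
  have "(\<integral>\<^sup>+x. ?K z x \<partial>CN01) = ennreal ((1 + (cmod (meanO w z t j))\<^sup>2) / v (st w z t) j)" for z
  proof -
    have "(\<integral>\<^sup>+x. ?K z x \<partial>CN01) = (\<integral>\<^sup>+x. ennreal (1 / v (st w z t) j) * ennreal ((cmod (x + meanO w z t j))\<^sup>2) \<partial>CN01)"
      using v_pos by (intro nn_integral_cong) (simp add: less_imp_le flip: ennreal_mult)
    also have "\<dots> = ennreal (1 / v (st w z t) j) * ennreal (1 + (cmod (meanO w z t j))\<^sup>2)"
      by (subst nn_integral_cmult) (auto simp: CN01_second_moment)
    finally show ?thesis by (simp add: v_nonneg del: ennreal_plus flip: ennreal_mult)
  qed
  then show ?thesis using 1 by (simp only:)
qed

lemma EE_received_power_sum: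
  assumes w: "w < M" and t: "t < n"
  shows "(\<Sum>j\<in>A. EE (\<lambda>z. ennreal ((cmod (z (t, j) + meanO w z t j))\<^sup>2 / v (st w z t) j))) \<le>
    ennreal (card A) + ennreal (1 / P) * (\<Sum>i\<in>\<Omega>. EE (\<lambda>z. ennreal ((cmod (X w z t i))\<^sup>2)))"
proof -
  have "(\<Sum>j\<in>A. EE (\<lambda>z. ennreal ((cmod (z (t, j) + meanO w z t j))\<^sup>2 / v (st w z t) j))) =
     EE (\<lambda>z. \<Sum>j\<in>A. ennreal ((1 + (cmod (meanO w z t j))\<^sup>2) / v (st w z t) j))"
    using t by (simp add: EE_received_power E.iter_sum[OF cut_facts(4)])
  also have "\<dots> \<le> EE (\<lambda>z. ennreal (card A) + ennreal (1 / P) * (\<Sum>i\<in>\<Omega>. ennreal ((cmod (X w z t i))\<^sup>2)))"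
  proof (rule E.iter_mono)
    fix z
    have "(\<Sum>j\<in>A. ennreal ((1 + (cmod (meanO w z t j))\<^sup>2) / v (st w z t) j)) =
       ennreal (\<Sum>j\<in>A. (1 + (cmod (meanO w z t j))\<^sup>2) / v (st w z t) j)"
      using v_pos by (intro sum_ennreal divide_nonneg_nonneg) (auto simp: less_imp_le)
    also have "\<dots> \<le> ennreal (card A + (\<Sum>i\<in>\<Omega>. (cmod (X w z t i))\<^sup>2) / P)"
      by (intro ennreal_leI second_moment_bound w t)
    also have "\<dots> = ennreal (card A) + ennreal (1 / P) * (\<Sum>i\<in>\<Omega>. ennreal ((cmod (X w z t i))\<^sup>2))"
      using P_pos by (subst ennreal_plus) (auto simp: sum_nonneg less_imp_le simp flip: ennreal_mult)
    finally show "(\<Sum>j\<in>A. ennreal ((1 + (cmod (meanO w z t j))\<^sup>2) / v (st w z t) j)) \<le>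
        ennreal (card A) + ennreal (1 / P) * (\<Sum>i\<in>\<Omega>. ennreal ((cmod (X w z t i))\<^sup>2))" .
  qed
  also have "\<dots> = ennreal (card A) + ennreal (1 / P) * (\<Sum>i\<in>\<Omega>. EE (\<lambda>z. ennreal ((cmod (X w z t i))\<^sup>2)))"
    using P_pos by (simp add: E.iter_add E.iter_cmult E.iter_sum[OF cut_facts(3)] iter_E_const del: sum_ennreal)
  finally show ?thesis .
qed

lemma message_bound:
  assumes w: "w < M"
  shows "ennreal (ln M * (1 - measure (noise N n) (err_event c N h w)) + (1 + n * card A)) \<le>
    ennreal M * EE (\<lambda>z. of_bool (ok w z) * ennreal (R w z)) + (1 + (ennreal (n * ln (card (states m N))) +
    (\<Sum>t<n. ennreal (\<Sum>s\<in>states m N. (\<Sum>j\<in>A. ln (v s j)) * state_prob w t s) +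
      (ennreal (card A) + ennreal (1 / P) * (\<Sum>i\<in>\<Omega>. EE (\<lambda>z. ennreal ((cmod (X w z t i))\<^sup>2)))))))"
    (is "?l \<le> _ + (1 + (_ + (\<Sum>t<n. ?b t)))")
proof -
  have M: "ln (real M) \<ge> 0" using M_pos by auto
  have err: "1 - measure (noise N n) (err_event c N h w) \<ge> 0"
    using prob_space.prob_le_1[OF prob_space_noise] by simp
  have "?l = ennreal (ln M) * EE (\<lambda>z. of_bool (ok w z)) + (1 + (\<Sum>t<n. \<Sum>j\<in>A. 1))"
  proof -
    have 1: "1 + (\<Sum>t<n. \<Sum>j\<in>A. 1) = ennreal (1 + n * card A)"
      by (simp add: ennreal_of_nat_eq_real_of_nat ennreal_mult)
    show ?thesis unfolding 1 EE_ok[OF w]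
      using M err by (simp del: ennreal_plus flip: ennreal_mult ennreal_plus)
  qed
  also have "\<dots> = EE (\<lambda>z. ennreal (ln M) * of_bool (ok w z) + (1 + (\<Sum>t<n. \<Sum>j\<in>A. ennreal ((cmod (z (t, j)))\<^sup>2))))"
    using M by (simp add: E.iter_add E.iter_cmult E.iter_sum[OF cut_facts(4)] E.iter_sum[OF finite_lessThan] iter_E_const EE_noise_power
        del: sum_ennreal)
  also have "\<dots> \<le> EE (\<lambda>z. ennreal M * (of_bool (ok w z) * ennreal (R w z)) + (ennreal (R w z) + (ennreal (n * ln (card (states m N))) +
    (\<Sum>t<n. \<Sum>j\<in>A. ennreal (ln (v (st w z t) j)) + ennreal ((cmod (z (t, j) + meanO w z t j))\<^sup>2 / v (st w z t) j)))))"
    by (intro E.iter_mono pointwise_bound_ennreal w)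
  also have "\<dots> = ennreal M * EE (\<lambda>z. of_bool (ok w z) * ennreal (R w z)) + (1 + (ennreal (n * ln (card (states m N))) +
    (\<Sum>t<n. \<Sum>j\<in>A. EE (\<lambda>z. ennreal (ln (v (st w z t) j))) + EE (\<lambda>z. ennreal ((cmod (z (t, j) + meanO w z t j))\<^sup>2 / v (st w z t) j)))))"
    by (simp only: E.iter_add E.iter_cmult[OF of_nat_0_le_iff] E.iter_sum[OF cut_facts(4)] E.iter_sum[OF finite_lessThan] iter_E_const EE_R)
  also have "\<dots> \<le> ennreal M * EE (\<lambda>z. of_bool (ok w z) * ennreal (R w z)) + (1 + (ennreal (n * ln (card (states m N))) + (\<Sum>t<n. ?b t)))"
  proof (intro add_left_mono sum_mono)
    fix t assume "t \<in> {..<n}"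
    then have t: "t < n" by simp
    have "(\<Sum>j\<in>A. EE (\<lambda>z. ennreal (ln (v (st w z t) j)))) = (\<Sum>j\<in>A. ennreal (\<Sum>s\<in>states m N. ln (v s j) * state_prob w t s))"
      by (intro sum.cong refl EE_state_function w t ln_v_nonneg)
    also have "\<dots> = ennreal (\<Sum>j\<in>A. \<Sum>s\<in>states m N. ln (v s j) * state_prob w t s)"
      by (intro sum_ennreal sum_nonneg mult_nonneg_nonneg ln_v_nonneg state_prob_nonneg)
    also have "(\<Sum>j\<in>A. \<Sum>s\<in>states m N. ln (v s j) * state_prob w t s) = (\<Sum>s\<in>states m N. (\<Sum>j\<in>A. ln (v s j)) * state_prob w t s)"
      unfolding sum_distrib_right by (rule sum.swap)
    finally show "(\<Sum>j\<in>A. EE (\<lambda>z. ennreal (ln (v (st w z t) j))) + EE (\<lambda>z. ennreal ((cmod (z (t, j) + meanO w z t j))\<^sup>2 / v (st w z t) j))) \<le> ?b t"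
      unfolding sum.distrib by (simp only: add_left_mono[OF EE_received_power_sum[OF w t]])
  qed
  finally show ?thesis .
qed

text \<open>The power constraint holds on average over the messages, so the bounds for single
  messages are added before it is used. The noise energy on the left cancels the term with
  \<open>card A\<close> on the right, and \<open>card \<Omega> \<le> N + 1\<close> bounds what is
  left.\<close>

lemma cut_bound_sum:
  shows "ln M * (\<Sum>w<M. 1 - measure (noise N n) (err_event c N h w)) \<le>
     M + M * (n * ln (card (states m N))) + (\<Sum>w<M. \<Sum>t<n. \<Sum>s\<in>states m N. (\<Sum>j\<in>A. ln (v s j)) * state_prob w t s)
     + M * (n * (N + 1))"
proof -
  let ?S = "states m N"
  let ?err = "\<lambda>w. 1 - measure (noise N n) (err_event c N h w)"
  let ?L = "\<lambda>w t. \<Sum>s\<in>?S. (\<Sum>j\<in>A. ln (v s j)) * state_prob w t s"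
  let ?x = "\<lambda>w t i. EE (\<lambda>z. ennreal ((cmod (X w z t i))\<^sup>2))"
  have M: "ln (real M) \<ge> 0" using M_pos by auto
  have S: "ln (real (card ?S)) \<ge> 0" using card_states_pos[of m N] by (auto intro: ln_ge_zero)
  have err: "?err w \<ge> 0" for w
    using prob_space.prob_le_1[OF prob_space_noise] by simp
  have L: "?L w t \<ge> 0" for w t
    by (intro sum_nonneg mult_nonneg_nonneg ln_v_nonneg state_prob_nonneg)
  have P: "(\<Sum>w<M. \<Sum>t<n. ennreal (1 / P) * (\<Sum>i\<in>\<Omega>. ?x w t i)) \<le> ennreal (M * (n * (N + 1)))"
  proof -
    have "(\<Sum>w<M. \<Sum>t<n. ennreal (1 / P) * (\<Sum>i\<in>\<Omega>. ?x w t i)) = (\<Sum>t<n. \<Sum>i\<in>\<Omega>. ennreal (1 / P) * (\<Sum>w<M. ?x w t i))"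
      unfolding sum_distrib_left by (rule trans[OF sum.swap]) (intro sum.cong refl sum.swap)
    also have "\<dots> \<le> (\<Sum>t<n. \<Sum>i\<in>\<Omega>. ennreal (1 / P) * ennreal (M * P))"
      using cut_facts(2) by (intro sum_mono mult_left_mono EE_power) auto
    also have "\<dots> = ennreal (n * (card \<Omega> * M))"
      using P_pos by (simp add: ennreal_of_nat_eq_real_of_nat flip: ennreal_mult)
    also have "\<dots> \<le> ennreal (M * (n * (N + 1)))"
    proof -
      have "card \<Omega> \<le> N + 1" using card_mono[of "{0..N}" \<Omega>] cut_facts(2) by simp
      then have "n * (card \<Omega> * M) \<le> n * ((N + 1) * M)" by (intro mult_le_mono) auto
      then show ?thesis by (intro ennreal_leI) (simp add: algebra_simps flip: of_nat_mult of_nat_add of_nat_Suc)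
    qed
    finally show ?thesis .
  qed
  have "ennreal (\<Sum>w<M. ln M * ?err w + (1 + n * card A)) = (\<Sum>w<M. ennreal (ln M * ?err w + (1 + n * card A)))"
    using M err by (intro sum_ennreal[symmetric]) (simp add: add_nonneg_nonneg)
  also have "\<dots> \<le> (\<Sum>w<M. ennreal M * EE (\<lambda>z. of_bool (ok w z) * ennreal (R w z)) + (1 + (ennreal (n * ln (card ?S)) +
    (\<Sum>t<n. ennreal (?L w t) + (ennreal (card A) + ennreal (1 / P) * (\<Sum>i\<in>\<Omega>. ?x w t i))))))"
    by (intro sum_mono message_bound) simp
  also have "\<dots> = ennreal M * (\<Sum>w<M. EE (\<lambda>z. of_bool (ok w z) * ennreal (R w z))) + (ennreal M + (ennreal (M * (n * ln (card ?S))) +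
     (ennreal (\<Sum>w<M. \<Sum>t<n. ?L w t) + (ennreal (M * (n * card A)) + (\<Sum>w<M. \<Sum>t<n. ennreal (1 / P) * (\<Sum>i\<in>\<Omega>. ?x w t i))))))"
  proof -
    have "(\<Sum>w<M. \<Sum>t<n. ennreal (?L w t)) = ennreal (\<Sum>w<M. \<Sum>t<n. ?L w t)"
      using L by (simp add: sum_nonneg)
    then show ?thesis using S
      by (simp only: sum.distrib sum_distrib_left[symmetric])
         (simp add: ennreal_of_nat_eq_real_of_nat ennreal_mult)
  qed
  also have "\<dots> \<le> ennreal M * 1 + (ennreal M + (ennreal (M * (n * ln (card ?S))) +
     (ennreal (\<Sum>w<M. \<Sum>t<n. ?L w t) + (ennreal (M * (n * card A)) + ennreal (M * (n * (N + 1)))))))"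
    by (intro add_mono mult_left_mono sum_EE_ok_R P order_refl) simp
  also have "\<dots> = ennreal (M + (M + (M * (n * ln (card ?S)) + ((\<Sum>w<M. \<Sum>t<n. ?L w t) + (M * (n * card A) + M * (n * (N + 1)))))))"
  proof -
    have 1: "0 \<le> real M * (n * ln (card ?S))" using S by simp
    have 2: "0 \<le> (\<Sum>w<M. \<Sum>t<n. ?L w t)" by (intro sum_nonneg L)
    have 3: "0 \<le> real (M * (n * card A))" "0 \<le> real (M * (n * (N + 1)))" "0 \<le> real M" by simp_all
    show ?thesis
      using 1 2 3 by (simp add: ennreal_plus[symmetric] add_nonneg_nonneg del: ennreal_plus)
  qed
  finally have "(\<Sum>w<M. ln M * ?err w + (1 + n * card A)) \<le>
     M + (M + (M * (n * ln (card ?S)) + ((\<Sum>w<M. \<Sum>t<n. ?L w t) + (M * (n * card A) + M * (n * (N + 1))))))"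
    using S ln_v_nonneg state_prob_nonneg by (subst (asm) ennreal_le_iff) (auto intro!: add_nonneg_nonneg mult_nonneg_nonneg sum_nonneg)
  moreover have "(\<Sum>w<M. ln M * ?err w + (1 + n * card A)) = ln M * (\<Sum>w<M. ?err w) + M * (1 + n * card A)"
    by (simp add: sum.distrib sum_distrib_left distrib_left)
  ultimately show ?thesis by (simp add: distrib_left)
qed

end


context network_law
begin

text \<open>The states averaged over time and messages serve as the probability vector
  \<open>\<lambda>\<close> of \<open>C_cs_iid\<close>. The law depends on the code but on no
  cut.\<close>

definition state_law :: "state \<Rightarrow> real" where
  "state_law s = (\<Sum>w<M. \<Sum>t<n. state_prob w t s) / (M * n)"

lemma state_law_prob:
  assumes "n > 0" shows "state_law \<in> prob_vecs (states m N)"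
proof -
  have "sum state_law (states m N) = (\<Sum>s\<in>states m N. \<Sum>w<M. \<Sum>t<n. state_prob w t s) / (M * n)"
    by (simp add: state_law_def sum_divide_distrib)
  also have "(\<Sum>s\<in>states m N. \<Sum>w<M. \<Sum>t<n. state_prob w t s) = (\<Sum>w<M. \<Sum>t<n. \<Sum>s\<in>states m N. state_prob w t s)"
    by (rule trans[OF sum.swap]) (intro sum.cong refl sum.swap)
  also have "\<dots> = M * n" by (simp add: state_prob_sum)
  finally have "sum state_law (states m N) = 1" using assms M_pos by simp
  moreover have "0 \<le> state_law s" for s
    unfolding state_law_def by (intro divide_nonneg_nonneg sum_nonneg state_prob_nonneg) simp
  ultimately show ?thesis by (simp add: prob_vecs_def)
qed

end

context network_cut
begin

text \<open>The information crossing the cut is a sum over active links and linear in the state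
  probabilities, so averaging over time and messages produces the cut value of
  \<open>state_law\<close>; \<open>ln 2\<close> converts bits to nats.\<close>

lemma ln_v_cut:
  assumes "n > 0"
  shows "(\<Sum>w<M. \<Sum>t<n. \<Sum>s\<in>states m N. (\<Sum>j\<in>A. ln (v s j)) * state_prob w t s) =
    (M * n) * (ln 2 * cut_val m N (link_cap h P) state_law \<Omega>)"
proof -
  let ?S = "states m N"
  let ?l = "\<lambda>i j. ln (1 + P * (cmod (h j i))\<^sup>2)"
  have Mn: "real M * real n > 0" using assms M_pos by simp
  have "(\<Sum>w<M. \<Sum>t<n. \<Sum>s\<in>?S. (\<Sum>j\<in>A. ln (v s j)) * state_prob w t s) =
     (\<Sum>s\<in>?S. (\<Sum>j\<in>A. ln (v s j)) * (\<Sum>w<M. \<Sum>t<n. state_prob w t s))"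
  proof -
    have "(\<Sum>w<M. \<Sum>t<n. \<Sum>s\<in>?S. (\<Sum>j\<in>A. ln (v s j)) * state_prob w t s) =
      (\<Sum>w<M. \<Sum>s\<in>?S. \<Sum>t<n. (\<Sum>j\<in>A. ln (v s j)) * state_prob w t s)"
      by (intro sum.cong refl sum.swap)
    also have "\<dots> = (\<Sum>s\<in>?S. \<Sum>w<M. \<Sum>t<n. (\<Sum>j\<in>A. ln (v s j)) * state_prob w t s)" by (rule sum.swap)
    finally show ?thesis by (simp add: sum_distrib_left)
  qed
  also have "\<dots> = (\<Sum>s\<in>?S. (\<Sum>j\<in>A. ln (v s j)) * ((M * n) * state_law s))"
    using Mn by (intro sum.cong refl arg_cong2[where f = "(*)"]) (simp add: state_law_def)
  also have "\<dots> = (M * n) * (\<Sum>s\<in>?S. state_law s * (\<Sum>j\<in>A. \<Sum>i\<in>\<Omega>. if active s i j then ?l i j else 0))"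
    unfolding sum_distrib_left[of "real (M * n)"] by (intro sum.cong refl) (simp add: v_ln)
  also have "(\<Sum>s\<in>?S. state_law s * (\<Sum>j\<in>A. \<Sum>i\<in>\<Omega>. if active s i j then ?l i j else 0)) =
     (\<Sum>i\<in>\<Omega>. \<Sum>j\<in>A. \<Sum>s\<in>?S. state_law s * (if active s i j then ?l i j else 0))"
  proof -
    have "(\<Sum>s\<in>?S. state_law s * (\<Sum>j\<in>A. \<Sum>i\<in>\<Omega>. if active s i j then ?l i j else 0)) =
      (\<Sum>s\<in>?S. \<Sum>i\<in>\<Omega>. \<Sum>j\<in>A. state_law s * (if active s i j then ?l i j else 0))"
      unfolding sum_distrib_left by (intro sum.cong refl sum.swap)
    also have "\<dots> = (\<Sum>i\<in>\<Omega>. \<Sum>s\<in>?S. \<Sum>j\<in>A. state_law s * (if active s i j then ?l i j else 0))"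
      by (rule sum.swap)
    also have "\<dots> = (\<Sum>i\<in>\<Omega>. \<Sum>j\<in>A. \<Sum>s\<in>?S. state_law s * (if active s i j then ?l i j else 0))"
      by (intro sum.cong refl sum.swap)
    finally show ?thesis .
  qed
  also have "\<dots> = ln 2 * cut_val m N (link_cap h P) state_law \<Omega>"
    unfolding cut_val_def sum_distrib_left A_def[symmetric]
  proof (intro sum.cong refl)
    fix i j
    have "(\<Sum>s\<in>?S. state_law s * (if active s i j then ?l i j else 0)) = (\<Sum>s\<in>{s\<in>?S. active s i j}. state_law s * ?l i j)"
      by (subst sum.inter_filter[OF finite_states]) (intro sum.cong refl, simp)
    then show "(\<Sum>s\<in>?S. state_law s * (if active s i j then ?l i j else 0)) =
       ln 2 * ((\<Sum>s\<in>{s\<in>?S. active s i j}. state_law s) * link_cap h P j i)"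
      by (simp add: link_cap_def log_def sum_distrib_right)
  qed
  finally show ?thesis by simp
qed

lemma cut_bound:
  assumes "n > 0"
  shows "(1 - err_prob c N h) * log 2 M \<le>
    log 2 (exp 1) + n * (log 2 (card (states m N)) + (N + 1) * log 2 (exp 1) + cut_val m N (link_cap h P) state_law \<Omega>)"
proof -
  have M: "real M > 0" using M_pos by simp
  have "(\<Sum>w<M. 1 - measure (noise N n) (err_event c N h w)) = M * (1 - err_prob c N h)"
    using M by (simp add: sum_subtractf err_prob_def algebra_simps)
  with cut_bound_sum have "M * (ln M * (1 - err_prob c N h)) \<le>
     M * (1 + n * ln (card (states m N)) + n * (ln 2 * cut_val m N (link_cap h P) state_law \<Omega>) + n * (N + 1))"
    unfolding ln_v_cut[OF assms] by (simp add: algebra_simps)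
  then have "ln M * (1 - err_prob c N h) \<le>
     1 + n * ln (card (states m N)) + n * (ln 2 * cut_val m N (link_cap h P) state_law \<Omega>) + n * (N + 1)"
    using M by (simp only: mult_le_cancel_left_pos)
  then have "ln M * (1 - err_prob c N h) / ln 2 \<le>
     (1 + n * ln (card (states m N)) + n * (ln 2 * cut_val m N (link_cap h P) state_law \<Omega>) + n * (N + 1)) / ln 2"
    by (rule divide_right_mono) simp
  also have "\<dots> = 1 / ln 2 + n * (ln (card (states m N)) / ln 2 + (N + 1) * (1 / ln 2) + cut_val m N (link_cap h P) state_law \<Omega>)"
    by (simp add: field_simps)
  finally show ?thesis by (simp add: log_def mult.commute)
qed

end

section \<open>From single cuts to the upper bound on the capacity\<close>

lemma cut_vals_finite: "finite (cuts N)" "cuts N \<noteq> {}"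
proof -
  show "finite (cuts N)" by (rule finite_subset[of _ "Pow {0..N}"]) (auto simp: cuts_def)
  show "cuts N \<noteq> {}" by (auto simp: cuts_def intro: exI[of _ "{0}"])
qed

lemma Min_cut_le_C:
  assumes lam: "lam \<in> prob_vecs (states m N)" and l: "\<And>i j. l j i \<ge> 0"
  shows "Min (cut_val m N l lam ` cuts N) \<le> C_cs_iid m N l"
  unfolding C_cs_iid_def
proof (rule cSUP_upper[OF lam], rule bdd_aboveI2)
  fix lam' assume lam': "lam' \<in> prob_vecs (states m N)"
  \<comment> \<open>The cut around the source gives a bound uniform in the law, which the
    real-valued supremum requires.\<close>
  have "{0} \<in> cuts N" by (auto simp: cuts_def)
  then have "Min (cut_val m N l lam' ` cuts N) \<le> cut_val m N l lam' {0}"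
    using cut_vals_finite by (intro Min_le) auto
  also have "\<dots> \<le> (\<Sum>i\<in>{0::nat}. \<Sum>j\<in>{0..N+1} - {0}. 1 * l j i)"
    unfolding cut_val_def
  proof (intro sum_mono mult_right_mono l)
    fix i j :: nat
    have "sum lam' {s \<in> states m N. active s i j} \<le> sum lam' (states m N)"
      using lam' finite_states by (intro sum_mono2) (auto simp: prob_vecs_def)
    then show "sum lam' {s \<in> states m N. active s i j} \<le> 1" using lam' by (simp add: prob_vecs_def)
  qed
  finally show "Min (cut_val m N l lam' ` cuts N) \<le> (\<Sum>i\<in>{0::nat}. \<Sum>j\<in>{0..N+1} - {0}. 1 * l j i)" .
qed

lemma link_cap_nonneg: "P > 0 \<Longrightarrow> link_cap h P j i \<ge> 0"
  unfolding link_cap_def by (subst zero_le_log_cancel_iff) (auto intro: add_pos_nonneg)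

text \<open>One \<open>state_law\<close> serves all cuts, so the bounds per cut combine into a bound
  by their minimum, and this is at most \<open>C_cs_iid\<close>. The error probability is then sent
  to 0.\<close>

theorem converse:
  assumes P: "P > 0" and R: "R \<ge> 0" and ach: "achievable m N h P R"
  shows "R \<le> C_cs_iid m N (link_cap h P) + GAP m N"
proof -
  let ?C = "C_cs_iid m N (link_cap h P) + GAP m N"
  obtain \<Lambda> :: "(complex \<Rightarrow> ennreal) \<Rightarrow> ennreal" where "invariant_integral \<Lambda>"
    using invariant_integral_exists by blast
  then interpret complex_invariant_integral \<Lambda> by (simp add: complex_invariant_integral_def)
  have key: "(1 - \<epsilon>) * R \<le> \<epsilon> + ?C" if e: "0 < \<epsilon>" "\<epsilon> < 1" for \<epsilon>
  proof -
    obtain n0 where n0: "\<And>n. n \<ge> n0 \<Longrightarrow> \<exists>c. valid_code m N h P c \<and> blen c = n \<and>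
        real (nmsg c) \<ge> 2 powr (real n * R) \<and> err_prob c N h \<le> \<epsilon>"
      using ach e unfolding achievable_def by blast
    \<comment> \<open>Long enough for the additive constant of \<open>cut_bound\<close> to cost at
      most \<open>\<epsilon>\<close> per channel use.\<close>
    define n where "n = max n0 (nat \<lceil>log 2 (exp 1) / \<epsilon>\<rceil> + 1)"
    have n: "n \<ge> n0" "n > 0" "log 2 (exp 1) / \<epsilon> \<le> real n" by (auto simp: n_def, linarith)
    obtain c where c: "valid_code m N h P c" "blen c = n" "real (nmsg c) \<ge> 2 powr (real n * R)" "err_prob c N h \<le> \<epsilon>"
      using n0[OF n(1)] by blast
    interpret network_law m N h P c \<Lambda>
      by unfold_locales (use P c in auto)
    have "(1 - \<epsilon>) * (real n * R) \<le> (1 - err_prob c N h) * log 2 (nmsg c)"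
    proof (rule mult_mono)
      have "real n * R = log 2 (2 powr (real n * R))" by simp
      also have "\<dots> \<le> log 2 (nmsg c)" using c(3) M_pos by (subst log_le_cancel_iff) auto
      finally show "real n * R \<le> log 2 (nmsg c)" .
    qed (use c e R in auto)
    moreover have "(1 - err_prob c N h) * log 2 (nmsg c) \<le> log 2 (exp 1) + n * (GAP m N + cut_val m N (link_cap h P) state_law \<Omega>)"
      if "\<Omega> \<in> cuts N" for \<Omega>
    proof -
      interpret network_cut m N h P c \<Lambda> \<Omega> by unfold_locales (rule that)
      have "log 2 (exp 1) + n * (log 2 (card (states m N)) + (N + 1) * log 2 (exp 1) + cut_val m N (link_cap h P) state_law \<Omega>) \<le>
         log 2 (exp 1) + n * (GAP m N + cut_val m N (link_cap h P) state_law \<Omega>)"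
        using log_card_states_le[of m N]
        by (intro add_left_mono mult_left_mono add_right_mono) (auto simp: add.commute)
      then show ?thesis using cut_bound n(2) c(2) by (auto intro: order_trans)
    qed
    ultimately have 1: "(1 - \<epsilon>) * (real n * R) \<le> log 2 (exp 1) + n * (GAP m N + cut_val m N (link_cap h P) state_law \<Omega>)"
      if "\<Omega> \<in> cuts N" for \<Omega> using that by (meson order_trans)
    have "Min (cut_val m N (link_cap h P) state_law ` cuts N) \<in> cut_val m N (link_cap h P) state_law ` cuts N"
      using cut_vals_finite by (intro Min_in) auto
    then have "(1 - \<epsilon>) * (real n * R) \<le> log 2 (exp 1) + n * (GAP m N + Min (cut_val m N (link_cap h P) state_law ` cuts N))"
      using 1 by auto
    also have "\<dots> \<le> real n * \<epsilon> + n * (GAP m N + C_cs_iid m N (link_cap h P))"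
    proof (intro add_mono mult_left_mono add_left_mono Min_cut_le_C)
      show "log 2 (exp 1) \<le> real n * \<epsilon>" using n(3) e by (simp add: field_simps)
      show "state_law \<in> prob_vecs (states m N)" using state_law_prob n(2) c(2) by simp
    qed (use P in \<open>auto simp: link_cap_nonneg\<close>)
    finally have "real n * ((1 - \<epsilon>) * R) \<le> real n * (\<epsilon> + ?C)" by (simp add: algebra_simps)
    then show ?thesis using n(2) by (simp only: mult_le_cancel_left_pos of_nat_0_less_iff)
  qed
  have "((\<lambda>\<epsilon>. (1 - \<epsilon>) * R) \<longlongrightarrow> (1 - 0) * R) (at_right 0)" by (intro tendsto_intros)
  moreover have "((\<lambda>\<epsilon>. \<epsilon> + ?C) \<longlongrightarrow> 0 + ?C) (at_right 0)" by (intro tendsto_intros)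
  moreover have "eventually (\<lambda>\<epsilon>. (1 - \<epsilon>) * R \<le> \<epsilon> + ?C) (at_right 0)"
    using key eventually_at_right_real[of 0 1] by (auto elim: eventually_mono)
  ultimately have "(1 - 0) * R \<le> 0 + ?C" by (intro tendsto_le[of "at_right (0::real)"]) auto
  then show ?thesis by simp
qed

section \<open>Coding for the scalar Gaussian channel\<close>

text \<open>The logarithm of the ratio between the density of \<open>y\<close> given
  \<open>x\<close>, Gaussian around \<open>h * x\<close> with variance 1, and the output density of
  variance \<open>1 + a\<close> that arises from Gaussian inputs.\<close>

definition info_density :: "complex \<Rightarrow> real \<Rightarrow> complex \<Rightarrow> complex \<Rightarrow> real" where
  "info_density h a x y = ln (1 + a) - (cmod (y - h * x))\<^sup>2 + (cmod y)\<^sup>2 / (1 + a)"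

lemma info_density_measurable[measurable]:
  assumes [measurable]: "f \<in> borel_measurable M" "g \<in> borel_measurable M"
  shows "(\<lambda>z. info_density h a (f z) (g z)) \<in> borel_measurable M"
  unfolding info_density_def by measurable

lemma indicator_cball_measurable[measurable]:
  "(\<lambda>x. indicator (cball c B) x :: ennreal) \<in> borel_measurable borel"
  "(\<lambda>x. indicator (- cball c B) x :: ennreal) \<in> borel_measurable borel"
  for c :: "'a::euclidean_space"
  by (intro borel_measurable_indicator; simp)+

definition trunc_mass :: "real \<Rightarrow> real \<Rightarrow> real" where
  "trunc_mass p B = enn2real (\<integral>\<^sup>+x. ennreal (cgauss p x) * indicator (cball 0 B) x \<partial>lborel)"

lemma trunc_mass_le_one:
  assumes "p > 0"
  shows "ennreal (trunc_mass p B) = (\<integral>\<^sup>+x. ennreal (cgauss p x) * indicator (cball 0 B) x \<partial>lborel)"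
    "trunc_mass p B \<le> 1"
proof -
  have le: "(\<integral>\<^sup>+x. ennreal (cgauss p x) * indicator (cball 0 B) x \<partial>lborel) \<le> 1"
  proof -
    have "(\<integral>\<^sup>+x. ennreal (cgauss p x) * indicator (cball 0 B) x \<partial>lborel) \<le> (\<integral>\<^sup>+x. ennreal (cgauss p x) \<partial>lborel)"
      by (intro nn_integral_mono) (simp add: indicator_def)
    then show ?thesis using nn_integral_cgauss[OF assms, of 0] by simp
  qed
  then have "(\<integral>\<^sup>+x. ennreal (cgauss p x) * indicator (cball 0 B) x \<partial>lborel) < top"
    by (rule le_less_trans) simp
  then show eq: "ennreal (trunc_mass p B) = (\<integral>\<^sup>+x. ennreal (cgauss p x) * indicator (cball 0 B) x \<partial>lborel)"
    unfolding trunc_mass_def by simp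
  show "trunc_mass p B \<le> 1" using le unfolding eq[symmetric] by (simp add: ennreal_le_1)
qed

lemma trunc_mass_limit:
  assumes p: "p > 0" and c: "c < 1"
  obtains B where "B > 0" "trunc_mass p B > c"
proof -
  have "(SUP n. \<integral>\<^sup>+x. ennreal (cgauss p x) * indicator (cball 0 (real n)) x \<partial>lborel) =
      (\<integral>\<^sup>+x. (SUP n. ennreal (cgauss p x) * indicator (cball 0 (real n)) x) \<partial>lborel)"
  proof (rule nn_integral_monotone_convergence_SUP[symmetric])
    show "incseq (\<lambda>n x. ennreal (cgauss p x) * indicator (cball 0 (real n)) x)"
      by (intro incseq_SucI le_funI mult_left_mono) (auto simp: indicator_def)
  qed measurable
  also have "\<dots> = (\<integral>\<^sup>+x. ennreal (cgauss p x) \<partial>lborel)"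
  proof (intro nn_integral_cong antisym SUP_least)
    fix x :: complex and n :: nat
    show "ennreal (cgauss p x) * indicator (cball 0 (real n)) x \<le> ennreal (cgauss p x)"
      by (auto simp: indicator_def)
    obtain k :: nat where "cmod x \<le> real k" using real_arch_simple by blast
    then show "ennreal (cgauss p x) \<le> (SUP n. ennreal (cgauss p x) * indicator (cball 0 (real n)) x)"
      by (intro SUP_upper2[of k]) auto
  qed
  also have "\<dots> = 1" using nn_integral_cgauss[OF p, of 0] by simp
  finally have "ennreal (max c 0) < (SUP n. \<integral>\<^sup>+x. ennreal (cgauss p x) * indicator (cball 0 (real n)) x \<partial>lborel)"
    using c by (simp add: ennreal_less_one_iff)
  then obtain k :: nat where k: "ennreal (max c 0) < (\<integral>\<^sup>+x. ennreal (cgauss p x) * indicator (cball 0 (real k)) x \<partial>lborel)"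
    by (auto simp: less_SUP_iff)
  \<comment> \<open>A disc of radius 0 is a null set, so the radius found is positive.\<close>
  have "k \<noteq> 0"
  proof
    assume "k = 0"
    then have "(\<integral>\<^sup>+x. ennreal (cgauss p x) * indicator (cball 0 (real k)) x \<partial>lborel) = (\<integral>\<^sup>+x. ennreal (cgauss p x) * indicator {0} x \<partial>lborel)"
      by simp
    also have "\<dots> = 0"
      by (subst nn_integral_indicator_singleton) auto
    finally show False using k by simp
  qed
  moreover have "max c 0 < trunc_mass p (real k)"
    using k unfolding trunc_mass_le_one(1)[OF p, symmetric] by (subst (asm) ennreal_less_iff) auto
  ultimately show thesis using that[of "real k"] by auto
qed

text \<open>The Gaussian law of variance \<open>p\<close> conditioned on the disc of radius
  \<open>B\<close>.\<close>

definition input_law :: "real \<Rightarrow> real \<Rightarrow> complex measure" where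
  "input_law p B = density lborel (\<lambda>x. ennreal (cgauss p x / trunc_mass p B) * indicator (cball 0 B) x)"

lemma space_input_law[simp]: "space (input_law p B) = UNIV"
  and sets_input_law[simp, measurable_cong]: "sets (input_law p B) = sets borel"
  by (simp_all add: input_law_def)

lemma nn_integral_input_law:
  assumes "f \<in> borel_measurable borel"
  shows "(\<integral>\<^sup>+x. f x \<partial>input_law p B) = (\<integral>\<^sup>+x. ennreal (cgauss p x / trunc_mass p B) * indicator (cball 0 B) x * f x \<partial>lborel)"
  unfolding input_law_def using assms by (subst nn_integral_density) (auto simp: mult.assoc)

text \<open>Conditioning raises the density by a factor of at most
  \<open>1 / trunc_mass p B\<close>. Exponential moments of the full Gaussian therefore carry over
  at this price per symbol, which is close to 1 for large \<open>B\<close>.\<close>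

lemma nn_integral_input_law_le:
  assumes p: "p > 0" and t: "trunc_mass p B > 0" and f: "f \<in> borel_measurable borel"
  shows "(\<integral>\<^sup>+x. f x \<partial>input_law p B) \<le> ennreal (1 / trunc_mass p B) * (\<integral>\<^sup>+x. ennreal (cgauss p x) * f x \<partial>lborel)"
proof -
  have "(\<integral>\<^sup>+x. f x \<partial>input_law p B) \<le> (\<integral>\<^sup>+x. ennreal (1 / trunc_mass p B) * (ennreal (cgauss p x) * f x) \<partial>lborel)"
    unfolding nn_integral_input_law[OF f]
  proof (rule nn_integral_mono)
    fix x
    have "ennreal (cgauss p x / trunc_mass p B) = ennreal (1 / trunc_mass p B) * ennreal (cgauss p x)"
      using t p by (simp add: cgauss_pos less_imp_le flip: ennreal_mult)
    then show "ennreal (cgauss p x / trunc_mass p B) * indicator (cball 0 B) x * f x \<le> ennreal (1 / trunc_mass p B) * (ennreal (cgauss p x) * f x)"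
      by (auto simp: indicator_def mult.assoc)
  qed
  also have "\<dots> = ennreal (1 / trunc_mass p B) * (\<integral>\<^sup>+x. ennreal (cgauss p x) * f x \<partial>lborel)"
    using f by (subst nn_integral_cmult) auto
  finally show ?thesis .
qed

lemma prob_space_input_law:
  assumes p: "p > 0" and t: "trunc_mass p B > 0"
  shows "prob_space (input_law p B)"
proof (rule prob_spaceI)
  have "emeasure (input_law p B) (space (input_law p B)) = (\<integral>\<^sup>+x. 1 \<partial>input_law p B)" by simp
  also have "\<dots> = (\<integral>\<^sup>+x. ennreal (1 / trunc_mass p B) * (ennreal (cgauss p x) * indicator (cball 0 B) x) \<partial>lborel)"
    using t p unfolding nn_integral_input_law[OF borel_measurable_const]
    by (intro nn_integral_cong) (simp add: cgauss_pos less_imp_le mult.assoc[symmetric] flip: ennreal_mult)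
  also have "\<dots> = ennreal (1 / trunc_mass p B) * ennreal (trunc_mass p B)"
    by (subst nn_integral_cmult) (auto simp: trunc_mass_le_one(1)[OF p])
  also have "\<dots> = 1" using t by (simp flip: ennreal_mult)
  finally show "emeasure (input_law p B) (space (input_law p B)) = 1" .
qed

lemma input_law_outside: "(\<integral>\<^sup>+x. indicator (- cball 0 B) x \<partial>input_law p B) = 0"
proof -
  have "(\<lambda>x. ennreal (cgauss p x / trunc_mass p B) * indicator (cball 0 B) x * indicator (- cball 0 B) x) = (\<lambda>_. 0)"
    by (intro ext) (simp add: indicator_def)
  then show ?thesis using nn_integral_input_law[OF indicator_cball_measurable(2), of p B 0 B] by simp
qed

text \<open>The tilted integral behind the Chernoff bound for a correct codeword; it equals
  \<open>exp (- s ln (1 + a)) / (1 - s\<^sup>2 a / (1 + a))\<close> for the untruncated Gaussian input.\<close>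
lemma gaussian_tilted_info:
  fixes h :: complex
  assumes p: "p > 0" and s: "0 \<le> s" "s < 1"
  defines "a \<equiv> p * (cmod h)\<^sup>2"
  shows "(\<integral>\<^sup>+x. ennreal (cgauss p x) * (\<integral>\<^sup>+z. ennreal (exp (- s * info_density h a x (h * x + z))) \<partial>CN01) \<partial>lborel) \<le>
    ennreal (exp (- s * ln (1 + a)) / (1 - s\<^sup>2))"
proof -
  have a: "a \<ge> 0" using p by (simp add: a_def)
  define d where "d = 1 / p + (1 - s) * (cmod h)\<^sup>2"
  have pd: "p * d = 1 + (1 - s) * a" using p by (simp add: d_def a_def field_simps)
  have d: "d > 0" using p s by (auto simp: d_def intro!: add_pos_nonneg)
  define e where "e = exp (- s * ln (1 + a)) / (pi * pi * p)"
  have e: "e \<ge> 0" using p by (simp add: e_def)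
  have pt: "cgauss p x * (cgauss 1 (y - h * x) * exp (- s * info_density h a x y)) =
     e * exp (- (s / (1 + a)) * (cmod y)\<^sup>2) * exp (- (1 / p * (cmod x)\<^sup>2) - (1 - s) * (cmod (y - h * x))\<^sup>2)" for x y
  proof -
    define A where "A = (cmod (y - h * x))\<^sup>2"
    define Y where "Y = (cmod y)\<^sup>2 / (1 + a)"
    have "- (s / (1 + a)) * (cmod y)\<^sup>2 = - s * Y" by (simp add: Y_def)
    moreover have "exp (- s * info_density h a x y) = exp (- s * ln (1 + a)) * exp (s * A) * exp (- s * Y)"
      unfolding info_density_def A_def[symmetric] Y_def[symmetric] exp_add[symmetric] by (simp add: algebra_simps)
    moreover have "exp (- (1 / p * (cmod x)\<^sup>2) - (1 - s) * A) = exp (- (cmod x)\<^sup>2 / p) * exp (- A) * exp (s * A)"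
      unfolding exp_add[symmetric] by (simp add: algebra_simps)
    ultimately show ?thesis unfolding A_def[symmetric] by (simp add: cgauss_def e_def A_def mult_ac)
  qed
  have "(\<integral>\<^sup>+x. ennreal (cgauss p x) * (\<integral>\<^sup>+z. ennreal (exp (- s * info_density h a x (h * x + z))) \<partial>CN01) \<partial>lborel) =
     (\<integral>\<^sup>+x. (\<integral>\<^sup>+y. ennreal (e * exp (- (s / (1 + a)) * (cmod y)\<^sup>2) * exp (- (1 / p * (cmod x)\<^sup>2) - (1 - s) * (cmod (y - h * x))\<^sup>2)) \<partial>lborel) \<partial>lborel)"
  proof (intro nn_integral_cong)
    fix x
    have "(\<integral>\<^sup>+z. ennreal (exp (- s * info_density h a x (h * x + z))) \<partial>CN01) =
       (\<integral>\<^sup>+z. ennreal (cgauss 1 (z + h * x - h * x) * exp (- s * info_density h a x (z + h * x))) \<partial>lborel)"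
      by (subst nn_integral_CN01) (auto simp: ennreal_mult' cgauss_pos less_imp_le add.commute)
    also have "\<dots> = (\<integral>\<^sup>+y. ennreal (cgauss 1 (y - h * x) * exp (- s * info_density h a x y)) \<partial>lborel)"
      by (rule nn_integral_lborel_translation) measurable
    finally have F: "(\<integral>\<^sup>+z. ennreal (exp (- s * info_density h a x (h * x + z))) \<partial>CN01) =
       (\<integral>\<^sup>+y. ennreal (cgauss 1 (y - h * x) * exp (- s * info_density h a x y)) \<partial>lborel)" .
    have "cgauss p x \<ge> 0" using p by (simp add: cgauss_pos less_imp_le)
    then show "ennreal (cgauss p x) * (\<integral>\<^sup>+z. ennreal (exp (- s * info_density h a x (h * x + z))) \<partial>CN01) =
       (\<integral>\<^sup>+y. ennreal (e * exp (- (s / (1 + a)) * (cmod y)\<^sup>2) * exp (- (1 / p * (cmod x)\<^sup>2) - (1 - s) * (cmod (y - h * x))\<^sup>2)) \<partial>lborel)"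
      unfolding F pt[symmetric] by (subst nn_integral_cmult[symmetric]) (measurable, simp only: ennreal_mult')
  qed
  \<comment> \<open>For fixed \<open>y\<close> the exponent is quadratic in \<open>x\<close> and
    falls to \<open>nn_integral_gaussian_convolution\<close>; what remains is a centred Gaussian in
    \<open>y\<close>.\<close>
  also have "\<dots> = (\<integral>\<^sup>+y. (\<integral>\<^sup>+x. ennreal (e * exp (- (s / (1 + a)) * (cmod y)\<^sup>2) * exp (- (1 / p * (cmod x)\<^sup>2) - (1 - s) * (cmod (y - h * x))\<^sup>2)) \<partial>lborel) \<partial>lborel)"
    by (rule lborel_pair.Fubini') measurable
  also have "\<dots> = (\<integral>\<^sup>+y. ennreal (e * (pi / d) * exp (- (s / (1 + a) + (1 - s) / (p * d)) * (cmod (y - 0))\<^sup>2)) \<partial>lborel)"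
  proof (intro nn_integral_cong)
    fix y
    have "(\<integral>\<^sup>+x. ennreal (e * exp (- (s / (1 + a)) * (cmod y)\<^sup>2) * exp (- (1 / p * (cmod x)\<^sup>2) - (1 - s) * (cmod (y - h * x))\<^sup>2)) \<partial>lborel)
       = ennreal (e * exp (- (s / (1 + a)) * (cmod y)\<^sup>2)) * ennreal (pi / d * exp (- (1 / p * (1 - s) / d) * (cmod y)\<^sup>2))"
      using e p s unfolding d_def
      by (subst nn_integral_gaussian_convolution[symmetric])
         (auto simp: ennreal_mult nn_integral_cmult)
    also have "\<dots> = ennreal (e * exp (- (s / (1 + a)) * (cmod y)\<^sup>2) * (pi / d * exp (- (1 / p * (1 - s) / d) * (cmod y)\<^sup>2)))"
      using e d by (intro ennreal_mult[symmetric]) auto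
    also have "e * exp (- (s / (1 + a)) * (cmod y)\<^sup>2) * (pi / d * exp (- (1 / p * (1 - s) / d) * (cmod y)\<^sup>2)) =
       e * (pi / d) * exp (- (s / (1 + a) + (1 - s) / (p * d)) * (cmod (y - 0))\<^sup>2)"
    proof -
      have "- (s / (1 + a) + (1 - s) / (p * d)) * (cmod (y - 0))\<^sup>2 = - (s / (1 + a)) * (cmod y)\<^sup>2 + - (1 / p * (1 - s) / d) * (cmod y)\<^sup>2"
        by (simp add: algebra_simps)
      then show ?thesis by (simp only: exp_add) simp
    qed
    finally show "(\<integral>\<^sup>+x. ennreal (e * exp (- (s / (1 + a)) * (cmod y)\<^sup>2) * exp (- (1 / p * (cmod x)\<^sup>2) - (1 - s) * (cmod (y - h * x))\<^sup>2)) \<partial>lborel)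
       = ennreal (e * (pi / d) * exp (- (s / (1 + a) + (1 - s) / (p * d)) * (cmod (y - 0))\<^sup>2))" .
  qed
  also have "\<dots> = ennreal (e * (pi / d)) * ennreal (pi / (s / (1 + a) + (1 - s) / (p * d)))"
  proof -
    define g where "g = s / (1 + a) + (1 - s) / (p * d)"
    define k where "k = e * (pi / d)"
    have g: "g > 0" unfolding g_def using s p d a by (intro add_nonneg_pos) auto
    have k: "k \<ge> 0" unfolding k_def using e d by simp
    have "(\<integral>\<^sup>+y. ennreal (k * exp (- g * (cmod (y - 0))\<^sup>2)) \<partial>lborel) =
        (\<integral>\<^sup>+y. ennreal k * ennreal (exp (- g * (cmod (y - 0))\<^sup>2)) \<partial>lborel)"
      using k by (intro nn_integral_cong ennreal_mult) auto
    also have "\<dots> = ennreal k * ennreal (pi / g)"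
      unfolding nn_integral_exp_square[OF g, of 0, symmetric] by (rule nn_integral_cmult) measurable
    finally show ?thesis unfolding g_def k_def .
  qed
  also have "\<dots> = ennreal (e * (pi / d) * (pi / (s / (1 + a) + (1 - s) / (p * d))))"
    using e d s p a by (intro ennreal_mult[symmetric]) auto
  also have "\<dots> \<le> ennreal (exp (- s * ln (1 + a)) / (1 - s\<^sup>2))"
  proof (rule ennreal_leI)
    have s2: "s\<^sup>2 < 1" using s by (simp add: power_less_one_iff)
    have "e * (pi / d) * (pi / (s / (1 + a) + (1 - s) / (p * d))) = exp (- s * ln (1 + a)) / ((p * d) * (s / (1 + a) + (1 - s) / (p * d)))"
      using p d by (simp add: e_def)
    also have "(p * d) * (s / (1 + a) + (1 - s) / (p * d)) = 1 - s\<^sup>2 * (a / (1 + a))"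
    proof -
      have "(p * d) * (s / (1 + a) + (1 - s) / (p * d)) = (p * d) * s / (1 + a) + (1 - s)"
        using p d by (simp add: distrib_left)
      also have "\<dots> = 1 - s\<^sup>2 * (a / (1 + a))"
        unfolding pd using a by (simp add: field_simps power2_eq_square)
      finally show ?thesis .
    qed
    also have "exp (- s * ln (1 + a)) / (1 - s\<^sup>2 * (a / (1 + a))) \<le> exp (- s * ln (1 + a)) / (1 - s\<^sup>2)"
    proof (rule divide_left_mono)
      have "s\<^sup>2 * (a / (1 + a)) \<le> s\<^sup>2 * 1" using a by (intro mult_left_mono) auto
      then show "1 - s\<^sup>2 \<le> 1 - s\<^sup>2 * (a / (1 + a))" by simp
      then show "0 < (1 - s\<^sup>2 * (a / (1 + a))) * (1 - s\<^sup>2)" using s2 by (intro mult_pos_pos) linarith+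
    qed simp
    finally show "e * (pi / d) * (pi / (s / (1 + a) + (1 - s) / (p * d))) \<le> exp (- s * ln (1 + a)) / (1 - s\<^sup>2)" .
  qed
  finally show ?thesis .
qed

text \<open>\<open>exp (info_density h a x y)\<close> is the conditional output density divided by
  the marginal one, and averaging the conditional density over \<open>x\<close> gives the
  marginal.\<close>

lemma gaussian_wrong_codeword:
  fixes h :: complex
  assumes p: "p > 0"
  defines "a \<equiv> p * (cmod h)\<^sup>2"
  shows "(\<integral>\<^sup>+x. ennreal (cgauss p x) * ennreal (exp (info_density h a x y)) \<partial>lborel) = 1"
proof -
  have a: "a \<ge> 0" using p by (simp add: a_def)
  define d where "d = 1 / p + 1 * (cmod h)\<^sup>2"
  have pd: "p * d = 1 + a" using p by (simp add: d_def a_def field_simps)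
  have d: "d > 0" using p by (auto simp: d_def intro!: add_pos_nonneg)
  have "cgauss p x * exp (info_density h a x y) = (1 + a) / (pi * p) * exp ((cmod y)\<^sup>2 / (1 + a)) *
      exp (- (1 / p * (cmod x)\<^sup>2) - 1 * (cmod (y - h * x))\<^sup>2)" for x
  proof -
    define A where "A = (cmod (y - h * x))\<^sup>2"
    define Y where "Y = (cmod y)\<^sup>2 / (1 + a)"
    have "exp (info_density h a x y) = (1 + a) * exp Y * exp (- A)"
      unfolding info_density_def A_def[symmetric] Y_def[symmetric] using a
      by (simp add: exp_add exp_diff exp_minus field_simps)
    moreover have "exp (- (1 / p * (cmod x)\<^sup>2) - 1 * A) = exp (- (cmod x)\<^sup>2 / p) * exp (- A)"
      unfolding exp_add[symmetric] by simp
    ultimately show ?thesis unfolding A_def[symmetric] Y_def[symmetric] by (simp add: cgauss_def)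
  qed
  then have "(\<integral>\<^sup>+x. ennreal (cgauss p x) * ennreal (exp (info_density h a x y)) \<partial>lborel) =
     (\<integral>\<^sup>+x. ennreal ((1 + a) / (pi * p) * exp ((cmod y)\<^sup>2 / (1 + a))) * ennreal (exp (- (1 / p * (cmod x)\<^sup>2) - 1 * (cmod (y - h * x))\<^sup>2)) \<partial>lborel)"
    using p a by (simp add: cgauss_pos less_imp_le flip: ennreal_mult)
  also have "\<dots> = ennreal ((1 + a) / (pi * p) * exp ((cmod y)\<^sup>2 / (1 + a))) * ennreal (pi / d * exp (- (1 / p * 1 / d) * (cmod y)\<^sup>2))"
    using p nn_integral_gaussian_convolution[of "1 / p" 1 y h] unfolding d_def
    by (subst nn_integral_cmult) auto
  also have "\<dots> = ennreal ((1 + a) / (pi * p) * exp ((cmod y)\<^sup>2 / (1 + a)) * (pi / d * exp (- (1 / p * 1 / d) * (cmod y)\<^sup>2)))"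
    using p a d by (intro ennreal_mult[symmetric]) auto
  also have "(1 + a) / (pi * p) * exp ((cmod y)\<^sup>2 / (1 + a)) * (pi / d * exp (- (1 / p * 1 / d) * (cmod y)\<^sup>2)) = 1"
  proof -
    have "1 / p * 1 / d = 1 / (1 + a)" using pd p by (simp flip: pd)
    then have "exp ((cmod y)\<^sup>2 / (1 + a)) * exp (- (1 / p * 1 / d) * (cmod y)\<^sup>2) = 1"
      by (simp add: exp_add[symmetric])
    moreover have "(1 + a) / (pi * p) * (pi / d) = 1" unfolding pd[symmetric] using p d by simp
    moreover have "c1 * E1 * (c2 * E2) = (c1 * c2) * (E1 * E2)" for c1 c2 E1 E2 :: real by simp
    ultimately show ?thesis by (simp only: mult_1)
  qed
  finally show ?thesis by simp
qed

text \<open>Feeds the Chernoff bound for the empirical power of a codebook.\<close>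

lemma gaussian_mgf:
  assumes p: "p > 0" and eta: "\<eta> * p < 1"
  shows "(\<integral>\<^sup>+x. ennreal (cgauss p x) * ennreal (exp (\<eta> * (cmod x)\<^sup>2)) \<partial>lborel) = ennreal (1 / (1 - \<eta> * p))"
proof -
  have c: "1 / p - \<eta> > 0" using p eta by (simp add: field_simps)
  have "cgauss p x * exp (\<eta> * (cmod x)\<^sup>2) = 1 / (pi * p) * exp (- (1 / p - \<eta>) * (cmod (x - 0))\<^sup>2)" for x
    by (simp add: cgauss_def exp_add[symmetric] algebra_simps)
  then have "(\<integral>\<^sup>+x. ennreal (cgauss p x) * ennreal (exp (\<eta> * (cmod x)\<^sup>2)) \<partial>lborel) =
     (\<integral>\<^sup>+x. ennreal (1 / (pi * p)) * ennreal (exp (- (1 / p - \<eta>) * (cmod (x - 0))\<^sup>2)) \<partial>lborel)"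
    using p by (simp add: cgauss_pos less_imp_le flip: ennreal_mult)
  also have "\<dots> = ennreal (1 / (pi * p)) * ennreal (pi / (1 / p - \<eta>))"
    using nn_integral_exp_square[OF c, of 0] by (subst nn_integral_cmult) auto
  also have "\<dots> = ennreal (1 / (1 - \<eta> * p))"
    using p c eta by (simp add: field_simps flip: ennreal_mult)
  finally show ?thesis .
qed

text \<open>The Chernoff factor of one channel use for the event that the sent symbol gathers too
  little information; \<open>wrong_exponent\<close> is the counterpart for a competing symbol
  \<open>x'\<close>.\<close>

definition correct_exponent :: "complex \<Rightarrow> real \<Rightarrow> real \<Rightarrow> complex \<Rightarrow> ennreal" where
  "correct_exponent h a s x = (\<integral>\<^sup>+z. ennreal (exp (- s * info_density h a x (h * x + z))) \<partial>CN01)"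

definition wrong_exponent :: "complex \<Rightarrow> real \<Rightarrow> complex \<Rightarrow> complex \<Rightarrow> ennreal" where
  "wrong_exponent h a x x' = (\<integral>\<^sup>+z. ennreal (exp (info_density h a x' (h * x + z))) \<partial>CN01)"

interpretation CN01: prob_space CN01 by (rule prob_space_CN01)

lemma correct_exponent_measurable[measurable]: "correct_exponent h a s \<in> borel_measurable borel"
proof -
  have "(\<lambda>(x, z). ennreal (exp (- s * info_density h a x (h * x + z)))) \<in> borel_measurable (borel \<Otimes>\<^sub>M CN01)"
    unfolding split_def by measurable
  from CN01.borel_measurable_nn_integral_fst[OF this] show ?thesis
    unfolding correct_exponent_def[abs_def] by simp
qed

lemma wrong_exponent_measurable[measurable]:
  assumes [measurable]: "f \<in> borel_measurable L" "g \<in> borel_measurable L"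
  shows "(\<lambda>x. wrong_exponent h a (f x) (g x)) \<in> borel_measurable L"
proof -
  have "(\<lambda>(x, z). ennreal (exp (info_density h a (g x) (h * f x + z)))) \<in> borel_measurable (L \<Otimes>\<^sub>M CN01)"
    unfolding split_def by measurable
  from CN01.borel_measurable_nn_integral_fst[OF this] show ?thesis
    unfolding wrong_exponent_def[abs_def] by simp
qed

lemma correct_exponent_bound:
  assumes p: "p > 0" and t: "trunc_mass p B > 0" and s: "0 \<le> s" "s < 1"
  shows "(\<integral>\<^sup>+x. correct_exponent h (p * (cmod h)\<^sup>2) s x \<partial>input_law p B) \<le>
    ennreal (exp (- s * ln (1 + p * (cmod h)\<^sup>2)) / (1 - s\<^sup>2) / trunc_mass p B)"
proof -
  have s2: "s\<^sup>2 < 1" using s by (simp add: power_less_one_iff)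
  have "(\<integral>\<^sup>+x. correct_exponent h (p * (cmod h)\<^sup>2) s x \<partial>input_law p B) \<le>
      ennreal (1 / trunc_mass p B) * (\<integral>\<^sup>+x. ennreal (cgauss p x) * correct_exponent h (p * (cmod h)\<^sup>2) s x \<partial>lborel)"
    by (intro nn_integral_input_law_le p t) measurable
  also have "\<dots> \<le> ennreal (1 / trunc_mass p B) * ennreal (exp (- s * ln (1 + p * (cmod h)\<^sup>2)) / (1 - s\<^sup>2))"
    unfolding correct_exponent_def by (intro mult_left_mono gaussian_tilted_info p s) simp
  also have "\<dots> = ennreal (exp (- s * ln (1 + p * (cmod h)\<^sup>2)) / (1 - s\<^sup>2) / trunc_mass p B)"
    using t s2 by (subst ennreal_mult[symmetric]) auto
  finally show ?thesis .
qed

lemma wrong_exponent_bound: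
  assumes p: "p > 0" and t: "trunc_mass p B > 0"
  shows "(\<integral>\<^sup>+x'. wrong_exponent h (p * (cmod h)\<^sup>2) x x' \<partial>input_law p B) \<le> ennreal (1 / trunc_mass p B)"
proof -
  interpret I: prob_space "input_law p B" by (rule prob_space_input_law[OF p t])
  interpret pair_sigma_finite "input_law p B" CN01 by standard
  let ?a = "p * (cmod h)\<^sup>2"
  have "(\<integral>\<^sup>+x'. wrong_exponent h ?a x x' \<partial>input_law p B) =
     (\<integral>\<^sup>+z. \<integral>\<^sup>+x'. ennreal (exp (info_density h ?a x' (h * x + z))) \<partial>input_law p B \<partial>CN01)"
    unfolding wrong_exponent_def by (rule Fubini'[symmetric]) (unfold split_def, measurable)
  also have "\<dots> \<le> (\<integral>\<^sup>+z. ennreal (1 / trunc_mass p B) \<partial>CN01)"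
  proof (rule nn_integral_mono)
    fix z
    have "(\<integral>\<^sup>+x'. ennreal (exp (info_density h ?a x' (h * x + z))) \<partial>input_law p B) \<le>
      ennreal (1 / trunc_mass p B) * (\<integral>\<^sup>+x'. ennreal (cgauss p x') * ennreal (exp (info_density h ?a x' (h * x + z))) \<partial>lborel)"
      by (intro nn_integral_input_law_le p t) measurable
    then show "(\<integral>\<^sup>+x'. ennreal (exp (info_density h ?a x' (h * x + z))) \<partial>input_law p B) \<le> ennreal (1 / trunc_mass p B)"
      by (simp add: gaussian_wrong_codeword[OF p])
  qed
  also have "\<dots> = ennreal (1 / trunc_mass p B)" using CN01.emeasure_space_1 by simp
  finally show ?thesis .
qed

lemma input_law_mgf:
  assumes p: "p > 0" and t: "trunc_mass p B > 0" and eta: "\<eta> * p < 1"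
  shows "(\<integral>\<^sup>+x. ennreal (exp (\<eta> * ((cmod x)\<^sup>2 - p'))) \<partial>input_law p B) \<le>
    ennreal (exp (- \<eta> * p') / (1 - \<eta> * p) / trunc_mass p B)"
proof -
  have "(\<integral>\<^sup>+x. ennreal (exp (\<eta> * ((cmod x)\<^sup>2 - p'))) \<partial>input_law p B) =
    (\<integral>\<^sup>+x. ennreal (exp (- \<eta> * p')) * ennreal (exp (\<eta> * (cmod x)\<^sup>2)) \<partial>input_law p B)"
    by (simp add: exp_add[symmetric] algebra_simps flip: ennreal_mult)
  also have "\<dots> = ennreal (exp (- \<eta> * p')) * (\<integral>\<^sup>+x. ennreal (exp (\<eta> * (cmod x)\<^sup>2)) \<partial>input_law p B)"
    by (rule nn_integral_cmult) measurable
  also have "\<dots> \<le> ennreal (exp (- \<eta> * p')) * (ennreal (1 / trunc_mass p B) * (\<integral>\<^sup>+x. ennreal (cgauss p x) * ennreal (exp (\<eta> * (cmod x)\<^sup>2)) \<partial>lborel))"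
    by (intro mult_left_mono nn_integral_input_law_le p t) auto
  also have "\<dots> = ennreal (exp (- \<eta> * p') / (1 - \<eta> * p) / trunc_mass p B)"
    using t eta by (simp add: gaussian_mgf[OF p eta] flip: ennreal_mult)
  finally show ?thesis .
qed

section \<open>Random codebooks with threshold decoding\<close>

definition codeword_info :: "complex \<Rightarrow> real \<Rightarrow> nat \<Rightarrow> (nat \<Rightarrow> nat \<Rightarrow> complex) \<Rightarrow> nat \<Rightarrow> (nat \<Rightarrow> complex) \<Rightarrow> real" where
  "codeword_info h a n x w y = (\<Sum>t<n. info_density h a (x w t) (y t))"

lemma exists_less_of_nn_integral_less:
  assumes "prob_space L" "(\<integral>\<^sup>+x. f x \<partial>L) < 1"
  shows "\<exists>x\<in>space L. f x < (1::ennreal)"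
proof (rule ccontr)
  assume "\<not> ?thesis"
  then have "(\<integral>\<^sup>+x. 1 \<partial>L) \<le> (\<integral>\<^sup>+x. f x \<partial>L)" by (intro nn_integral_mono) (auto simp: not_less)
  then show False using assms by (simp add: prob_space.emeasure_space_1)
qed

text \<open>A first-moment argument. Normalised error bounds, power violations and amplitude
  violations are added up to one nonnegative functional of the codebook. Its mean is below 1 by
  \<open>total\<close>, so a single codebook keeps all of them below 1 at once.\<close>

lemma random_codebook:
  fixes h :: complex and \<epsilon> :: real
  assumes p: "p > 0" and t: "trunc_mass p B > 0" and s: "0 \<le> s" "s < 1"
    and eta: "\<eta> > 0" "\<eta> * p < 1" and M: "M \<ge> 1" and \<epsilon>: "\<epsilon> > 0"
  defines "a \<equiv> p * (cmod h)\<^sup>2"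
  assumes total: "(exp (s * \<gamma>) * (exp (- s * ln (1 + a)) / (1 - s\<^sup>2) / trunc_mass p B) ^ n +
      real M * (exp (- \<gamma>) * (1 / trunc_mass p B) ^ n)) / \<epsilon> +
      real n * (exp (- \<eta> * p') / (1 - \<eta> * p) / trunc_mass p B) ^ M < 1"
  obtains x where "\<And>w t. w < M \<Longrightarrow> t < n \<Longrightarrow> cmod (x w t) \<le> B"
    and "\<And>t. t < n \<Longrightarrow> (\<Sum>w<M. (cmod (x w t))\<^sup>2) \<le> real M * p'"
    and "(\<Sum>w<M. (\<integral>\<^sup>+z. ennreal (exp (s * (\<gamma> - codeword_info h a n x w (\<lambda>t. h * x w t + z t)))) +
        (\<Sum>w'\<in>{..<M} - {w}. ennreal (exp (codeword_info h a n x w' (\<lambda>t. h * x w t + z t) - \<gamma>)))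
        \<partial>PiM {..<n} (\<lambda>_. CN01))) \<le> ennreal (\<epsilon> * M)"
proof -
  let ?\<mu> = "input_law p B"
  \<comment> \<open>A column holds the symbols of all messages at one time, and \<open>?X\<close> is
    a product of columns. Decoding terms thus factor over time, power terms over the messages within
    a column.\<close>
  let ?\<nu> = "PiM {..<M} (\<lambda>_. ?\<mu>)"
  let ?X = "PiM {..<n} (\<lambda>_. ?\<nu>)"
  let ?f = "correct_exponent h a s" and ?g = "wrong_exponent h a"
  interpret \<mu>: prob_space ?\<mu> by (rule prob_space_input_law[OF p t])
  interpret \<nu>: prob_space ?\<nu> by (intro prob_space_PiM \<mu>.prob_space_axioms)
  interpret X: prob_space ?X by (intro prob_space_PiM \<nu>.prob_space_axioms)
  interpret row: product_sigma_finite "\<lambda>_::nat. ?\<mu>" by standard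
  interpret col: product_sigma_finite "\<lambda>_::nat. ?\<nu>" by standard
  interpret noise: product_sigma_finite "\<lambda>_::nat. CN01" by standard
  define K where "K = exp (- s * ln (1 + a)) / (1 - s\<^sup>2) / trunc_mass p B"
  define G where "G = 1 / trunc_mass p B"
  define \<rho> where "\<rho> = exp (- \<eta> * p') / (1 - \<eta> * p) / trunc_mass p B"
  have s2: "s\<^sup>2 < 1" using s by (simp add: power_less_one_iff)
  have nn: "K \<ge> 0" "G \<ge> 0" "\<rho> \<ge> 0" using t s2 eta by (auto simp: K_def G_def \<rho>_def)
  have m1[measurable]: "(\<lambda>r. r w) \<in> borel_measurable ?\<nu>" if "w < M" for w
    using measurable_component_singleton[of w "{..<M}" "\<lambda>_. ?\<mu>"] that by simp
  have rows: "(\<integral>\<^sup>+r. \<phi> (r w) \<partial>?\<nu>) = (\<integral>\<^sup>+x. \<phi> x \<partial>?\<mu>)" if "w < M" "\<phi> \<in> borel_measurable borel" for w \<phi>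
  proof -
    have "(\<integral>\<^sup>+x. \<phi> x \<partial>?\<mu>) = (\<integral>\<^sup>+x. \<phi> x \<partial>distr ?\<nu> ?\<mu> (\<lambda>r. r w))"
      using that by (subst distr_PiM_component) (auto intro: \<mu>.prob_space_axioms)
    also have "\<dots> = (\<integral>\<^sup>+r. \<phi> (r w) \<partial>?\<nu>)"
      using that by (subst nn_integral_distr) (auto simp: measurable_cong_sets[OF sets_input_law refl])
    finally show ?thesis ..
  qed
  have cols: "(\<integral>\<^sup>+X. \<phi> (X t) \<partial>?X) = (\<integral>\<^sup>+r. \<phi> r \<partial>?\<nu>)" if "t < n" "\<phi> \<in> borel_measurable ?\<nu>" for t \<phi>
  proof -
    have "(\<integral>\<^sup>+r. \<phi> r \<partial>?\<nu>) = (\<integral>\<^sup>+r. \<phi> r \<partial>distr ?X ?\<nu> (\<lambda>X. X t))"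
      using that by (subst distr_PiM_component) (auto intro: \<nu>.prob_space_axioms)
    also have "\<dots> = (\<integral>\<^sup>+X. \<phi> (X t) \<partial>?X)"
      using that by (subst nn_integral_distr) auto
    finally show ?thesis ..
  qed
  have f_row: "(\<integral>\<^sup>+r. ?f (r w) \<partial>?\<nu>) \<le> ennreal K" if "w < M" for w
    using that correct_exponent_bound[OF p t s, of h] by (subst rows) (auto simp: K_def a_def)
  have g_row: "(\<integral>\<^sup>+r. ?g (r w) (r w') \<partial>?\<nu>) \<le> ennreal G" if w: "w < M" "w' < M" "w \<noteq> w'" for w w'
  proof -
    let ?I = "{..<M} - {w'}"
    have I: "insert w' ?I = {..<M}" using w by auto
    have m: "(\<lambda>r. ?g (r w) (r w')) \<in> borel_measurable (PiM (insert w' ?I) (\<lambda>_. ?\<mu>))"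
      unfolding I using w by measurable
    interpret P: prob_space "PiM ?I (\<lambda>_. ?\<mu>)" by (intro prob_space_PiM \<mu>.prob_space_axioms)
    have "(\<integral>\<^sup>+r. ?g (r w) (r w') \<partial>?\<nu>) = (\<integral>\<^sup>+r. \<integral>\<^sup>+x'. ?g ((r(w' := x')) w) ((r(w' := x')) w') \<partial>?\<mu> \<partial>PiM ?I (\<lambda>_. ?\<mu>))"
      using row.product_nn_integral_insert[of ?I w', OF _ _ m] unfolding I by simp
    also have "\<dots> \<le> (\<integral>\<^sup>+r. ennreal G \<partial>PiM ?I (\<lambda>_. ?\<mu>))"
      using w wrong_exponent_bound[OF p t, of h] by (intro nn_integral_mono) (simp add: a_def G_def)
    also have "\<dots> = ennreal G" using P.emeasure_space_1 by simp
    finally show ?thesis .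
  qed
  have e_row: "(\<integral>\<^sup>+r. (\<Prod>w<M. ennreal (exp (\<eta> * ((cmod (r w))\<^sup>2 - p')))) \<partial>?\<nu>) \<le> ennreal (\<rho> ^ M)"
  proof -
    have "(\<integral>\<^sup>+r. (\<Prod>w<M. ennreal (exp (\<eta> * ((cmod (r w))\<^sup>2 - p')))) \<partial>?\<nu>) =
        (\<Prod>w<M. \<integral>\<^sup>+x. ennreal (exp (\<eta> * ((cmod x)\<^sup>2 - p'))) \<partial>?\<mu>)"
      by (rule row.product_nn_integral_prod) (auto simp: measurable_cong_sets[OF sets_input_law refl])
    also have "\<dots> \<le> (\<Prod>w<M. ennreal \<rho>)"
      unfolding \<rho>_def by (intro prod_mono_ennreal input_law_mgf p t eta)
    finally show ?thesis using nn by (simp add: ennreal_power)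
  qed
  define F1 where "F1 X w = ennreal (exp (s * \<gamma>)) * (\<Prod>t<n. ?f (X t w))" for X :: "nat \<Rightarrow> nat \<Rightarrow> complex" and w
  define F2 where "F2 X w w' = ennreal (exp (- \<gamma>)) * (\<Prod>t<n. ?g (X t w) (X t w'))" for X :: "nat \<Rightarrow> nat \<Rightarrow> complex" and w w'
  \<comment> \<open>\<open>F3 X t < 1\<close> says that the power constraint at time
    \<open>t\<close> holds strictly. \<open>F4\<close> below is 0 or 1 and has mean 0; it excludes
    symbols off the disc, turning an almost sure amplitude bound into a sure one.\<close>
  define F3 where "F3 X t = (\<Prod>w<M. ennreal (exp (\<eta> * ((cmod (X t w))\<^sup>2 - p'))))" for X :: "nat \<Rightarrow> nat \<Rightarrow> complex" and t
  define F4 where "F4 X t w = (indicator (- cball 0 B) (X t w) :: ennreal)" for X :: "nat \<Rightarrow> nat \<Rightarrow> complex" and t w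
  define F where "F X = ennreal (1 / (\<epsilon> * M)) * (\<Sum>w<M. F1 X w + (\<Sum>w'\<in>{..<M} - {w}. F2 X w w')) +
      ((\<Sum>t<n. F3 X t) + (\<Sum>t<n. \<Sum>w<M. F4 X t w))" for X
  have mX[measurable]: "(\<lambda>X. X t w) \<in> borel_measurable ?X" if "t < n" "w < M" for t w
  proof -
    have "(\<lambda>X. X t) \<in> measurable ?X ?\<nu>" using measurable_component_singleton[of t "{..<n}" "\<lambda>_. ?\<nu>"] that by simp
    from measurable_compose[OF this m1[OF that(2)]] show ?thesis .
  qed
  have mF1: "(\<lambda>X. F1 X w) \<in> borel_measurable ?X" if "w < M" for w
    using that unfolding F1_def
    by (intro borel_measurable_times_ennreal borel_measurable_const borel_measurable_prod_ennreal measurable_compose[OF mX correct_exponent_measurable]) auto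
  have mF2: "(\<lambda>X. F2 X w w') \<in> borel_measurable ?X" if "w < M" "w' < M" for w w'
    using that unfolding F2_def
    by (intro borel_measurable_times_ennreal borel_measurable_const borel_measurable_prod_ennreal wrong_exponent_measurable mX) auto
  have mF3: "(\<lambda>X. F3 X t) \<in> borel_measurable ?X" if "t < n" for t
  proof -
    have "(\<lambda>u. ennreal (exp (\<eta> * ((cmod u)\<^sup>2 - p')))) \<in> borel_measurable borel" by measurable
    from measurable_compose[OF mX this] show ?thesis
      using that unfolding F3_def by (intro borel_measurable_prod_ennreal) auto
  qed
  have mF4: "(\<lambda>X. F4 X t w) \<in> borel_measurable ?X" if "t < n" "w < M" for w t
    using that unfolding F4_def by (intro measurable_compose[OF mX indicator_cball_measurable(2)])
  have i1: "(\<integral>\<^sup>+X. F1 X w \<partial>?X) \<le> ennreal (exp (s * \<gamma>) * K ^ n)" if w: "w < M" for w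
  proof -
    have m: "(\<lambda>r. ?f (r w)) \<in> borel_measurable ?\<nu>" using w by measurable
    have "(\<integral>\<^sup>+X. F1 X w \<partial>?X) = ennreal (exp (s * \<gamma>)) * (\<integral>\<^sup>+X. (\<Prod>t<n. ?f (X t w)) \<partial>?X)"
      unfolding F1_def using w
      by (intro nn_integral_cmult borel_measurable_prod_ennreal measurable_compose[OF mX correct_exponent_measurable]) auto
    also have "(\<integral>\<^sup>+X. (\<Prod>t<n. ?f (X t w)) \<partial>?X) = (\<Prod>t<n. \<integral>\<^sup>+r. ?f (r w) \<partial>?\<nu>)"
      by (rule col.product_nn_integral_prod[of "{..<n}" "\<lambda>_ r. ?f (r w)"]) (use m in auto)
    also have "ennreal (exp (s * \<gamma>)) * \<dots> \<le> ennreal (exp (s * \<gamma>)) * (\<Prod>t<n. ennreal K)"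
      by (intro mult_left_mono prod_mono_ennreal f_row w) simp
    finally show ?thesis using nn by (simp add: ennreal_power ennreal_mult)
  qed
  have i2: "(\<integral>\<^sup>+X. F2 X w w' \<partial>?X) \<le> ennreal (exp (- \<gamma>) * G ^ n)" if w: "w < M" "w' < M" "w \<noteq> w'" for w w'
  proof -
    have m: "(\<lambda>r. ?g (r w) (r w')) \<in> borel_measurable ?\<nu>" using w by measurable
    have "(\<integral>\<^sup>+X. F2 X w w' \<partial>?X) = ennreal (exp (- \<gamma>)) * (\<integral>\<^sup>+X. (\<Prod>t<n. ?g (X t w) (X t w')) \<partial>?X)"
      unfolding F2_def using w
      by (intro nn_integral_cmult borel_measurable_prod_ennreal wrong_exponent_measurable mX) auto
    also have "(\<integral>\<^sup>+X. (\<Prod>t<n. ?g (X t w) (X t w')) \<partial>?X) = (\<Prod>t<n. \<integral>\<^sup>+r. ?g (r w) (r w') \<partial>?\<nu>)"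
      by (rule col.product_nn_integral_prod[of "{..<n}" "\<lambda>_ r. ?g (r w) (r w')"]) (use m in auto)
    also have "ennreal (exp (- \<gamma>)) * \<dots> \<le> ennreal (exp (- \<gamma>)) * (\<Prod>t<n. ennreal G)"
      by (intro mult_left_mono prod_mono_ennreal g_row w) simp
    finally show ?thesis using nn by (simp add: ennreal_power ennreal_mult)
  qed
  have i3: "(\<integral>\<^sup>+X. F3 X t \<partial>?X) \<le> ennreal (\<rho> ^ M)" if "t < n" for t
  proof -
    have "(\<lambda>r. \<Prod>w<M. ennreal (exp (\<eta> * ((cmod (r w))\<^sup>2 - p')))) \<in> borel_measurable ?\<nu>" by measurable
    from cols[OF that this] show ?thesis unfolding F3_def using e_row by simp
  qed
  have i4: "(\<integral>\<^sup>+X. F4 X t w \<partial>?X) = 0" if "t < n" "w < M" for t w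
  proof -
    have "(\<lambda>r. indicator (- cball 0 B) (r w) :: ennreal) \<in> borel_measurable ?\<nu>"
      using that by (intro measurable_compose[OF m1 indicator_cball_measurable(2)])
    from cols[OF that(1) this] show ?thesis
      unfolding F4_def using rows[OF that(2) indicator_cball_measurable(2)[of 0 B]] input_law_outside by simp
  qed
  have "(\<integral>\<^sup>+X. F X \<partial>?X) = ennreal (1 / (\<epsilon> * M)) * (\<Sum>w<M. (\<integral>\<^sup>+X. F1 X w \<partial>?X) + (\<Sum>w'\<in>{..<M} - {w}. \<integral>\<^sup>+X. F2 X w w' \<partial>?X)) +
      ((\<Sum>t<n. \<integral>\<^sup>+X. F3 X t \<partial>?X) + (\<Sum>t<n. \<Sum>w<M. \<integral>\<^sup>+X. F4 X t w \<partial>?X))"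
  proof -
    have m1: "(\<lambda>X. \<Sum>w'\<in>{..<M} - {w}. F2 X w w') \<in> borel_measurable ?X" if "w < M" for w
      using that by (intro borel_measurable_sum mF2) auto
    have m2: "(\<lambda>X. \<Sum>w<M. F1 X w + (\<Sum>w'\<in>{..<M} - {w}. F2 X w w')) \<in> borel_measurable ?X"
      by (intro borel_measurable_sum borel_measurable_add m1 mF1) auto
    have m3: "(\<lambda>X. \<Sum>t<n. F3 X t) \<in> borel_measurable ?X"
      by (intro borel_measurable_sum mF3) auto
    have m4: "(\<lambda>X. \<Sum>w<M. F4 X t w) \<in> borel_measurable ?X" if "t < n" for t
      using that by (intro borel_measurable_sum mF4) auto
    have m5: "(\<lambda>X. \<Sum>t<n. \<Sum>w<M. F4 X t w) \<in> borel_measurable ?X"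
      by (intro borel_measurable_sum m4) auto
    have "(\<integral>\<^sup>+X. F X \<partial>?X) = ennreal (1 / (\<epsilon> * M)) * (\<integral>\<^sup>+X. (\<Sum>w<M. F1 X w + (\<Sum>w'\<in>{..<M} - {w}. F2 X w w')) \<partial>?X) +
      ((\<integral>\<^sup>+X. (\<Sum>t<n. F3 X t) \<partial>?X) + (\<integral>\<^sup>+X. (\<Sum>t<n. \<Sum>w<M. F4 X t w) \<partial>?X))"
      unfolding F_def
      by (subst nn_integral_add, intro borel_measurable_times_ennreal borel_measurable_const m2, intro borel_measurable_add m3 m5,
          subst nn_integral_add[OF m3 m5], subst nn_integral_cmult[OF m2], rule refl)
    also have "(\<integral>\<^sup>+X. (\<Sum>w<M. F1 X w + (\<Sum>w'\<in>{..<M} - {w}. F2 X w w')) \<partial>?X) =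
      (\<Sum>w<M. (\<integral>\<^sup>+X. F1 X w \<partial>?X) + (\<Sum>w'\<in>{..<M} - {w}. \<integral>\<^sup>+X. F2 X w w' \<partial>?X))"
      by (subst nn_integral_sum, intro borel_measurable_add mF1 m1; simp)
         (intro sum.cong refl, subst nn_integral_add, auto intro!: mF1 m1 nn_integral_sum mF2)
    also have "(\<integral>\<^sup>+X. (\<Sum>t<n. F3 X t) \<partial>?X) = (\<Sum>t<n. \<integral>\<^sup>+X. F3 X t \<partial>?X)"
      by (rule nn_integral_sum) (auto intro: mF3)
    also have "(\<integral>\<^sup>+X. (\<Sum>t<n. \<Sum>w<M. F4 X t w) \<partial>?X) = (\<Sum>t<n. \<Sum>w<M. \<integral>\<^sup>+X. F4 X t w \<partial>?X)"
      by (subst nn_integral_sum, auto intro!: m4 sum.cong nn_integral_sum mF4)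
    finally show ?thesis .
  qed
  also have "\<dots> \<le> ennreal (1 / (\<epsilon> * M)) * (\<Sum>w<M. ennreal (exp (s * \<gamma>) * K ^ n) + (\<Sum>w'\<in>{..<M} - {w}. ennreal (exp (- \<gamma>) * G ^ n))) +
      ((\<Sum>t<n. ennreal (\<rho> ^ M)) + (\<Sum>t<n. \<Sum>w<M. 0))"
    by (intro add_mono mult_left_mono sum_mono i1 i2 i3) (auto simp: i4)
  also have "\<dots> \<le> ennreal (1 / (\<epsilon> * M)) * (\<Sum>w<M. ennreal (exp (s * \<gamma>) * K ^ n) + (\<Sum>w'<M. ennreal (exp (- \<gamma>) * G ^ n))) +
      ((\<Sum>t<n. ennreal (\<rho> ^ M)) + (\<Sum>t<n. \<Sum>w<M. 0))"
    by (intro add_mono mult_left_mono sum_mono order_refl sum_mono2) auto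
  also have "\<dots> = ennreal ((exp (s * \<gamma>) * K ^ n + real M * (exp (- \<gamma>) * G ^ n)) / \<epsilon> + real n * \<rho> ^ M)"
  proof -
    have "(\<Sum>w<M. ennreal (exp (s * \<gamma>) * K ^ n) + (\<Sum>w'<M. ennreal (exp (- \<gamma>) * G ^ n))) =
        ennreal (M * (exp (s * \<gamma>) * K ^ n + real M * (exp (- \<gamma>) * G ^ n)))"
      using nn by (simp add: ennreal_of_nat_eq_real_of_nat del: ennreal_plus flip: ennreal_mult ennreal_plus)
    moreover have "(\<Sum>t<n. ennreal (\<rho> ^ M)) + (\<Sum>t<n. \<Sum>w<M. 0) = ennreal (n * \<rho> ^ M)"
      using nn by (simp add: ennreal_of_nat_eq_real_of_nat flip: ennreal_mult)
    ultimately show ?thesis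
      using nn \<epsilon> M by (simp del: ennreal_plus flip: ennreal_mult ennreal_plus)
  qed
  also have "\<dots> < 1"
    using total unfolding K_def G_def \<rho>_def by (simp add: ennreal_less_one_iff)
  finally obtain X where X: "X \<in> space ?X" "F X < 1"
    using exists_less_of_nn_integral_less[OF X.prob_space_axioms] by blast
  define x where "x w t = X t w" for w t
  have le: "ennreal (1 / (\<epsilon> * M)) * (\<Sum>w<M. F1 X w + (\<Sum>w'\<in>{..<M} - {w}. F2 X w w')) < 1"
    "(\<Sum>t<n. F3 X t) < 1" "(\<Sum>t<n. \<Sum>w<M. F4 X t w) < 1"
    using X(2) unfolding F_def
    by (meson add_increasing add_increasing2 le_less_trans order_refl zero_le)+
  show thesis
  proof (rule that[of x])
    show "cmod (x w t) \<le> B" if "w < M" "t < n" for w t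
    proof (rule ccontr)
      assume "\<not> ?thesis"
      then have "F4 X t w = 1" by (simp add: F4_def x_def indicator_def)
      moreover have "F4 X t w \<le> (\<Sum>w<M. F4 X t w)" using that by (intro member_le_sum) auto
      moreover have "(\<Sum>w<M. F4 X t w) \<le> (\<Sum>t<n. \<Sum>w<M. F4 X t w)"
        using that by (intro member_le_sum[of t _ "\<lambda>t. \<Sum>w<M. F4 X t w"]) auto
      ultimately show False using le(3) by auto
    qed
    show "(\<Sum>w<M. (cmod (x w t))\<^sup>2) \<le> real M * p'" if "t < n" for t
    proof -
      have "F3 X t \<le> (\<Sum>t<n. F3 X t)" using that by (intro member_le_sum) auto
      then have "F3 X t < 1" using le(2) by (rule le_less_trans)
      moreover have "F3 X t = ennreal (exp (\<eta> * ((\<Sum>w<M. (cmod (x w t))\<^sup>2) - M * p')))"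
        by (simp add: F3_def x_def prod_ennreal exp_sum[symmetric] sum_distrib_left[symmetric] sum_subtractf)
      ultimately have "\<eta> * ((\<Sum>w<M. (cmod (x w t))\<^sup>2) - M * p') < 0"
        by (simp add: ennreal_less_one_iff)
      then show ?thesis using eta by (simp add: mult_less_0_iff)
    qed
    have err: "(\<integral>\<^sup>+z. ennreal (exp (s * (\<gamma> - codeword_info h a n x w (\<lambda>t. h * x w t + z t)))) +
        (\<Sum>w'\<in>{..<M} - {w}. ennreal (exp (codeword_info h a n x w' (\<lambda>t. h * x w t + z t) - \<gamma>)))
        \<partial>PiM {..<n} (\<lambda>_. CN01)) = F1 X w + (\<Sum>w'\<in>{..<M} - {w}. F2 X w w')" for w
    proof -
      have mz[measurable]: "(\<lambda>z. info_density h a u (k + z t)) \<in> borel_measurable (PiM {..<n} (\<lambda>_. CN01))" if "t < n" for t u k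
      proof -
        have "(\<lambda>z. z t) \<in> borel_measurable (PiM {..<n} (\<lambda>_. CN01))"
          using measurable_component_singleton[of t "{..<n}" "\<lambda>_. CN01"] that
          by (simp add: measurable_cong_sets[OF refl sets_CN01])
        moreover have "(\<lambda>z. info_density h a u (k + z)) \<in> borel_measurable borel" by measurable
        ultimately show ?thesis by (rule measurable_compose)
      qed
      have 1: "(\<integral>\<^sup>+z. ennreal (exp (s * (\<gamma> - codeword_info h a n x w (\<lambda>t. h * x w t + z t)))) \<partial>PiM {..<n} (\<lambda>_. CN01)) = F1 X w"
      proof -
        have "ennreal (exp (s * (\<gamma> - codeword_info h a n x w (\<lambda>t. h * x w t + z t)))) =
          ennreal (exp (s * \<gamma>)) * (\<Prod>t<n. ennreal (exp (- s * info_density h a (x w t) (h * x w t + z t))))" for z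
          by (simp add: codeword_info_def prod_ennreal exp_sum[symmetric] sum_negf sum_distrib_left exp_add[symmetric] right_diff_distrib flip: ennreal_mult)
        then have "(\<integral>\<^sup>+z. ennreal (exp (s * (\<gamma> - codeword_info h a n x w (\<lambda>t. h * x w t + z t)))) \<partial>PiM {..<n} (\<lambda>_. CN01)) =
          ennreal (exp (s * \<gamma>)) * (\<integral>\<^sup>+z. (\<Prod>t<n. ennreal (exp (- s * info_density h a (x w t) (h * x w t + z t)))) \<partial>PiM {..<n} (\<lambda>_. CN01))"
          by (simp only:) (intro nn_integral_cmult, measurable)
        also have "(\<integral>\<^sup>+z. (\<Prod>t<n. ennreal (exp (- s * info_density h a (x w t) (h * x w t + z t)))) \<partial>PiM {..<n} (\<lambda>_. CN01)) =
          (\<Prod>t<n. correct_exponent h a s (x w t))"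
          unfolding correct_exponent_def
          by (rule noise.product_nn_integral_prod[of "{..<n}" "\<lambda>t z. ennreal (exp (- s * info_density h a (x w t) (h * x w t + z)))"])
             (auto simp: measurable_cong_sets[OF sets_CN01 refl])
        finally show ?thesis by (simp only: F1_def x_def[symmetric])
      qed
      have 2: "(\<integral>\<^sup>+z. ennreal (exp (codeword_info h a n x w' (\<lambda>t. h * x w t + z t) - \<gamma>)) \<partial>PiM {..<n} (\<lambda>_. CN01)) = F2 X w w'" for w'
      proof -
        have "ennreal (exp (codeword_info h a n x w' (\<lambda>t. h * x w t + z t) - \<gamma>)) =
          ennreal (exp (- \<gamma>)) * (\<Prod>t<n. ennreal (exp (info_density h a (x w' t) (h * x w t + z t))))" for z
          by (simp add: codeword_info_def prod_ennreal exp_sum[symmetric] exp_add[symmetric] flip: ennreal_mult)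
        then have "(\<integral>\<^sup>+z. ennreal (exp (codeword_info h a n x w' (\<lambda>t. h * x w t + z t) - \<gamma>)) \<partial>PiM {..<n} (\<lambda>_. CN01)) =
          ennreal (exp (- \<gamma>)) * (\<integral>\<^sup>+z. (\<Prod>t<n. ennreal (exp (info_density h a (x w' t) (h * x w t + z t)))) \<partial>PiM {..<n} (\<lambda>_. CN01))"
          by (simp only:) (intro nn_integral_cmult, measurable)
        also have "(\<integral>\<^sup>+z. (\<Prod>t<n. ennreal (exp (info_density h a (x w' t) (h * x w t + z t)))) \<partial>PiM {..<n} (\<lambda>_. CN01)) =
          (\<Prod>t<n. wrong_exponent h a (x w t) (x w' t))"
          unfolding wrong_exponent_def
          by (rule noise.product_nn_integral_prod[of "{..<n}" "\<lambda>t z. ennreal (exp (info_density h a (x w' t) (h * x w t + z)))"])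
             (auto simp: measurable_cong_sets[OF sets_CN01 refl])
        finally show ?thesis by (simp only: F2_def x_def[symmetric])
      qed
      show ?thesis unfolding 1[symmetric] 2[symmetric] codeword_info_def
        by (subst nn_integral_add, measurable) (subst nn_integral_sum, auto)
    qed
    have eM: "\<epsilon> * M > 0" using \<epsilon> M by simp
    have "ennreal (\<epsilon> * M) * (ennreal (1 / (\<epsilon> * M)) * (\<Sum>w<M. F1 X w + (\<Sum>w'\<in>{..<M} - {w}. F2 X w w'))) \<le> ennreal (\<epsilon> * M) * 1"
      using le(1) by (intro mult_left_mono) auto
    moreover have "ennreal (\<epsilon> * M) * ennreal (1 / (\<epsilon> * M)) = 1"
      using \<epsilon> M by (simp flip: ennreal_mult)
    ultimately show "(\<Sum>w<M. (\<integral>\<^sup>+z. ennreal (exp (s * (\<gamma> - codeword_info h a n x w (\<lambda>t. h * x w t + z t)))) +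
        (\<Sum>w'\<in>{..<M} - {w}. ennreal (exp (codeword_info h a n x w' (\<lambda>t. h * x w t + z t) - \<gamma>)))
        \<partial>PiM {..<n} (\<lambda>_. CN01))) \<le> ennreal (\<epsilon> * M)"
      unfolding err by (simp add: mult.assoc[symmetric])
  qed
qed

text \<open>The candidate \<open>M\<close> makes \<open>LEAST\<close> well defined when no codeword
  passes the threshold; the output is then 0, so that a valid message is always returned.\<close>

definition threshold_decoder :: "complex \<Rightarrow> real \<Rightarrow> nat \<Rightarrow> (nat \<Rightarrow> nat \<Rightarrow> complex) \<Rightarrow> real \<Rightarrow> nat \<Rightarrow> (nat \<Rightarrow> complex) \<Rightarrow> nat" where
  "threshold_decoder h a n x \<gamma> M y =
     (let w = (LEAST w. w = M \<or> (w < M \<and> \<gamma> \<le> codeword_info h a n x w y)) in if w < M then w else 0)"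

lemma threshold_decoder_error:
  assumes w: "w < M" and err: "threshold_decoder h a n x \<gamma> M y \<noteq> w"
  shows "codeword_info h a n x w y < \<gamma> \<or> (\<exists>w'\<in>{..<M} - {w}. \<gamma> \<le> codeword_info h a n x w' y)"
proof (rule ccontr)
  assume no: "\<not> ?thesis"
  have "(LEAST w. w = M \<or> (w < M \<and> \<gamma> \<le> codeword_info h a n x w y)) = w"
  proof (rule Least_equality)
    show "w = M \<or> (w < M \<and> \<gamma> \<le> codeword_info h a n x w y)" using w no by auto
    show "w \<le> v" if "v = M \<or> (v < M \<and> \<gamma> \<le> codeword_info h a n x v y)" for v
      using that w no by (cases "v = w") auto
  qed
  then show False using err w by (simp add: threshold_decoder_def)
qed

text \<open>Shaped for use by relays. \<open>D\<close> returns a valid message on every input, so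
  even a mistaken relay sends a codeword, of amplitude at most \<open>B\<close>. Power is averaged
  over the messages for each time separately, as in \<open>valid_code\<close>, and \<open>D\<close>
  looks at \<open>n\<close> signals only.\<close>

definition awgn_code :: "complex \<Rightarrow> nat \<Rightarrow> nat \<Rightarrow> real \<Rightarrow> real \<Rightarrow> real \<Rightarrow> (nat \<Rightarrow> nat \<Rightarrow> complex) \<Rightarrow> ((nat \<Rightarrow> complex) \<Rightarrow> nat) \<Rightarrow> bool" where
  "awgn_code h n M B p \<epsilon> x D \<longleftrightarrow>
     (\<forall>w<M. \<forall>t<n. cmod (x w t) \<le> B) \<and>
     (\<forall>t<n. (\<Sum>w<M. (cmod (x w t))\<^sup>2) \<le> real M * p) \<and>
     (\<forall>y. D y < M) \<and> (\<forall>y y'. (\<forall>t<n. y t = y' t) \<longrightarrow> D y = D y') \<and>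
     D \<in> measurable (PiM {..<n} (\<lambda>_. borel)) (count_space UNIV) \<and>
     (\<Sum>w<M. measure (PiM {..<n} (\<lambda>_. CN01)) {z\<in>space (PiM {..<n} (\<lambda>_. CN01)). D (\<lambda>t. h * x w t + z t) \<noteq> w}) \<le> \<epsilon> * M"

lemma awgn_decoder_measurable:
  assumes "awgn_code h n M B p \<epsilon> x D" "\<And>t. t < n \<Longrightarrow> (\<lambda>\<omega>. Y \<omega> t) \<in> borel_measurable L"
  shows "(\<lambda>\<omega>. D (Y \<omega>)) \<in> measurable L (count_space UNIV)"
proof -
  have "(\<lambda>\<omega>. \<lambda>t\<in>{..<n}. Y \<omega> t) \<in> measurable L (PiM {..<n} (\<lambda>_. borel))"
    using assms(2) by (intro measurable_restrict) auto
  moreover have "D \<in> measurable (PiM {..<n} (\<lambda>_. borel)) (count_space UNIV)"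
    using assms(1) by (simp add: awgn_code_def)
  ultimately have "(\<lambda>\<omega>. D (\<lambda>t\<in>{..<n}. Y \<omega> t)) \<in> measurable L (count_space UNIV)"
    by (rule measurable_compose)
  moreover have "D (\<lambda>t\<in>{..<n}. Y \<omega> t) = D (Y \<omega>)" for \<omega>
  proof -
    have "\<forall>t<n. (\<lambda>t\<in>{..<n}. Y \<omega> t) t = Y \<omega> t" by simp
    then show ?thesis using assms(1) unfolding awgn_code_def by blast
  qed
  ultimately show ?thesis by simp
qed

text \<open>An error means that the sent codeword misses the threshold or another one passes it.
  Each indicator is at most the corresponding exponential, so the hypothesis on integrals bounds the
  error probability.\<close>

lemma threshold_code:
  fixes \<epsilon> p B \<gamma> s :: real
  assumes M: "M \<ge> 1" and s: "s \<ge> 0" and \<epsilon>: "\<epsilon> \<ge> 0"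
    and B: "\<And>w t. w < M \<Longrightarrow> t < n \<Longrightarrow> cmod (x w t) \<le> B"
    and p: "\<And>t. t < n \<Longrightarrow> (\<Sum>w<M. (cmod (x w t))\<^sup>2) \<le> real M * p"
    and err: "(\<Sum>w<M. (\<integral>\<^sup>+z. ennreal (exp (s * (\<gamma> - codeword_info h a n x w (\<lambda>t. h * x w t + z t)))) +
        (\<Sum>w'\<in>{..<M} - {w}. ennreal (exp (codeword_info h a n x w' (\<lambda>t. h * x w t + z t) - \<gamma>)))
        \<partial>PiM {..<n} (\<lambda>_. CN01))) \<le> ennreal (\<epsilon> * M)"
  shows "awgn_code h n M B p \<epsilon> x (threshold_decoder h a n x \<gamma> M)"
proof -
  let ?D = "threshold_decoder h a n x \<gamma> M"
  let ?N = "PiM {..<n} (\<lambda>_. CN01)"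
  interpret N: prob_space ?N by (intro prob_space_PiM prob_space_CN01)
  have dep: "?D y = ?D y'" if "\<forall>t<n. y t = y' t" for y y'
  proof -
    have "codeword_info h a n x w y = codeword_info h a n x w y'" for w
      unfolding codeword_info_def using that by (intro sum.cong) auto
    then show ?thesis by (simp add: threshold_decoder_def)
  qed
  have mi: "(\<lambda>y. codeword_info h a n x w y) \<in> borel_measurable (PiM {..<n} (\<lambda>_. borel))" for w
    unfolding codeword_info_def by measurable
  have mD: "?D \<in> measurable (PiM {..<n} (\<lambda>_. borel)) (count_space UNIV)"
    unfolding threshold_decoder_def[abs_def] Let_def using mi by measurable
  have mDz: "(\<lambda>z. ?D (\<lambda>t. h * x w t + z t)) \<in> measurable ?N (count_space UNIV)" for w
  proof -
    have "(\<lambda>z. \<lambda>t\<in>{..<n}. h * x w t + z t) \<in> measurable ?N (PiM {..<n} (\<lambda>_. borel))"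
      by (intro measurable_restrict) measurable
    from measurable_compose[OF this mD] have "(\<lambda>z. ?D (\<lambda>t\<in>{..<n}. h * x w t + z t)) \<in> measurable ?N (count_space UNIV)" .
    moreover have "?D (\<lambda>t\<in>{..<n}. h * x w t + z t) = ?D (\<lambda>t. h * x w t + z t)" for z by (rule dep) simp
    ultimately show ?thesis by simp
  qed
  have pe: "ennreal (measure ?N {z\<in>space ?N. ?D (\<lambda>t. h * x w t + z t) \<noteq> w}) \<le>
      (\<integral>\<^sup>+z. ennreal (exp (s * (\<gamma> - codeword_info h a n x w (\<lambda>t. h * x w t + z t)))) +
        (\<Sum>w'\<in>{..<M} - {w}. ennreal (exp (codeword_info h a n x w' (\<lambda>t. h * x w t + z t) - \<gamma>))) \<partial>?N)"
    if w: "w < M" for w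
  proof -
    have ev: "{z\<in>space ?N. ?D (\<lambda>t. h * x w t + z t) \<noteq> w} \<in> sets ?N"
      using measurable_sets[OF mDz[of w], of "- {w}"] by (auto simp: vimage_def Int_def conj_commute)
    have "ennreal (measure ?N {z\<in>space ?N. ?D (\<lambda>t. h * x w t + z t) \<noteq> w}) = (\<integral>\<^sup>+z. indicator {z\<in>space ?N. ?D (\<lambda>t. h * x w t + z t) \<noteq> w} z \<partial>?N)"
      using ev by (simp add: N.emeasure_eq_measure)
    also have "\<dots> \<le> (\<integral>\<^sup>+z. ennreal (exp (s * (\<gamma> - codeword_info h a n x w (\<lambda>t. h * x w t + z t)))) +
        (\<Sum>w'\<in>{..<M} - {w}. ennreal (exp (codeword_info h a n x w' (\<lambda>t. h * x w t + z t) - \<gamma>))) \<partial>?N)"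
    proof (rule nn_integral_mono)
      fix z
      let ?y = "\<lambda>t. h * x w t + z t"
      show "indicator {z\<in>space ?N. ?D (\<lambda>t. h * x w t + z t) \<noteq> w} z \<le>
         ennreal (exp (s * (\<gamma> - codeword_info h a n x w ?y))) + (\<Sum>w'\<in>{..<M} - {w}. ennreal (exp (codeword_info h a n x w' ?y - \<gamma>)))"
      proof (cases "?D ?y = w")
        case False
        from threshold_decoder_error[OF w this] show ?thesis
        proof
          assume "codeword_info h a n x w ?y < \<gamma>"
          then have "1 \<le> ennreal (exp (s * (\<gamma> - codeword_info h a n x w ?y)))"
            using s by simp
          then show ?thesis by (intro order_trans[OF _ add_increasing2]) (auto simp: indicator_def)
        next
          assume "\<exists>w'\<in>{..<M} - {w}. \<gamma> \<le> codeword_info h a n x w' ?y"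
          then obtain w' where w': "w' \<in> {..<M} - {w}" "\<gamma> \<le> codeword_info h a n x w' ?y" by blast
          have "1 \<le> ennreal (exp (codeword_info h a n x w' ?y - \<gamma>))" using w' by simp
          also have "\<dots> \<le> (\<Sum>w'\<in>{..<M} - {w}. ennreal (exp (codeword_info h a n x w' ?y - \<gamma>)))"
            using w' by (intro member_le_sum) auto
          finally show ?thesis by (intro order_trans[OF _ add_increasing]) (auto simp: indicator_def)
        qed
      qed simp
    qed
    finally show ?thesis .
  qed
  have "ennreal (\<Sum>w<M. measure ?N {z\<in>space ?N. ?D (\<lambda>t. h * x w t + z t) \<noteq> w}) =
     (\<Sum>w<M. ennreal (measure ?N {z\<in>space ?N. ?D (\<lambda>t. h * x w t + z t) \<noteq> w}))"
    by (intro sum_ennreal[symmetric]) simp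
  also have "\<dots> \<le> ennreal (\<epsilon> * M)"
    by (rule order_trans[OF sum_mono err]) (rule pe, simp)
  finally have "(\<Sum>w<M. measure ?N {z\<in>space ?N. ?D (\<lambda>t. h * x w t + z t) \<noteq> w}) \<le> \<epsilon> * M"
    using \<epsilon> by (subst (asm) ennreal_le_iff) auto
  moreover have "?D y < M" for y using M by (simp add: threshold_decoder_def Let_def)
  ultimately show ?thesis
    unfolding awgn_code_def by (intro conjI allI impI B p dep mD; simp)
qed

text \<open>The bounds \<open>B\<close> and \<open>p\<close> are fixed before
  \<open>\<epsilon>\<close>, so that \<open>\<epsilon>\<close> can later be chosen in terms of them.
  The condition \<open>n \<le> M\<close> serves the power constraint: it is an empirical average
  over \<open>M\<close> codewords, violated at a given time with probability exponentially small in
  \<open>M\<close>, and there are \<open>n\<close> times.\<close>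

theorem awgn_codes_exist:
  fixes h :: complex
  assumes P: "P > 0" and r: "r < ln (1 + P * (cmod h)\<^sup>2)"
  obtains B p where "B > 0" "0 < p" "p < P"
    and "\<And>\<epsilon>. \<epsilon> > 0 \<Longrightarrow> \<exists>n0. \<forall>n\<ge>n0. \<forall>M. 1 \<le> M \<and> n \<le> M \<and> real M \<le> exp (real n * r) \<longrightarrow> (\<exists>x D. awgn_code h n M B p \<epsilon> x D)"
proof -
  define S where "S = (cmod h)\<^sup>2"
  have S: "S \<ge> 0" by (simp add: S_def)
  have er: "exp r < 1 + P * S"
    using r P S unfolding S_def[symmetric] by (metis add_pos_nonneg exp_less_mono exp_ln less_imp_le mult_nonneg_nonneg zero_less_one)
  have "max 0 ((exp r - 1) / S) < P"
    using er P S by (cases "S = 0") (auto simp: field_simps)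
  \<comment> \<open>\<open>q\<close> is the variance of the random symbols before truncation: below
    \<open>P\<close>, yet large enough for \<open>ln (1 + q * S)\<close> to exceed \<open>r\<close>.
    For \<open>S = 0\<close> the quotient is 0 by convention.\<close>
  then obtain q where q: "max 0 ((exp r - 1) / S) < q" "q < P" using dense by blast
  have q0: "q > 0" using q by simp
  define a where "a = q * S"
  have a: "a \<ge> 0" using q0 S by (simp add: a_def)
  define L where "L = ln (1 + a)"
  have rL: "r < L"
  proof -
    have "exp r < 1 + a"
    proof (cases "S = 0")
      case True then show ?thesis using er by (simp add: a_def)
    next
      case False
      then have "S > 0" using S by simp
      then show ?thesis using q by (simp add: a_def field_simps)
    qed
    then have "ln (exp r) < L" unfolding L_def using a by (subst ln_less_cancel_iff) auto
    then show ?thesis by simp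
  qed
  define p where "p = (q + P) / 2"
  have p: "q < p" "p < P" using q by (auto simp: p_def)
  \<comment> \<open>The decoding threshold will lie \<open>\<delta>\<close> below \<open>L\<close>
    and hence \<open>2 * \<delta>\<close> above \<open>r\<close>. One \<open>\<delta>\<close> of the
    latter pays for truncation, the other is the exponent against wrong codewords.\<close>
  define \<delta> where "\<delta> = (L - r) / 3"
  have \<delta>: "\<delta> > 0" using rL by (simp add: \<delta>_def)
  \<comment> \<open>The Chernoff parameter: the gain \<open>s * \<delta>\<close> is linear in
    \<open>s\<close>, the loss from \<open>1 / (1 - s^2)\<close> quadratic.\<close>
  define s where "s = min (\<delta> / 4) (1 / 2)"
  have s: "s > 0" "s \<le> 1 / 2" "s \<le> \<delta> / 4" using \<delta> by (auto simp: s_def)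
  \<comment> \<open>By \<open>ln (1 - y) \<ge> - y - 2 * y^2\<close> the exponent of a power
    violation is at least \<open>\<kappa>\<close>. The first bound on \<open>\<eta>\<close> makes
    \<open>\<kappa>\<close> positive, the second keeps \<open>y = \<eta> * q\<close> at most
    1/2.\<close>
  define \<eta> where "\<eta> = min ((p - q) / (4 * q\<^sup>2)) (1 / (2 * q))"
  have \<eta>: "\<eta> > 0" "\<eta> \<le> (p - q) / (4 * q\<^sup>2)" "\<eta> \<le> 1 / (2 * q)" using p q0 by (auto simp: \<eta>_def)
  have eq: "0 \<le> \<eta> * q" "\<eta> * q \<le> 1 / 2" using \<eta> q0 by (auto simp: field_simps)
  define \<kappa> where "\<kappa> = \<eta> * (p - q) - 2 * (\<eta> * q)\<^sup>2"
  have \<kappa>: "\<kappa> > 0"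
  proof -
    have "\<eta> * q\<^sup>2 * 4 \<le> p - q" using \<eta>(2) q0 by (simp add: field_simps)
    then have "\<eta> * (\<eta> * q\<^sup>2 * 4) \<le> \<eta> * (p - q)" using \<eta> by (intro mult_left_mono) auto
    then have "4 * (\<eta> * q)\<^sup>2 \<le> \<eta> * (p - q)" by (simp add: power2_eq_square algebra_simps)
    moreover have "\<eta> * (p - q) > 0" using \<eta> p by simp
    ultimately show ?thesis unfolding \<kappa>_def by linarith
  qed
  \<comment> \<open>The budget per symbol for truncation: half of the power exponent and a quarter
    of the decoding gain.\<close>
  define \<tau> where "\<tau> = min (\<kappa> / 2) (s * \<delta> / 4)"
  have s\<delta>: "s * \<delta> \<le> \<delta>" using mult_right_mono[of s 1 \<delta>] s \<delta> by simp
  have \<tau>: "\<tau> > 0" "\<tau> \<le> \<kappa> / 2" "\<tau> \<le> s * \<delta> / 4"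
    using \<kappa> s \<delta> by (auto simp: \<tau>_def)
  then have \<tau>4: "\<tau> \<le> \<delta>" using s\<delta> \<delta> by linarith
  obtain B where B: "B > 0" "trunc_mass q B > exp (- \<tau>)"
    using trunc_mass_limit[OF q0, of "exp (- \<tau>)"] \<tau> by auto
  define \<theta> where "\<theta> = trunc_mass q B"
  have \<theta>: "\<theta> > 0" "1 / \<theta> \<le> exp \<tau>" using B exp_gt_zero[of "- \<tau>"] unfolding \<theta>_def
    by (linarith, smt (verit, best) exp_gt_zero exp_minus frac_le inverse_eq_divide inverse_inverse_eq)
  define \<rho> where "\<rho> = exp (- \<eta> * p) / (1 - \<eta> * q) / \<theta>"
  have \<rho>: "0 \<le> \<rho>" "\<rho> \<le> exp (- \<kappa> / 2)"
  proof -
    show "0 \<le> \<rho>" using eq \<theta> by (simp add: \<rho>_def)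
    have "- (\<eta> * q) - 2 * (\<eta> * q)\<^sup>2 \<le> ln (1 - \<eta> * q)" by (intro ln_one_minus_pos_lower_bound eq)
    then have "exp (- (\<eta> * q) - 2 * (\<eta> * q)\<^sup>2) \<le> 1 - \<eta> * q" using eq by (subst (asm) ln_ge_iff) auto
    then have "exp (- \<eta> * p) / (1 - \<eta> * q) \<le> exp (- \<eta> * p) / exp (- (\<eta> * q) - 2 * (\<eta> * q)\<^sup>2)"
      using eq by (intro divide_left_mono) auto
    also have "\<dots> = exp (- \<kappa>)" by (simp add: \<kappa>_def exp_diff[symmetric] algebra_simps)
    finally have "exp (- \<eta> * p) / (1 - \<eta> * q) * (1 / \<theta>) \<le> exp (- \<kappa>) * exp \<tau>"
      using \<theta> by (intro mult_mono) auto
    also have "\<dots> \<le> exp (- \<kappa> / 2)" using \<tau> by (simp add: exp_add[symmetric])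
    finally show "\<rho> \<le> exp (- \<kappa> / 2)" by (simp add: \<rho>_def)
  qed
  define K where "K = exp (- s * L) / (1 - s\<^sup>2) / \<theta>"
  have s2: "0 \<le> s\<^sup>2" "s\<^sup>2 \<le> 1 / 2" "s\<^sup>2 \<le> s * \<delta> / 4"
  proof -
    show "0 \<le> s\<^sup>2" by simp
    have "s\<^sup>2 \<le> s * (1/2)" "s\<^sup>2 \<le> s * (\<delta> / 4)" unfolding power2_eq_square using s by (intro mult_left_mono; simp)+
    then show "s\<^sup>2 \<le> 1 / 2" "s\<^sup>2 \<le> s * \<delta> / 4" using s by auto
  qed
  have K: "0 \<le> K" "exp (s * (L - \<delta>)) * K \<le> exp (- (s * \<delta> / 4))"
  proof -
    show "0 \<le> K" using s2 \<theta> by (simp add: K_def)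
    have "2 * (s\<^sup>2)\<^sup>2 \<le> s\<^sup>2" using mult_left_mono[OF s2(2), of "2 * s\<^sup>2"] by (simp add: power2_eq_square)
    moreover have "- s\<^sup>2 - 2 * (s\<^sup>2)\<^sup>2 \<le> ln (1 - s\<^sup>2)" by (intro ln_one_minus_pos_lower_bound s2)
    ultimately have "- 2 * s\<^sup>2 \<le> ln (1 - s\<^sup>2)" by linarith
    then have "exp (- 2 * s\<^sup>2) \<le> 1 - s\<^sup>2" using s2 by (subst (asm) ln_ge_iff) auto
    then have "1 / (1 - s\<^sup>2) \<le> 1 / exp (- 2 * s\<^sup>2)" using s2 by (intro divide_left_mono) auto
    also have "\<dots> = exp (2 * s\<^sup>2)" by (simp add: exp_minus field_simps)
    finally have "1 / (1 - s\<^sup>2) * (1 / \<theta>) \<le> exp (2 * s\<^sup>2) * exp \<tau>" using \<theta> by (intro mult_mono) auto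
    then have "exp (s * (L - \<delta>)) * exp (- s * L) * (1 / (1 - s\<^sup>2) * (1 / \<theta>)) \<le> exp (s * (L - \<delta>)) * exp (- s * L) * (exp (2 * s\<^sup>2) * exp \<tau>)"
      by (intro mult_left_mono) auto
    also have "\<dots> = exp (- (s * \<delta>) + 2 * s\<^sup>2 + \<tau>)" by (simp add: exp_add[symmetric] algebra_simps)
    also have "\<dots> \<le> exp (- (s * \<delta> / 4))" using s2 \<tau> by simp
    finally show "exp (s * (L - \<delta>)) * K \<le> exp (- (s * \<delta> / 4))" by (simp add: K_def)
  qed
  define c where "c = s * \<delta> / 4"
  have c: "c > 0" "c \<le> \<delta>" using s \<delta> s\<delta> by (auto simp: c_def)
  have main: "\<exists>n0. \<forall>n\<ge>n0. \<forall>M. 1 \<le> M \<and> n \<le> M \<and> real M \<le> exp (real n * r) \<longrightarrow> (\<exists>x D. awgn_code h n M B p \<epsilon> x D)" if \<epsilon>: "\<epsilon> > 0" for \<epsilon>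
  proof -
    have "((\<lambda>n. 2 * exp (- (real n * c)) / \<epsilon> + real n * exp (- (real n * (\<kappa> / 2)))) \<longlongrightarrow> 0) sequentially"
    proof -
      have k: "\<kappa> / 2 > 0" using \<kappa> by simp
      have exp_lim: "(\<lambda>n. exp (- (real n * b))) \<longlonglongrightarrow> 0" "(\<lambda>n. real n * exp (- (real n * b))) \<longlonglongrightarrow> 0" if "b > 0" for b
        using that by real_asymp+
      have "(\<lambda>n. 2 * exp (- (real n * c)) / \<epsilon> + real n * exp (- (real n * (\<kappa> / 2)))) \<longlonglongrightarrow> 2 * 0 / \<epsilon> + 0"
        using \<epsilon> by (intro tendsto_intros exp_lim c k) auto
      then show ?thesis by simp
    qed
    then have "eventually (\<lambda>n. 2 * exp (- (real n * c)) / \<epsilon> + real n * exp (- (real n * (\<kappa> / 2))) < 1) sequentially"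
      by (rule order_tendstoD) simp
    then obtain n0 where n0: "\<And>n. n \<ge> n0 \<Longrightarrow> 2 * exp (- (real n * c)) / \<epsilon> + real n * exp (- (real n * (\<kappa> / 2))) < 1"
      by (auto simp: eventually_sequentially)
    have "\<exists>x D. awgn_code h n M B p \<epsilon> x D" if n: "n \<ge> n0" and M: "1 \<le> M" "n \<le> M" "real M \<le> exp (real n * r)" for n M
    proof -
      define \<gamma> where "\<gamma> = real n * (L - \<delta>)"
      have "exp (s * \<gamma>) * K ^ n = (exp (s * (L - \<delta>)) * K) ^ n"
        by (simp add: \<gamma>_def power_mult_distrib exp_of_nat_mult[symmetric] algebra_simps)
      also have "\<dots> \<le> exp (- (s * \<delta> / 4)) ^ n" using K by (intro power_mono) auto
      also have "\<dots> = exp (- (real n * c))" by (simp add: c_def exp_of_nat_mult[symmetric])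
      finally have 1: "exp (s * \<gamma>) * K ^ n \<le> exp (- (real n * c))" .
      have "real M * (exp (- \<gamma>) * (1 / \<theta>) ^ n) \<le> exp (real n * r) * (exp (- \<gamma>) * exp \<tau> ^ n)"
        using M \<theta> by (intro mult_mono power_mono) auto
      also have "\<dots> = exp (real n * r - \<gamma> + real n * \<tau>)"
        by (simp add: exp_of_nat_mult[symmetric] exp_add[symmetric] algebra_simps)
      also have "\<dots> \<le> exp (- (real n * c))"
      proof -
        have "r - (L - \<delta>) + \<tau> \<le> - c" using \<tau>4 c(2) unfolding \<delta>_def by (simp add: field_simps)
        then have "real n * (r - (L - \<delta>) + \<tau>) \<le> real n * (- c)" by (rule mult_left_mono) simp
        then show ?thesis unfolding exp_le_cancel_iff \<gamma>_def by (simp add: algebra_simps)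
      qed
      finally have 2: "real M * (exp (- \<gamma>) * (1 / \<theta>) ^ n) \<le> exp (- (real n * c))" .
      have "\<rho> ^ M \<le> exp (- \<kappa> / 2) ^ M" using \<rho> by (intro power_mono) auto
      also have "\<dots> \<le> exp (- \<kappa> / 2) ^ n" using \<kappa> M by (intro power_decreasing) auto
      also have "\<dots> = exp (- (real n * (\<kappa> / 2)))" by (simp add: exp_of_nat_mult[symmetric])
      finally have 3: "real n * \<rho> ^ M \<le> real n * exp (- (real n * (\<kappa> / 2)))" by (intro mult_left_mono) auto
      have "(exp (s * \<gamma>) * K ^ n + real M * (exp (- \<gamma>) * (1 / \<theta>) ^ n)) / \<epsilon> + real n * \<rho> ^ M \<le>
         2 * exp (- (real n * c)) / \<epsilon> + real n * exp (- (real n * (\<kappa> / 2)))"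
        using 1 2 3 \<epsilon> by (intro add_mono divide_right_mono) auto
      also have "\<dots> < 1" by (rule n0[OF n])
      finally have total: "(exp (s * \<gamma>) * (exp (- s * ln (1 + q * (cmod h)\<^sup>2)) / (1 - s\<^sup>2) / trunc_mass q B) ^ n +
          real M * (exp (- \<gamma>) * (1 / trunc_mass q B) ^ n)) / \<epsilon> +
          real n * (exp (- \<eta> * p) / (1 - \<eta> * q) / trunc_mass q B) ^ M < 1"
        by (simp only: K_def \<rho>_def \<theta>_def L_def a_def S_def)
      have cond: "trunc_mass q B > 0" "0 \<le> s" "s < 1" "\<eta> * q < 1"
        using \<theta>(1) s eq by (auto simp: \<theta>_def)
      from random_codebook[OF q0 cond(1,2,3) \<eta>(1) cond(4) M(1) \<epsilon> total]
      obtain x where "\<And>w t. w < M \<Longrightarrow> t < n \<Longrightarrow> cmod (x w t) \<le> B"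
        "\<And>t. t < n \<Longrightarrow> (\<Sum>w<M. (cmod (x w t))\<^sup>2) \<le> real M * p"
        "(\<Sum>w<M. (\<integral>\<^sup>+z. ennreal (exp (s * (\<gamma> - codeword_info h (q * (cmod h)\<^sup>2) n x w (\<lambda>t. h * x w t + z t)))) +
          (\<Sum>w'\<in>{..<M} - {w}. ennreal (exp (codeword_info h (q * (cmod h)\<^sup>2) n x w' (\<lambda>t. h * x w t + z t) - \<gamma>)))
          \<partial>PiM {..<n} (\<lambda>_. CN01))) \<le> ennreal (\<epsilon> * M)" by blast
      from threshold_code[OF M(1) cond(2) less_imp_le[OF \<epsilon>] this] show ?thesis by blast
    qed
    then show ?thesis by blast
  qed
  show thesis by (rule that[OF B(1) _ p(2) main]) (use p q0 in auto)
qed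

section \<open>Maximum flows and path decompositions\<close>

definition divergence :: "'v set \<Rightarrow> ('v \<times> 'v \<Rightarrow> real) \<Rightarrow> 'v \<Rightarrow> real" where
  "divergence V f u = (\<Sum>w\<in>V. f (u, w)) - (\<Sum>w\<in>V. f (w, u))"

lemma divergence_add: "divergence V (\<lambda>e. f e + g e) u = divergence V f u + divergence V g u"
  by (simp add: divergence_def sum.distrib)

lemma divergence_scale: "divergence V (\<lambda>e. a * f e) u = a * divergence V f u"
  by (simp add: divergence_def sum_distrib_left right_diff_distrib)

lemma divergence_edge:
  assumes "finite V" "v \<in> V" "w \<in> V"
  shows "divergence V (\<lambda>e. of_bool (e = (v, w))) u = of_bool (u = v) - of_bool (u = w)"
  using assms by (auto simp: divergence_def of_bool_def if_distrib cong: if_cong)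

locale flow_network =
  fixes V :: "'v set" and s t :: 'v and c :: "'v \<times> 'v \<Rightarrow> real"
  assumes V: "finite V" and st: "s \<in> V" "t \<in> V" "s \<noteq> t" and c_nonneg: "\<And>e. 0 \<le> c e"
begin

definition flow :: "('v \<times> 'v \<Rightarrow> real) \<Rightarrow> bool" where
  "flow f \<longleftrightarrow> (\<forall>e. 0 \<le> f e \<and> f e \<le> c e) \<and> (\<forall>v\<in>V - {s, t}. divergence V f v = 0)"

lemma flow_bounds: assumes "flow f" shows "0 \<le> f e" "f e \<le> c e"
  using assms unfolding flow_def by blast+

lemma cut_flow:
  assumes f: "\<forall>v\<in>V - {s, t}. divergence V f v = 0" and W: "W \<subseteq> V" "s \<in> W" "t \<notin> W"
  shows "divergence V f s = (\<Sum>v\<in>W. \<Sum>w\<in>V - W. f (v, w)) - (\<Sum>v\<in>W. \<Sum>w\<in>V - W. f (w, v))"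
proof -
  have fW: "finite W" using W V finite_subset by blast
  have "divergence V f s = (\<Sum>v\<in>W. divergence V f v)"
    using W fW f by (subst sum.remove[of W s]) (auto intro!: sum.neutral)
  also have "\<dots> = (\<Sum>v\<in>W. \<Sum>w\<in>V. f (v, w)) - (\<Sum>v\<in>W. \<Sum>w\<in>V. f (w, v))"
    by (simp add: divergence_def sum_subtractf)
  also have "(\<Sum>v\<in>W. \<Sum>w\<in>V. f (v, w)) = (\<Sum>v\<in>W. \<Sum>w\<in>V - W. f (v, w)) + (\<Sum>v\<in>W. \<Sum>w\<in>W. f (v, w))"
    using V W by (subst sum.distrib[symmetric]) (intro sum.cong refl sum.subset_diff)
  also have "(\<Sum>v\<in>W. \<Sum>w\<in>V. f (w, v)) = (\<Sum>v\<in>W. \<Sum>w\<in>V - W. f (w, v)) + (\<Sum>v\<in>W. \<Sum>w\<in>W. f (w, v))"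
    using V W by (subst sum.distrib[symmetric]) (intro sum.cong refl sum.subset_diff)
  also have "(\<Sum>v\<in>W. \<Sum>w\<in>W. f (w, v)) = (\<Sum>v\<in>W. \<Sum>w\<in>W. f (v, w))" by (rule sum.swap)
  finally show ?thesis by simp
qed

text \<open>Flows form a closed subset of a product of compact intervals, and the divergence at
  \<open>s\<close> is a finite sum of coordinates, hence continuous in the product topology.\<close>

lemma max_flow_exists: "\<exists>f. flow f \<and> (\<forall>g. flow g \<longrightarrow> divergence V g s \<le> divergence V f s)"
proof -
  let ?F = "{f. flow f}"
  have cont: "continuous_on UNIV (\<lambda>f. divergence V f v)" for v
    unfolding divergence_def by (intro continuous_intros continuous_on_product_coordinates)
  have "compact (PiE UNIV (\<lambda>e. {0..c e}))"
  proof -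
    have "compactin (product_topology (\<lambda>_. euclidean) UNIV) (PiE UNIV (\<lambda>e. {0..c e}))"
      by (subst compactin_PiE) (auto simp: compactin_euclidean_iff)
    then show ?thesis by (simp add: euclidean_product_topology compactin_euclidean_iff)
  qed
  moreover have "closed {f. \<forall>v\<in>V - {s, t}. divergence V f v = 0}"
    unfolding Collect_ball_eq by (intro closed_INT ballI closed_Collect_eq cont continuous_on_const)
  moreover have "?F = PiE UNIV (\<lambda>e. {0..c e}) \<inter> {f. \<forall>v\<in>V - {s, t}. divergence V f v = 0}"
    by (auto simp: flow_def PiE_def Pi_def)
  ultimately have "compact ?F" by (simp add: compact_Int_closed)
  moreover have "(\<lambda>_. 0) \<in> ?F" using c_nonneg by (simp add: flow_def divergence_def)
  ultimately obtain f where "f \<in> ?F" "\<forall>g\<in>?F. divergence V g s \<le> divergence V f s"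
    using continuous_attains_sup[of ?F "\<lambda>f. divergence V f s"] continuous_on_subset[OF cont] by blast
  then show ?thesis by auto
qed

text \<open>Directions in which a flow can be perturbed form a convex cone, so the nodes to which a unit
  of flow can be pushed from the source in a feasible direction are closed under residual edges.\<close>
definition feasible_direction :: "('v \<times> 'v \<Rightarrow> real) \<Rightarrow> ('v \<times> 'v \<Rightarrow> real) \<Rightarrow> bool" where
  "feasible_direction f g \<longleftrightarrow> (\<forall>e. (f e = 0 \<longrightarrow> 0 \<le> g e) \<and> (f e = c e \<longrightarrow> g e \<le> 0)) \<and> (\<forall>e. e \<notin> V \<times> V \<longrightarrow> g e = 0)"

definition pushable :: "('v \<times> 'v \<Rightarrow> real) \<Rightarrow> 'v set" where
  "pushable f = {w\<in>V. \<exists>g. feasible_direction f g \<and> (\<forall>u\<in>V. divergence V g u = of_bool (u = s) - of_bool (u = w))}"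

text \<open>A feasible direction can be followed for a small positive step. Only finitely many edges
  lie in \<open>V \<times> V\<close>, so one step size suits them all.\<close>

lemma augment:
  assumes f: "flow f" and t: "t \<in> pushable f"
  shows "\<exists>f'. flow f' \<and> divergence V f' s > divergence V f s"
proof -
  obtain g where g: "feasible_direction f g" "\<And>u. u \<in> V \<Longrightarrow> divergence V g u = of_bool (u = s) - of_bool (u = t)"
    using t by (auto simp: pushable_def)
  have "eventually (\<lambda>\<epsilon>. \<forall>e\<in>V \<times> V. 0 \<le> f e + \<epsilon> * g e \<and> f e + \<epsilon> * g e \<le> c e) (at_right 0)"
  proof (intro eventually_ball_finite ballI eventually_conj)
    fix e
    have lim: "((\<lambda>\<epsilon>. f e + \<epsilon> * g e) \<longlongrightarrow> f e + 0 * g e) (at_right 0)" by (intro tendsto_intros)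
    have pos: "eventually (\<lambda>\<epsilon>::real. \<epsilon> > 0) (at_right 0)" by (simp add: eventually_at_right_less)
    show "eventually (\<lambda>\<epsilon>. 0 \<le> f e + \<epsilon> * g e) (at_right 0)"
    proof (cases "f e = 0")
      case True
      then have "0 \<le> g e" using g(1) unfolding feasible_direction_def by blast
      then show ?thesis using True pos by (auto elim!: eventually_mono)
    next
      case False
      then have "f e > 0" using flow_bounds[OF f, of e] by linarith
      then have "eventually (\<lambda>\<epsilon>. 0 < f e + \<epsilon> * g e) (at_right 0)" using lim by (intro order_tendstoD) auto
      then show ?thesis by (auto elim!: eventually_mono)
    qed
    show "eventually (\<lambda>\<epsilon>. f e + \<epsilon> * g e \<le> c e) (at_right 0)"
    proof (cases "f e = c e")
      case True
      then have "g e \<le> 0" using g(1) unfolding feasible_direction_def by blast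
      then show ?thesis using True pos by (auto elim!: eventually_mono simp: mult_le_0_iff)
    next
      case False
      then have "f e < c e" using flow_bounds[OF f, of e] by linarith
      then have "eventually (\<lambda>\<epsilon>. f e + \<epsilon> * g e < c e) (at_right 0)" using lim by (intro order_tendstoD) auto
      then show ?thesis by (auto elim!: eventually_mono)
    qed
  qed (use V in auto)
  moreover have "eventually (\<lambda>\<epsilon>::real. \<epsilon> > 0) (at_right 0)" by (simp add: eventually_at_right_less)
  ultimately have "eventually (\<lambda>\<epsilon>. \<epsilon> > 0 \<and> (\<forall>e\<in>V \<times> V. 0 \<le> f e + \<epsilon> * g e \<and> f e + \<epsilon> * g e \<le> c e)) (at_right 0)"
    by eventually_elim simp
  then obtain \<epsilon> where \<epsilon>: "\<epsilon> > 0" "\<And>e. e \<in> V \<times> V \<Longrightarrow> 0 \<le> f e + \<epsilon> * g e \<and> f e + \<epsilon> * g e \<le> c e"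
    using eventually_happens'[OF trivial_limit_at_right_real] by blast
  define f' where "f' = (\<lambda>e. f e + \<epsilon> * g e)"
  have div: "divergence V f' u = divergence V f u + \<epsilon> * (of_bool (u = s) - of_bool (u = t))" if "u \<in> V" for u
    unfolding f'_def by (simp add: divergence_add divergence_scale g(2)[OF that])
  have "0 \<le> f' e \<and> f' e \<le> c e" for e
  proof (cases "e \<in> V \<times> V")
    case False
    then have "g e = 0" using g(1) unfolding feasible_direction_def by blast
    then show ?thesis using flow_bounds[OF f, of e] unfolding f'_def by simp
  qed (use \<epsilon>(2) in \<open>simp add: f'_def\<close>)
  moreover have "divergence V f' v = 0" if "v \<in> V - {s, t}" for v
    using that f div[of v] by (simp add: flow_def)
  ultimately have "flow f'" by (simp add: flow_def)
  moreover have "divergence V f' s > divergence V f s" using div[OF st(1)] st(3) \<epsilon>(1) by simp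
  ultimately show ?thesis by blast
qed

text \<open>Otherwise +1 on \<open>(v, w)\<close> or -1 on \<open>(w, v)\<close> could be added to
  the direction that reaches \<open>v\<close>, and \<open>w\<close> would be pushable as
  well.\<close>

lemma pushable_step:
  assumes f: "flow f" and v: "v \<in> pushable f" and w: "w \<in> V" "w \<notin> pushable f"
  shows "f (v, w) = c (v, w)" "f (w, v) = 0"
proof -
  obtain g where g: "feasible_direction f g" "\<And>u. u \<in> V \<Longrightarrow> divergence V g u = of_bool (u = s) - of_bool (u = v)"
    and vV: "v \<in> V"
    using v by (auto simp: pushable_def)
  have g1: "0 \<le> g e" if "f e = 0" for e using g(1) that unfolding feasible_direction_def by blast
  have g2: "g e \<le> 0" if "f e = c e" for e using g(1) that unfolding feasible_direction_def by blast
  have g3: "g e = 0" if "e \<notin> V \<times> V" for e using g(1) that unfolding feasible_direction_def by blast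
  show "f (v, w) = c (v, w)"
  proof (rule ccontr)
    assume ne: "f (v, w) \<noteq> c (v, w)"
    let ?g = "\<lambda>e. g e + of_bool (e = (v, w))"
    have "feasible_direction f ?g"
      unfolding feasible_direction_def
    proof (intro conjI allI impI)
      show "0 \<le> ?g e" if "f e = 0" for e using g1[OF that] by simp
      show "?g e \<le> 0" if "f e = c e" for e using g2[OF that] that ne by auto
      show "?g e = 0" if "e \<notin> V \<times> V" for e using g3[OF that] that vV w by auto
    qed
    moreover have "divergence V ?g u = of_bool (u = s) - of_bool (u = w)" if "u \<in> V" for u
      using g(2)[OF that] by (simp add: divergence_add divergence_edge[OF V vV w(1)])
    ultimately show False using w by (auto simp: pushable_def)
  qed
  show "f (w, v) = 0"
  proof (rule ccontr)
    assume ne: "f (w, v) \<noteq> 0"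
    let ?g = "\<lambda>e. g e + (- 1) * of_bool (e = (w, v))"
    have "feasible_direction f ?g"
      unfolding feasible_direction_def
    proof (intro conjI allI impI)
      show "0 \<le> ?g e" if "f e = 0" for e using g1[OF that] that ne by auto
      show "?g e \<le> 0" if "f e = c e" for e using g2[OF that] by (cases "e = (w, v)") auto
      show "?g e = 0" if "e \<notin> V \<times> V" for e using g3[OF that] that vV w by auto
    qed
    moreover have "divergence V ?g u = of_bool (u = s) - of_bool (u = w)" if "u \<in> V" for u
      using g(2)[OF that] by (simp only: divergence_add divergence_scale divergence_edge[OF V w(1) vV]) simp
    ultimately show False using w by (auto simp: pushable_def)
  qed
qed

text \<open>At a maximum the sink is not pushable. The pushable nodes then form a cut that is
  saturated outwards and empty inwards, so the flow value equals its capacity.\<close>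

theorem max_flow_ge:
  assumes cuts: "\<And>W. W \<subseteq> V \<Longrightarrow> s \<in> W \<Longrightarrow> t \<notin> W \<Longrightarrow> r \<le> (\<Sum>v\<in>W. \<Sum>w\<in>V - W. c (v, w))"
  obtains f where "flow f" "divergence V f s \<ge> r"
proof -
  obtain f where f: "flow f" and max: "\<And>g. flow g \<Longrightarrow> divergence V g s \<le> divergence V f s"
    using max_flow_exists by blast
  have t: "t \<notin> pushable f" using augment[OF f] max by (meson not_less)
  have "feasible_direction f (\<lambda>_. 0)" by (simp add: feasible_direction_def)
  then have s: "s \<in> pushable f" using st by (auto simp: pushable_def divergence_def intro!: exI[of _ "\<lambda>_. 0"])
  have W: "pushable f \<subseteq> V" by (auto simp: pushable_def)
  have "divergence V f s = (\<Sum>v\<in>pushable f. \<Sum>w\<in>V - pushable f. f (v, w)) - (\<Sum>v\<in>pushable f. \<Sum>w\<in>V - pushable f. f (w, v))"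
    using f by (intro cut_flow W s t) (simp add: flow_def)
  also have "\<dots> = (\<Sum>v\<in>pushable f. \<Sum>w\<in>V - pushable f. c (v, w))"
    using pushable_step[OF f] by simp
  also have "\<dots> \<ge> r" by (rule cuts[OF W s t])
  finally show thesis using that f by blast
qed

definition path :: "'v list \<Rightarrow> bool" where
  "path p \<longleftrightarrow> distinct p \<and> set p \<subseteq> V \<and> 2 \<le> length p \<and> hd p = s \<and> last p = t"

definition path_edges :: "'v list \<Rightarrow> ('v \<times> 'v) set" where
  "path_edges p = {(p ! k, p ! Suc k) |k. Suc k < length p}"

lemma walk_of_reachable:
  assumes "(s, v) \<in> E\<^sup>*"
  shows "\<exists>p. p \<noteq> [] \<and> distinct p \<and> hd p = s \<and> last p = v \<and> (\<forall>k. Suc k < length p \<longrightarrow> (p ! k, p ! Suc k) \<in> E)"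
  using assms
proof (induction rule: rtrancl_induct)
  case base
  show ?case by (intro exI[of _ "[s]"]) auto
next
  case (step y z)
  then obtain p where p: "p \<noteq> []" "distinct p" "hd p = s" "last p = y" "\<And>k. Suc k < length p \<Longrightarrow> (p ! k, p ! Suc k) \<in> E"
    by blast
  show ?case
  proof (cases "z \<in> set p")
    case True
    then obtain i where i: "i < length p" "p ! i = z" by (auto simp: in_set_conv_nth)
    \<comment> \<open>When the walk returns to a visited node it is cut back to that visit, which
      keeps the nodes distinct.\<close>
    let ?q = "take (Suc i) p"
    have "last ?q = z" using i by (simp add: take_Suc_conv_app_nth)
    moreover have "hd ?q = s" using p by simp
    moreover have "(?q ! k, ?q ! Suc k) \<in> E" if "Suc k < length ?q" for k using that p(5)[of k] by simp
    ultimately show ?thesis using p by (intro exI[of _ ?q]) auto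
  next
    case False
    let ?q = "p @ [z]"
    have "(?q ! k, ?q ! Suc k) \<in> E" if k: "Suc k < length ?q" for k
    proof (cases "Suc k < length p")
      case True then show ?thesis using p(5)[of k] by (simp add: nth_append)
    next
      case False
      then have "k = length p - 1" "length p > 0" using k p(1) by auto
      then show ?thesis using p step(2) by (simp add: nth_append last_conv_nth)
    qed
    then show ?thesis using p False by (intro exI[of _ ?q]) auto
  qed
qed

text \<open>Since the nodes are distinct, the edge indicator is a sum over positions, and the
  divergences of consecutive edges telescope.\<close>

lemma divergence_path:
  assumes p: "path p" and u: "u \<in> V"
  shows "divergence V (\<lambda>e. of_bool (e \<in> path_edges p)) u = of_bool (u = s) - of_bool (u = t)"
proof -
  let ?l = "length p - 1"
  have l: "length p = Suc ?l" "p \<noteq> []" using p by (auto simp: path_def)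
  have inj: "p ! k = p ! k' \<longleftrightarrow> k = k'" if "k < length p" "k' < length p" for k k'
    using p that by (simp add: path_def nth_eq_iff_index_eq)
  have ind: "of_bool (e \<in> path_edges p) = (\<Sum>k<?l. of_bool (e = (p ! k, p ! Suc k)) :: real)" for e
  proof (cases "e \<in> path_edges p")
    case True
    then obtain k where "Suc k < length p" "e = (p ! k, p ! Suc k)" unfolding path_edges_def by blast
    then have k: "k < ?l" "e = (p ! k, p ! Suc k)" by auto
    have "of_bool (e = (p ! j, p ! Suc j)) = (if j = k then 1 else 0 :: real)" if "j < ?l" for j
      using inj[of k j] that k l by auto
    then have "(\<Sum>j<?l. of_bool (e = (p ! j, p ! Suc j)) :: real) = (\<Sum>j<?l. if j = k then 1 else 0)"
      by (intro sum.cong refl) auto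
    then show ?thesis using True k by simp
  next
    case False
    then have "e \<noteq> (p ! k, p ! Suc k)" if "k < ?l" for k using that l by (auto simp: path_edges_def)
    then show ?thesis using False by (auto intro!: sum.neutral[symmetric])
  qed
  have mem: "p ! k \<in> V" if "k < length p" for k using p that nth_mem unfolding path_def by blast
  have "divergence V (\<lambda>e. of_bool (e \<in> path_edges p)) u = (\<Sum>k<?l. divergence V (\<lambda>e. of_bool (e = (p ! k, p ! Suc k))) u)"
    unfolding ind divergence_def sum_subtractf by (intro arg_cong2[where f = "(-)"] sum.swap)
  also have "\<dots> = (\<Sum>k<?l. of_bool (u = p ! k) - of_bool (u = p ! Suc k))"
    using l mem by (intro sum.cong refl divergence_edge V) auto
  also have "\<dots> = of_bool (u = p ! 0) - of_bool (u = p ! ?l)"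
    by (rule sum_lessThan_telescope')
  finally show ?thesis using p l by (simp add: path_def hd_conv_nth last_conv_nth)
qed

text \<open>If \<open>t\<close> were not reachable along edges of positive flow, the reachable nodes
  would form a cut with no outgoing flow, against a positive divergence at \<open>s\<close>.\<close>

lemma positive_path:
  assumes f: "flow f" and pos: "divergence V f s > 0"
  obtains p where "path p" "\<And>e. e \<in> path_edges p \<Longrightarrow> f e > 0"
proof -
  let ?E = "{e\<in>V \<times> V. f e > 0}"
  define W where "W = {v\<in>V. (s, v) \<in> ?E\<^sup>*}"
  have "t \<in> W"
  proof (rule ccontr)
    assume t: "t \<notin> W"
    have z: "f (v, w) = 0" if "v \<in> W" "w \<in> V - W" for v w
    proof (rule ccontr)
      assume "f (v, w) \<noteq> 0"
      then have "f (v, w) > 0" using flow_bounds[OF f, of "(v, w)"] by linarith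
      then have "(v, w) \<in> ?E" using that by (auto simp: W_def)
      then have "(s, w) \<in> ?E\<^sup>*" using that by (auto simp: W_def intro: rtrancl_into_rtrancl)
      then show False using that by (auto simp: W_def)
    qed
    have "divergence V f s = (\<Sum>v\<in>W. \<Sum>w\<in>V - W. f (v, w)) - (\<Sum>v\<in>W. \<Sum>w\<in>V - W. f (w, v))"
      using f st t by (intro cut_flow) (auto simp: flow_def W_def)
    also have "\<dots> \<le> 0" using z flow_bounds[OF f] by (simp add: sum_nonneg)
    finally show False using pos by simp
  qed
  then have "(s, t) \<in> ?E\<^sup>*" by (simp add: W_def)
  from walk_of_reachable[OF this] obtain p where p: "p \<noteq> []" "distinct p" "hd p = s" "last p = t"
    "\<And>k. Suc k < length p \<Longrightarrow> (p ! k, p ! Suc k) \<in> ?E" by blast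
  have len: "2 \<le> length p"
  proof (rule ccontr)
    assume "\<not> ?thesis"
    moreover have "length p > 0" using p(1) by simp
    ultimately have "length p = 1" by linarith
    then obtain x where "p = [x]" by (auto simp: length_Suc_conv)
    then show False using p(3,4) st(3) by simp
  qed
  have "p ! k \<in> V" if "k < length p" for k
  proof (cases "Suc k < length p")
    case True then show ?thesis using p(5)[of k] by auto
  next
    case False
    then have "k = Suc (k - 1)" "Suc (k - 1) < length p" using that len by auto
    then show ?thesis using p(5)[of "k - 1"] by auto
  qed
  then have "path p" using p len by (auto simp: path_def in_set_conv_nth)
  moreover have "f e > 0" if "e \<in> path_edges p" for e using that p(5) by (auto simp: path_edges_def)
  ultimately show thesis using that by blast
qed

lemma path_edges_V: assumes "path p" shows "path_edges p \<subseteq> V \<times> V"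
proof -
  have "p ! k \<in> V" if "k < length p" for k using assms that nth_mem unfolding path_def by blast
  then show ?thesis by (auto simp: path_edges_def)
qed

lemma path_edges_nonempty: assumes "path p" shows "path_edges p \<noteq> {}"
proof -
  have "Suc 0 < length p" using assms by (simp add: path_def)
  then have "(p ! 0, p ! Suc 0) \<in> path_edges p" unfolding path_edges_def by blast
  then show ?thesis by blast
qed

text \<open>Induction on the number of edges with positive flow. Removing the bottleneck along a
  positive path empties an edge; the last removal is shortened so that the total is exactly
  \<open>r\<close>. Circulations and surplus flow may stay behind, hence the inequality on each
  edge.\<close>

theorem path_decomposition:
  assumes "flow f" "0 \<le> r" "r \<le> divergence V f s"
  shows "\<exists>L. (\<forall>(p, x)\<in>set L. path p \<and> x > 0) \<and> (\<Sum>(p, x)\<leftarrow>L. x) = r \<and>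
     (\<forall>e. (\<Sum>(p, x)\<leftarrow>L. if e \<in> path_edges p then x else 0) \<le> f e)"
  using assms
proof (induction "card {e\<in>V \<times> V. f e > 0}" arbitrary: f r rule: less_induct)
  case less
  note f = less.prems(1)
  show ?case
  proof (cases "r = 0")
    case True
    then show ?thesis using flow_bounds[OF f] by (intro exI[of _ "[]"]) simp
  next
    case False
    then have r: "r > 0" using less.prems by simp
    then have "divergence V f s > 0" using less.prems(3) by linarith
    from positive_path[OF f this] obtain p where p: "path p" "\<And>e. e \<in> path_edges p \<Longrightarrow> f e > 0"
      by blast
    have fin: "finite (path_edges p)" using path_edges_V[OF p(1)] V by (meson finite_SigmaI finite_subset)
    define \<mu> where "\<mu> = Min (f ` path_edges p)"
    have \<mu>: "\<mu> > 0" "\<And>e. e \<in> path_edges p \<Longrightarrow> \<mu> \<le> f e" "\<mu> \<in> f ` path_edges p"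
      using fin path_edges_nonempty[OF p(1)] p(2) by (auto simp: \<mu>_def)
    \<comment> \<open>Either \<open>r\<close> is used up here, or a whole bottleneck is removed and
      the induction measure drops.\<close>
    define \<delta> where "\<delta> = min \<mu> r"
    have \<delta>: "\<delta> > 0" "\<delta> \<le> \<mu>" "\<delta> \<le> r" using \<mu> r by (auto simp: \<delta>_def)
    define f' where "f' = (\<lambda>e. f e + (- \<delta>) * of_bool (e \<in> path_edges p))"
    have f'_le: "f' e \<le> f e" and f'_ge: "0 \<le> f' e" for e
      using \<delta> \<mu>(2)[of e] flow_bounds[OF f, of e] by (auto simp: f'_def of_bool_def)
    have div: "divergence V f' u = divergence V f u - \<delta> * (of_bool (u = s) - of_bool (u = t))" if "u \<in> V" for u
      unfolding f'_def divergence_add divergence_scale divergence_path[OF p(1) that] by simp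
    have f': "flow f'"
      unfolding flow_def
    proof (intro conjI allI ballI)
      show "0 \<le> f' e" "f' e \<le> c e" for e using f'_le[of e] f'_ge[of e] flow_bounds[OF f, of e] by linarith+
      show "divergence V f' v = 0" if "v \<in> V - {s, t}" for v using that f div[of v] by (simp add: flow_def)
    qed
    have "\<exists>L. (\<forall>(p, x)\<in>set L. path p \<and> x > 0) \<and> (\<Sum>(p, x)\<leftarrow>L. x) = r - \<delta> \<and>
     (\<forall>e. (\<Sum>(p, x)\<leftarrow>L. if e \<in> path_edges p then x else 0) \<le> f' e)"
    proof (cases "\<delta> = r")
      case True
      then show ?thesis using f'_ge by (intro exI[of _ "[]"]) auto
    next
      case False
      then have "\<delta> = \<mu>" by (auto simp: \<delta>_def min_def split: if_splits)
      then obtain e where e: "e \<in> path_edges p" "f e = \<delta>" using \<mu>(3) by auto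
      then have "f' e = 0" by (simp add: f'_def)
      moreover have "f e > 0" "e \<in> V \<times> V" using e p path_edges_V[OF p(1)] by auto
      moreover have "{e\<in>V \<times> V. f' e > 0} \<subseteq> {e\<in>V \<times> V. f e > 0}" using f'_le by (force intro: less_le_trans)
      ultimately have "{e\<in>V \<times> V. f' e > 0} \<subset> {e\<in>V \<times> V. f e > 0}" by force
      then have "card {e\<in>V \<times> V. f' e > 0} < card {e\<in>V \<times> V. f e > 0}"
        using V by (intro psubset_card_mono) auto
      then show ?thesis
        using less.hyps[OF _ f', of "r - \<delta>"] \<delta> less.prems(3) div[OF st(1)] st(3) by simp
    qed
    then obtain L where L: "\<forall>(p, x)\<in>set L. path p \<and> x > 0" "(\<Sum>(p, x)\<leftarrow>L. x) = r - \<delta>"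
      "\<And>e. (\<Sum>(p, x)\<leftarrow>L. if e \<in> path_edges p then x else 0) \<le> f' e" by blast
    have "(\<Sum>(p, x)\<leftarrow>(p, \<delta>) # L. if e \<in> path_edges p then x else 0) \<le> f e" for e
      using L(3)[of e] by (auto simp: f'_def)
    then show ?thesis using L p \<delta> by (intro exI[of _ "(p, \<delta>) # L"]) auto
  qed
qed

end

section \<open>Pipelined decode-and-forward\<close>

text \<open>A uniformly chosen tuple has uniform coordinates; written with products, so that nothing
  is divided by a cardinality.\<close>

lemma sum_PiE_coordinate:
  fixes \<phi> :: "'b \<Rightarrow> real"
  assumes I: "finite I" "i \<in> I" and A: "\<And>j. j \<in> I \<Longrightarrow> finite (A j)"
  shows "card (A i) * (\<Sum>f\<in>PiE I A. \<phi> (f i)) = card (PiE I A) * (\<Sum>a\<in>A i. \<phi> a)"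
proof -
  have "(\<Sum>f\<in>PiE I A. \<phi> (f i)) = (\<Sum>f\<in>PiE I A. \<Prod>j\<in>I. if j = i then \<phi> (f j) else 1)"
    using I by (intro sum.cong refl) (simp add: prod.remove)
  also have "\<dots> = (\<Prod>j\<in>I. \<Sum>a\<in>A j. if j = i then \<phi> a else 1)"
    by (rule prod_sum_PiE[symmetric]) (use I A in auto)
  also have "\<dots> = (\<Sum>a\<in>A i. \<phi> a) * (\<Prod>j\<in>I - {i}. real (card (A j)))"
    using I by (subst prod.remove[of I i]) (auto intro!: arg_cong2[where f = "(*)"] prod.cong)
  finally have "card (A i) * (\<Sum>f\<in>PiE I A. \<phi> (f i)) = (card (A i) * (\<Prod>j\<in>I - {i}. real (card (A j)))) * (\<Sum>a\<in>A i. \<phi> a)"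
    by simp
  also have "card (A i) * (\<Prod>j\<in>I - {i}. real (card (A j))) = card (PiE I A)"
    using I by (simp add: card_PiE prod.remove[of I i])
  finally show ?thesis .
qed

text \<open>A superblock has \<open>T\<close> channel uses and runs through the states
  \<open>S\<close>. On path \<open>pt \<kappa>\<close>, hop \<open>k\<close> owns the
  \<open>nu \<kappa> k\<close> slots given by \<open>th \<kappa> k\<close> and has its own link
  code. Each of the \<open>nb\<close> data pieces of the path comes from an alphabet of size
  \<open>al \<kappa>\<close>, and \<open>N + 1\<close> further superblocks let the pipeline drain.
  In \<open>power\<close>, \<open>K * (N + 1) * nb\<close> bounds the number of link decodings, and
  \<open>B\<^sup>2\<close> the energy spent once any of them has failed.\<close>

locale pipeline =
  fixes m :: mode and N :: nat and h :: "nat \<Rightarrow> nat \<Rightarrow> complex" and P :: real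
    and T nb K n :: nat
    and pt :: "nat \<Rightarrow> nat list" and S :: "nat \<Rightarrow> state"
    and nu :: "nat \<Rightarrow> nat \<Rightarrow> nat" and th :: "nat \<Rightarrow> nat \<Rightarrow> nat \<Rightarrow> nat" and al :: "nat \<Rightarrow> nat"
    and x :: "nat \<Rightarrow> nat \<Rightarrow> nat \<Rightarrow> nat \<Rightarrow> complex" and D :: "nat \<Rightarrow> nat \<Rightarrow> (nat \<Rightarrow> complex) \<Rightarrow> nat"
    and B p e :: real
  assumes T_pos: "T > 0" and n_ge: "(nb + N + 1) * T \<le> n"
    and S_states: "\<And>\<tau>. S \<tau> \<in> states m N"
    and pt: "\<And>\<kappa>. \<kappa> < K \<Longrightarrow> distinct (pt \<kappa>) \<and> set (pt \<kappa>) \<subseteq> {0..N+1} \<and> 2 \<le> length (pt \<kappa>) \<and> pt \<kappa> ! 0 = 0 \<and> last (pt \<kappa>) = N + 1"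
    and th: "\<And>\<kappa> k q. \<kappa> < K \<Longrightarrow> Suc k < length (pt \<kappa>) \<Longrightarrow> q < nu \<kappa> k \<Longrightarrow>
      th \<kappa> k q < T \<and> active (S (th \<kappa> k q)) (pt \<kappa> ! k) (pt \<kappa> ! Suc k)"
    and th_inj: "\<And>\<kappa> k q \<kappa>' k' q'. \<kappa> < K \<Longrightarrow> Suc k < length (pt \<kappa>) \<Longrightarrow> q < nu \<kappa> k \<Longrightarrow>
      \<kappa>' < K \<Longrightarrow> Suc k' < length (pt \<kappa>') \<Longrightarrow> q' < nu \<kappa>' k' \<Longrightarrow>
      th \<kappa> k q = th \<kappa>' k' q' \<Longrightarrow> pt \<kappa> ! k = pt \<kappa>' ! k' \<Longrightarrow> \<kappa> = \<kappa>' \<and> k = k' \<and> q = q'"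
    and al: "\<And>\<kappa>. \<kappa> < K \<Longrightarrow> al \<kappa> \<ge> 1"
    and codes: "\<And>\<kappa> k. \<kappa> < K \<Longrightarrow> Suc k < length (pt \<kappa>) \<Longrightarrow>
      awgn_code (h (pt \<kappa> ! Suc k) (pt \<kappa> ! k)) (nu \<kappa> k) (al \<kappa>) B p e (x \<kappa> k) (D \<kappa> k)"
    and e: "e \<ge> 0" and power: "p + B\<^sup>2 * (real (K * (N + 1) * nb) * e) \<le> P" "P \<ge> 0"
begin

definition hop :: "nat \<Rightarrow> nat \<Rightarrow> bool" where
  "hop \<kappa> k \<longleftrightarrow> \<kappa> < K \<and> Suc k < length (pt \<kappa>)"

text \<open>A message is a table of digits: entry \<open>(\<kappa>, b)\<close> is piece
  \<open>b\<close> sent along path \<open>\<kappa>\<close>.\<close>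

definition Msgs :: "(nat \<times> nat \<Rightarrow> nat) set" where
  "Msgs = PiE ({..<K} \<times> {..<nb}) (\<lambda>i. {..<al (fst i)})"

definition dg :: "nat \<Rightarrow> nat \<times> nat \<Rightarrow> nat" where
  "dg = (SOME f. bij_betw f {0..<card Msgs} Msgs)"

text \<open>The channel uses after the last superblock are idle and pad the code to length
  \<open>n\<close>.\<close>

definition sched :: "nat \<Rightarrow> state" where
  "sched t = (if t < (nb + N + 1) * T then S (t mod T) else (\<lambda>_. ({}, {})))"

definition at_slot :: "nat \<Rightarrow> nat \<Rightarrow> nat \<times> nat \<times> nat \<Rightarrow> bool" where
  "at_slot i \<tau> = (\<lambda>(\<kappa>, k, q). hop \<kappa> k \<and> q < nu \<kappa> k \<and> th \<kappa> k q = \<tau> \<and> pt \<kappa> ! k = i)"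

text \<open>\<open>est\<close> stands for what the sender believes: the source inserts the true
  digits, a relay its decoded ones. Transmission then follows the same rule for both.\<close>

definition signal :: "nat \<Rightarrow> nat \<Rightarrow> (nat \<Rightarrow> nat \<Rightarrow> nat \<Rightarrow> nat) \<Rightarrow> complex" where
  "signal i t est = (if t < (nb + N + 1) * T \<and> (\<exists>s. at_slot i (t mod T) s) then
     (case SOME s. at_slot i (t mod T) s of (\<kappa>, k, q) \<Rightarrow>
        if k \<le> t div T \<and> t div T - k < nb then x \<kappa> k (est \<kappa> k (t div T - k)) q else 0) else 0)"

text \<open>In superblock \<open>b + k\<close>, hop \<open>k\<close> of path \<open>\<kappa>\<close> carries piece \<open>b\<close> of that path's data; a relay
  re-encodes what it decodes from the preceding superblock.\<close>
definition net_code :: code where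
  "net_code = \<lparr> blen = n, nmsg = card Msgs,
     src = (\<lambda>w t. (sched t 0, signal 0 t (\<lambda>\<kappa> k b. dg w (\<kappa>, b)))),
     rel = (\<lambda>i t Y. (sched t i, signal i t (\<lambda>\<kappa> k b. D \<kappa> (k - 1) (\<lambda>q. Y ((b + (k - 1)) * T + th \<kappa> (k - 1) q))))),
     dst = (\<lambda>t Y. sched t (N + 1)),
     dec = (\<lambda>Y. SOME w. w < card Msgs \<and> (\<forall>\<kappa><K. \<forall>b<nb. dg w (\<kappa>, b) =
        D \<kappa> (length (pt \<kappa>) - 2) (\<lambda>q. Y ((b + (length (pt \<kappa>) - 2)) * T + th \<kappa> (length (pt \<kappa>) - 2) q)))) \<rparr>"

lemma net_code_simps[simp]:
  "blen net_code = n" "nmsg net_code = card Msgs"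
  "src net_code w t = (sched t 0, signal 0 t (\<lambda>\<kappa> k b. dg w (\<kappa>, b)))"
  "rel net_code i t Y = (sched t i, signal i t (\<lambda>\<kappa> k b. D \<kappa> (k - 1) (\<lambda>q. Y ((b + (k - 1)) * T + th \<kappa> (k - 1) q))))"
  "dst net_code t Y = sched t (N + 1)"
  by (simp_all add: net_code_def)

sublocale code_run N h net_code .

abbreviation "M \<equiv> card Msgs"

lemma finite_Msgs: "finite Msgs"
  unfolding Msgs_def by (intro finite_PiE) auto

lemma dg_bij: "bij_betw dg {0..<M} Msgs"
proof -
  have "\<exists>f. bij_betw f {0..<M} Msgs" by (rule ex_bij_betw_nat_finite[OF finite_Msgs])
  then show ?thesis unfolding dg_def by (rule someI_ex)
qed

lemma dg_less: "w < M \<Longrightarrow> \<kappa> < K \<Longrightarrow> b < nb \<Longrightarrow> dg w (\<kappa>, b) < al \<kappa>"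
proof -
  assume a: "w < M" "\<kappa> < K" "b < nb"
  then have "dg w \<in> Msgs" using bij_betwE[OF dg_bij] by auto
  then show ?thesis using a by (auto simp: Msgs_def PiE_def Pi_def)
qed

lemma dg_inj:
  assumes "w < M" "w' < M" "\<And>\<kappa> b. \<kappa> < K \<Longrightarrow> b < nb \<Longrightarrow> dg w (\<kappa>, b) = dg w' (\<kappa>, b)"
  shows "w = w'"
proof -
  have "dg w \<in> Msgs" "dg w' \<in> Msgs" using assms bij_betwE[OF dg_bij] by auto
  then have "dg w = dg w'" using assms(3) unfolding Msgs_def by (intro PiE_ext) auto
  then show ?thesis using assms bij_betw_imp_inj_on[OF dg_bij] by (auto simp: inj_on_def)
qed

lemma M_card: "M = (\<Prod>\<kappa><K. al \<kappa> ^ nb)"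
proof -
  have "M = (\<Prod>i\<in>{..<K} \<times> {..<nb}. al (fst i))" unfolding Msgs_def by (subst card_PiE) auto
  also have "\<dots> = (\<Prod>\<kappa><K. \<Prod>b<nb. al \<kappa>)"
    unfolding prod.cartesian_product by (intro prod.cong) auto
  finally show ?thesis by simp
qed

lemma M_pos: "M > 0"
  unfolding M_card using al by (intro prod_pos zero_less_power) (auto simp: Suc_le_eq)

lemma sum_digit:
  fixes \<phi> :: "nat \<Rightarrow> real"
  assumes "\<kappa> < K" "b < nb"
  shows "al \<kappa> * (\<Sum>w<M. \<phi> (dg w (\<kappa>, b))) = M * (\<Sum>a<al \<kappa>. \<phi> a)"
proof -
  have "(\<Sum>w<M. \<phi> (dg w (\<kappa>, b))) = (\<Sum>f\<in>Msgs. \<phi> (f (\<kappa>, b)))"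
    using sum.reindex_bij_betw[OF dg_bij, of "\<lambda>f. \<phi> (f (\<kappa>, b))"] by (simp add: lessThan_atLeast0)
  then show ?thesis
    using sum_PiE_coordinate[of "{..<K} \<times> {..<nb}" "(\<kappa>, b)" "\<lambda>i. {..<al (fst i)}" \<phi>] assms
    by (simp add: Msgs_def)
qed

lemma sched_states: "sched t \<in> states m N"
  using S_states idle_state by (simp add: sched_def)

lemma sched_out: "i > N + 1 \<Longrightarrow> sched t i = ({}, {})"
  using sched_states[of t] by (auto simp: states_def)

lemma st_eq: "st w z t = sched t"
proof
  fix i
  consider "i = 0" | "i \<noteq> 0" "i \<le> N" | "i = N + 1" | "i > N + 1" by linarith
  then show "st w z t i = sched t i"
    by cases (simp_all add: st_def choice_def sched_out)
qed

lemma X_source: "X w z t 0 = signal 0 t (\<lambda>\<kappa> k b. dg w (\<kappa>, b))"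
  by (simp add: X_def choice_def)

lemma X_relay:
  assumes "i \<in> {1..N}"
  shows "X w z t i = signal i t (\<lambda>\<kappa> k b. D \<kappa> (k - 1) (\<lambda>q. H w z t i ((b + (k - 1)) * T + th \<kappa> (k - 1) q)))"
  using assms by (simp add: X_def choice_def)

lemma at_slot_unique: "at_slot i \<tau> s \<Longrightarrow> at_slot i \<tau> s' \<Longrightarrow> s = s'"
  using th_inj by (auto simp: at_slot_def hop_def split: prod.splits)

lemma signal_at:
  assumes "at_slot i (t mod T) (\<kappa>, k, q)"
  shows "signal i t est = (if t < (nb + N + 1) * T \<and> k \<le> t div T \<and> t div T - k < nb then x \<kappa> k (est \<kappa> k (t div T - k)) q else 0)"
proof -
  have "(SOME s. at_slot i (t mod T) s) = (\<kappa>, k, q)"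
    using assms at_slot_unique by (intro some_equality) auto
  then show ?thesis using assms by (auto simp: signal_def)
qed

lemma signal_none: "\<nexists>s. at_slot i (t mod T) s \<Longrightarrow> signal i t est = 0"
  by (simp add: signal_def)

lemma hop_nodes:
  assumes "hop \<kappa> k"
  shows "pt \<kappa> ! k \<in> {0..N}" "pt \<kappa> ! Suc k \<in> {1..N+1}" "k > 0 \<Longrightarrow> pt \<kappa> ! k \<in> {1..N}" "k \<le> N" "length (pt \<kappa>) \<le> N + 2"
proof -
  have \<kappa>: "\<kappa> < K" "Suc k < length (pt \<kappa>)" using assms by (auto simp: hop_def)
  note p = pt[OF \<kappa>(1)]
  have mem: "pt \<kappa> ! j \<in> {0..N+1}" if "j < length (pt \<kappa>)" for j using p that nth_mem by blast
  have l: "pt \<kappa> ! (length (pt \<kappa>) - 1) = N + 1" using p \<kappa> by (subst last_conv_nth[symmetric]) auto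
  have inj: "j = j'" if "pt \<kappa> ! j = pt \<kappa> ! j'" "j < length (pt \<kappa>)" "j' < length (pt \<kappa>)" for j j'
    using p that by (simp add: nth_eq_iff_index_eq)
  have "pt \<kappa> ! k \<noteq> N + 1"
  proof
    assume "pt \<kappa> ! k = N + 1"
    then have "pt \<kappa> ! k = pt \<kappa> ! (length (pt \<kappa>) - 1)" using l by (simp only:)
    then have "k = length (pt \<kappa>) - 1" by (rule inj) (use \<kappa> in auto)
    then show False using \<kappa> by linarith
  qed
  then show 1: "pt \<kappa> ! k \<in> {0..N}" using mem[of k] \<kappa> by auto
  have "pt \<kappa> ! Suc k \<noteq> 0"
  proof
    assume "pt \<kappa> ! Suc k = 0"
    then have "pt \<kappa> ! Suc k = pt \<kappa> ! 0" using p by (simp only:)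
    then have "Suc k = 0" by (rule inj) (use \<kappa> in auto)
    then show False by simp
  qed
  then show "pt \<kappa> ! Suc k \<in> {1..N+1}" using mem[of "Suc k"] \<kappa> by auto
  show "pt \<kappa> ! k \<in> {1..N}" if "k > 0"
  proof -
    have "pt \<kappa> ! k \<noteq> 0"
    proof
      assume "pt \<kappa> ! k = 0"
      then have "pt \<kappa> ! k = pt \<kappa> ! 0" using p by (simp only:)
      then have "k = 0" by (rule inj) (use \<kappa> in auto)
      then show False using that by simp
    qed
    then show ?thesis using 1 by auto
  qed
  have "length (pt \<kappa>) = card (set (pt \<kappa>))" using p by (simp add: distinct_card)
  also have "\<dots> \<le> card {0..N+1}" using p by (intro card_mono) auto
  finally show "length (pt \<kappa>) \<le> N + 2" by simp
  then show "k \<le> N" using \<kappa> by linarith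
qed

lemma slot_time:
  assumes "hop \<kappa> k" "q < nu \<kappa> k" "b < nb"
  shows "((b + k) * T + th \<kappa> k q) mod T = th \<kappa> k q" "((b + k) * T + th \<kappa> k q) div T = b + k"
    "(b + k) * T + th \<kappa> k q < (nb + N + 1) * T" "(b + k) * T + th \<kappa> k q < n"
    "(b + k) * T + th \<kappa> k q < (b + Suc k) * T"
    "sched ((b + k) * T + th \<kappa> k q) = S (th \<kappa> k q)"
proof -
  have t: "th \<kappa> k q < T" using th assms by (auto simp: hop_def)
  then show 1: "((b + k) * T + th \<kappa> k q) mod T = th \<kappa> k q" "((b + k) * T + th \<kappa> k q) div T = b + k" by auto
  show 2: "(b + k) * T + th \<kappa> k q < (b + Suc k) * T" using t by simp
  have "b + Suc k \<le> nb + N + 1" using hop_nodes(4)[OF assms(1)] assms(3) by linarith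
  then have "(b + Suc k) * T \<le> (nb + N + 1) * T" by (rule mult_le_mono1)
  with 2 show 3: "(b + k) * T + th \<kappa> k q < (nb + N + 1) * T" by linarith
  then show "(b + k) * T + th \<kappa> k q < n" using n_ge by linarith
  show "sched ((b + k) * T + th \<kappa> k q) = S (th \<kappa> k q)" using 3 1(1) by (simp add: sched_def)
qed

lemma at_slot_hop: "hop \<kappa> k \<Longrightarrow> q < nu \<kappa> k \<Longrightarrow> at_slot (pt \<kappa> ! k) (th \<kappa> k q) (\<kappa>, k, q)"
  by (simp add: at_slot_def)

section \<open>Propagation of correct decoding along a path\<close>

lemma mean_hop:
  assumes hop: "hop \<kappa> k" and q: "q < nu \<kappa> k" and b: "b < nb"
  shows "mean w z ((b + k) * T + th \<kappa> k q) (pt \<kappa> ! Suc k) =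
    h (pt \<kappa> ! Suc k) (pt \<kappa> ! k) * X w z ((b + k) * T + th \<kappa> k q) (pt \<kappa> ! k)"
proof -
  let ?t = "(b + k) * T + th \<kappa> k q" and ?i = "pt \<kappa> ! k" and ?j = "pt \<kappa> ! Suc k"
  have act: "active (S (th \<kappa> k q)) ?i ?j" using th hop q by (auto simp: hop_def)
  have st: "st w z ?t = S (th \<kappa> k q)" by (simp only: st_eq slot_time(6)[OF hop q b])
  have j: "?j \<in> {0..N+1}" using hop_nodes(2)[OF hop] by auto
  have ij: "?i \<noteq> ?j" using pt[of \<kappa>] hop by (simp add: hop_def nth_eq_iff_index_eq)
  have iN: "?i \<in> {0..N} - {?j}" using hop_nodes(1)[OF hop] ij by auto
  have uniq: "active (S (th \<kappa> k q)) i' ?j \<longleftrightarrow> i' = ?i" if "i' \<in> {0..N} - {?j}" for i'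
  proof
    assume "active (S (th \<kappa> k q)) i' ?j"
    then have "card {i', ?i} \<le> card {i \<in> {0..N} - {?j}. active (S (th \<kappa> k q)) i ?j}"
      using that act iN by (intro card_mono) auto
    also have "\<dots> \<le> 1" by (rule active_card_dest[OF S_states j])
    finally show "i' = ?i" by (cases "i' = ?i") auto
  qed (use act in simp)
  have "mean w z ?t ?j = (\<Sum>i\<in>{0..N} - {?j}. if i = ?i then h ?j ?i * X w z ?t ?i else 0)"
    unfolding mean_def st by (intro sum.cong refl) (simp add: uniq)
  also have "\<dots> = h ?j ?i * X w z ?t ?i" using iN by (subst sum.delta) auto
  finally show ?thesis .
qed

text \<open>Stated for the codeword that ought to be sent, not for the one actually sent. The event
  thus involves the noise of one hop and one superblock only, and its probability is that of the
  link code even though earlier relays may have erred.\<close>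

definition good :: "nat \<Rightarrow> (nat \<times> nat \<Rightarrow> complex) \<Rightarrow> nat \<Rightarrow> nat \<Rightarrow> nat \<Rightarrow> bool" where
  "good w z \<kappa> k b \<longleftrightarrow> D \<kappa> k (\<lambda>q. h (pt \<kappa> ! Suc k) (pt \<kappa> ! k) * x \<kappa> k (dg w (\<kappa>, b)) q +
      z ((b + k) * T + th \<kappa> k q, pt \<kappa> ! Suc k)) = dg w (\<kappa>, b)"

lemma D_cong:
  assumes "hop \<kappa> k" "\<And>q. q < nu \<kappa> k \<Longrightarrow> Y q = Y' q"
  shows "D \<kappa> k Y = D \<kappa> k Y'"
proof -
  have "\<forall>y y'. (\<forall>q<nu \<kappa> k. y q = y' q) \<longrightarrow> D \<kappa> k y = D \<kappa> k y'"
    using codes[of \<kappa> k] assms(1) unfolding awgn_code_def hop_def by blast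
  then show ?thesis using assms(2) by blast
qed

lemma decode_step:
  assumes hop: "hop \<kappa> k" and b: "b < nb" and good: "good w z \<kappa> k b"
    and sent: "\<And>q. q < nu \<kappa> k \<Longrightarrow> X w z ((b + k) * T + th \<kappa> k q) (pt \<kappa> ! k) = x \<kappa> k (dg w (\<kappa>, b)) q"
    and t: "(b + Suc k) * T \<le> t"
  shows "D \<kappa> k (\<lambda>q. H w z t (pt \<kappa> ! Suc k) ((b + k) * T + th \<kappa> k q)) = dg w (\<kappa>, b)"
proof -
  have "H w z t (pt \<kappa> ! Suc k) ((b + k) * T + th \<kappa> k q) = h (pt \<kappa> ! Suc k) (pt \<kappa> ! k) * x \<kappa> k (dg w (\<kappa>, b)) q +
      z ((b + k) * T + th \<kappa> k q, pt \<kappa> ! Suc k)" if q: "q < nu \<kappa> k" for q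
  proof -
    have "(b + k) * T + th \<kappa> k q < t" using slot_time(5)[OF hop q b] t by linarith
    then show ?thesis unfolding hist_eq mean_hop[OF hop q b] sent[OF q] by (simp only: if_True add.commute)
  qed
  then have "D \<kappa> k (\<lambda>q. H w z t (pt \<kappa> ! Suc k) ((b + k) * T + th \<kappa> k q)) =
     D \<kappa> k (\<lambda>q. h (pt \<kappa> ! Suc k) (pt \<kappa> ! k) * x \<kappa> k (dg w (\<kappa>, b)) q + z ((b + k) * T + th \<kappa> k q, pt \<kappa> ! Suc k))"
    by (rule D_cong[OF hop])
  then show ?thesis using good by (simp add: good_def)
qed

text \<open>Induction along the path: if the preceding hop carried the right codeword and its link
  decoder succeeds on it, the relay has recovered the digit before its own superblock for this piece
  begins.\<close>

lemma sent_correct: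
  assumes "hop \<kappa> k" "b < nb" "\<And>k'. k' < k \<Longrightarrow> good w z \<kappa> k' b" "q < nu \<kappa> k"
  shows "X w z ((b + k) * T + th \<kappa> k q) (pt \<kappa> ! k) = x \<kappa> k (dg w (\<kappa>, b)) q"
  using assms
proof (induction k arbitrary: q)
  case 0
  note s = slot_time[OF 0(1,4,2)]
  have p0: "pt \<kappa> ! 0 = 0" using pt[of \<kappa>] 0(1) by (simp add: hop_def)
  have "at_slot 0 (((b + 0) * T + th \<kappa> 0 q) mod T) (\<kappa>, 0, q)"
    using at_slot_hop[OF 0(1,4)] p0 by (simp only: s(1))
  from signal_at[OF this] show ?case
    unfolding p0 X_source using s(2,3) 0(2) by simp
next
  case (Suc k)
  have hop: "hop \<kappa> k" using Suc.prems(1) by (simp add: hop_def)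
  note s = slot_time[OF Suc.prems(1,4,2)]
  let ?t = "(b + Suc k) * T + th \<kappa> (Suc k) q"
  have i: "pt \<kappa> ! Suc k \<in> {1..N}" using hop_nodes(3)[OF Suc.prems(1)] by simp
  have sent: "X w z ((b + k) * T + th \<kappa> k q') (pt \<kappa> ! k) = x \<kappa> k (dg w (\<kappa>, b)) q'" if "q' < nu \<kappa> k" for q'
    using Suc.prems that by (intro Suc.IH hop) auto
  have d: "D \<kappa> k (\<lambda>q. H w z ?t (pt \<kappa> ! Suc k) ((b + k) * T + th \<kappa> k q)) = dg w (\<kappa>, b)"
    using Suc.prems by (intro decode_step hop sent) auto
  have "at_slot (pt \<kappa> ! Suc k) (?t mod T) (\<kappa>, Suc k, q)"
    using at_slot_hop[OF Suc.prems(1,4)] by (simp only: s(1))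
  from signal_at[OF this] show ?case
    unfolding X_relay[OF i] using s(2,3) Suc.prems(2) d by simp
qed

definition all_good :: "nat \<Rightarrow> (nat \<times> nat \<Rightarrow> complex) \<Rightarrow> bool" where
  "all_good w z \<longleftrightarrow> (\<forall>\<kappa> k b. hop \<kappa> k \<longrightarrow> b < nb \<longrightarrow> good w z \<kappa> k b)"

lemma all_goodD: "all_good w z \<Longrightarrow> hop \<kappa> k \<Longrightarrow> b < nb \<Longrightarrow> good w z \<kappa> k b"
  unfolding all_good_def by blast

lemma decoded:
  assumes g: "all_good w z" and hop: "hop \<kappa> k" and b: "b < nb" and t: "(b + Suc k) * T \<le> t"
  shows "D \<kappa> k (\<lambda>q. H w z t (pt \<kappa> ! Suc k) ((b + k) * T + th \<kappa> k q)) = dg w (\<kappa>, b)"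
proof (rule decode_step[OF hop b all_goodD[OF g hop b] _ t])
  fix q assume "q < nu \<kappa> k"
  moreover have "good w z \<kappa> k' b" if "k' < k" for k'
    using that hop by (intro all_goodD[OF g _ b]) (simp add: hop_def)
  ultimately show "X w z ((b + k) * T + th \<kappa> k q) (pt \<kappa> ! k) = x \<kappa> k (dg w (\<kappa>, b)) q"
    by (intro sent_correct hop b)
qed

definition final_digit :: "(nat \<Rightarrow> complex) \<Rightarrow> nat \<Rightarrow> nat \<Rightarrow> nat" where
  "final_digit Y \<kappa> b = D \<kappa> (length (pt \<kappa>) - 2) (\<lambda>q. Y ((b + (length (pt \<kappa>) - 2)) * T + th \<kappa> (length (pt \<kappa>) - 2) q))"

lemma last_hop:
  assumes "\<kappa> < K"
  shows "hop \<kappa> (length (pt \<kappa>) - 2)" "pt \<kappa> ! Suc (length (pt \<kappa>) - 2) = N + 1"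
proof -
  have l: "2 \<le> length (pt \<kappa>)" "last (pt \<kappa>) = N + 1" using pt[OF assms] by auto
  then show "hop \<kappa> (length (pt \<kappa>) - 2)" using assms by (simp add: hop_def)
  have "Suc (length (pt \<kappa>) - 2) = length (pt \<kappa>) - 1" using l by simp
  moreover have "pt \<kappa> \<noteq> []" using l by auto
  ultimately show "pt \<kappa> ! Suc (length (pt \<kappa>) - 2) = N + 1" using l by (simp add: last_conv_nth)
qed

text \<open>Justifies the \<open>SOME\<close> in the decoder: digits within their ranges form a
  table in \<open>Msgs\<close>, and \<open>dg\<close> enumerates the tables bijectively, so exactly
  one message fits.\<close>

lemma dec_iff:
  assumes w: "w < M" and digits: "\<And>\<kappa> b. \<kappa> < K \<Longrightarrow> b < nb \<Longrightarrow> final_digit Y \<kappa> b < al \<kappa>"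
  shows "dec net_code Y = w \<longleftrightarrow> (\<forall>\<kappa><K. \<forall>b<nb. dg w (\<kappa>, b) = final_digit Y \<kappa> b)"
proof -
  let ?P = "\<lambda>w. w < M \<and> (\<forall>\<kappa><K. \<forall>b<nb. dg w (\<kappa>, b) = final_digit Y \<kappa> b)"
  have d: "dec net_code Y = (SOME w. ?P w)" by (simp add: net_code_def final_digit_def)
  have "(\<lambda>i\<in>{..<K} \<times> {..<nb}. final_digit Y (fst i) (snd i)) \<in> Msgs"
    unfolding Msgs_def using digits by (intro restrict_PiE_iff[THEN iffD2]) auto
  then obtain v where v: "v < M" "dg v = (\<lambda>i\<in>{..<K} \<times> {..<nb}. final_digit Y (fst i) (snd i))"
    using bij_betw_imp_surj_on[OF dg_bij] by (auto simp: image_iff dest!: equalityD2[THEN subsetD])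
  then have Pv: "?P v" by simp
  have uv: "u = v" if "?P u" for u
  proof (rule dg_inj)
    show "u < M" "v < M" using that Pv by auto
    show "dg u (\<kappa>, b) = dg v (\<kappa>, b)" if "\<kappa> < K" "b < nb" for \<kappa> b
      using \<open>?P u\<close> Pv that by simp
  qed
  have dv: "dec net_code Y = v" unfolding d by (rule some_equality) (rule Pv, erule uv)
  show ?thesis unfolding dv
  proof
    assume "v = w" then show "\<forall>\<kappa><K. \<forall>b<nb. dg w (\<kappa>, b) = final_digit Y \<kappa> b" using Pv by simp
  next
    assume "\<forall>\<kappa><K. \<forall>b<nb. dg w (\<kappa>, b) = final_digit Y \<kappa> b"
    then show "v = w" using uv[of w] w by simp
  qed
qed

lemma D_less: "hop \<kappa> k \<Longrightarrow> D \<kappa> k Y < al \<kappa>"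
  using codes[of \<kappa> k] unfolding awgn_code_def hop_def by blast

lemma dec_correct:
  assumes "w < M" "all_good w z"
  shows "dec net_code (H w z n (N + 1)) = w"
proof -
  have "final_digit (H w z n (N + 1)) \<kappa> b = dg w (\<kappa>, b)" if "\<kappa> < K" "b < nb" for \<kappa> b
  proof -
    note l = last_hop[OF that(1)]
    have "b + Suc (length (pt \<kappa>) - 2) \<le> nb + N + 1"
      using hop_nodes(4)[OF l(1)] that(2) by linarith
    then have "(b + Suc (length (pt \<kappa>) - 2)) * T \<le> (nb + N + 1) * T" by (rule mult_le_mono1)
    then have "(b + Suc (length (pt \<kappa>) - 2)) * T \<le> n" using n_ge by linarith
    from decoded[OF assms(2) l(1) that(2) this] show ?thesis by (simp only: l(2) final_digit_def)
  qed
  then show ?thesis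
    using assms(1) dg_less by (subst dec_iff) auto
qed

end

context pipeline
begin

section \<open>Measurability, error probability and transmit power of the network code\<close>

lemma D_measurable:
  assumes "hop \<kappa> k" "\<And>q. q < nu \<kappa> k \<Longrightarrow> (\<lambda>\<omega>. Y \<omega> q) \<in> borel_measurable L"
  shows "(\<lambda>\<omega>. D \<kappa> k (Y \<omega>)) \<in> measurable L (count_space UNIV)"
  by (rule awgn_decoder_measurable[OF codes]) (use assms in \<open>auto simp: hop_def\<close>)

lemma noise_component_measurable:
  assumes "t < n" "j \<in> {1..N+1}" shows "(\<lambda>z. z (t, j)) \<in> borel_measurable (noise N n)"
  using measurable_component_singleton[of "(t, j)" "{..<n} \<times> {1..N+1}" "\<lambda>_. CN01"] assms
  by (simp add: noise_def measurable_cong_sets[OF refl sets_CN01])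

lemma H_measurable_of_X:
  assumes X: "\<And>t' i. t' < t \<Longrightarrow> i \<in> {0..N} \<Longrightarrow> (\<lambda>z. X w z t' i) \<in> borel_measurable (noise N n)"
    and t: "t \<le> n" and j: "j \<in> {1..N+1}"
  shows "(\<lambda>z. H w z t j \<tau>) \<in> borel_measurable (noise N n)"
proof (cases "\<tau> < t")
  case True
  have "(\<lambda>z. if active (sched \<tau>) i j then h j i * X w z \<tau> i else 0) \<in> borel_measurable (noise N n)"
    if "i \<in> {0..N} - {j}" for i
  proof (cases "active (sched \<tau>) i j")
    case True': True
    have [measurable]: "(\<lambda>z. X w z \<tau> i) \<in> borel_measurable (noise N n)" using that by (intro X True) auto
    show ?thesis using True' by simp
  qed simp
  then have "(\<lambda>z. mean w z \<tau> j) \<in> borel_measurable (noise N n)"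
    unfolding mean_def st_eq by (rule borel_measurable_sum)
  then have "(\<lambda>z. z (\<tau>, j) + mean w z \<tau> j) \<in> borel_measurable (noise N n)"
    using noise_component_measurable[of \<tau> j] True t j by (intro borel_measurable_add) auto
  then show ?thesis using True by (simp add: hist_eq)
qed (simp add: hist_eq)

text \<open>Strong induction on time. The past enters a relay's input only through a decoded digit,
  a discrete variable, and any function of such a variable is measurable.\<close>

lemma X_measurable:
  "t < n \<Longrightarrow> i \<in> {0..N} \<Longrightarrow> (\<lambda>z. X w z t i) \<in> borel_measurable (noise N n)"
proof (induction t arbitrary: i rule: less_induct)
  case (less t)
  show ?case
  proof (cases "i = 0")
    case True
    then show ?thesis by (simp add: X_source)
  next
    case False
    then have i: "i \<in> {1..N}" using less.prems by auto
    show ?thesis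
    proof (cases "\<exists>s. at_slot i (t mod T) s")
      case False
      then show ?thesis by (simp add: X_relay[OF i] signal_none)
    next
      case True
      then obtain \<kappa> k q where s: "at_slot i (t mod T) (\<kappa>, k, q)" by auto
      then have hop: "hop \<kappa> k" "pt \<kappa> ! k = i" by (auto simp: at_slot_def)
      \<comment> \<open>Position 0 of a path is the source, so a relay has \<open>k \<ge> 1\<close>
        and \<open>k - 1\<close> is the hop on which it received.\<close>
      have "k \<noteq> 0" using hop i pt[of \<kappa>] by (auto simp: hop_def intro!: gr0I)
      then have hop': "hop \<kappa> (k - 1)" using hop by (auto simp: hop_def)
      have Hm: "(\<lambda>z. H w z t i \<tau>) \<in> borel_measurable (noise N n)" for \<tau>
        using i less.prems by (intro H_measurable_of_X less.IH) auto
      have Dm: "(\<lambda>z. D \<kappa> (k - 1) (\<lambda>q. H w z t i ((t div T - k + (k - 1)) * T + th \<kappa> (k - 1) q))) \<in> measurable (noise N n) (count_space UNIV)"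
        by (intro D_measurable hop' Hm)
      have "(\<lambda>a. x \<kappa> k a q) \<in> measurable (count_space UNIV) borel" by simp
      note c = measurable_compose[OF Dm this]
      show ?thesis
        unfolding X_relay[OF i] signal_at[OF s]
        by (cases "t < (nb + N + 1) * T \<and> k \<le> t div T \<and> t div T - k < nb")
           (simp_all only: if_True if_False simp_thms c borel_measurable_const)
    qed
  qed
qed

lemma H_measurable:
  "t \<le> n \<Longrightarrow> j \<in> {1..N+1} \<Longrightarrow> (\<lambda>z. H w z t j \<tau>) \<in> borel_measurable (noise N n)"
  by (intro H_measurable_of_X X_measurable) auto

lemma err_event_sets:
  assumes w: "w < M" shows "err_event net_code N h w \<in> sets (noise N n)"
proof -
  let ?Y = "\<lambda>z. H w z n (N + 1)"
  have meas: "{z \<in> space (noise N n). dg w i = final_digit (?Y z) (fst i) (snd i)} \<in> sets (noise N n)"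
    if i: "i \<in> {..<K} \<times> {..<nb}" for i
  proof -
    have "(\<lambda>z. final_digit (?Y z) (fst i) (snd i)) \<in> measurable (noise N n) (count_space UNIV)"
      unfolding final_digit_def using i last_hop by (intro D_measurable H_measurable) auto
    from measurable_sets[OF this, of "{dg w i}"] show ?thesis
      by (simp add: vimage_def Int_def conj_commute eq_commute)
  qed
  have "dec net_code (?Y z) = w \<longleftrightarrow> (\<forall>i\<in>{..<K} \<times> {..<nb}. dg w i = final_digit (?Y z) (fst i) (snd i))" for z
  proof -
    have "final_digit (?Y z) \<kappa> b < al \<kappa>" if "\<kappa> < K" for \<kappa> b
      unfolding final_digit_def by (rule D_less[OF last_hop(1)[OF that]])
    then have "dec net_code (?Y z) = w \<longleftrightarrow> (\<forall>\<kappa><K. \<forall>b<nb. dg w (\<kappa>, b) = final_digit (?Y z) \<kappa> b)"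
      by (intro dec_iff w)
    then show ?thesis by auto
  qed
  then have "err_event net_code N h w = space (noise N n) -
      {z \<in> space (noise N n). \<forall>i\<in>{..<K} \<times> {..<nb}. dg w i = final_digit (?Y z) (fst i) (snd i)}"
    by (auto simp: err_event_def)
  also have "\<dots> \<in> sets (noise N n)"
    by (intro sets.Diff sets.top sets.sets_Collect_finite_All meas) auto
  finally show ?thesis .
qed

definition bad :: "nat \<Rightarrow> nat \<times> nat \<times> nat \<Rightarrow> (nat \<times> nat \<Rightarrow> complex) set" where
  "bad w = (\<lambda>(\<kappa>, k, b). {z \<in> space (noise N n). \<not> good w z \<kappa> k b})"

definition link_error :: "nat \<Rightarrow> nat \<Rightarrow> nat \<Rightarrow> real" where
  "link_error \<kappa> k a = measure (PiM {..<nu \<kappa> k} (\<lambda>_. CN01)) {\<zeta>\<in>space (PiM {..<nu \<kappa> k} (\<lambda>_. CN01)).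
     D \<kappa> k (\<lambda>q. h (pt \<kappa> ! Suc k) (pt \<kappa> ! k) * x \<kappa> k a q + \<zeta> q) \<noteq> a}"

text \<open>The slots of a hop are distinct, so the noise seen there is a reindexed block of
  independent \<open>CN01\<close> variables, exactly as in the definition of the link code.\<close>

lemma bad_measure:
  assumes hop: "hop \<kappa> k" and b: "b < nb"
  shows "bad w (\<kappa>, k, b) \<in> sets (noise N n)" "measure (noise N n) (bad w (\<kappa>, k, b)) = link_error \<kappa> k (dg w (\<kappa>, b))"
proof -
  let ?I = "{..<nu \<kappa> k}" and ?j = "pt \<kappa> ! Suc k"
  let ?f = "\<lambda>q. ((b + k) * T + th \<kappa> k q, ?j)" and ?a = "dg w (\<kappa>, b)"
  let ?g = "h ?j (pt \<kappa> ! k)"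
  let ?PI = "PiM ?I (\<lambda>_. CN01)"
  let ?A = "{\<zeta>\<in>space ?PI. D \<kappa> k (\<lambda>q. ?g * x \<kappa> k ?a q + \<zeta> q) \<noteq> ?a}"
  let ?r = "\<lambda>z. \<lambda>q\<in>?I. z (?f q)"
  have f: "?f q \<in> {..<n} \<times> {1..N+1}" if "q \<in> ?I" for q
    using slot_time(4)[OF hop _ b] hop_nodes(2)[OF hop] that by auto
  have inj: "inj_on ?f ?I"
    using th_inj[of \<kappa> k _ \<kappa> k] hop by (auto simp: inj_on_def hop_def)
  have distr: "distr (noise N n) ?PI ?r = ?PI"
    unfolding noise_def using f inj by (intro distr_PiM_reindex prob_space_CN01) auto
  have rm: "?r \<in> measurable (noise N n) ?PI"
    using f by (intro measurable_restrict) (auto simp: noise_def)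
  have comp: "(\<lambda>\<zeta>. \<zeta> q) \<in> borel_measurable ?PI" if "q < nu \<kappa> k" for q
    using measurable_component_singleton[of q ?I "\<lambda>_. CN01"] that
    by (simp add: measurable_cong_sets[OF refl sets_CN01])
  have "(\<lambda>\<zeta>. D \<kappa> k (\<lambda>q. ?g * x \<kappa> k ?a q + \<zeta> q)) \<in> measurable ?PI (count_space UNIV)"
    by (intro D_measurable hop borel_measurable_add comp) auto
  from measurable_sets[OF this, of "- {?a}"] have A: "?A \<in> sets ?PI"
    by (simp add: vimage_def Int_def conj_commute)
  have "D \<kappa> k (\<lambda>q. ?g * x \<kappa> k ?a q + ?r z q) = D \<kappa> k (\<lambda>q. ?g * x \<kappa> k ?a q + z (?f q))" for z
    by (rule D_cong[OF hop]) simp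
  then have pre: "?r -` ?A \<inter> space (noise N n) = bad w (\<kappa>, k, b)"
    using measurable_space[OF rm] by (auto simp: bad_def good_def)
  show "bad w (\<kappa>, k, b) \<in> sets (noise N n)"
    using measurable_sets[OF rm A] by (simp only: pre)
  have "measure ?PI ?A = measure (distr (noise N n) ?PI ?r) ?A" by (simp only: distr)
  also have "\<dots> = measure (noise N n) (bad w (\<kappa>, k, b))"
    by (subst measure_distr[OF rm A]) (simp only: pre)
  finally show "measure (noise N n) (bad w (\<kappa>, k, b)) = link_error \<kappa> k (dg w (\<kappa>, b))"
    by (simp add: link_error_def)
qed

lemma bad_sum:
  assumes hop: "hop \<kappa> k" and b: "b < nb"
  shows "(\<Sum>w<M. measure (noise N n) (bad w (\<kappa>, k, b))) \<le> e * M"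
proof -
  have \<kappa>: "\<kappa> < K" using hop by (simp add: hop_def)
  have a: "real (al \<kappa>) > 0" using al[OF \<kappa>] by simp
  have "(\<Sum>a<al \<kappa>. link_error \<kappa> k a) \<le> e * al \<kappa>"
    using codes[of \<kappa> k] hop by (simp add: awgn_code_def hop_def link_error_def)
  then have "real M * (\<Sum>a<al \<kappa>. link_error \<kappa> k a) \<le> real M * (e * al \<kappa>)" by (rule mult_left_mono) simp
  then have "al \<kappa> * (\<Sum>w<M. link_error \<kappa> k (dg w (\<kappa>, b))) \<le> al \<kappa> * (e * M)"
    unfolding sum_digit[OF \<kappa> b] by (simp add: mult_ac)
  then show ?thesis using a by (simp add: bad_measure(2)[OF hop b])
qed

definition hop_events :: "(nat \<times> nat \<times> nat) set" where
  "hop_events = {(\<kappa>, k, b). hop \<kappa> k \<and> b < nb}"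

lemma hop_events_card: "finite hop_events" "card hop_events \<le> K * (N + 1) * nb"
proof -
  have sub: "hop_events \<subseteq> {..<K} \<times> {..<N+1} \<times> {..<nb}"
    using hop_nodes(4) by (auto simp: hop_events_def hop_def less_Suc_eq_le)
  then show "finite hop_events" by (rule finite_subset) auto
  have "card hop_events \<le> card ({..<K} \<times> {..<N+1} \<times> {..<nb})" using sub by (intro card_mono) auto
  then show "card hop_events \<le> K * (N + 1) * nb" by (simp only: card_cartesian_product card_lessThan mult.assoc)
qed

definition bad_any :: "nat \<Rightarrow> (nat \<times> nat \<Rightarrow> complex) set" where
  "bad_any w = (\<Union>i\<in>hop_events. bad w i)"

lemma bad_any_iff: "z \<in> space (noise N n) \<Longrightarrow> z \<in> bad_any w \<longleftrightarrow> \<not> all_good w z"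
  by (auto simp: bad_any_def hop_events_def bad_def all_good_def)

lemma bad_any_sets: "bad_any w \<in> sets (noise N n)"
  unfolding bad_any_def using hop_events_card bad_measure(1) by (intro sets.finite_UN) (auto simp: hop_events_def)

lemma bad_any_sum: "(\<Sum>w<M. measure (noise N n) (bad_any w)) \<le> real (K * (N + 1) * nb) * e * M"
proof -
  interpret prob_space "noise N n" unfolding noise_def by (intro prob_space_PiM prob_space_CN01)
  have "(\<Sum>w<M. measure (noise N n) (bad_any w)) \<le> (\<Sum>w<M. \<Sum>i\<in>hop_events. measure (noise N n) (bad w i))"
    unfolding bad_any_def using hop_events_card bad_measure(1)
    by (intro sum_mono finite_measure_subadditive_finite) (auto simp: hop_events_def)
  also have "\<dots> = (\<Sum>i\<in>hop_events. \<Sum>w<M. measure (noise N n) (bad w i))" by (rule sum.swap)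
  also have "\<dots> \<le> (\<Sum>i\<in>hop_events. e * M)"
    using bad_sum by (intro sum_mono) (auto simp: hop_events_def)
  also have "\<dots> = card hop_events * (e * M)" by simp
  also have "\<dots> \<le> real (K * (N + 1) * nb) * (e * M)"
    using hop_events_card(2) e by (intro mult_right_mono of_nat_mono) auto
  finally show ?thesis by (simp add: mult.assoc)
qed

lemma net_error: "err_prob net_code N h \<le> real (K * (N + 1) * nb) * e"
proof -
  interpret prob_space "noise N n" unfolding noise_def by (intro prob_space_PiM prob_space_CN01)
  have "measure (noise N n) (err_event net_code N h w) \<le> measure (noise N n) (bad_any w)" if "w < M" for w
  proof (rule finite_measure_mono[OF _ bad_any_sets], rule subsetI)
    fix z assume z: "z \<in> err_event net_code N h w"
    then have "z \<in> space (noise N n)" by (simp add: err_event_def)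
    moreover have "\<not> all_good w z" using z dec_correct[OF that] by (auto simp: err_event_def)
    ultimately show "z \<in> bad_any w" by (simp add: bad_any_iff)
  qed
  then have "(\<Sum>w<M. measure (noise N n) (err_event net_code N h w)) \<le> (\<Sum>w<M. measure (noise N n) (bad_any w))"
    by (intro sum_mono) simp
  also have "\<dots> \<le> real (K * (N + 1) * nb) * e * M" by (rule bad_any_sum)
  finally show ?thesis using M_pos by (simp add: err_prob_def divide_le_eq)
qed

text \<open>Unless some link decoding fails, the input is a symbol of the intended codeword, whose
  energy averages to at most \<open>p\<close>. After a failure it is still a symbol of the codebook,
  of energy at most \<open>B\<^sup>2\<close>, so the excess is \<open>B\<^sup>2\<close> times the
  failure probability.\<close>

lemma net_power:
  assumes t: "t < n" and i: "i \<in> {0..N}"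
  shows "(\<Sum>w<M. \<integral>\<^sup>+z. ennreal ((cmod (X w z t i))\<^sup>2) \<partial>noise N n) \<le> ennreal (real M * P)"
proof (cases "\<exists>\<kappa> k q. at_slot i (t mod T) (\<kappa>, k, q) \<and> t < (nb + N + 1) * T \<and> k \<le> t div T \<and> t div T - k < nb")
  case False
  have "X w z t i = 0" for w z
  proof -
    have "signal i t est = 0" for est
    proof (cases "\<exists>s. at_slot i (t mod T) s")
      case True
      then obtain \<kappa> k q where s: "at_slot i (t mod T) (\<kappa>, k, q)" by auto
      then show ?thesis using False by (subst signal_at[OF s]) auto
    qed (simp add: signal_none)
    then show ?thesis using i X_source X_relay[of i] by (cases "i = 0") auto
  qed
  then show ?thesis using power by simp
next
  case True
  then obtain \<kappa> k q where s: "at_slot i (t mod T) (\<kappa>, k, q)" and tG: "t < (nb + N + 1) * T"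
    and k: "k \<le> t div T" "t div T - k < nb" by blast
  define b where "b = t div T - k"
  have b: "b < nb" using k by (simp add: b_def)
  have hop: "hop \<kappa> k" and q: "q < nu \<kappa> k" and th_t: "th \<kappa> k q = t mod T" and pi: "pt \<kappa> ! k = i"
    using s by (auto simp: at_slot_def)
  have \<kappa>: "\<kappa> < K" using hop by (simp add: hop_def)
  have t_eq: "t = (b + k) * T + th \<kappa> k q"
    using k by (simp add: b_def th_t)
  have cB: "cmod (x \<kappa> k a q) \<le> B" if "a < al \<kappa>" for a
    using codes[of \<kappa> k] hop q that by (simp add: awgn_code_def hop_def)
  have Xform: "\<exists>a<al \<kappa>. X w z t i = x \<kappa> k a q" if w: "w < M" for w z
  proof (cases "i = 0")
    case True
    then show ?thesis unfolding True X_source signal_at[OF s[unfolded True]]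
      using tG k dg_less[OF w \<kappa>] by auto
  next
    case False
    then have i1: "i \<in> {1..N}" using i by auto
    have "k \<noteq> 0" using hop pi i1 pt[OF \<kappa>] by (auto intro!: gr0I)
    then have "hop \<kappa> (k - 1)" using hop by (auto simp: hop_def)
    then have "D \<kappa> (k - 1) Y < al \<kappa>" for Y by (rule D_less)
    then show ?thesis unfolding X_relay[OF i1] signal_at[OF s] using tG k by auto
  qed
  have XB: "(cmod (X w z t i))\<^sup>2 \<le> B\<^sup>2" if "w < M" for w z
    using Xform[OF that, of z] cB by (auto intro!: power_mono)
  have pt_le: "ennreal ((cmod (X w z t i))\<^sup>2) \<le> ennreal ((cmod (x \<kappa> k (dg w (\<kappa>, b)) q))\<^sup>2) + ennreal (B\<^sup>2) * indicator (bad_any w) z"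
    if w: "w < M" and z: "z \<in> space (noise N n)" for w z
  proof (cases "all_good w z")
    case True
    have "good w z \<kappa> k' b" if "k' < k" for k'
      using that hop by (intro all_goodD[OF True _ b]) (simp add: hop_def)
    then have "X w z t i = x \<kappa> k (dg w (\<kappa>, b)) q"
      using sent_correct[OF hop b _ q, of w z] by (simp only: pi t_eq)
    then show ?thesis by simp
  next
    case False
    then have "indicator (bad_any w) z = (1 :: ennreal)" using bad_any_iff[OF z] by simp
    then show ?thesis using ennreal_leI[OF XB[OF w, of z]] by (simp add: add_increasing)
  qed
  interpret prob_space "noise N n" unfolding noise_def by (intro prob_space_PiM prob_space_CN01)
  have "(\<Sum>w<M. \<integral>\<^sup>+z. ennreal ((cmod (X w z t i))\<^sup>2) \<partial>noise N n) \<le>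
     (\<Sum>w<M. ennreal ((cmod (x \<kappa> k (dg w (\<kappa>, b)) q))\<^sup>2 + B\<^sup>2 * measure (noise N n) (bad_any w)))"
  proof (intro sum_mono)
    fix w assume "w \<in> {..<M}"
    then have w: "w < M" by simp
    have "(\<integral>\<^sup>+z. ennreal ((cmod (X w z t i))\<^sup>2) \<partial>noise N n) \<le>
       (\<integral>\<^sup>+z. ennreal ((cmod (x \<kappa> k (dg w (\<kappa>, b)) q))\<^sup>2) + ennreal (B\<^sup>2) * indicator (bad_any w) z \<partial>noise N n)"
      by (intro nn_integral_mono pt_le w)
    also have "\<dots> = ennreal ((cmod (x \<kappa> k (dg w (\<kappa>, b)) q))\<^sup>2) + ennreal (B\<^sup>2) * emeasure (noise N n) (bad_any w)"
      using bad_any_sets by (simp add: nn_integral_add nn_integral_cmult emeasure_space_1)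
    also have "\<dots> = ennreal ((cmod (x \<kappa> k (dg w (\<kappa>, b)) q))\<^sup>2 + B\<^sup>2 * measure (noise N n) (bad_any w))"
      by (simp add: emeasure_eq_measure ennreal_mult)
    finally show "(\<integral>\<^sup>+z. ennreal ((cmod (X w z t i))\<^sup>2) \<partial>noise N n) \<le>
       ennreal ((cmod (x \<kappa> k (dg w (\<kappa>, b)) q))\<^sup>2 + B\<^sup>2 * measure (noise N n) (bad_any w))" .
  qed
  also have "\<dots> = ennreal ((\<Sum>w<M. (cmod (x \<kappa> k (dg w (\<kappa>, b)) q))\<^sup>2) + B\<^sup>2 * (\<Sum>w<M. measure (noise N n) (bad_any w)))"
    by (subst sum_ennreal) (auto simp: sum.distrib sum_distrib_left)
  also have "\<dots> \<le> ennreal (real M * P)"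
  proof (rule ennreal_leI)
    have "(\<Sum>a<al \<kappa>. (cmod (x \<kappa> k a q))\<^sup>2) \<le> al \<kappa> * p"
      using codes[of \<kappa> k] hop q by (simp add: awgn_code_def hop_def)
    then have "real M * (\<Sum>a<al \<kappa>. (cmod (x \<kappa> k a q))\<^sup>2) \<le> real M * (al \<kappa> * p)" by (rule mult_left_mono) simp
    then have "al \<kappa> * (\<Sum>w<M. (cmod (x \<kappa> k (dg w (\<kappa>, b)) q))\<^sup>2) \<le> al \<kappa> * (M * p)"
      using sum_digit[OF \<kappa> b, of "\<lambda>a. (cmod (x \<kappa> k a q))\<^sup>2"] by (simp add: mult_ac)
    then have 1: "(\<Sum>w<M. (cmod (x \<kappa> k (dg w (\<kappa>, b)) q))\<^sup>2) \<le> M * p"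
      using al[OF \<kappa>] by simp
    have 2: "B\<^sup>2 * (\<Sum>w<M. measure (noise N n) (bad_any w)) \<le> B\<^sup>2 * (real (K * (N + 1) * nb) * e * M)"
      by (intro mult_left_mono bad_any_sum) simp
    have "M * (p + B\<^sup>2 * (real (K * (N + 1) * nb) * e)) \<le> M * P"
      by (intro mult_left_mono power) simp
    then show "(\<Sum>w<M. (cmod (x \<kappa> k (dg w (\<kappa>, b)) q))\<^sup>2) + B\<^sup>2 * (\<Sum>w<M. measure (noise N n) (bad_any w)) \<le> real M * P"
      using 1 2 by (simp add: algebra_simps)
  qed
  finally show ?thesis .
qed

lemma sched_node_ok: "i \<in> {0..N+1} \<Longrightarrow> node_ok m N i (sched t i)"
  using sched_states[of t] by (simp add: states_def)

theorem net_code_valid: "valid_code m N h P net_code"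
  unfolding valid_code_def
proof (intro conjI allI impI ballI)
  have X: "input net_code N h w z i t = X w z t i" for w z i t by (simp add: X_def input_def)
  show "1 \<le> nmsg net_code" using M_pos by simp
  show "node_ok m N 0 (fst (src net_code w t))" for w t using sched_node_ok[of 0] by simp
  show "node_ok m N i (fst (rel net_code i t Y))" if "i \<in> {1..N}" for i t Y using sched_node_ok[of i] that by simp
  show "node_ok m N (N + 1) (dst net_code t Y)" for t Y using sched_node_ok[of "N + 1"] by simp
  show "err_event net_code N h w \<in> sets (noise N (blen net_code))" if "w < nmsg net_code" for w
    using err_event_sets that by simp
  show "(\<lambda>z. input net_code N h w z i t) \<in> borel_measurable (noise N (blen net_code))"
    if "i \<in> {0..N}" "t < blen net_code" for w i t
    unfolding X using X_measurable that by simp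
  show "(\<Sum>w<nmsg net_code. \<integral>\<^sup>+z. ennreal ((cmod (input net_code N h w z i t))\<^sup>2) \<partial>noise N (blen net_code))
      \<le> ennreal (real (nmsg net_code) * P)" if "i \<in> {0..N}" "t < blen net_code" for i t
    unfolding X using net_power that by simp
qed

end

section \<open>Scheduling and achievable rates\<close>

lemma disjoint_subsets_exist:
  assumes "finite J" "finite A" "(\<Sum>j\<in>J. a j) \<le> card A"
  shows "\<exists>F. (\<forall>j\<in>J. F j \<subseteq> A \<and> card (F j) = a j) \<and> disjoint_family_on F J"
  using assms
proof (induction J arbitrary: A rule: finite_induct)
  case (insert j J)
  have le: "a j \<le> card A" using insert.prems insert.hyps by simp
  obtain B where B: "B \<subseteq> A" "card B = a j" "finite B"
    by (rule obtain_subset_with_card_n[OF le])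
  have "(\<Sum>j\<in>J. a j) \<le> card (A - B)"
    using insert.prems insert.hyps B by (simp add: card_Diff_subset)
  moreover have "finite (A - B)" using insert.prems by simp
  ultimately obtain F where F1: "\<forall>i\<in>J. F i \<subseteq> A - B \<and> card (F i) = a i" and F2: "disjoint_family_on F J"
    using insert.IH[of "A - B"] by blast
  have F: "F i \<subseteq> A - B" "card (F i) = a i" if "i \<in> J" for i using F1 that by blast+
  let ?F = "F(j := B)"
  have "?F i \<subseteq> A \<and> card (?F i) = a i" if "i \<in> insert j J" for i
  proof (cases "i = j")
    case False
    then have "i \<in> J" using that by simp
    then show ?thesis using F[of i] False by auto
  qed (simp add: B)
  moreover have "disjoint_family_on ?F (insert j J)"
  proof -
    have "B \<inter> F i = {}" if "i \<in> J" for i using F(1)[OF that] by blast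
    then show ?thesis using F2 insert.hyps by (auto simp: disjoint_family_on_def)
  qed
  ultimately show ?case by blast
qed (auto simp: disjoint_family_on_def)

lemma awgn_code_mono:
  assumes "awgn_code h n M B p e x D" "B \<le> B'" "p \<le> p'"
  shows "awgn_code h n M B' p' e x D"
proof -
  have "real M * p \<le> real M * p'" using assms by (intro mult_left_mono) auto
  then show ?thesis using assms unfolding awgn_code_def by (meson order_trans)
qed

lemma eventually_linear_ge:
  fixes c d :: real
  assumes "c > 0" shows "eventually (\<lambda>T. d \<le> real T * c) sequentially"
proof (rule eventually_sequentiallyI[of "nat \<lceil>d / c\<rceil>"])
  fix T assume "nat \<lceil>d / c\<rceil> \<le> T"
  then have "d / c \<le> real T" by linarith
  then show "d \<le> real T * c" using assms by (simp add: field_simps)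
qed

text \<open>State \<open>s\<close> receives the rounded-down share \<open>T * lam s\<close> of the
  slots. The shares fit into \<open>T\<close> slots, and what rounding leaves over is idle.\<close>

lemma schedule_exists:
  fixes T :: nat
  assumes lam: "lam \<in> prob_vecs (states m N)"
  obtains S :: "nat \<Rightarrow> state" where "\<And>\<tau>. S \<tau> \<in> states m N"
    and "\<And>i j. (\<Sum>s\<in>{s\<in>states m N. active s i j}. nat \<lfloor>real T * lam s\<rfloor>) \<le> card {\<tau>. \<tau> < T \<and> active (S \<tau>) i j}"
proof -
  let ?S = "states m N"
  define a where "a s = nat \<lfloor>real T * lam s\<rfloor>" for s
  have pos: "s \<in> ?S \<Longrightarrow> lam s \<ge> 0" for s using lam by (simp add: prob_vecs_def)
  have "real (\<Sum>s\<in>?S. a s) \<le> (\<Sum>s\<in>?S. real T * lam s)"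
    unfolding of_nat_sum a_def using pos by (intro sum_mono) (simp add: floor_le_iff)
  also have "\<dots> = T" using lam by (simp add: prob_vecs_def sum_distrib_left[symmetric])
  finally have "(\<Sum>s\<in>?S. a s) \<le> card {..<T}" by (simp only: card_lessThan of_nat_le_iff)
  then have "\<exists>F. (\<forall>s\<in>?S. F s \<subseteq> {..<T} \<and> card (F s) = a s) \<and> disjoint_family_on F ?S"
    by (rule disjoint_subsets_exist[OF finite_states finite_lessThan])
  then obtain F where F: "\<And>s. s \<in> ?S \<Longrightarrow> F s \<subseteq> {..<T} \<and> card (F s) = a s" "disjoint_family_on F ?S"
    by blast
  define S where "S \<tau> = (if \<exists>s\<in>?S. \<tau> \<in> F s then SOME s. s \<in> ?S \<and> \<tau> \<in> F s else (\<lambda>_. ({}, {})))" for \<tau>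
  have sel: "S \<tau> \<in> ?S \<and> \<tau> \<in> F (S \<tau>)" if "\<exists>s\<in>?S. \<tau> \<in> F s" for \<tau>
  proof -
    have "\<exists>s. s \<in> ?S \<and> \<tau> \<in> F s" using that by blast
    from someI_ex[OF this] show ?thesis using that by (simp add: S_def)
  qed
  have S: "S \<tau> \<in> ?S" for \<tau>
    using sel[of \<tau>] idle_state by (cases "\<exists>s\<in>?S. \<tau> \<in> F s") (auto simp: S_def)
  have uniq: "S \<tau> = s" if "s \<in> ?S" "\<tau> \<in> F s" for \<tau> s
  proof (rule ccontr)
    assume "S \<tau> \<noteq> s"
    moreover have "S \<tau> \<in> ?S" "\<tau> \<in> F (S \<tau>)" using sel that by blast+
    ultimately have "F (S \<tau>) \<inter> F s = {}" using F(2) that unfolding disjoint_family_on_def by blast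
    then show False using that \<open>\<tau> \<in> F (S \<tau>)\<close> by blast
  qed
  have "(\<Sum>s\<in>{s\<in>?S. active s i j}. a s) \<le> card {\<tau>. \<tau> < T \<and> active (S \<tau>) i j}" for i j
  proof -
    let ?A = "{s\<in>?S. active s i j}"
    have fin: "finite (F s)" if "s \<in> ?S" for s using F(1)[OF that] finite_subset by blast
    have "(\<Sum>s\<in>?A. a s) = (\<Sum>s\<in>?A. card (F s))" using F(1) by (intro sum.cong) auto
    also have "\<dots> = card (\<Union>s\<in>?A. F s)"
      using F(2) fin finite_states[of m N] by (subst card_UN_disjoint) (auto simp: disjoint_family_on_def)
    also have "\<dots> \<le> card {\<tau>. \<tau> < T \<and> active (S \<tau>) i j}"
    proof (rule card_mono)
      show "(\<Union>s\<in>?A. F s) \<subseteq> {\<tau>. \<tau> < T \<and> active (S \<tau>) i j}"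
      proof
        fix \<tau> assume "\<tau> \<in> (\<Union>s\<in>?A. F s)"
        then obtain s where s: "s \<in> ?S" "active s i j" "\<tau> \<in> F s" by blast
        then show "\<tau> \<in> {\<tau>. \<tau> < T \<and> active (S \<tau>) i j}" using uniq[OF s(1,3)] F(1)[OF s(1)] by auto
      qed
    qed simp
    finally show ?thesis .
  qed
  then show thesis using that S unfolding a_def by blast
qed

definition hops :: "nat \<Rightarrow> (nat \<Rightarrow> nat list) \<Rightarrow> (nat \<times> nat) set" where
  "hops K pt = {(\<kappa>, k). \<kappa> < K \<and> Suc k < length (pt \<kappa>)}"

definition hops_on :: "nat \<Rightarrow> (nat \<Rightarrow> nat list) \<Rightarrow> nat \<Rightarrow> nat \<Rightarrow> (nat \<times> nat) set" where
  "hops_on K pt i j = {(\<kappa>, k)\<in>hops K pt. pt \<kappa> ! k = i \<and> pt \<kappa> ! Suc k = j}"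

lemma finite_hops: "finite (hops K pt)" "finite (hops_on K pt i j)"
proof -
  have "hops K pt = (SIGMA \<kappa>:{..<K}. {k. Suc k < length (pt \<kappa>)})" by (auto simp: hops_def)
  moreover have "finite {k. Suc k < length (pt \<kappa>)}" for \<kappa>
    by (rule finite_subset[of _ "{..<length (pt \<kappa>)}"]) auto
  ultimately show 1: "finite (hops K pt)" by (simp add: finite_SigmaI)
  show "finite (hops_on K pt i j)" unfolding hops_on_def by (rule finite_subset[OF _ 1]) auto
qed

text \<open>A node transmitting at a given time does so on one link only, so slots need only be
  kept disjoint among hops that share an edge.\<close>
lemma slots_exist:
  fixes K T :: nat and S :: "nat \<Rightarrow> state" and pt :: "nat \<Rightarrow> nat list" and nu :: "nat \<Rightarrow> nat \<Rightarrow> nat"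
  assumes S: "\<And>\<tau>. S \<tau> \<in> states m N"
    and pt: "\<And>\<kappa>. \<kappa> < K \<Longrightarrow> set (pt \<kappa>) \<subseteq> {0..N+1}"
    and cap: "\<And>i j. (\<Sum>(\<kappa>, k)\<in>hops_on K pt i j. nu \<kappa> k) \<le> card {\<tau>. \<tau> < T \<and> active (S \<tau>) i j}"
  obtains th :: "nat \<Rightarrow> nat \<Rightarrow> nat \<Rightarrow> nat" where "\<And>\<kappa> k q. (\<kappa>, k) \<in> hops K pt \<Longrightarrow> q < nu \<kappa> k \<Longrightarrow>
      th \<kappa> k q < T \<and> active (S (th \<kappa> k q)) (pt \<kappa> ! k) (pt \<kappa> ! Suc k)"
    and "\<And>\<kappa> k q \<kappa>' k' q'. (\<kappa>, k) \<in> hops K pt \<Longrightarrow> q < nu \<kappa> k \<Longrightarrow> (\<kappa>', k') \<in> hops K pt \<Longrightarrow> q' < nu \<kappa>' k' \<Longrightarrow>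
      th \<kappa> k q = th \<kappa>' k' q' \<Longrightarrow> pt \<kappa> ! k = pt \<kappa>' ! k' \<Longrightarrow> \<kappa> = \<kappa>' \<and> k = k' \<and> q = q'"
proof -
  note fJ = finite_hops(2)[of K pt]
  let ?T = "\<lambda>i j. {\<tau>. \<tau> < T \<and> active (S \<tau>) i j}"
  define good where "good i j F \<longleftrightarrow> (\<forall>l\<in>hops_on K pt i j. F l \<subseteq> ?T i j \<and> card (F l) = nu (fst l) (snd l)) \<and> disjoint_family_on F (hops_on K pt i j)" for i j F
  have ex: "\<exists>F. good i j F" for i j
    unfolding good_def
  proof (rule disjoint_subsets_exist[OF fJ])
    show "finite (?T i j)" by simp
    show "(\<Sum>l\<in>hops_on K pt i j. nu (fst l) (snd l)) \<le> card (?T i j)" using cap[of i j] by (simp add: split_def)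
  qed
  define F where "F i j = (SOME F. good i j F)" for i j
  have good: "good i j (F i j)" for i j unfolding F_def by (rule someI_ex[OF ex])
  have F1: "F i j l \<subseteq> ?T i j \<and> card (F i j l) = nu (fst l) (snd l)" if "l \<in> hops_on K pt i j" for i j l
    using good[of i j] that unfolding good_def by blast
  have F2: "F i j l \<inter> F i j l' = {}" if "l \<in> hops_on K pt i j" "l' \<in> hops_on K pt i j" "l \<noteq> l'" for i j l l'
    using good[of i j] that unfolding good_def disjoint_family_on_def by blast
  define A where "A \<kappa> k = F (pt \<kappa> ! k) (pt \<kappa> ! Suc k) (\<kappa>, k)" for \<kappa> k
  have inJ: "(\<kappa>, k) \<in> hops_on K pt (pt \<kappa> ! k) (pt \<kappa> ! Suc k)" if "(\<kappa>, k) \<in> hops K pt" for \<kappa> k using that by (simp add: hops_on_def)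
  have A: "A \<kappa> k \<subseteq> ?T (pt \<kappa> ! k) (pt \<kappa> ! Suc k)" "card (A \<kappa> k) = nu \<kappa> k" "finite (A \<kappa> k)" if "(\<kappa>, k) \<in> hops K pt" for \<kappa> k
  proof -
    show 1: "A \<kappa> k \<subseteq> ?T (pt \<kappa> ! k) (pt \<kappa> ! Suc k)" "card (A \<kappa> k) = nu \<kappa> k"
      using F1[OF inJ[OF that]] by (simp_all add: A_def)
    show "finite (A \<kappa> k)" by (rule finite_subset[OF 1(1)]) simp
  qed
  define th where "th \<kappa> k = (SOME f. bij_betw f {0..<nu \<kappa> k} (A \<kappa> k))" for \<kappa> k
  have bij: "bij_betw (th \<kappa> k) {0..<nu \<kappa> k} (A \<kappa> k)" if "(\<kappa>, k) \<in> hops K pt" for \<kappa> k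
    unfolding th_def using ex_bij_betw_nat_finite[OF A(3)[OF that]] unfolding A(2)[OF that] by (rule someI_ex)
  have inA: "th \<kappa> k q \<in> A \<kappa> k" if "(\<kappa>, k) \<in> hops K pt" "q < nu \<kappa> k" for \<kappa> k q
    using bij_betwE[OF bij[OF that(1)]] that(2) by auto
  show thesis
  proof (rule that[of th])
    show "th \<kappa> k q < T \<and> active (S (th \<kappa> k q)) (pt \<kappa> ! k) (pt \<kappa> ! Suc k)" if "(\<kappa>, k) \<in> hops K pt" "q < nu \<kappa> k" for \<kappa> k q
      using inA[OF that] A(1)[OF that(1)] by blast
  next
    fix \<kappa> k q \<kappa>' k' q'
    assume h: "(\<kappa>, k) \<in> hops K pt" "q < nu \<kappa> k" and h': "(\<kappa>', k') \<in> hops K pt" "q' < nu \<kappa>' k'"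
      and eq: "th \<kappa> k q = th \<kappa>' k' q'" "pt \<kappa> ! k = pt \<kappa>' ! k'"
    let ?\<tau> = "th \<kappa> k q" and ?i = "pt \<kappa> ! k"
    have a: "?\<tau> \<in> A \<kappa> k" "?\<tau> \<in> A \<kappa>' k'" using inA[OF h] inA[OF h'] eq by auto
    then have act: "active (S ?\<tau>) ?i (pt \<kappa> ! Suc k)" "active (S ?\<tau>) ?i (pt \<kappa>' ! Suc k')"
      using A(1)[OF h(1)] A(1)[OF h'(1)] eq(2) by auto
    have "\<kappa> < K" "k < length (pt \<kappa>)" using h by (auto simp: hops_def)
    then have i: "?i \<in> {0..N+1}" using pt[of \<kappa>] nth_mem by blast
    have j: "pt \<kappa> ! Suc k = pt \<kappa>' ! Suc k'"
    proof (rule ccontr)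
      assume ne: "pt \<kappa> ! Suc k \<noteq> pt \<kappa>' ! Suc k'"
      have "{j\<in>{pt \<kappa> ! Suc k, pt \<kappa>' ! Suc k'}. active (S ?\<tau>) ?i j} = {pt \<kappa> ! Suc k, pt \<kappa>' ! Suc k'}" using act by auto
      then show False using active_card_source[OF S[of ?\<tau>] i, of "{pt \<kappa> ! Suc k, pt \<kappa>' ! Suc k'}"] ne by simp
    qed
    have "(\<kappa>, k) = (\<kappa>', k')"
    proof (rule ccontr)
      assume "(\<kappa>, k) \<noteq> (\<kappa>', k')"
      moreover have "(\<kappa>', k') \<in> hops_on K pt ?i (pt \<kappa> ! Suc k)" using inJ[OF h'(1)] eq(2) j by simp
      ultimately have "F ?i (pt \<kappa> ! Suc k) (\<kappa>, k) \<inter> F ?i (pt \<kappa> ! Suc k) (\<kappa>', k') = {}"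
        by (intro F2 inJ[OF h(1)])
      then have "A \<kappa> k \<inter> A \<kappa>' k' = {}" using eq(2) j by (simp add: A_def)
      then show False using a by blast
    qed
    then show "\<kappa> = \<kappa>' \<and> k = k' \<and> q = q'"
      using bij[OF h(1)] h h' eq by (auto simp: bij_betw_def inj_on_def)
  qed
qed

lemma achievable_zero: 
  assumes "P \<ge> 0" shows "achievable m N h P 0"
  unfolding achievable_def
proof (intro allI impI exI conjI)
  fix \<epsilon> :: real and n :: nat assume e: "\<epsilon> > 0"
  define c where "c = \<lparr> blen = n, nmsg = 1, src = \<lambda>_ _. (({}, {}), 0), rel = \<lambda>_ _ _. (({}, {}), 0), dst = \<lambda>_ _. ({}, {}), dec = \<lambda>_. 0 \<rparr>"
  have c: "blen c = n" "nmsg c = 1" "\<And>w t. src c w t = (({}, {}), 0)" "\<And>i t Y. rel c i t Y = (({}, {}), 0)"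
    "\<And>t Y. dst c t Y = ({}, {})" "\<And>Y. dec c Y = 0" by (simp_all add: c_def)
  have E: "err_event c N h 0 = {}" by (simp add: err_event_def c)
  have X: "input c N h w z k t = 0" for w z k t by (simp add: input_def choice_def c)
  show "valid_code m N h P c" using assms by (simp add: valid_code_def E X node_ok_def c)
  show "blen c = n" by (rule c)
  show "2 powr (real n * 0) \<le> real (nmsg c)" by (simp add: c)
  show "err_prob c N h \<le> \<epsilon>" using e by (simp add: err_prob_def E c)
qed

text \<open>The links are finitely many, so the largest \<open>B\<close>, the largest
  \<open>p\<close> (still below \<open>P\<close>) and the largest \<open>n0\<close> suit all of
  them; as for a single link, \<open>B\<close> and \<open>p\<close> precede
  \<open>\<epsilon>\<close>.\<close>

lemma awgn_codes_family:
  fixes g :: "'a \<Rightarrow> complex"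
  assumes P: "P > 0" and J: "finite J" "\<And>j. j \<in> J \<Longrightarrow> r j < ln (1 + P * (cmod (g j))\<^sup>2)"
  shows "\<exists>B p. B > 0 \<and> 0 < p \<and> p < P \<and> (\<forall>\<epsilon>>0. \<exists>n0. \<forall>j\<in>J. \<forall>n\<ge>n0. \<forall>M. 1 \<le> M \<and> n \<le> M \<and> real M \<le> exp (real n * r j) \<longrightarrow>
    (\<exists>x D. awgn_code (g j) n M B p \<epsilon> x D))"
  using J
proof (induction J rule: finite_induct)
  case empty
  show ?case using P by (intro exI[of _ "P / 2"]) auto
next
  case (insert j J)
  have "\<exists>B p. B > 0 \<and> 0 < p \<and> p < P \<and> (\<forall>\<epsilon>>0. \<exists>n0. \<forall>j\<in>J. \<forall>n\<ge>n0. \<forall>M. 1 \<le> M \<and> n \<le> M \<and> real M \<le> exp (real n * r j) \<longrightarrow>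
    (\<exists>x D. awgn_code (g j) n M B p \<epsilon> x D))"
    by (rule insert.IH, rule insert.prems, rule insertI2)
  then
  obtain B1 p1 where 1: "B1 > 0" "0 < p1" "p1 < P" and c1: "\<forall>\<epsilon>>0. \<exists>n0. \<forall>j\<in>J. \<forall>n\<ge>n0. \<forall>M. 1 \<le> M \<and> n \<le> M \<and> real M \<le> exp (real n * r j) \<longrightarrow>
    (\<exists>x D. awgn_code (g j) n M B1 p1 \<epsilon> x D)" by (elim exE conjE) (rule that)
  obtain B2 p2 where 2: "B2 > 0" "0 < p2" "p2 < P" and c2: "\<And>\<epsilon>. \<epsilon> > 0 \<Longrightarrow> \<exists>n0. \<forall>n\<ge>n0. \<forall>M. 1 \<le> M \<and> n \<le> M \<and> real M \<le> exp (real n * r j) \<longrightarrow>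
    (\<exists>x D. awgn_code (g j) n M B2 p2 \<epsilon> x D)" by (rule awgn_codes_exist[OF P insert.prems[of j, OF insertI1]]) (rule that)
  let ?B = "max B1 B2" and ?p = "max p1 p2"
  have mono1: "awgn_code h n M B1 p1 \<epsilon> x D \<Longrightarrow> awgn_code h n M ?B ?p \<epsilon> x D" for h n M \<epsilon> x D
    by (erule awgn_code_mono) auto
  have mono2: "awgn_code h n M B2 p2 \<epsilon> x D \<Longrightarrow> awgn_code h n M ?B ?p \<epsilon> x D" for h n M \<epsilon> x D
    by (erule awgn_code_mono) auto
  show ?case
  proof (rule exI[of _ ?B], rule exI[of _ ?p], intro conjI allI impI)
    fix \<epsilon> :: real assume e: "\<epsilon> > 0"
    obtain n1 where n1: "\<And>i n M. i \<in> J \<Longrightarrow> n \<ge> n1 \<Longrightarrow> 1 \<le> M \<Longrightarrow> n \<le> M \<Longrightarrow> real M \<le> exp (real n * r i) \<Longrightarrow>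
       \<exists>x D. awgn_code (g i) n M B1 p1 \<epsilon> x D" using c1 e by blast
    obtain n2 where n2: "\<And>n M. n \<ge> n2 \<Longrightarrow> 1 \<le> M \<Longrightarrow> n \<le> M \<Longrightarrow> real M \<le> exp (real n * r j) \<Longrightarrow>
       \<exists>x D. awgn_code (g j) n M B2 p2 \<epsilon> x D" using c2[OF e] by blast
    show "\<exists>n0. \<forall>i\<in>insert j J. \<forall>n\<ge>n0. \<forall>M. 1 \<le> M \<and> n \<le> M \<and> real M \<le> exp (real n * r i) \<longrightarrow>
       (\<exists>x D. awgn_code (g i) n M ?B ?p \<epsilon> x D)"
    proof (intro exI[of _ "max n1 n2"] ballI allI impI)
      fix i n M assume i: "i \<in> insert j J" and n: "n \<ge> max n1 n2" and M: "1 \<le> M \<and> n \<le> M \<and> real M \<le> exp (real n * r i)"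
      show "\<exists>x D. awgn_code (g i) n M ?B ?p \<epsilon> x D"
      proof (cases "i = j")
        case True
        then obtain x D where "awgn_code (g i) n M B2 p2 \<epsilon> x D" using n2[of n M] n M by auto
        then show ?thesis using mono2 by blast
      next
        case False
        then obtain x D where "awgn_code (g i) n M B1 p1 \<epsilon> x D" using n1[of i n M] n M i by auto
        then show ?thesis using mono1 by blast
      qed
    qed
  qed (use 1 2 in auto)
qed

lemma cut_law_exists:
  assumes "R < C_cs_iid m N l"
  obtains lam where "lam \<in> prob_vecs (states m N)" "\<And>\<Omega>. \<Omega> \<in> cuts N \<Longrightarrow> R < cut_val m N l lam \<Omega>"
proof -
  have "(\<lambda>s. of_bool (s = (\<lambda>_. ({}, {})))) \<in> prob_vecs (states m N)"
    using finite_states idle_state by (simp add: prob_vecs_def of_bool_def)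
  then have ne: "prob_vecs (states m N) \<noteq> {}" by blast
  have "\<not> (\<forall>lam\<in>prob_vecs (states m N). Min (cut_val m N l lam ` cuts N) \<le> R)"
  proof
    assume "\<forall>lam\<in>prob_vecs (states m N). Min (cut_val m N l lam ` cuts N) \<le> R"
    then have "C_cs_iid m N l \<le> R" unfolding C_cs_iid_def by (intro cSUP_least[OF ne]) blast
    with assms show False by simp
  qed
  then obtain lam where lam: "lam \<in> prob_vecs (states m N)" "R < Min (cut_val m N l lam ` cuts N)"
    by (auto simp: not_le)
  have "R < cut_val m N l lam \<Omega>" if "\<Omega> \<in> cuts N" for \<Omega>
    using lam(2) cut_vals_finite that by simp
  then show thesis using that lam(1) by blast
qed

definition link_time :: "mode \<Rightarrow> nat \<Rightarrow> (state \<Rightarrow> real) \<Rightarrow> nat \<Rightarrow> nat \<Rightarrow> real" where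
  "link_time m N lam i j = (\<Sum>s\<in>{s\<in>states m N. active s i j}. lam s)"

text \<open>Giving link (i, j) its active time multiplied by its capacity turns the schedule into a
  flow network whose cut capacities are the values \<open>cut_val\<close>. Max-flow min-cut and path
  decomposition then yield the path rates.\<close>

lemma path_allocation:
  assumes P: "P > 0" and R: "0 \<le> R" "R < C_cs_iid m N (link_cap h P)"
  obtains lam K pt xr where "lam \<in> prob_vecs (states m N)"
    and "\<And>\<kappa>. \<kappa> < K \<Longrightarrow> distinct (pt \<kappa>) \<and> set (pt \<kappa>) \<subseteq> {0..N+1} \<and> 2 \<le> length (pt \<kappa>) \<and> pt \<kappa> ! 0 = 0 \<and> last (pt \<kappa>) = N + 1"
    and "\<And>\<kappa>. \<kappa> < K \<Longrightarrow> xr \<kappa> > 0" and "(\<Sum>\<kappa><K. xr \<kappa>) = R"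
    and "\<And>i j. (\<Sum>(\<kappa>, k)\<in>hops_on K pt i j. xr \<kappa>) \<le> link_time m N lam i j * link_cap h P j i"
proof -
  obtain lam where lam: "lam \<in> prob_vecs (states m N)" "\<And>\<Omega>. \<Omega> \<in> cuts N \<Longrightarrow> R < cut_val m N (link_cap h P) lam \<Omega>"
    using cut_law_exists[OF R(2)] by blast
  define c where "c = (\<lambda>(i, j). link_time m N lam i j * link_cap h P j i)"
  have "link_time m N lam i j \<ge> 0" for i j
    unfolding link_time_def using lam(1) by (intro sum_nonneg) (auto simp: prob_vecs_def)
  then have c0: "0 \<le> c e" for e using link_cap_nonneg[OF P] by (auto simp: c_def split_def)
  interpret flow_network "{0..N+1}" 0 "N+1" c by unfold_locales (auto simp: c0)
  \<comment> \<open>A node set that contains 0 and misses N + 1 is exactly a member of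
    \<open>cuts N\<close>.\<close>
  have "R \<le> (\<Sum>v\<in>W. \<Sum>w\<in>{0..N+1} - W. c (v, w))" if "W \<subseteq> {0..N+1}" "0 \<in> W" "N+1 \<notin> W" for W
  proof -
    have "x \<le> N" if "x \<in> W" for x 
    proof -
      have "x \<noteq> N + 1" "x \<le> N + 1" using that \<open>N+1 \<notin> W\<close> \<open>W \<subseteq> {0..N+1}\<close> by auto
      then show ?thesis by simp
    qed
    then have "W \<in> cuts N" using that by (auto simp: cuts_def)
    from lam(2)[OF this] show ?thesis by (simp add: cut_val_def c_def link_time_def)
  qed
  then obtain f where f: "flow f" "divergence {0..N+1} f 0 \<ge> R" using max_flow_ge by blast
  obtain L where L: "\<forall>(p, x)\<in>set L. path p \<and> x > 0" "(\<Sum>(p, x)\<leftarrow>L. x) = R"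
     "\<forall>e. (\<Sum>(p, x)\<leftarrow>L. if e \<in> path_edges p then x else 0) \<le> f e"
    using path_decomposition[OF f(1) R(1) f(2)] by blast
  define K where "K = length L"
  define pt where "pt \<kappa> = fst (L ! \<kappa>)" for \<kappa>
  define xr where "xr \<kappa> = snd (L ! \<kappa>)" for \<kappa>
  have pth: "path (pt \<kappa>)" and xr: "xr \<kappa> > 0" if "\<kappa> < K" for \<kappa>
  proof -
    have "L ! \<kappa> \<in> set L" using that by (simp add: K_def)
    then show "path (pt \<kappa>)" "xr \<kappa> > 0" using L(1) by (auto simp: pt_def xr_def split_def)
  qed
  have "(\<Sum>(\<kappa>, k)\<in>hops_on K pt i j. xr \<kappa>) \<le> link_time m N lam i j * link_cap h P j i" for i j
  proof -
    let ?A = "\<lambda>\<kappa>. {k. Suc k < length (pt \<kappa>) \<and> pt \<kappa> ! k = i \<and> pt \<kappa> ! Suc k = j}"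
    have "hops_on K pt i j = (SIGMA \<kappa>:{..<K}. ?A \<kappa>)" by (auto simp: hops_on_def hops_def)
    moreover have finA: "finite (?A \<kappa>)" for \<kappa> by (rule finite_subset[of _ "{..<length (pt \<kappa>)}"]) auto
    ultimately have "(\<Sum>(\<kappa>, k)\<in>hops_on K pt i j. xr \<kappa>) = (\<Sum>\<kappa><K. \<Sum>k\<in>?A \<kappa>. xr \<kappa>)"
      using sum.Sigma[OF finite_lessThan, of K ?A "\<lambda>\<kappa> k. xr \<kappa>"] by simp
    also have "\<dots> \<le> (\<Sum>\<kappa><K. if (i, j) \<in> path_edges (pt \<kappa>) then xr \<kappa> else 0)"
    proof (rule sum_mono)
      fix \<kappa> assume "\<kappa> \<in> {..<K}"
      then have \<kappa>: "\<kappa> < K" by simp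
      \<comment> \<open>A path has distinct nodes and so uses each edge at most once; its rate is
        counted once per edge.\<close>
      have un: "k = k'" if "k \<in> ?A \<kappa>" "k' \<in> ?A \<kappa>" for k k'
      proof -
        have "pt \<kappa> ! k = pt \<kappa> ! k'" "k < length (pt \<kappa>)" "k' < length (pt \<kappa>)" using that by auto
        moreover have "distinct (pt \<kappa>)" using pth[OF \<kappa>] unfolding path_def by blast
        ultimately show ?thesis by (simp add: nth_eq_iff_index_eq)
      qed
      show "(\<Sum>k\<in>?A \<kappa>. xr \<kappa>) \<le> (if (i, j) \<in> path_edges (pt \<kappa>) then xr \<kappa> else 0)"
      proof (cases "?A \<kappa> = {}")
        case True
        show ?thesis unfolding True using xr[OF \<kappa>] by simp
      next
        case False
        then obtain k where k: "k \<in> ?A \<kappa>" by blast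
        then have "?A \<kappa> = {k}" using un by blast
        moreover have "(i, j) \<in> path_edges (pt \<kappa>)" using k by (auto simp: path_edges_def)
        ultimately show ?thesis by (simp only: sum.insert[OF finite.emptyI] if_True) simp
      qed
    qed
    also have "\<dots> = (\<Sum>(p, x)\<leftarrow>L. if (i, j) \<in> path_edges p then x else 0)"
      unfolding xr_def by (simp add: sum_list_sum_nth K_def pt_def split_def lessThan_atLeast0)
    also have "\<dots> \<le> f (i, j)" using L(3) by blast
    also have "\<dots> \<le> c (i, j)" by (rule flow_bounds(2)[OF f(1)])
    finally show ?thesis by (simp add: c_def)
  qed
  moreover have "(\<Sum>\<kappa><K. xr \<kappa>) = R"
    using L(2) by (simp add: sum_list_sum_nth K_def xr_def split_def lessThan_atLeast0)
  moreover have "distinct (pt \<kappa>) \<and> set (pt \<kappa>) \<subseteq> {0..N+1} \<and> 2 \<le> length (pt \<kappa>) \<and> pt \<kappa> ! 0 = 0 \<and> last (pt \<kappa>) = N + 1" if "\<kappa> < K" for \<kappa>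
  proof -
    have p: "distinct (pt \<kappa>)" "set (pt \<kappa>) \<subseteq> {0..N+1}" "2 \<le> length (pt \<kappa>)" "hd (pt \<kappa>) = 0" "last (pt \<kappa>) = N + 1"
      using pth[OF that] unfolding path_def by blast+
    then have "pt \<kappa> \<noteq> []" by auto
    then show ?thesis using p by (simp add: hd_conv_nth)
  qed
  ultimately show thesis using that lam(1) xr by blast
qed

section \<open>Rounding of rates to slots and alphabets\<close>

locale rate_allocation =
  fixes m :: mode and N :: nat and h :: "nat \<Rightarrow> nat \<Rightarrow> complex" and P R0 R1 :: real
    and lam :: "state \<Rightarrow> real" and K :: nat and pt :: "nat \<Rightarrow> nat list" and xr :: "nat \<Rightarrow> real"
  assumes P: "P > 0" and R: "0 \<le> R0" "R0 < R1"
    and lam: "lam \<in> prob_vecs (states m N)"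
    and pt: "\<And>\<kappa>. \<kappa> < K \<Longrightarrow> distinct (pt \<kappa>) \<and> set (pt \<kappa>) \<subseteq> {0..N+1} \<and> 2 \<le> length (pt \<kappa>) \<and> pt \<kappa> ! 0 = 0 \<and> last (pt \<kappa>) = N + 1"
    and xr: "\<And>\<kappa>. \<kappa> < K \<Longrightarrow> xr \<kappa> > 0" and sum_xr: "(\<Sum>\<kappa><K. xr \<kappa>) = R1"
    and load: "\<And>i j. (\<Sum>(\<kappa>, k)\<in>hops_on K pt i j. xr \<kappa>) \<le> link_time m N lam i j * link_cap h P j i"
begin

text \<open>Path rates are scaled by \<open>\<beta>\<close> and link rates by \<open>\<beta>'\<close>; the slack between the two absorbs the
  rounding of the slot numbers.\<close>
definition \<beta> :: real where "\<beta> = (R0 + R1) / (2 * R1)"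
definition \<beta>' :: real where "\<beta>' = (1 + \<beta>) / 2"

definition hop_cap :: "nat \<times> nat \<Rightarrow> real" where
  "hop_cap = (\<lambda>(\<kappa>, k). link_cap h P (pt \<kappa> ! Suc k) (pt \<kappa> ! k))"

text \<open>As many slots as are needed to carry \<open>T * (\<beta> * xr \<kappa>)\<close> bits at
  the fraction \<open>\<beta>'\<close> of the link capacity.\<close>

definition nu :: "nat \<Rightarrow> nat \<Rightarrow> nat \<Rightarrow> nat" where
  "nu T \<kappa> k = nat \<lceil>real T * (\<beta> * xr \<kappa> / (\<beta>' * hop_cap (\<kappa>, k)))\<rceil>"

definition al :: "nat \<Rightarrow> nat \<Rightarrow> nat" where
  "al T \<kappa> = nat \<lfloor>2 powr (real T * (\<beta> * xr \<kappa>))\<rfloor>"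

lemma beta: "0 < \<beta>" "\<beta> < \<beta>'" "\<beta>' < 1" "\<beta> * R1 = (R0 + R1) / 2"
proof -
  have "R1 > 0" using R by simp
  then show "0 < \<beta>" "\<beta> * R1 = (R0 + R1) / 2" using R by (auto simp: \<beta>_def)
  have "\<beta> < 1" using R \<open>R1 > 0\<close> by (simp add: \<beta>_def)
  then show "\<beta> < \<beta>'" "\<beta>' < 1" by (simp_all add: \<beta>'_def)
qed

lemma link_time_nonneg: "link_time m N lam i j \<ge> 0"
  unfolding link_time_def using lam by (intro sum_nonneg) (auto simp: prob_vecs_def)

lemma hop_pos:
  assumes "(\<kappa>, k) \<in> hops_on K pt i j"
  shows "link_time m N lam i j > 0" "link_cap h P j i > 0"
proof -
  have nn: "xr (fst e) \<ge> 0" if "e \<in> hops_on K pt i j" for e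
    using that xr[of "fst e"] by (auto simp: hops_on_def hops_def)
  have "0 < xr \<kappa>" using xr[of \<kappa>] assms by (auto simp: hops_on_def hops_def)
  also have "xr \<kappa> \<le> (\<Sum>e\<in>hops_on K pt i j. xr (fst e))"
    using member_le_sum[OF assms, of "\<lambda>e. xr (fst e)"] nn finite_hops by simp
  also have "\<dots> \<le> link_time m N lam i j * link_cap h P j i" using load[of i j] by (simp add: split_def)
  finally have 1: "0 < link_time m N lam i j * link_cap h P j i" .
  then show "link_time m N lam i j > 0" "link_cap h P j i > 0"
    using link_time_nonneg[of i j] link_cap_nonneg[OF P, of h j i] by (auto simp: zero_less_mult_iff)
qed

lemma hops_onI: "(\<kappa>, k) \<in> hops K pt \<Longrightarrow> (\<kappa>, k) \<in> hops_on K pt (pt \<kappa> ! k) (pt \<kappa> ! Suc k)"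
  by (simp add: hops_on_def)

lemma hop_cap_pos: "e \<in> hops K pt \<Longrightarrow> hop_cap e > 0"
  using hop_pos(2)[OF hops_onI] by (cases e) (auto simp: hop_cap_def)

lemma hop_cap_on: "e \<in> hops_on K pt i j \<Longrightarrow> hop_cap e = link_cap h P j i"
  by (auto simp: hop_cap_def hops_on_def)

lemma nu_bounds:
  assumes "(\<kappa>, k) \<in> hops K pt"
  defines "y \<equiv> \<beta> * xr \<kappa> / (\<beta>' * hop_cap (\<kappa>, k))"
  shows "y > 0" "real T * y \<le> nu T \<kappa> k" "nu T \<kappa> k \<le> real T * y + 1"
proof -
  show y: "y > 0" using beta hop_cap_pos[OF assms(1)] xr[of \<kappa>] assms(1) by (auto simp: y_def hops_def intro!: divide_pos_pos mult_pos_pos)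
  then have "real T * y \<ge> 0" by simp
  then show "real T * y \<le> nu T \<kappa> k" "nu T \<kappa> k \<le> real T * y + 1"
    unfolding nu_def y_def[symmetric] by linarith+
qed

text \<open>The fraction \<open>1 - \<beta> / \<beta>'\<close> of each used link's time stays free.
  It grows linearly in \<open>T\<close>, while rounding costs at most one slot for each hop and one
  for each state.\<close>

lemma slots_suffice:
  "eventually (\<lambda>T. \<forall>i j. (\<Sum>(\<kappa>, k)\<in>hops_on K pt i j. nu T \<kappa> k) \<le> (\<Sum>s\<in>{s\<in>states m N. active s i j}. nat \<lfloor>real T * lam s\<rfloor>)) sequentially"
proof -
  let ?E = "(\<lambda>(\<kappa>, k). (pt \<kappa> ! k, pt \<kappa> ! Suc k)) ` hops K pt"
  let ?d = "real (card (hops K pt)) + real (card (states m N))"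
  have fE: "finite ?E" using finite_hops by simp
  have "eventually (\<lambda>T. ?d \<le> real T * (link_time m N lam (fst e) (snd e) * (1 - \<beta> / \<beta>'))) sequentially" if e: "e \<in> ?E" for e
  proof (rule eventually_linear_ge)
    obtain q where "e = (\<lambda>(\<kappa>, k). (pt \<kappa> ! k, pt \<kappa> ! Suc k)) q" "q \<in> hops K pt"
      using e by (rule imageE)
    then have "link_time m N lam (fst e) (snd e) > 0"
      using hop_pos(1)[OF hops_onI, of "fst q" "snd q"] by (simp add: split_def)
    moreover have "1 - \<beta> / \<beta>' > 0" using beta by simp
    ultimately show "link_time m N lam (fst e) (snd e) * (1 - \<beta> / \<beta>') > 0" by (rule mult_pos_pos)
  qed
  then have "eventually (\<lambda>T. \<forall>e\<in>?E. ?d \<le> real T * (link_time m N lam (fst e) (snd e) * (1 - \<beta> / \<beta>'))) sequentially"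
    by (intro eventually_ball_finite[OF fE]) blast
  then show ?thesis
  proof (rule eventually_mono, intro allI)
    fix T i j assume T: "\<forall>e\<in>?E. ?d \<le> real T * (link_time m N lam (fst e) (snd e) * (1 - \<beta> / \<beta>'))"
    let ?A = "{s\<in>states m N. active s i j}" and ?\<Lambda> = "link_time m N lam i j" and ?H = "hops_on K pt i j"
    show "(\<Sum>(\<kappa>, k)\<in>?H. nu T \<kappa> k) \<le> (\<Sum>s\<in>?A. nat \<lfloor>real T * lam s\<rfloor>)"
    proof (cases "?H = {}")
      case False
      then obtain \<kappa> k where \<kappa>: "(\<kappa>, k) \<in> ?H" by auto
      note cap = hop_pos(2)[OF \<kappa>]
      have "(i, j) \<in> ?E" using \<kappa> by (force simp: hops_on_def)
      then have d: "?d \<le> real T * (?\<Lambda> * (1 - \<beta> / \<beta>'))" using T by auto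
      have "real (\<Sum>(\<kappa>, k)\<in>?H. nu T \<kappa> k) = (\<Sum>e\<in>?H. real (nu T (fst e) (snd e)))" by (simp add: split_def)
      also have "\<dots> \<le> (\<Sum>e\<in>?H. real T * \<beta> / (\<beta>' * link_cap h P j i) * xr (fst e) + 1)"
      proof (rule sum_mono)
        fix e assume e: "e \<in> ?H"
        then have "(fst e, snd e) \<in> hops K pt" by (auto simp: hops_on_def)
        from nu_bounds(3)[OF this, of T] show "real (nu T (fst e) (snd e)) \<le> real T * \<beta> / (\<beta>' * link_cap h P j i) * xr (fst e) + 1"
          using hop_cap_on[OF e] by (simp add: mult.assoc)
      qed
      also have "\<dots> = real T * \<beta> / (\<beta>' * link_cap h P j i) * (\<Sum>e\<in>?H. xr (fst e)) + card ?H"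
        by (simp add: sum.distrib sum_distrib_left)
      also have "\<dots> \<le> real T * \<beta> / (\<beta>' * link_cap h P j i) * (?\<Lambda> * link_cap h P j i) + card (hops K pt)"
      proof (intro add_mono mult_left_mono)
        show "(\<Sum>e\<in>?H. xr (fst e)) \<le> ?\<Lambda> * link_cap h P j i" using load[of i j] by (simp add: split_def)
        show "real (card ?H) \<le> real (card (hops K pt))"
          unfolding of_nat_le_iff by (rule card_mono[OF finite_hops(1)]) (auto simp: hops_on_def)
      qed (use beta cap in simp)
      also have "real T * \<beta> / (\<beta>' * link_cap h P j i) * (?\<Lambda> * link_cap h P j i) = real T * ?\<Lambda> * (\<beta> / \<beta>')"
        using cap by simp
      also have "real T * ?\<Lambda> * (\<beta> / \<beta>') + card (hops K pt) \<le> real T * ?\<Lambda> - card (states m N)"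
        using d by (simp add: algebra_simps)
      also have "\<dots> \<le> real T * ?\<Lambda> - card ?A"
        using card_mono[OF finite_states, of ?A m N] by auto
      also have "\<dots> = (\<Sum>s\<in>?A. real T * lam s - 1)"
        by (simp add: link_time_def sum_subtractf sum_distrib_left)
      also have "\<dots> \<le> (\<Sum>s\<in>?A. real (nat \<lfloor>real T * lam s\<rfloor>))" by (intro sum_mono) linarith
      finally show ?thesis by (simp only: of_nat_sum[symmetric] of_nat_le_iff)
    qed simp
  qed
qed

lemma al_bounds:
  assumes "\<kappa> < K"
  shows "2 powr (real T * (\<beta> * xr \<kappa>) - 1) \<le> al T \<kappa>" "1 \<le> al T \<kappa>" "al T \<kappa> \<le> 2 powr (real T * (\<beta> * xr \<kappa>))"
proof -
  let ?y = "2 powr (real T * (\<beta> * xr \<kappa>)) :: real"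
  have "?y \<ge> 2 powr 0" using beta xr[OF assms] by (intro powr_mono) auto
  then have y: "?y \<ge> 1" by simp
  then show "1 \<le> al T \<kappa>" unfolding al_def by linarith
  show "al T \<kappa> \<le> ?y" unfolding al_def using y by linarith
  have "\<lfloor>?y\<rfloor> \<ge> 1" using y by simp
  then have "real (al T \<kappa>) = of_int \<lfloor>?y\<rfloor>" "(of_int \<lfloor>?y\<rfloor> :: real) \<ge> 1" by (simp_all add: al_def)
  moreover have "?y - 1 < of_int \<lfloor>?y\<rfloor>" by linarith
  ultimately have "?y / 2 \<le> al T \<kappa>" by linarith
  then show "2 powr (real T * (\<beta> * xr \<kappa>) - 1) \<le> al T \<kappa>" by (simp add: powr_diff)
qed

text \<open>The alphabet fits a link code of rate \<open>\<beta>'\<close> times the capacity, in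
  nats; as \<open>\<beta>' < 1\<close>, this is strictly below what the link supports.\<close>

lemma al_le_exp:
  assumes "(\<kappa>, k) \<in> hops K pt"
  shows "al T \<kappa> \<le> exp (real (nu T \<kappa> k) * (\<beta>' * (ln 2 * hop_cap (\<kappa>, k))))"
proof -
  let ?y = "\<beta> * xr \<kappa> / (\<beta>' * hop_cap (\<kappa>, k))"
  have c: "\<beta>' > 0" "hop_cap (\<kappa>, k) > 0" using beta hop_cap_pos[OF assms] by auto
  have "al T \<kappa> \<le> 2 powr (real T * (\<beta> * xr \<kappa>))" using al_bounds(3) assms by (auto simp: hops_def)
  also have "\<dots> = exp (real T * (\<beta> * xr \<kappa>) * ln 2)" by (simp add: powr_def mult.commute)
  also have "real T * (\<beta> * xr \<kappa>) * ln 2 = real T * ?y * (\<beta>' * (ln 2 * hop_cap (\<kappa>, k)))" using c by simp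
  also have "exp \<dots> \<le> exp (real (nu T \<kappa> k) * (\<beta>' * (ln 2 * hop_cap (\<kappa>, k))))"
    unfolding exp_le_cancel_iff using nu_bounds(2)[OF assms] c by (intro mult_right_mono) auto
  finally show ?thesis .
qed

text \<open>Meets the condition \<open>n \<le> M\<close> of the link codes: alphabets grow
  exponentially in \<open>T\<close>, slot numbers linearly.\<close>

lemma eventually_nu_le_al:
  assumes "(\<kappa>, k) \<in> hops K pt" shows "eventually (\<lambda>T. nu T \<kappa> k \<le> al T \<kappa>) sequentially"
proof -
  define y where "y = \<beta> * xr \<kappa> / (\<beta>' * hop_cap (\<kappa>, k))"
  define d where "d = \<beta> * xr \<kappa>"
  have \<kappa>: "\<kappa> < K" using assms by (simp add: hops_def)
  have "d > 0" using beta xr[OF \<kappa>] by (simp add: d_def)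
  then have "eventually (\<lambda>T. real T * y + 1 \<le> 2 powr (real T * d - 1)) sequentially"
    using nu_bounds(1)[OF assms] unfolding y_def[symmetric] by real_asymp
  then show ?thesis
  proof (rule eventually_mono)
    fix T assume "real T * y + 1 \<le> 2 powr (real T * d - 1)"
    then have "real (nu T \<kappa> k) \<le> real (al T \<kappa>)"
      using nu_bounds(3)[OF assms, of T] al_bounds(1)[OF \<kappa>, of T] by (simp add: d_def y_def)
    then show "nu T \<kappa> k \<le> al T \<kappa>" by simp
  qed
qed

lemma eventually_nu_ge:
  assumes "(\<kappa>, k) \<in> hops K pt" shows "eventually (\<lambda>T. n0 \<le> nu T \<kappa> k) sequentially"
  using eventually_linear_ge[OF nu_bounds(1)[OF assms], of "real n0"]
proof (rule eventually_mono)
  fix T assume "real n0 \<le> real T * (\<beta> * xr \<kappa> / (\<beta>' * hop_cap (\<kappa>, k)))"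
  then have "real n0 \<le> real (nu T \<kappa> k)" using nu_bounds(2)[OF assms, of T] by linarith
  then show "n0 \<le> nu T \<kappa> k" by simp
qed


text \<open>The choices are made in this order: amplitude \<open>B\<close> and power
  \<open>p\<close>, then the number \<open>nb\<close> of pieces, then the link error
  \<open>e\<close>, and last the superblock length \<open>T\<close>, which grows with the block
  length. The number of link decodings does not depend on \<open>T\<close>, so a fixed
  \<open>e\<close> suffices.\<close>

lemma achievable_rate: "achievable m N h P R0"
  unfolding achievable_def
proof (intro allI impI)
  fix \<epsilon> :: real assume \<epsilon>: "\<epsilon> > 0"
  let ?J = "hops K pt"
  have K: "K > 0" using sum_xr R by (cases K) auto
  let ?g = "\<lambda>(\<kappa>, k). h (pt \<kappa> ! Suc k) (pt \<kappa> ! k)" and ?r = "\<lambda>e. \<beta>' * (ln 2 * hop_cap e)"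
  have r_less: "?r e < ln (1 + P * (cmod (?g e))\<^sup>2)" if "e \<in> ?J" for e
  proof -
    have "ln (1 + P * (cmod (?g e))\<^sup>2) = ln 2 * hop_cap e"
      by (simp add: hop_cap_def link_cap_def log_def split_def)
    moreover have "\<beta>' * (ln 2 * hop_cap e) < 1 * (ln 2 * hop_cap e)"
      using beta hop_cap_pos[OF that] by (intro mult_strict_right_mono) auto
    ultimately show ?thesis by simp
  qed
  have "\<exists>B p. B > 0 \<and> 0 < p \<and> p < P \<and> (\<forall>\<epsilon>>0. \<exists>n0. \<forall>j\<in>?J. \<forall>n\<ge>n0. \<forall>M. 1 \<le> M \<and> n \<le> M \<and> real M \<le> exp (real n * ?r j) \<longrightarrow>
      (\<exists>x D. awgn_code (?g j) n M B p \<epsilon> x D))"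
    by (rule awgn_codes_family[OF P finite_hops(1)]) (rule r_less)
  then obtain B p where B: "B > 0" and p: "0 < p" "p < P"
    and codes: "\<forall>\<epsilon>>0. \<exists>n0. \<forall>j\<in>?J. \<forall>n\<ge>n0. \<forall>M. 1 \<le> M \<and> n \<le> M \<and> real M \<le> exp (real n * ?r j) \<longrightarrow>
      (\<exists>x D. awgn_code (?g j) n M B p \<epsilon> x D)" by (elim exE conjE) (rule that)
  have gain: "\<beta> * R1 - R0 > 0" using beta(4) R by simp
  \<comment> \<open>Makes the data of \<open>nb\<close> superblocks exceed the target
    \<open>R0\<close> for all \<open>nb + N + 1\<close> of them, including those in which the
    pipeline drains.\<close>
  define nb where "nb = nat \<lceil>(N + 1) * R0 / (\<beta> * R1 - R0)\<rceil> + 1"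
  have "(N + 1) * R0 / (\<beta> * R1 - R0) < nb" unfolding nb_def by linarith
  then have nb: "(N + 1) * R0 < nb * (\<beta> * R1 - R0)" using gain by (simp add: field_simps)
  define G where "G = nb + N + 1"
  define Q where "Q = K * (N + 1) * nb"
  \<comment> \<open>The union bound over \<open>Q\<close> link decodings must stay below
    \<open>\<epsilon>\<close>, and the excess energy must fit into \<open>P - p\<close>; adding 1
    keeps the denominators positive.\<close>
  define e where "e = min (\<epsilon> / (Q + 1)) ((P - p) / (B\<^sup>2 * Q + 1))"
  have e: "e > 0" using \<epsilon> p by (auto simp: e_def intro!: divide_pos_pos add_nonneg_pos)
  have "Q * e \<le> (Q + 1) * e" using e by simp
  also have "\<dots> \<le> (Q + 1) * (\<epsilon> / (Q + 1))" by (intro mult_left_mono) (auto simp: e_def)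
  also have "\<dots> = \<epsilon>" by simp
  finally have e_err: "Q * e \<le> \<epsilon>" .
  have "B\<^sup>2 * Q + 1 > 0" by (intro add_nonneg_pos) auto
  have "B\<^sup>2 * Q * e \<le> (B\<^sup>2 * Q + 1) * e" using e by simp
  also have "\<dots> \<le> (B\<^sup>2 * Q + 1) * ((P - p) / (B\<^sup>2 * Q + 1))"
    using \<open>B\<^sup>2 * Q + 1 > 0\<close> by (intro mult_left_mono) (auto simp: e_def)
  also have "\<dots> = P - p" using \<open>B\<^sup>2 * Q + 1 > 0\<close> by simp
  finally have e_pow: "p + B\<^sup>2 * (Q * e) \<le> P" by (simp add: mult.assoc)
  obtain n1 where n1: "\<And>\<kappa> k n M. (\<kappa>, k) \<in> ?J \<Longrightarrow> n \<ge> n1 \<Longrightarrow> 1 \<le> M \<Longrightarrow> n \<le> M \<Longrightarrow> real M \<le> exp (real n * ?r (\<kappa>, k)) \<Longrightarrow>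
      \<exists>x D. awgn_code (h (pt \<kappa> ! Suc k) (pt \<kappa> ! k)) n M B p e x D"
  proof -
    obtain n0 where n0: "\<forall>j\<in>?J. \<forall>n\<ge>n0. \<forall>M. 1 \<le> M \<and> n \<le> M \<and> real M \<le> exp (real n * ?r j) \<longrightarrow>
      (\<exists>x D. awgn_code (?g j) n M B p e x D)" using codes e by blast
    show thesis
    proof (rule that[of n0])
      fix \<kappa> k n M assume "(\<kappa>, k) \<in> ?J" "n \<ge> n0" "1 \<le> M" "n \<le> M" "real M \<le> exp (real n * ?r (\<kappa>, k))"
      then show "\<exists>x D. awgn_code (h (pt \<kappa> ! Suc k) (pt \<kappa> ! k)) n M B p e x D"
        using n0[rule_format, of "(\<kappa>, k)" n M] by simp
    qed
  qed
  have "eventually (\<lambda>T. \<forall>(\<kappa>, k)\<in>?J. n1 \<le> nu T \<kappa> k \<and> nu T \<kappa> k \<le> al T \<kappa>) sequentially"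
    using finite_hops(1) eventually_nu_le_al eventually_nu_ge
    by (intro eventually_ball_finite) (auto intro: eventually_conj)
  \<comment> \<open>\<open>real nb * K\<close> covers the rounding of the alphabets, at most one bit
    for each piece and path. \<open>G * R0\<close> covers the channel uses that remain when
    \<open>n\<close> is not a multiple of \<open>G\<close>.\<close>
  moreover have "eventually (\<lambda>T. real nb * K + G * R0 \<le> real T * (nb * (\<beta> * R1) - G * R0)) sequentially"
    by (rule eventually_linear_ge) (use nb in \<open>simp add: G_def algebra_simps\<close>)
  ultimately have "eventually (\<lambda>T. 0 < T \<and> (\<forall>(\<kappa>, k)\<in>?J. n1 \<le> nu T \<kappa> k \<and> nu T \<kappa> k \<le> al T \<kappa>) \<and>
      real nb * K + G * R0 \<le> real T * (nb * (\<beta> * R1) - G * R0) \<and>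
      (\<forall>i j. (\<Sum>(\<kappa>, k)\<in>hops_on K pt i j. nu T \<kappa> k) \<le> (\<Sum>s\<in>{s\<in>states m N. active s i j}. nat \<lfloor>real T * lam s\<rfloor>))) sequentially"
    by (intro eventually_conj slots_suffice eventually_gt_at_top)
  then obtain T0 where T0: "\<And>T. T \<ge> T0 \<Longrightarrow> 0 < T \<and> (\<forall>(\<kappa>, k)\<in>?J. n1 \<le> nu T \<kappa> k \<and> nu T \<kappa> k \<le> al T \<kappa>) \<and>
      real nb * K + G * R0 \<le> real T * (nb * (\<beta> * R1) - G * R0) \<and>
      (\<forall>i j. (\<Sum>(\<kappa>, k)\<in>hops_on K pt i j. nu T \<kappa> k) \<le> (\<Sum>s\<in>{s\<in>states m N. active s i j}. nat \<lfloor>real T * lam s\<rfloor>))"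
    unfolding eventually_sequentially by blast
  show "\<exists>n0. \<forall>n\<ge>n0. \<exists>c. valid_code m N h P c \<and> blen c = n \<and> 2 powr (real n * R0) \<le> real (nmsg c) \<and> err_prob c N h \<le> \<epsilon>"
  proof (intro exI[of _ "G * T0"] allI impI)
    fix n assume n: "G * T0 \<le> n"
    define T where "T = n div G"
    have G: "G > 0" by (simp add: G_def)
    have "T \<ge> T0" using n G by (simp add: T_def less_eq_div_iff_mult_less_eq mult.commute)
    note T = T0[OF this]
    have T_pos: "T > 0" and rate: "real nb * K + G * R0 \<le> real T * (nb * (\<beta> * R1) - G * R0)" using T by blast+
    have nu1: "n1 \<le> nu T \<kappa> k" "nu T \<kappa> k \<le> al T \<kappa>" if "(\<kappa>, k) \<in> ?J" for \<kappa> k using T that by blast+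
    have slots: "(\<Sum>(\<kappa>, k)\<in>hops_on K pt i j. nu T \<kappa> k) \<le> (\<Sum>s\<in>{s\<in>states m N. active s i j}. nat \<lfloor>real T * lam s\<rfloor>)" for i j
      using T by blast
    obtain S where S: "\<And>\<tau>. S \<tau> \<in> states m N"
      and S_card: "\<And>i j. (\<Sum>s\<in>{s\<in>states m N. active s i j}. nat \<lfloor>real T * lam s\<rfloor>) \<le> card {\<tau>. \<tau> < T \<and> active (S \<tau>) i j}"
      using schedule_exists[OF lam, of T] by blast
    have cap: "(\<Sum>(\<kappa>, k)\<in>hops_on K pt i j. nu T \<kappa> k) \<le> card {\<tau>. \<tau> < T \<and> active (S \<tau>) i j}" for i j
      using slots S_card by (rule order_trans)
    obtain th where th: "\<And>\<kappa> k q. (\<kappa>, k) \<in> ?J \<Longrightarrow> q < nu T \<kappa> k \<Longrightarrow>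
        th \<kappa> k q < T \<and> active (S (th \<kappa> k q)) (pt \<kappa> ! k) (pt \<kappa> ! Suc k)"
      and th_inj: "\<And>\<kappa> k q \<kappa>' k' q'. (\<kappa>, k) \<in> ?J \<Longrightarrow> q < nu T \<kappa> k \<Longrightarrow> (\<kappa>', k') \<in> ?J \<Longrightarrow> q' < nu T \<kappa>' k' \<Longrightarrow>
        th \<kappa> k q = th \<kappa>' k' q' \<Longrightarrow> pt \<kappa> ! k = pt \<kappa>' ! k' \<Longrightarrow> \<kappa> = \<kappa>' \<and> k = k' \<and> q = q'"
    proof (rule slots_exist[OF S _ cap])
      show "set (pt \<kappa>) \<subseteq> {0..N+1}" if "\<kappa> < K" for \<kappa> using pt[OF that] by blast
    qed (rule that)
    have "\<exists>x D. awgn_code (h (pt \<kappa> ! Suc k) (pt \<kappa> ! k)) (nu T \<kappa> k) (al T \<kappa>) B p e x D" if "(\<kappa>, k) \<in> ?J" for \<kappa> k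
    proof (rule n1[OF that nu1(1)[OF that] _ nu1(2)[OF that] al_le_exp[OF that]])
      show "1 \<le> al T \<kappa>" using al_bounds(2) that by (simp add: hops_def)
    qed
    then have "\<exists>x. \<exists>D. awgn_code (h (pt \<kappa> ! Suc k) (pt \<kappa> ! k)) (nu T \<kappa> k) (al T \<kappa>) B p e x D" if "(\<kappa>, k) \<in> ?J" for \<kappa> k
      using that by blast
    define x where "x \<kappa> k = (SOME x. \<exists>D. awgn_code (h (pt \<kappa> ! Suc k) (pt \<kappa> ! k)) (nu T \<kappa> k) (al T \<kappa>) B p e x D)" for \<kappa> k
    define D where "D \<kappa> k = (SOME D. awgn_code (h (pt \<kappa> ! Suc k) (pt \<kappa> ! k)) (nu T \<kappa> k) (al T \<kappa>) B p e (x \<kappa> k) D)" for \<kappa> k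
    have xD: "awgn_code (h (pt \<kappa> ! Suc k) (pt \<kappa> ! k)) (nu T \<kappa> k) (al T \<kappa>) B p e (x \<kappa> k) (D \<kappa> k)" if "(\<kappa>, k) \<in> ?J" for \<kappa> k
    proof -
      have "\<exists>D. awgn_code (h (pt \<kappa> ! Suc k) (pt \<kappa> ! k)) (nu T \<kappa> k) (al T \<kappa>) B p e (x \<kappa> k) D"
        unfolding x_def using \<open>(\<kappa>, k) \<in> ?J \<Longrightarrow> \<exists>x. \<exists>D. awgn_code (h (pt \<kappa> ! Suc k) (pt \<kappa> ! k)) (nu T \<kappa> k) (al T \<kappa>) B p e x D\<close> that
        by (intro someI_ex[of "\<lambda>x. \<exists>D. awgn_code (h (pt \<kappa> ! Suc k) (pt \<kappa> ! k)) (nu T \<kappa> k) (al T \<kappa>) B p e x D"]) blast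
      then show ?thesis unfolding D_def by (rule someI_ex)
    qed
    have GT: "G * T \<le> n" "n \<le> G * (T + 1)"
      using G by (simp_all add: T_def) (metis dividend_less_div_times less_imp_le mult.commute mult_Suc_right add.commute)
    interpret pipeline m N h P T nb K n pt S "nu T" th "al T" x D B p e
    proof
      show "(nb + N + 1) * T \<le> n" using GT(1) by (simp add: G_def)
    next
      fix \<kappa> k q \<kappa>' k' q'
      assume "\<kappa> < K" "Suc k < length (pt \<kappa>)" "q < nu T \<kappa> k" "\<kappa>' < K" "Suc k' < length (pt \<kappa>')" "q' < nu T \<kappa>' k'"
        "th \<kappa> k q = th \<kappa>' k' q'" "pt \<kappa> ! k = pt \<kappa>' ! k'"
      then show "\<kappa> = \<kappa>' \<and> k = k' \<and> q = q'" by (intro th_inj) (simp_all add: hops_def)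
    next
      show "p + B\<^sup>2 * (real (K * (N + 1) * nb) * e) \<le> P" using e_pow by (simp add: Q_def)
    next
      fix \<kappa> k q assume "\<kappa> < K" "Suc k < length (pt \<kappa>)" "q < nu T \<kappa> k"
      then show "th \<kappa> k q < T \<and> active (S (th \<kappa> k q)) (pt \<kappa> ! k) (pt \<kappa> ! Suc k)"
        by (intro th) (simp_all add: hops_def)
    next
      fix \<kappa> k assume "\<kappa> < K" "Suc k < length (pt \<kappa>)"
      then show "awgn_code (h (pt \<kappa> ! Suc k) (pt \<kappa> ! k)) (nu T \<kappa> k) (al T \<kappa>) B p e (x \<kappa> k) (D \<kappa> k)"
        by (intro xD) (simp add: hops_def)
    next
      show "al T \<kappa> \<ge> 1" if "\<kappa> < K" for \<kappa> using al_bounds(2)[OF that] .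
    next
      show "distinct (pt \<kappa>) \<and> set (pt \<kappa>) \<subseteq> {0..N+1} \<and> 2 \<le> length (pt \<kappa>) \<and> pt \<kappa> ! 0 = 0 \<and> last (pt \<kappa>) = N + 1"
        if "\<kappa> < K" for \<kappa> by (rule pt[OF that])
    qed (use T_pos S P e in auto)
    have "2 powr (real n * R0) \<le> 2 powr (nb * (real T * (\<beta> * R1) - K))"
    proof (rule powr_mono)
      have "real n * R0 \<le> real (G * (T + 1)) * R0" using GT(2) R by (intro mult_right_mono) (auto simp del: of_nat_mult)
      also have "\<dots> \<le> nb * (real T * (\<beta> * R1) - K)" using rate by (simp add: algebra_simps)
      finally show "real n * R0 \<le> nb * (real T * (\<beta> * R1) - K)" .
    qed simp
    also have "real T * (\<beta> * R1) - K = (\<Sum>\<kappa><K. real T * (\<beta> * xr \<kappa>) - 1)"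
      by (simp add: sum_subtractf sum_xr[symmetric] sum_distrib_left)
    also have "2 powr (nb * (\<Sum>\<kappa><K. real T * (\<beta> * xr \<kappa>) - 1)) = (\<Prod>\<kappa><K. (2 powr (real T * (\<beta> * xr \<kappa>) - 1)) ^ nb)"
      by (simp add: sum_distrib_left powr_sum powr_realpow[symmetric] powr_powr mult.commute)
    also have "\<dots> \<le> (\<Prod>\<kappa><K. real (al T \<kappa>) ^ nb)"
      by (intro prod_mono conjI power_mono) (use al_bounds(1) in auto)
    also have "\<dots> = card Msgs" by (simp add: M_card)
    finally have "2 powr (real n * R0) \<le> card Msgs" .
    moreover have "err_prob net_code N h \<le> \<epsilon>" using net_error e_err unfolding Q_def by linarith
    ultimately show "\<exists>c. valid_code m N h P c \<and> blen c = n \<and> 2 powr (real n * R0) \<le> real (nmsg c) \<and> err_prob c N h \<le> \<epsilon>"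
      using net_code_valid by (intro exI[of _ net_code]) simp
  qed
qed

end

theorem achievability:
  assumes P: "P > 0" and R: "0 \<le> R" "R < C_cs_iid m N (link_cap h P)"
  shows "achievable m N h P R"
proof -
  obtain R1 where R1: "R < R1" "R1 < C_cs_iid m N (link_cap h P)" using dense[OF R(2)] by blast
  have "0 \<le> R1" using R R1 by simp
  from path_allocation[OF P this R1(2)] obtain lam K pt xr where "lam \<in> prob_vecs (states m N)"
    and "\<And>\<kappa>. \<kappa> < K \<Longrightarrow> distinct (pt \<kappa>) \<and> set (pt \<kappa>) \<subseteq> {0..N+1} \<and> 2 \<le> length (pt \<kappa>) \<and> pt \<kappa> ! 0 = 0 \<and> last (pt \<kappa>) = N + 1"
    and "\<And>\<kappa>. \<kappa> < K \<Longrightarrow> xr \<kappa> > 0" and "(\<Sum>\<kappa><K. xr \<kappa>) = R1"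
    and "\<And>i j. (\<Sum>(\<kappa>, k)\<in>hops_on K pt i j. xr \<kappa>) \<le> link_time m N lam i j * link_cap h P j i"
    by blast
  then interpret rate_allocation m N h P R R1 lam K pt xr
    using P R(1) R1(1) by unfold_locales
  show ?thesis by (rule achievable_rate)
qed

theorem theorem1:
  fixes m :: mode and N :: nat and h :: "nat \<Rightarrow> nat \<Rightarrow> complex" and P :: real
  assumes "P > 0"
  shows "ereal (C_cs_iid m N (link_cap h P)) \<le> capacity m N h P \<and>
         capacity m N h P \<le> ereal (C_cs_iid m N (link_cap h P) + GAP m N)"
proof
  show "ereal (C_cs_iid m N (link_cap h P)) \<le> capacity m N h P"
  proof (rule dense_le)
    fix y assume y: "y < ereal (C_cs_iid m N (link_cap h P))"
    \<comment> \<open>Only nonnegative rates enter \<open>capacity\<close>, so values below 0 are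
      handled by the code with a single message.\<close>
    have 0: "ereal 0 \<le> capacity m N h P"
      unfolding capacity_def using achievable_zero[of P m N h] assms by (intro Sup_upper imageI) simp
    show "y \<le> capacity m N h P"
    proof (cases "y \<le> 0")
      case True
      then show ?thesis using 0 unfolding zero_ereal_def[symmetric] by (rule order_trans)
    next
      case False
      then obtain r where r: "y = ereal r" using y by (cases y) auto
      then have "achievable m N h P r" using y False by (intro achievability[OF assms]) auto
      then show ?thesis unfolding capacity_def using r False by (intro Sup_upper) (auto intro: imageI)
    qed
  qed
  show "capacity m N h P \<le> ereal (C_cs_iid m N (link_cap h P) + GAP m N)"
    unfolding capacity_def using converse[OF assms] by (intro Sup_least) auto
qed

end
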